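(* Let $p$ be a prime and $q$ a prime power ($p$ may or may not divide $q$). For every integer $r\ge 0$, $$\mathrm{FGL}^-_{r+1}(p,q,x)=\exp\Bigl(-\sum_{n\ge1}(-1)^n\bigl(q^n-(-1)^n\bigr)_p^{\,r}\,\frac{x^n}{n}\Bigr)$$ as formal power series in $x$.
   Context: For a natural number $m\geq 1$, $m_p=p^{\nu_p(m)}$ denotes the $p$-part of $m$, and $m_p^r=(m_p)^r$. For $n\ge 1$, $\mathrm{GL}^-_n(\mathbf F_q)$ denotes the general unitary group: the group of all $\mathbf F_{q^2}$-linear automorphisms of $V=\mathbf F_{q^2}^n$ preserving the non-degenerate Hermitian form $\langle u,v\rangle=c\sum_{i=1}^n(-1)^{i+1}u_iv_{n+1-i}^q$, where $c\in\mathbf F_{q^2}^\times$ satisfies $c^{q-1}=(-1)^{n+1}$. $\mathrm L^-_n(\mathbf F_q)^*$ is the poset, under inclusion, of nonzero totally isotropic subspaces $U$ of $V$ (i.e. $0\ne U\subseteq U^\perp$), with its natural $\mathrm{GL}^-_n(\mathbf F_q)$-action. The reduced Euler characteristic of a finite poset $P$ is $\widetilde\chi(P)=\sum_{i\ge -1}(-1)^ic_i(P)$, where $c_i(P)$ is the number of chains in $P$ with $i+1$ elements and $c_{-1}(P)=1$ (so $\widetilde\chi(\emptyset)=-1$). For $r\ge1$ the $r$th $p$-primary equivariant reduced Euler characteristic is $$\widetilde\chi_r(p,\mathrm{GL}^-_n(\mathbf F_q))=\frac1{|\mathrm{GL}^-_n(\mathbf F_q)|}\sum_{X}\widetilde\chi\bigl(C_{\mathrm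 L^-_n(\mathbf F_q)^*}(X(\mathbf Z\times\mathbf Z_p^{r-1}))\bigr),$$ where $X$ runs over all homomorphisms $\mathbf Z\times\mathbf Z_p^{r-1}\to\mathrm{GL}^-_n(\mathbf F_q)$ ($\mathbf Z_p$ the $p$-adic integers), equivalently over all commuting $r$-tuples $(X_1,\dots,X_r)$ of elements of $\mathrm{GL}^-_n(\mathbf F_q)$ with $X_2,\dots,X_r$ of $p$-power order, and $C$ denotes the induced subposet of subspaces invariant under the image of $X$. The generating function is $\mathrm{FGL}^-_r(p,q,x)=1-\sum_{n\ge1}\widetilde\chi_r(p,\mathrm{GL}^-_n(\mathbf F_q))\,x^n$. *)

theory Defs
  imports
    "Jordan_Normal_Form.VS_Connect"
    "HOL-Algebra.Generated_Groups"
    "HOL-Algebra.Multiplicative_Group"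
    "HOL-Computational_Algebra.Formal_Power_Series"
    "HOL-Number_Theory.Prime_Powers"
begin

definition p_part :: "nat \<Rightarrow> nat \<Rightarrow> nat" where
  "p_part p m = p ^ multiplicity p m"

(* c_i(P) is the number of (i+1)-element chains. The summation index k is i + 1, so that
   k = 0 is the empty chain and (-1)^i = (-1)^(k+1). Only meaningful for finite P. *)
definition reduced_euler_char :: "'b::order set \<Rightarrow> int" where
  "reduced_euler_char P =
     (\<Sum>k\<le>card P. (-1) ^ (k + 1) *
        int (card {C. C \<subseteq> P \<and> Complete_Partial_Order.chain (\<le>) C \<and> card C = k}))"

(* Coordinates of carrier_vec n are numbered from 0, so (-1)^(i+1) u_i v_(n+1-i)^q
   becomes (-1)^i u_i v_(n-1-i)^q. *)
definition herm_form :: "nat \<Rightarrow> nat \<Rightarrow> 'a::field \<Rightarrow> 'a vec \<Rightarrow> 'a vec \<Rightarrow> 'a" where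
  "herm_form n q c u v = c * (\<Sum>i<n. (-1) ^ i * u $ i * (v $ (n - 1 - i)) ^ q)"

definition unitary_group :: "nat \<Rightarrow> nat \<Rightarrow> 'a::field \<Rightarrow> 'a mat monoid" where
  "unitary_group n q c =
     \<lparr>carrier = {A \<in> carrier_mat n n. invertible_mat A \<and>
        (\<forall>u \<in> carrier_vec n. \<forall>v \<in> carrier_vec n.
           herm_form n q c (A *\<^sub>v u) (A *\<^sub>v v) = herm_form n q c u v)},
      monoid.mult = (*), one = 1\<^sub>m n\<rparr>"

definition herm_perp :: "nat \<Rightarrow> nat \<Rightarrow> 'a::field \<Rightarrow> 'a vec set \<Rightarrow> 'a vec set" where
  "herm_perp n q c U = {v \<in> carrier_vec n. \<forall>u \<in> U. herm_form n q c u v = 0}"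

definition isotropic_subspaces :: "nat \<Rightarrow> nat \<Rightarrow> 'a::field \<Rightarrow> 'a vec set set" where
  "isotropic_subspaces n q c =
     {U. VectorSpace.subspace class_ring U (module_vec TYPE('a) n) \<and>
         U \<noteq> {0\<^sub>v n} \<and> U \<subseteq> herm_perp n q c U}"

definition invariant_subposet :: "'a::field vec set set \<Rightarrow> 'a mat set \<Rightarrow> 'a vec set set" where
  "invariant_subposet L H = {U \<in> L. \<forall>A \<in> H. (\<lambda>v. A *\<^sub>v v) ` U = U}"

(* For r \<ge> 1 and G finite, a homomorphism from Z x Z_p^(r-1) (Z_p the p-adic integers) to G
   is given by the images of the r standard topological generators: a commuting r-tuple in
   which all entries but the first have p-power order. Its image is the subgroup generated by
   the entries. *)
definition hom_tuples :: "nat \<Rightarrow> nat \<Rightarrow> ('g, 'm) monoid_scheme \<Rightarrow> 'g list set" where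
  "hom_tuples p r G =
     {X. length X = r \<and> set X \<subseteq> carrier G \<and>
         (\<forall>x \<in> set X. \<forall>y \<in> set X. x \<otimes>\<^bsub>G\<^esub> y = y \<otimes>\<^bsub>G\<^esub> x) \<and>
         (\<forall>x \<in> set (tl X). \<exists>k. group.ord G x = p ^ k)}"

definition equiv_reduced_euler_char ::
  "nat \<Rightarrow> nat \<Rightarrow> nat \<Rightarrow> nat \<Rightarrow> 'a::{field,finite} \<Rightarrow> rat" where
  "equiv_reduced_euler_char r p n q c =
     1 / of_nat (card (carrier (unitary_group n q c))) *
     (\<Sum>X \<in> hom_tuples p r (unitary_group n q c).
        of_int (reduced_euler_char
          (invariant_subposet (isotropic_subspaces n q c)
             (generate (unitary_group n q c) (set X)))))"

(* The scalar c n is the one used in the Hermitian form on F_(q^2)^n; it depends on n. *)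
definition FGL_minus :: "nat \<Rightarrow> nat \<Rightarrow> nat \<Rightarrow> (nat \<Rightarrow> 'a::{field,finite}) \<Rightarrow> rat fps" where
  "FGL_minus r p q c =
     1 - Abs_fps (\<lambda>n. if n = 0 then 0 else equiv_reduced_euler_char r p n q (c n))"

end

(* By Burnside's lemma, the sum over commuting tuples counts orbits of pairs consisting of a
   commuting r-tuple of p-elements and a chain of invariant totally isotropic subspaces, weighted
   by (-1)^(length of the chain).

   Suppose that p does not divide q, or that r = 0. Over an algebraic closure, with the
   q^2-Frobenius phi as descent datum, the tuple is diagonalisable, and there is a basis of joint
   eigenvectors that phi permutes, that the Hermitian form pairs off, and that is adapted to the
   chain. So an orbit is determined by the multiset w of characters of the tuple, which is
   stable under sg : chi -> chi^(-q), and by a chain of nonempty multisets f with sg (sg f) = f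
   and f + sg f contained in w; every such datum occurs. Summing the signs over all f below w
   gives the identity S(x) = S'(x^2) W(x), where S and S' count the multisets stable under sg and
   sg^2 and W is the required generating function. The logarithmic derivative of S counts the
   fixed points of sg^n, that is, the r-tuples of p-power roots of unity of order dividing
   q^n - (-1)^n.

   If p divides q, an element Y <> 1 of p-power order in the tuple makes the poset of invariant
   isotropic subspaces conically contractible by
     U >= U inter ker(Y-1) <= (U inter ker(Y-1)) + (ker(Y-1) inter im(Y-1)),
   so that only the trivial r-tuple contributes and the claim reduces to r = 0. *)
theory Submission
  imports Defs "HOL-Algebra.Algebraic_Closure_Type" "HOL-Library.Function_Algebras"
    "HOL-Number_Theory.Cong" "HOL-Combinatorics.Cycles"
begin

section \<open>Hermitian spaces with a semilinear Frobenius\<close>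

hide_const (open) Polynomials.degree up_ring.coeff up_ring.monom Polynomials.lead_coeff

text \<open>A commuting tuple of p-elements need not have eigenvectors over the field with q^2
  elements. Over the closure the q-power map is no longer an involution, and Hermitian symmetry
  becomes \<open>h u v ^ q = h (phi v) u\<close>. An eigenvector of character chi then pairs only
  with characters psi such that chi = sg psi, while phi takes chi to sg (sg chi). This dictates the
  indexing of an eigenbasis by a permutation s with \<open>e (s i)\<close> dual to
  \<open>e i\<close> and \<open>phi (e i) = e (s (s i))\<close>: s is a formal square root of phi,
  uniform in the parity of the orbit lengths. If two tuples have equal eigenspace dimensions along
  their chains, such bases are built for both in parallel with the same index data, and the map
  between them is the conjugating isometry. Only the first entry of an (r+1)-tuple has unrestricted
  order; summing over it produces stabiliser orders, which is why the exponent is r. The sign in the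
  exponent of W comes from log S(x) - log S'(x^2): after x d/dx the second term is twice the number
  of fixed points of sg^n at even n and zero at odd n.\<close>

lemma card_roots_separable:
  fixes f :: "'b::alg_closed_field poly"
  assumes "f \<noteq> 0" and "\<And>x. poly f x = 0 \<Longrightarrow> poly (pderiv f) x \<noteq> 0"
  shows "card {x. poly f x = 0} = degree f"
proof -
  obtain A where A: "size A = degree f" "f = smult (lead_coeff f) (\<Prod>x\<in>#A. [:-x, 1:])"
    using alg_closed_imp_factorization[OF assms(1)] by blast
  have roots: "{x. poly f x = 0} = set_mset A"
  proof -
    have "poly f x = 0 \<longleftrightarrow> x \<in># A" for x
    proof -
      have "poly f x = lead_coeff f * (\<Prod>y\<in>#A. (x - y))"
        by (subst A(2)) (simp add: poly_prod_mset algebra_simps)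
      then show ?thesis using assms(1) by auto
    qed
    then show ?thesis by auto
  qed
  \<comment> \<open>A double root would also be a root of the derivative.\<close>
  have "count A x \<le> 1" for x
  proof (rule ccontr)
    assume "\<not> count A x \<le> 1"
    then have c: "count A x \<ge> 2" by simp
    then have "replicate_mset 2 x \<subseteq># A" by (simp add: count_le_replicate_mset_subset_eq)
    then obtain A' where A': "A = replicate_mset 2 x + A'" by (metis subset_mset.le_iff_add)
    define g where "g = smult (lead_coeff f) (\<Prod>x\<in>#A'. [:-x, 1:])"
    have "f = [:-x,1:]^2 * g"
      by (subst A(2)) (simp only: A' g_def numeral_2_eq_2 replicate_mset_Suc replicate_mset_0 image_mset_union prod_mset.union image_mset_add_mset prod_mset.add_mset image_mset_empty prod_mset.empty mult_smult_right power_Suc power_0 mult_1_right mult.assoc)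
    then have "pderiv f = [:-x,1:]^2 * pderiv g + g * pderiv ([:-x,1:]^2)"
      by (simp add: pderiv_mult)
    moreover have "poly (pderiv ([:-x,1:]^2)) x = 0"
      by (simp add: power2_eq_square pderiv_mult pderiv_pCons)
    ultimately have "poly (pderiv f) x = 0" by simp
    moreover have "x \<in># A" using c by (metis count_inI not_numeral_le_zero)
    then have "poly f x = 0" using roots by auto
    ultimately show False using assms(2) by blast
  qed
  then have "A = mset_set (set_mset A)"
  proof (intro multiset_eqI)
    fix x
    show "count A x = count (mset_set (set_mset A)) x"
      using \<open>\<And>x. count A x \<le> 1\<close>[of x] count_greater_eq_one_iff[of A x]
      by (cases "x \<in># A") (auto simp: not_in_iff intro: le_antisym)
  qed
  then have "size A = card (set_mset A)" by (metis size_mset_set)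
  then show ?thesis using A(1) roots by simp
qed

lemma degree_diff_eq_left:
  fixes p r :: "'b::ab_group_add poly"
  shows "degree r < degree p \<Longrightarrow> degree (p - r) = degree p"
  using degree_add_eq_left[of "- r" p] by simp

lemma card_roots_of_unity:
  fixes M :: nat
  assumes "of_nat M \<noteq> (0::'b::alg_closed_field)"
  shows "card {z::'b. z ^ M = 1} = M"
proof -
  have M: "M > 0" using assms by (cases M) auto
  define f where "f = monom (1::'b) M - 1"
  have p: "poly f x = x ^ M - 1" for x by (simp add: f_def poly_monom)
  have deg: "degree f = M"
    unfolding f_def using M by (subst degree_diff_eq_left) (auto simp: degree_monom_eq)
  have "poly (pderiv f) x \<noteq> 0" if "poly f x = 0" for x
  proof -
    have "x \<noteq> 0" using that M by (auto simp: p power_0_left)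
    moreover have "poly (pderiv f) x = of_nat M * x ^ (M - 1)"
      by (simp add: f_def pderiv_diff pderiv_monom poly_monom)
    ultimately show ?thesis using assms by simp
  qed
  moreover have "f \<noteq> 0" using deg M by auto
  ultimately have "card {x. poly f x = 0} = M"
    using card_roots_separable[of f] deg by simp
  then show ?thesis by (simp add: p)
qed

text \<open>The form in which averaging arguments are run below: a linear functional applied to a
  weighted orbit sum is a polynomial in the weight, and a weight is wanted from a given set (a
  subfield, the roots of unity) at which it does not vanish.\<close>

lemma exists_non_root:
  fixes f :: "'b::idom poly"
  assumes "coeff f k \<noteq> 0" "degree f < card S"
  obtains a where "a \<in> S" "poly f a \<noteq> 0"
proof -
  have "f \<noteq> 0" using assms(1) by auto
  have "\<not> S \<subseteq> {x. poly f x = 0}"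
  proof
    assume "S \<subseteq> {x. poly f x = 0}"
    then have "card S \<le> card {x. poly f x = 0}"
      using poly_roots_finite[OF \<open>f \<noteq> 0\<close>] by (rule card_mono[rotated])
    also have "\<dots> \<le> degree f" using card_poly_roots_bound[OF \<open>f \<noteq> 0\<close>] .
    finally show False using assms(2) by simp
  qed
  then show ?thesis using that by auto
qed

lemma funpow_stable: "(\<And>v. v \<in> W \<Longrightarrow> f v \<in> W) \<Longrightarrow> v \<in> W \<Longrightarrow> (f ^^ k) v \<in> W"
  by (induction k) auto

lemma funpow_period: "(f ^^ N) v = v \<Longrightarrow> (f ^^ (j * N)) v = v"
  by (induction j) (auto simp: funpow_add)

lemma funpow_period_mod: "(f ^^ N) v = v \<Longrightarrow> (f ^^ k) v = (f ^^ (k mod N)) v"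
  using funpow_period[of N f v "k div N"] funpow_add[of "k mod N" "k div N * N" f]
  by (simp add: add.commute[of "k mod N"])

text \<open>Models the extension of scalars of a Hermitian space over the field with q^2 elements.
  \<open>phi\<close> is the q^2-Frobenius on coordinates, so its fixed vectors are the rational
  ones, and the two periodicity assumptions say that every scalar and every vector is defined over a
  finite subfield. \<open>h_herm\<close> is what Hermitian symmetry becomes after extension: on
  rational vectors \<open>phi\<close> disappears from it.\<close>

locale herm_space = vector_space scale
  for scale :: "'b::alg_closed_field \<Rightarrow> 'v::ab_group_add \<Rightarrow> 'v" (infixr "*s" 75) +
  fixes q :: nat and V B :: "'v set" and phi :: "'v \<Rightarrow> 'v" and h :: "'v \<Rightarrow> 'v \<Rightarrow> 'b"
  assumes q2: "2 \<le> q"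
    and of_nat_q: "of_nat q = (0::'b)"
    and frob_add: "\<And>x y::'b. (x + y) ^ q = x ^ q + y ^ q"
    and frob_period: "\<And>x::'b. \<exists>N>0. x ^ (q ^ (2 * N)) = x"
    and finite_B: "finite B" and indep_B: "independent B" and span_B: "span B = V"
    and phi_in: "\<And>v. v \<in> V \<Longrightarrow> phi v \<in> V"
    and phi_add: "\<And>u v. phi (u + v) = phi u + phi v"
    and phi_scale: "\<And>c v. phi (c *s v) = c ^ (q\<^sup>2) *s phi v"
    and phi_period: "\<And>v. v \<in> V \<Longrightarrow> \<exists>N>0. (phi ^^ N) v = v"
    and h_add_left: "\<And>u v w. h (u + v) w = h u w + h v w"
    and h_scale_left: "\<And>c u v. h (c *s u) v = c * h u v"
    and h_add_right: "\<And>u v w. h u (v + w) = h u v + h u w"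
    and h_scale_right: "\<And>c u v. h u (c *s v) = c ^ q * h u v"
    and h_herm: "\<And>u v. h u v ^ q = h (phi v) u"
    and h_nondeg: "\<And>u. u \<in> V \<Longrightarrow> (\<And>v. v \<in> V \<Longrightarrow> h u v = 0) \<Longrightarrow> u = 0"
begin

lemma subspace_V: "subspace V"
  using span_B subspace_span by metis

lemma q_pos: "q > 0" using q2 by simp

lemma frob_pow_add: "((x::'b) + y) ^ (q ^ k) = x ^ (q ^ k) + y ^ (q ^ k)"
proof (induction k)
  case (Suc k)
  have "(x + y) ^ (q ^ Suc k) = ((x + y) ^ (q ^ k)) ^ q" by (simp add: power_mult[symmetric] mult.commute)
  also have "\<dots> = (x ^ (q ^ k)) ^ q + (y ^ (q ^ k)) ^ q" by (simp add: Suc frob_add)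
  finally show ?case by (simp add: power_mult[symmetric] mult.commute)
qed simp

lemma frob_pow_uminus: "(- (x::'b)) ^ (q ^ k) = - (x ^ (q ^ k))"
proof -
  have "x ^ (q ^ k) + (- x) ^ (q ^ k) = 0"
    using frob_pow_add[of x "-x" k] q_pos by (simp add: power_0_left)
  then show ?thesis by (simp add: eq_neg_iff_add_eq_0 add.commute)
qed

lemma frob_pow_diff: "((x::'b) - y) ^ (q ^ k) = x ^ (q ^ k) - y ^ (q ^ k)"
  using frob_pow_add[of x "-y" k] by (simp add: frob_pow_uminus)

lemma frob_pow_sum: "(\<Sum>i\<in>S. f i :: 'b) ^ (q ^ k) = (\<Sum>i\<in>S. f i ^ (q ^ k))"
  using q_pos by (induction S rule: infinite_finite_induct) (auto simp: frob_pow_add power_0_left)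

lemma frob_inj: "(x::'b) ^ (q ^ k) = y ^ (q ^ k) \<Longrightarrow> x = y"
  using frob_pow_diff[of x y k] by simp

lemma frob_pow_pow: "((x::'b) ^ (q ^ j)) ^ (q ^ k) = x ^ (q ^ (j + k))"
  by (simp add: power_mult[symmetric] power_add)

lemma card_frob_fixed:
  assumes "k > 0"
  shows "card {z::'b. z ^ (q ^ k) = z} = q ^ k"
proof -
  define f where "f = monom (1::'b) (q ^ k) - [:0, 1:]"
  have qk: "q ^ k > 1" using q2 assms by (metis less_le_trans one_less_numeral_iff one_less_power semiring_norm(76))
  have p: "poly f x = x ^ (q ^ k) - x" for x by (simp add: f_def poly_monom)
  have deg: "degree f = q ^ k"
    unfolding f_def using qk by (subst degree_diff_eq_left) (auto simp: degree_monom_eq)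
  have "poly (pderiv f) x = -1" for x
    using assms by (simp add: f_def pderiv_diff pderiv_monom poly_monom of_nat_q pderiv_pCons)
  moreover have "f \<noteq> 0" using deg qk by (metis degree_0 not_one_less_zero)
  ultimately have "card {x. poly f x = 0} = q ^ k"
    using card_roots_separable[of f] deg by simp
  then show ?thesis by (simp add: p)
qed

text \<open>The additive polynomial with terms \<open>c i\<close> times X^(q^(d i)) has
  \<open>c 0\<close> as its coefficient at X and degree at most q^(d (N - 1)), which is less than
  the number q^(d N) of admissible \<open>a\<close>; hence it cannot vanish at all of them. With all
  coefficients 1 this is the nonvanishing of the trace.\<close>

lemma exists_trace_functional:
  fixes c :: "nat \<Rightarrow> 'b"
  assumes "d > 0" "N > 0" "c 0 \<noteq> 0"
  obtains a where "a ^ (q ^ (d * N)) = a" "(\<Sum>i<N. c i * a ^ (q ^ (d * i))) \<noteq> 0"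
proof -
  define f where "f = (\<Sum>i<N. monom (c i) (q ^ (d * i)))"
  have q1: "1 < q" using q2 by simp
  have "coeff f 1 = (\<Sum>i<N. if i = 0 then c 0 else 0)"
    unfolding f_def coeff_sum using q1 assms(1)
    by (intro sum.cong) (auto simp: power_eq_1_iff coeff_monom)
  also have "\<dots> = c 0" using assms(2) by (subst sum.delta) auto
  finally have c1: "coeff f 1 \<noteq> 0" using assms(3) by simp
  have "degree f \<le> q ^ (d * (N - 1))"
    unfolding f_def
  proof (intro degree_sum_le)
    fix i assume "i \<in> {..<N}"
    then have "q ^ (d * i) \<le> q ^ (d * (N - 1))"
      using q1 by (intro power_increasing) auto
    then show "degree (monom (c i) (q ^ (d * i))) \<le> q ^ (d * (N - 1))"
      using degree_monom_le order_trans by blast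
  qed simp
  also have "\<dots> < q ^ (d * N)" using q1 assms by (intro power_strict_increasing) auto
  also have "\<dots> = card {z::'b. z ^ (q ^ (d * N)) = z}"
    using card_frob_fixed[of "d * N"] assms by simp
  finally obtain a where "a \<in> {z::'b. z ^ (q ^ (d * N)) = z}" "poly f a \<noteq> 0"
    using exists_non_root[OF c1] by blast
  then show ?thesis using that by (auto simp: f_def poly_sum poly_monom)
qed

section \<open>Calculus of the semilinear map and the sesquilinear form\<close>

lemma V_closed [simp, intro]:
  "0 \<in> V" "u \<in> V \<Longrightarrow> v \<in> V \<Longrightarrow> u + v \<in> V" "u \<in> V \<Longrightarrow> v \<in> V \<Longrightarrow> u - v \<in> V" "v \<in> V \<Longrightarrow> c *s v \<in> V"
  using subspace_V subspace_0 subspace_add subspace_diff subspace_scale by auto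

lemma phi_0 [simp]: "phi 0 = 0" using phi_add[of 0 0] by simp
lemma phi_sum: "phi (\<Sum>i\<in>S. f i) = (\<Sum>i\<in>S. phi (f i))"
  by (induction S rule: infinite_finite_induct) (auto simp: phi_add)
lemma phi_minus: "phi (u - v) = phi u - phi v"
  by (metis add_diff_cancel phi_add diff_add_cancel)
lemma phi_pow_add: "(phi ^^ k) (u + v) = (phi ^^ k) u + (phi ^^ k) v"
  by (induction k) (auto simp: phi_add)
lemma phi_pow_minus: "(phi ^^ k) (u - v) = (phi ^^ k) u - (phi ^^ k) v"
  by (induction k) (auto simp: phi_minus)
lemma phi_pow_sum: "(phi ^^ k) (\<Sum>i\<in>S. f i) = (\<Sum>i\<in>S. (phi ^^ k) (f i))"
  by (induction k) (auto simp: phi_sum)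
lemma phi_pow_scale: "(phi ^^ k) (c *s v) = c ^ (q ^ (2 * k)) *s (phi ^^ k) v"
proof (induction k)
  case (Suc k)
  have "(phi ^^ Suc k) (c *s v) = (c ^ (q ^ (2 * k))) ^ (q ^ 2) *s (phi ^^ Suc k) v"
    by (simp add: phi_scale Suc)
  then show ?case by (simp only: frob_pow_pow) (simp add: add.commute)
qed simp
lemma phi_pow_in: "v \<in> V \<Longrightarrow> (phi ^^ k) v \<in> V"
  using funpow_stable[of V phi] phi_in by auto
lemma phi_pow_0 [simp]: "(phi ^^ k) 0 = 0" by (induction k) auto
lemma phi_inj: "u \<in> V \<Longrightarrow> v \<in> V \<Longrightarrow> phi u = phi v \<Longrightarrow> u = v"
proof -
  assume a: "u \<in> V" "v \<in> V" "phi u = phi v"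
  obtain N where N: "N > 0" "(phi ^^ N) (u - v) = u - v" using phi_period a by blast
  have "phi (u - v) = 0" using a by (simp add: phi_minus)
  then have "(phi ^^ N) (u - v) = 0" using N(1)
    by (cases N) (simp_all add: funpow_swap1)
  then show "u = v" using N by simp
qed

lemma h_0 [simp]: "h 0 v = 0" "h v 0 = 0"
  using h_scale_left[of 0 0 v] h_scale_right[of v 0 0] q_pos by (auto simp: power_0_left)
lemma h_sum_left: "h (\<Sum>i\<in>S. f i) v = (\<Sum>i\<in>S. h (f i) v)"
  by (induction S rule: infinite_finite_induct) (auto simp: h_add_left)
lemma h_sum_right: "h v (\<Sum>i\<in>S. f i) = (\<Sum>i\<in>S. h v (f i))"
  by (induction S rule: infinite_finite_induct) (auto simp: h_add_right)
lemma h_diff_left: "h (u - v) w = h u w - h v w"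
  by (metis add_diff_cancel h_add_left diff_add_cancel)
lemma h_diff_right: "h w (u - v) = h w u - h w v"
  by (metis add_diff_cancel h_add_right diff_add_cancel)

lemma h_phi: "h (phi u) (phi v) = h u v ^ (q ^ 2)"
proof -
  have "h u v ^ (q ^ 2) = (h u v ^ q) ^ q" by (simp add: power_mult[symmetric] power2_eq_square)
  then show ?thesis by (simp add: h_herm)
qed

lemma h_phi_pow: "h ((phi ^^ k) u) ((phi ^^ k) v) = h u v ^ (q ^ (2 * k))"
proof (induction k)
  case (Suc k)
  have "h ((phi ^^ Suc k) u) ((phi ^^ Suc k) v) = (h u v ^ (q ^ (2 * k))) ^ (q ^ 2)"
    by (simp add: h_phi Suc)
  then show ?case by (simp only: frob_pow_pow) (simp add: add.commute)
qed simp

lemma h_sym_0: "h u v = 0 \<Longrightarrow> h (phi v) u = 0"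
  using h_herm[of u v] q_pos by (simp add: power_0_left)

lemma h_nondeg_right:
  assumes "u \<in> V" "\<And>v. v \<in> V \<Longrightarrow> h v u = 0" shows "u = 0"
proof (rule h_nondeg[OF assms(1)])
  fix v assume v: "v \<in> V"
  have "h u v ^ q = 0" using h_herm[of u v] assms(2)[OF phi_in[OF v]] by simp
  then show "h u v = 0" by simp
qed

text \<open>If \<open>u\<close> has period N under \<open>phi ^^ d\<close> and \<open>a\<close> has
  the matching Frobenius period, the orbit sum of \<open>a *s u\<close> under
  \<open>phi ^^ d\<close> is fixed. Its value under \<open>l\<close> is a weighted trace of
  \<open>a\<close> with first coefficient \<open>l u\<close>, so a suitable \<open>a\<close> keeps
  it nonzero. The functional is carried along because later steps need fixed vectors that still pair
  nontrivially with a given vector.\<close>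

lemma fixed_vector:
  assumes "d > 0" "subspace W" "W \<subseteq> V" "\<And>w. w \<in> W \<Longrightarrow> (phi ^^ d) w \<in> W"
    and l: "\<And>x y. l (x + y) = l x + l y" "\<And>c x. l (c *s x) = c * l x"
    and u: "u \<in> W" "l u \<noteq> (0::'b)"
  obtains u' where "u' \<in> W" "(phi ^^ d) u' = u'" "l u' \<noteq> 0"
proof -
  obtain N where N: "N > 0" "(phi ^^ N) u = u" using phi_period u(1) assms(3) by blast
  have l0: "l 0 = 0" using l(2)[of 0 0] by simp
  have lsum: "l (\<Sum>i\<in>S. f i) = (\<Sum>i\<in>S. l (f i))" for f :: "nat \<Rightarrow> 'v" and S
    by (induction S rule: infinite_finite_induct) (auto simp: l l0)
  obtain a where a: "a ^ (q ^ (2 * d * N)) = a"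
      "(\<Sum>i<N. l ((phi ^^ (d * i)) u) * a ^ (q ^ (2 * d * i))) \<noteq> 0"
    using exists_trace_functional[of "2 * d" N "\<lambda>i. l ((phi ^^ (d * i)) u)"] assms(1) N(1) u(2) by auto
  define u' where "u' = (\<Sum>i<N. (phi ^^ (d * i)) (a *s u))"
  have phiW: "(phi ^^ (d * i)) w \<in> W" if "w \<in> W" for i w
  proof (induction i)
    case (Suc i)
    then show ?case using assms(4)[OF Suc] by (simp add: funpow_add)
  qed (use that in simp)
  then have "u' \<in> W" unfolding u'_def
    by (intro subspace_sum[OF assms(2)]) (auto intro: phiW subspace_scale[OF assms(2) u(1)])
  moreover have "(phi ^^ d) u' = u'"
  proof -
    have per: "(phi ^^ (d * N)) (a *s u) = a *s u"
      using a(1) funpow_period[OF N(2), of d] by (simp add: phi_pow_scale mult.assoc)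
    have "(phi ^^ d) u' = (\<Sum>i<N. (phi ^^ (d * Suc i)) (a *s u))"
      by (simp add: u'_def phi_pow_sum funpow_add)
    also have "\<dots> = (\<Sum>i<Suc N. (phi ^^ (d * i)) (a *s u)) - a *s u"
      by (subst sum.lessThan_Suc_shift) simp
    also have "\<dots> = u'" using per by (simp add: u'_def)
    finally show ?thesis .
  qed
  moreover have "l u' \<noteq> 0"
    using a(2) by (simp add: u'_def lsum phi_pow_scale l(2) ac_simps)
  ultimately show ?thesis using that by blast
qed

text \<open>Commuting with \<open>phi\<close> is the descent condition: such operators are exactly
  those given by unitary matrices over the small field. Linearity is asked on the whole type, the
  remaining conditions only on V.\<close>

definition unit_op :: "('v \<Rightarrow> 'v) \<Rightarrow> bool" where
  "unit_op Y \<longleftrightarrow> (\<forall>x y. Y (x + y) = Y x + Y y) \<and> (\<forall>c x. Y (c *s x) = c *s Y x) \<and>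
     (\<forall>v\<in>V. Y v \<in> V) \<and> (\<forall>v\<in>V. phi (Y v) = Y (phi v)) \<and> (\<forall>u\<in>V. \<forall>v\<in>V. h (Y u) (Y v) = h u v)"

text \<open>The exponent M being invertible in the field makes each operator semisimple; this is
  where the characteristic p = char is excluded.\<close>

definition rep :: "('v \<Rightarrow> 'v) list \<Rightarrow> bool" where
  "rep \<rho> \<longleftrightarrow> (\<forall>Y\<in>set \<rho>. unit_op Y \<and> (\<exists>M>0. of_nat M \<noteq> (0::'b) \<and> (\<forall>v\<in>V. (Y ^^ M) v = v))) \<and>
     (\<forall>Y\<in>set \<rho>. \<forall>Z\<in>set \<rho>. \<forall>v\<in>V. Y (Z v) = Z (Y v))"

definition stab :: "('v \<Rightarrow> 'v) list \<Rightarrow> 'v set \<Rightarrow> bool" where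
  "stab \<rho> W \<longleftrightarrow> subspace W \<and> W \<subseteq> V \<and> (\<forall>w\<in>W. phi w \<in> W) \<and> (\<forall>Y\<in>set \<rho>. \<forall>w\<in>W. Y w \<in> W)"

text \<open>A list of eigenvalues of the wrong length gives the empty set rather than the zero
  space.\<close>

definition Eig :: "('v \<Rightarrow> 'v) list \<Rightarrow> 'b list \<Rightarrow> 'v set" where
  "Eig \<rho> \<chi> = {v \<in> V. length \<chi> = length \<rho> \<and> (\<forall>t<length \<rho>. (\<rho> ! t) v = \<chi> ! t *s v)}"

text \<open>Unitarity forces x * y^q = 1 for the eigenvalues x, y of two eigenvectors u, v with
  \<open>h u v\<close> nonzero; \<open>sg\<close> solves this for x.\<close>

definition sg :: "'b list \<Rightarrow> 'b list" where
  "sg \<chi> = map (\<lambda>z. inverse (z ^ q)) \<chi>"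

lemma unit_op_lin:
  assumes "unit_op Y"
  shows "Y (x + y) = Y x + Y y" "Y (c *s x) = c *s Y x" "Y 0 = 0" "Y (x - y) = Y x - Y y"
    "Y (\<Sum>i\<in>S. f i) = (\<Sum>i\<in>S. Y (f i))"
proof -
  show 1: "Y (x + y) = Y x + Y y" "Y (c *s x) = c *s Y x" for x y c using assms by (auto simp: unit_op_def)
  show 0: "Y 0 = 0" using 1(1)[of 0 0] by simp
  show "Y (x - y) = Y x - Y y" by (metis 1(1) add_diff_cancel diff_add_cancel)
  show "Y (\<Sum>i\<in>S. f i) = (\<Sum>i\<in>S. Y (f i))"
    by (induction S rule: infinite_finite_induct) (auto simp: 0 1)
qed

text \<open>Discrete Fourier transform: for z^M = 1 the sum of the
  \<open>z ^ t *s (Y ^^ t) u\<close> is an eigenvector for the inverse of z. Its value under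
  \<open>l\<close> is a polynomial in z of degree below M with constant term \<open>l u\<close>, so
  it does not vanish at all M roots of unity.\<close>

lemma eigenvector:
  assumes Y: "unit_op Y" and M: "of_nat M \<noteq> (0::'b)" "\<And>v. v \<in> V \<Longrightarrow> (Y ^^ M) v = v"
    and W: "subspace W" "W \<subseteq> V" "\<And>w. w \<in> W \<Longrightarrow> Y w \<in> W"
    and l: "\<And>x y. l (x + y) = l x + l y" "\<And>c x. l (c *s x) = c * l x"
    and u: "u \<in> W" "l u \<noteq> (0::'b)"
  obtains z u' where "u' \<in> W" "Y u' = z *s u'" "l u' \<noteq> 0"
proof -
  have M0: "M > 0" using M(1) by (cases M) auto
  have l0: "l 0 = 0" using l(2)[of 0 0] by simp
  have lsum: "l (\<Sum>i\<in>S. f i) = (\<Sum>i\<in>S. l (f i))" for f :: "nat \<Rightarrow> 'v" and S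
    by (induction S rule: infinite_finite_induct) (auto simp: l l0)
  define f where "f = (\<Sum>t<M. monom (l ((Y ^^ t) u)) t)"
  have "coeff f 0 = l u"
    unfolding f_def coeff_sum using M0 by (subst sum.cong[OF refl, of _ _ "\<lambda>t. if t = 0 then l u else 0"]) auto
  then have c0: "coeff f 0 \<noteq> 0" using u by simp
  have "degree f \<le> M - 1"
    unfolding f_def by (intro degree_sum_le) (auto intro!: order_trans[OF degree_monom_le])
  then have "degree f < card {z::'b. z ^ M = 1}"
    using M0 card_roots_of_unity[OF M(1)] by simp
  then obtain z where z: "z ^ M = 1" "poly f z \<noteq> 0" using exists_non_root[OF c0] by blast
  have z0: "z \<noteq> 0" using z(1) M0 by (auto simp: power_0_left)
  define u' where "u' = (\<Sum>t<M. z ^ t *s (Y ^^ t) u)"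
  have XW: "(Y ^^ t) u \<in> W" for t using funpow_stable[of W Y] W(3) u(1) by blast
  have "u' \<in> W" unfolding u'_def
    by (intro subspace_sum[OF W(1)] subspace_scale[OF W(1)] XW)
  moreover have "Y u' = inverse z *s u'"
  proof -
    have "z *s Y u' = (\<Sum>t<M. z ^ Suc t *s (Y ^^ Suc t) u)"
      by (simp add: u'_def unit_op_lin[OF Y] scale_sum_right)
    also have "\<dots> = (\<Sum>t<Suc M. z ^ t *s (Y ^^ t) u) - u"
      by (subst sum.lessThan_Suc_shift) simp
    also have "\<dots> = u'" using z(1) M(2) u(1) W(2) by (auto simp: u'_def)
    finally have "inverse z *s (z *s Y u') = inverse z *s u'" by simp
    then show ?thesis using z0 by simp
  qed
  moreover have "l u' \<noteq> 0"
    using z(2) by (simp add: u'_def f_def lsum l(2) poly_sum poly_monom mult.commute)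
  ultimately show ?thesis using that by blast
qed

lemma subspace_Eig: "length \<chi> = length \<rho> \<Longrightarrow> (\<And>Y. Y \<in> set \<rho> \<Longrightarrow> unit_op Y) \<Longrightarrow> subspace (Eig \<rho> \<chi>)"
  unfolding subspace_def Eig_def
  by (auto simp: unit_op_lin scale_right_distrib mult.commute)

text \<open>The eigenspace of the first operator inside W is stable under the others because they
  commute, so induction applies to it; the functional stays nonzero throughout.\<close>

lemma joint_eigenvector:
  assumes "rep \<rho>" "subspace W" "W \<subseteq> V" "\<And>Y w. Y \<in> set \<rho> \<Longrightarrow> w \<in> W \<Longrightarrow> Y w \<in> W"
    and l: "\<And>x y. l (x + y) = l x + l y" "\<And>c x. l (c *s x) = c * l x"
    and u: "u \<in> W" "l u \<noteq> (0::'b)"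
  shows "\<exists>\<chi> u'. u' \<in> W \<and> u' \<in> Eig \<rho> \<chi> \<and> l u' \<noteq> 0"
  using assms(1-4) u
proof (induction \<rho> arbitrary: W u)
  case Nil
  then show ?case by (auto simp: Eig_def)
next
  case (Cons Y \<rho>)
  have Y: "unit_op Y" using Cons.prems(1) by (auto simp: rep_def)
  obtain M where M: "of_nat M \<noteq> (0::'b)" "\<And>v. v \<in> V \<Longrightarrow> (Y ^^ M) v = v"
    using Cons.prems(1) by (auto simp: rep_def)
  have YW: "Y w \<in> W" if "w \<in> W" for w using Cons.prems(4)[of Y w] that by simp
  obtain z u1 where u1: "u1 \<in> W" "Y u1 = z *s u1" "l u1 \<noteq> 0"
    using eigenvector[OF Y M Cons.prems(2,3) YW l Cons.prems(5,6)] by blast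
  define W' where "W' = {w \<in> W. Y w = z *s w}"
  have "subspace W'" using Cons.prems(2) unfolding W'_def subspace_def
    by (auto simp: unit_op_lin[OF Y] scale_right_distrib mult.commute)
  moreover have "Z w \<in> W'" if "Z \<in> set \<rho>" "w \<in> W'" for Z w
  proof -
    have Z: "unit_op Z" using Cons.prems(1) that by (auto simp: rep_def)
    have "Y (Z w) = Z (Y w)" using Cons.prems(1,3) that by (auto simp: rep_def W'_def)
    then show ?thesis using that Cons.prems(4) by (auto simp: W'_def unit_op_lin[OF Z])
  qed
  moreover have "rep \<rho>" using Cons.prems(1) by (auto simp: rep_def)
  moreover have "W' \<subseteq> V" using Cons.prems(3) by (auto simp: W'_def)
  moreover have "u1 \<in> W'" using u1 by (auto simp: W'_def)
  ultimately obtain \<chi> u' where "u' \<in> W'" "u' \<in> Eig \<rho> \<chi>" "l u' \<noteq> 0"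
    using Cons.IH[of W' u1] u1(3) by blast
  then have "u' \<in> W \<and> u' \<in> Eig (Y # \<rho>) (z # \<chi>) \<and> l u' \<noteq> 0"
    by (auto simp: W'_def Eig_def nth_Cons split: nat.splits)
  then show ?case by blast
qed

section \<open>The action of \<open>sg\<close> on characters\<close>

lemma length_sg [simp]: "length (sg \<chi>) = length \<chi>" by (simp add: sg_def)
lemma length_sg_pow [simp]: "length ((sg ^^ k) \<chi>) = length \<chi>" by (induction k) auto

lemma sg_inj: "sg \<chi> = sg \<psi> \<Longrightarrow> \<chi> = \<psi>"
  unfolding sg_def by (rule map_injective) (use frob_inj[of _ 1] in \<open>auto simp: inj_on_def\<close>)

lemma sg_pow_inj: "(sg ^^ k) \<chi> = (sg ^^ k) \<psi> \<Longrightarrow> \<chi> = \<psi>"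
  by (induction k) (auto dest: sg_inj)

lemma sg_sg: "sg (sg \<chi>) = map (\<lambda>z. z ^ (q\<^sup>2)) \<chi>"
proof -
  have "inverse (inverse (z ^ q) ^ q) = z ^ (q\<^sup>2)" for z :: 'b
    by (simp only: power_inverse inverse_inverse_eq power2_eq_square power_mult)
  then show ?thesis by (simp add: sg_def)
qed

lemma sg_pow_even: "(sg ^^ (2 * k)) \<chi> = map (\<lambda>z. z ^ (q ^ (2 * k))) \<chi>"
proof (induction k)
  case (Suc k)
  have "(sg ^^ (2 * Suc k)) \<chi> = sg (sg ((sg ^^ (2 * k)) \<chi>))" by simp
  then show ?case unfolding sg_sg Suc by (simp add: power_mult[symmetric] power_add power2_eq_square ac_simps)
qed simp

lemma exists_common_period:
  assumes "finite S"
  shows "\<exists>N>0. \<forall>z\<in>S. (z::'b) ^ (q ^ (2 * N)) = z"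
  using assms
proof (induction S)
  case (insert x S)
  then obtain N where N: "N > 0" "\<forall>z\<in>S. z ^ (q ^ (2 * N)) = z" by blast
  obtain M where M: "M > 0" "x ^ (q ^ (2 * M)) = x" using frob_period by blast
  have per: "z ^ (q ^ (2 * (j * k))) = z" if "z ^ (q ^ (2 * k)) = z" for z :: 'b and j k
  proof (induction j)
    case (Suc j)
    have "z ^ (q ^ (2 * (Suc j * k))) = (z ^ (q ^ (2 * (j * k)))) ^ (q ^ (2 * k))"
      by (simp add: frob_pow_pow algebra_simps)
    then show ?case using Suc that by simp
  qed simp
  have "\<forall>z\<in>insert x S. z ^ (q ^ (2 * (M * N))) = z"
    using per[of _ N M] per[of x M N] N(2) M(2) by (auto simp: mult.commute)
  then show ?case using N(1) M(1) by (intro exI[of _ "M * N"]) auto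
qed (auto intro: exI[of _ 1])

lemma sg_period: "\<exists>m>0. (sg ^^ m) \<chi> = \<chi>"
proof -
  obtain N where "N > 0" "\<forall>z\<in>set \<chi>. z ^ (q ^ (2 * N)) = z"
    using exists_common_period[of "set \<chi>"] by auto
  then have "(sg ^^ (2 * N)) \<chi> = \<chi>" unfolding sg_pow_even by (simp add: map_idI)
  then show ?thesis using \<open>N > 0\<close> by (intro exI[of _ "2 * N"]) auto
qed

lemma h_Eig:
  assumes "rep \<rho>" "u \<in> Eig \<rho> \<chi>" "v \<in> Eig \<rho> \<psi>" "h u v \<noteq> 0"
  shows "\<chi> = sg \<psi>"
proof (rule nth_equalityI)
  show "length \<chi> = length (sg \<psi>)" using assms by (auto simp: Eig_def)
  fix t assume "t < length \<chi>"
  then have t: "t < length \<rho>" "t < length \<psi>" using assms by (auto simp: Eig_def)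
  have Y: "unit_op (\<rho> ! t)" using assms(1) t by (auto simp: rep_def)
  have "h u v = h ((\<rho> ! t) u) ((\<rho> ! t) v)" using Y assms(2,3) by (auto simp: unit_op_def Eig_def)
  also have "\<dots> = \<chi> ! t * ((\<psi> ! t) ^ q * h u v)"
    using assms(2,3) t by (simp add: Eig_def h_scale_left h_scale_right)
  finally have "\<chi> ! t * (\<psi> ! t) ^ q = 1" using assms(4) by simp
  then show "\<chi> ! t = sg \<psi> ! t" using t by (simp add: sg_def inverse_unique mult.commute)
qed

text \<open>Semilinearity raises each eigenvalue to the power q^2, which is \<open>sg\<close>
  applied twice; a single \<open>sg\<close> is visible only through the form.\<close>

lemma phi_Eig:
  assumes "rep \<rho>" "v \<in> Eig \<rho> \<chi>" shows "phi v \<in> Eig \<rho> (sg (sg \<chi>))"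
proof -
  have "(\<rho> ! t) (phi v) = sg (sg \<chi>) ! t *s phi v" if "t < length \<rho>" for t
  proof -
    have Y: "unit_op (\<rho> ! t)" using assms(1) that by (auto simp: rep_def)
    have "(\<rho> ! t) (phi v) = phi ((\<rho> ! t) v)" using Y assms(2) by (auto simp: unit_op_def Eig_def)
    then show ?thesis using assms(2) that by (simp add: Eig_def phi_scale sg_sg)
  qed
  then show ?thesis using assms by (auto simp: Eig_def phi_in)
qed

lemma phi_pow_Eig:
  assumes "rep \<rho>" "v \<in> Eig \<rho> \<chi>" shows "(phi ^^ k) v \<in> Eig \<rho> ((sg ^^ (2 * k)) \<chi>)"
  by (induction k) (use assms phi_Eig in \<open>auto\<close>)

end

section \<open>Dual eigenvectors\<close>

lemma funpow_minimal_period: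
  assumes "\<And>x y. f x = f y \<Longrightarrow> x = y" and "N > 0" "(f ^^ N) x = x"
  obtains d where "d > 0" "\<And>t t'. (f ^^ t) x = (f ^^ t') x \<longleftrightarrow> t mod d = t' mod d"
proof -
  define d where "d = (LEAST n. n > 0 \<and> (f ^^ n) x = x)"
  have d: "d > 0" "(f ^^ d) x = x"
    using LeastI[of "\<lambda>n. n > 0 \<and> (f ^^ n) x = x" N] assms(2,3) by (auto simp: d_def)
  have least: "n = 0" if "n < d" "(f ^^ n) x = x" for n
    using not_less_Least[of n "\<lambda>n. n > 0 \<and> (f ^^ n) x = x"] that by (auto simp: d_def)
  have inj: "(f ^^ k) u = (f ^^ k) w \<Longrightarrow> u = w" for k u w
    by (induction k) (auto dest: assms(1))
  have le: "i = j" if "i \<le> j" "j < d" "(f ^^ i) x = (f ^^ j) x" for i j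
  proof -
    have "(f ^^ i) ((f ^^ (j - i)) x) = (f ^^ i) x"
      using that by (simp flip: funpow_add comp_apply[of "f ^^ i"])
    then have "(f ^^ (j - i)) x = x" by (rule inj)
    moreover have "j - i < d" using that by linarith
    ultimately show ?thesis using least[of "j - i"] that by auto
  qed
  have "(f ^^ t) x = (f ^^ t') x \<longleftrightarrow> t mod d = t' mod d" for t t'
  proof
    assume "(f ^^ t) x = (f ^^ t') x"
    then have "(f ^^ (t mod d)) x = (f ^^ (t' mod d)) x"
      using funpow_period_mod[of d f x] d(2) by metis
    then show "t mod d = t' mod d"
      using le[of "t mod d" "t' mod d"] le[of "t' mod d" "t mod d"] d(1)
      by (metis mod_less_divisor nat_le_linear)
  next
    assume "t mod d = t' mod d"
    then show "(f ^^ t) x = (f ^^ t') x"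
      using funpow_period_mod[of d f x] d(2) by metis
  qed
  then show ?thesis using that d by blast
qed

context herm_space
begin

definition nondeg_on :: "'v set \<Rightarrow> bool" where
  "nondeg_on W \<longleftrightarrow> (\<forall>w\<in>W. w \<noteq> 0 \<longrightarrow> (\<exists>u\<in>W. h u w \<noteq> 0))"

text \<open>One cycle of the eigenbasis, written as an m-periodic sequence: advancing by one applies
  \<open>sg\<close> to the character and passes to the dual vector, advancing by two is
  \<open>phi\<close>. For even m this consists of two \<open>phi\<close>-orbits dual to each other,
  for odd m of a single self-dual one.\<close>

definition block :: "('v \<Rightarrow> 'v) list \<Rightarrow> 'v set \<Rightarrow> nat \<Rightarrow> 'b list \<Rightarrow> (nat \<Rightarrow> 'v) \<Rightarrow> bool" where
  "block \<rho> W m \<chi> b \<longleftrightarrow> 0 < m \<and> (\<forall>i. b i \<in> W \<and> b i \<in> Eig \<rho> ((sg ^^ i) \<chi>)) \<and> (\<forall>i. phi (b i) = b (i + 2)) \<and>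
     (\<forall>i. b (i + m) = b i) \<and> (\<forall>i j. h (b (i + 1)) (b j) = (if i mod m = j mod m then 1 else 0))"

lemma phi_pow_V_stab: "stab \<rho> W \<Longrightarrow> w \<in> W \<Longrightarrow> (phi ^^ k) w \<in> W"
  using funpow_stable[of W phi] by (auto simp: stab_def)

lemma h_phi_pow_Eig:
  assumes "rep \<rho>" "u \<in> Eig \<rho> \<chi>" "v \<in> Eig \<rho> \<psi>" "h ((phi ^^ t) u) ((phi ^^ t') v) \<noteq> 0"
  shows "(sg ^^ (2 * t)) \<chi> = (sg ^^ Suc (2 * t')) \<psi>"
  using h_Eig[OF assms(1) phi_pow_Eig[OF assms(1,2)] phi_pow_Eig[OF assms(1,3)] assms(4)] by simp

lemma sg_pow_Suc: "(sg ^^ k) (sg \<chi>) = (sg ^^ Suc k) \<chi>"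
  by (simp add: funpow_swap1)

text \<open>The \<open>phi\<close>-orbits of v and v' are interleaved, v at the even and v' at the
  odd places. Pairings within one orbit vanish by isotropy; between the orbits they vanish by
  comparing characters unless the indices agree modulo d, and then invariance under
  \<open>phi\<close> reduces them to \<open>h v' v = 1\<close>. \<open>h_herm\<close> handles the
  opposite order.\<close>

lemma even_block:
  assumes rep: "rep \<rho>" and W: "stab \<rho> W"
    and v: "v \<in> W" "v \<in> Eig \<rho> \<chi>" and v': "v' \<in> W" "v' \<in> Eig \<rho> (sg \<chi>)"
    and d: "d > 0" "(phi ^^ d) v = v" "(phi ^^ d) v' = v'"
    and per: "\<And>t t'. (sg ^^ (2 * t)) \<chi> = (sg ^^ (2 * t')) \<chi> \<Longrightarrow> t mod d = t' mod d"
    and hv: "h v' v = 1"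
    and iso: "\<And>t t'. h ((phi ^^ t) v) ((phi ^^ t') v) = 0" "\<And>t t'. h ((phi ^^ t) v') ((phi ^^ t') v') = 0"
  shows "block \<rho> W (2 * d) \<chi> (\<lambda>i. (phi ^^ (i div 2)) (if even i then v else v'))"
proof -
  define b where "b = (\<lambda>i. (phi ^^ (i div 2)) (if even i then v else v'))"
  have b: "b (2 * t) = (phi ^^ t) v" "b (Suc (2 * t)) = (phi ^^ t) v'" for t
    by (auto simp: b_def)
  have key: "h ((phi ^^ t) v') ((phi ^^ t') v) = (if t mod d = t' mod d then 1 else 0)" for t t'
  proof (cases "t mod d = t' mod d")
    case True
    then have "(phi ^^ t') v = (phi ^^ t) v" using funpow_period_mod[OF d(2)] by metis
    then show ?thesis using True hv by (simp add: h_phi_pow)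
  next
    case False
    have "h ((phi ^^ t) v') ((phi ^^ t') v) = 0"
    proof (rule ccontr)
      assume "h ((phi ^^ t) v') ((phi ^^ t') v) \<noteq> 0"
      from h_phi_pow_Eig[OF rep v'(2) v(2) this]
      have "sg ((sg ^^ (2 * t)) \<chi>) = sg ((sg ^^ (2 * t')) \<chi>)" by (simp add: sg_pow_Suc)
      then show False using per[of t t'] False by (auto dest: sg_inj)
    qed
    then show ?thesis using False by simp
  qed
  have mod2: "(2 * t) mod (2 * d) = 2 * (t mod d)" "Suc (2 * t) mod (2 * d) = Suc (2 * (t mod d))" for t
  proof -
    show "(2 * t) mod (2 * d) = 2 * (t mod d)" by simp
    have "Suc (2 * t) mod (2 * d) = (2 * (t mod d) + 1) mod (2 * d)"
      by (metis Suc_eq_plus1 mod_add_left_eq mult_mod_right)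
    also have "\<dots> = Suc (2 * (t mod d))"
      using mod_less_divisor[OF d(1), of t] by (subst mod_less) auto
    finally show "Suc (2 * t) mod (2 * d) = Suc (2 * (t mod d))" .
  qed
  have pair: "h (b (i + 1)) (b j) = (if i mod (2 * d) = j mod (2 * d) then 1 else 0)" for i j
  proof -
    consider t t' where "i = 2 * t" "j = 2 * t'" | t t' where "i = Suc (2 * t)" "j = 2 * t'"
      | t t' where "i = 2 * t" "j = Suc (2 * t')" | t t' where "i = Suc (2 * t)" "j = Suc (2 * t')"
      by (metis evenE oddE Suc_eq_plus1)
    then show ?thesis
    proof cases
      case 1 then show ?thesis using key by (simp add: b mod2)
    next
      case 2
      have "b (i + 1) = (phi ^^ Suc t) v" using b(1)[of "Suc t"] 2 by simp
      moreover have "i mod (2 * d) \<noteq> j mod (2 * d)" unfolding 2 mod2 by (rule Suc_double_not_eq_double)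
      ultimately show ?thesis using 2 iso(1)[of "Suc t" t'] by (simp add: b)
    next
      case 3
      have "i mod (2 * d) \<noteq> j mod (2 * d)" unfolding 3 mod2 by (rule double_not_eq_Suc_double)
      then show ?thesis using 3 iso(2)[of t t'] by (simp add: b)
    next
      case 4
      have "h (b (i + 1)) (b j) = h (phi ((phi ^^ t) v)) ((phi ^^ t') v')"
        using b(1)[of "Suc t"] 4 by (simp add: b)
      also have "\<dots> = h ((phi ^^ t') v') ((phi ^^ t) v) ^ q" by (simp add: h_herm)
      also have "\<dots> = (if t mod d = t' mod d then 1 else 0)" using key[of t' t] q_pos by auto
      finally show ?thesis using 4 by (simp add: mod2)
    qed
  qed
  have in_Eig: "b i \<in> W \<and> b i \<in> Eig \<rho> ((sg ^^ i) \<chi>)" for i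
  proof (cases "even i")
    case True
    then obtain t where "i = 2 * t" by (elim evenE)
    then show ?thesis using phi_pow_V_stab[OF W v(1)] phi_pow_Eig[OF rep v(2), of t] by (simp add: b)
  next
    case False
    then obtain t where i: "i = Suc (2 * t)" by (elim oddE) simp
    show ?thesis using phi_pow_V_stab[OF W v'(1)] phi_pow_Eig[OF rep v'(2), of t]
      unfolding i b sg_pow_Suc by simp
  qed
  have "phi (b i) = b (i + 2)" for i by (auto simp: b_def)
  moreover have "b (i + 2 * d) = b i" for i
  proof -
    have "(phi ^^ d) ((phi ^^ (i div 2)) x) = (phi ^^ (i div 2)) x" if "(phi ^^ d) x = x" for x
      using that by (metis add.commute comp_apply funpow_add)
    then show ?thesis using d by (auto simp: b_def funpow_add)
  qed
  ultimately show ?thesis unfolding block_def b_def[symmetric] using pair in_Eig d(1) by auto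
qed

text \<open>Nondegeneracy gives a vector pairing with v, which is moved into an eigenspace and then
  made fixed under \<open>phi ^^ d\<close> without losing the pairing; its character can only be
  \<open>sg \<chi>\<close>. The value y of the pairing satisfies y^(q^(2d)) = y because both vectors
  are fixed, so dividing by y does not destroy fixedness.\<close>

lemma dual_vector:
  assumes rep: "rep \<rho>" and W: "stab \<rho> W" "nondeg_on W"
    and v: "v \<in> W" "v \<in> Eig \<rho> \<chi>" "v \<noteq> 0"
    and d: "d > 0" "(phi ^^ d) v = v" "(sg ^^ (2 * d)) \<chi> = \<chi>"
  obtains v' where "v' \<in> W" "v' \<in> Eig \<rho> (sg \<chi>)" "(phi ^^ d) v' = v'" "h v' v = 1"
proof -
  have Wsub: "subspace W" "W \<subseteq> V" "\<And>Y w. Y \<in> set \<rho> \<Longrightarrow> w \<in> W \<Longrightarrow> Y w \<in> W" using W by (auto simp: stab_def)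
  obtain u where u: "u \<in> W" "h u v \<noteq> 0" using W(2) v by (auto simp: nondeg_on_def)
  obtain \<psi> u1 where u1: "u1 \<in> W" "u1 \<in> Eig \<rho> \<psi>" "h u1 v \<noteq> 0"
    using joint_eigenvector[where l = "\<lambda>u. h u v" and W = W and u = u and \<rho> = \<rho>]
      rep Wsub u h_add_left h_scale_left by blast
  have \<psi>: "\<psi> = sg \<chi>" using h_Eig[OF rep u1(2) v(2) u1(3)] .
  have len: "length (sg \<chi>) = length \<rho>" using v(2) by (auto simp: Eig_def)
  have sub: "subspace (W \<inter> Eig \<rho> (sg \<chi>))"
    using subspace_inter[OF Wsub(1) subspace_Eig[OF len]] rep by (auto simp: rep_def)
  have st: "(phi ^^ d) w \<in> W \<inter> Eig \<rho> (sg \<chi>)" if "w \<in> W \<inter> Eig \<rho> (sg \<chi>)" for w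
  proof -
    have "(sg ^^ (2 * d)) (sg \<chi>) = sg \<chi>" using d(3) by (simp add: sg_pow_Suc)
    then show ?thesis using phi_pow_V_stab[OF W(1)] phi_pow_Eig[OF rep, of w "sg \<chi>" d] that by auto
  qed
  obtain u2 where u2: "u2 \<in> W \<inter> Eig \<rho> (sg \<chi>)" "(phi ^^ d) u2 = u2" "h u2 v \<noteq> 0"
    using fixed_vector[OF d(1) sub _ st, of "\<lambda>u. h u v" u1] u1 \<psi> Wsub(2) h_add_left h_scale_left by blast
  define y where "y = h u2 v"
  have y: "y ^ (q ^ (2 * d)) = y" using h_phi_pow[of d u2 v] u2(2) d(2) by (simp add: y_def)
  define v' where "v' = inverse y *s u2"
  have "v' \<in> W \<inter> Eig \<rho> (sg \<chi>)" unfolding v'_def using subspace_scale[OF sub u2(1)] .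
  moreover have "(phi ^^ d) v' = v'" by (simp add: v'_def phi_pow_scale u2(2) power_inverse y)
  moreover have "h v' v = 1" using u2(3) by (simp add: v'_def h_scale_left y_def)
  ultimately show ?thesis using that by blast
qed

text \<open>An element of trace 1 from the field with q^2 elements to the one with q elements. It
  plays the role of one half in completing a hyperbolic pair and exists in characteristic 2 as
  well.\<close>

lemma exists_half:
  obtains a :: 'b where "a ^ (q\<^sup>2) = a" "a + a ^ q = 1"
proof -
  obtain z :: 'b where z0: "z ^ (q ^ (1 * 2)) = z" "(\<Sum>i<2. 1 * z ^ (q ^ (1 * i))) \<noteq> 0"
    by (rule exists_trace_functional[of 1 2 "\<lambda>_. 1"]) simp_all
  have two: "{..<2::nat} = {0, 1}" by auto
  have z: "z ^ (q\<^sup>2) = z" "z + z ^ q \<noteq> 0"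
    using z0 by (simp_all add: two)
  define t where "t = z + z ^ q"
  have pq: "x ^ (q\<^sup>2) = (x ^ q) ^ q" for x :: 'b by (simp only: power2_eq_square power_mult)
  have tq: "t ^ q = t" using z(1) by (simp only: t_def frob_add pq add.commute)
  have tq2: "t ^ (q\<^sup>2) = t" by (simp only: pq tq)
  have "(z / t) ^ (q ^ 2) = z / t" by (simp add: power_divide z(1) tq2)
  moreover have "z / t + (z / t) ^ q = 1"
    using z(2) by (simp add: power_divide tq flip: add_divide_distrib t_def)
  ultimately show ?thesis using that by blast
qed

text \<open>When \<open>sg \<chi>\<close> lies in the \<open>phi\<close>-orbit of \<open>\<chi>\<close>, a dual vector need not be isotropic; it is
  corrected by a multiple of a \<open>phi\<close>-translate of \<open>v\<close>, using an element of trace 1.\<close>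
lemma isotropic_dual_vector:
  assumes rep: "rep \<rho>" and W: "stab \<rho> W" "nondeg_on W"
    and v: "v \<in> W" "v \<in> Eig \<rho> \<chi>" "v \<noteq> 0"
    and d: "d > 0" "(phi ^^ d) v = v"
    and per: "\<And>t t'. (sg ^^ (2 * t)) \<chi> = (sg ^^ (2 * t')) \<chi> \<longleftrightarrow> t mod d = t' mod d"
    and iso: "\<And>t t'. h ((phi ^^ t) v) ((phi ^^ t') v) = 0"
  obtains v' where "v' \<in> W" "v' \<in> Eig \<rho> (sg \<chi>)" "(phi ^^ d) v' = v'" "h v' v = 1"
    "\<And>t t'. h ((phi ^^ t) v') ((phi ^^ t') v') = 0"
proof -
  have perd: "(sg ^^ (2 * d)) \<chi> = \<chi>" using per[of d 0] by simp
  obtain u where u: "u \<in> W" "u \<in> Eig \<rho> (sg \<chi>)" "(phi ^^ d) u = u" "h u v = 1"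
    using dual_vector[OF rep W v d perd] by blast
  show ?thesis
  proof (cases "\<exists>k. sg \<chi> = (sg ^^ (2 * k)) \<chi>")
    case False
    have "h ((phi ^^ t) u) ((phi ^^ t') u) = 0" for t t'
    proof (rule ccontr)
      assume "h ((phi ^^ t) u) ((phi ^^ t') u) \<noteq> 0"
      from h_phi_pow_Eig[OF rep u(2) u(2) this]
      have eq: "(sg ^^ Suc (2 * t)) \<chi> = (sg ^^ (2 * (t' + 1))) \<chi>" by (simp add: sg_pow_Suc)
      \<comment> \<open>Adding 2s steps turns 2t + 1 into 1 plus a multiple of the period 2d, which
        isolates \<open>sg \<chi>\<close> on one side.\<close>
      define s where "s = t * (d - 1)"
      have ts: "2 * s + Suc (2 * t) = 1 + t * (2 * d)" using d(1) by (cases d) (simp_all add: s_def algebra_simps)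
      have "(sg ^^ (2 * s + Suc (2 * t))) \<chi> = (sg ^^ (2 * s + 2 * (t' + 1))) \<chi>"
        using eq by (simp only: funpow_add comp_apply)
      also have "(sg ^^ (2 * s + Suc (2 * t))) \<chi> = sg \<chi>"
        unfolding ts funpow_add comp_apply using funpow_period[OF perd, of t] by simp
      finally have "sg \<chi> = (sg ^^ (2 * (s + (t' + 1)))) \<chi>" by (simp only: distrib_left)
      then show False using False by blast
    qed
    then show ?thesis using that u by blast
  next
    case True
    then obtain k0 where k0: "sg \<chi> = (sg ^^ (2 * k0)) \<chi>" by blast
    \<comment> \<open>Adding a full period keeps the relation and makes k positive, so that the
      exponents 2k - 1 and 2k - 2 below are true differences.\<close>
    define k where "k = k0 + d"
    have k: "k \<ge> 1" "sg \<chi> = (sg ^^ (2 * k)) \<chi>"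
      using d(1) k0 perd by (simp_all add: k_def distrib_left funpow_add)
    \<comment> \<open>On \<open>\<chi>\<close> the map \<open>sg\<close> agrees with its 2k-th
      power, so applying it twice gives 4k against 2. Thus \<open>phi ^^ k\<close> is a square root
      of \<open>phi\<close> on vectors fixed by \<open>phi ^^ d\<close>.\<close>
    have k2: "(2 * k) mod d = 1 mod d"
    proof -
      have "(sg ^^ (2 * (2 * k))) \<chi> = (sg ^^ (2 * k)) ((sg ^^ (2 * k)) \<chi>)"
        by (simp add: mult_2 funpow_add)
      also have "\<dots> = (sg ^^ (2 * k)) (sg \<chi>)" by (simp only: k(2)[symmetric])
      also have "\<dots> = sg ((sg ^^ (2 * k)) \<chi>)" by (simp add: sg_pow_Suc)
      also have "\<dots> = sg (sg \<chi>)" by (simp only: k(2)[symmetric])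
      finally have "(sg ^^ (2 * (2 * k))) \<chi> = (sg ^^ (2 * 1)) \<chi>" by (simp add: numeral_2_eq_2)
      then show ?thesis using per[of "2 * k" 1] by simp
    qed
    have phi2k: "(phi ^^ (2 * k)) w = phi w" if "(phi ^^ d) w = w" for w
    proof -
      have "(phi ^^ (2 * k)) w = (phi ^^ 1) w"
        using funpow_period_mod[OF that] k2 by metis
      then show ?thesis by simp
    qed
    \<comment> \<open>The obstruction to isotropy: by characters only pairs whose indices differ by
      k modulo d can pair nontrivially, and all these values are Frobenius conjugates of c.\<close>
    define c where "c = h ((phi ^^ k) u) u"
    have c1: "c ^ (q ^ (2 * k - 1)) = c"
    proof -
      have e: "2 * k - 1 = 1 + 2 * (k - 1)" "k - 1 + 1 = k" "k - 1 + k = 2 * k - 1" using k(1) by auto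
      have "phi ((phi ^^ (2 * k - 1)) u) = phi u"
      proof -
        have "phi ((phi ^^ (2 * k - 1)) u) = (phi ^^ (2 * k)) u"
          using k(1) by (cases k) auto
        then show ?thesis using phi2k[OF u(3)] by simp
      qed
      then have p: "(phi ^^ (2 * k - 1)) u = u"
        using phi_inj[of "(phi ^^ (2 * k - 1)) u" u] phi_pow_in u(2) by (auto simp: Eig_def)
      have "c ^ (q ^ (2 * k - 1)) = (c ^ q) ^ (q ^ (2 * (k - 1)))"
        using frob_pow_pow[of c 1 "2 * (k - 1)"] unfolding e(1) by simp
      also have "c ^ q = h (phi u) ((phi ^^ k) u)" by (simp add: c_def h_herm)
      also have "h (phi u) ((phi ^^ k) u) ^ (q ^ (2 * (k - 1))) =
          h ((phi ^^ (k - 1 + 1)) u) ((phi ^^ (k - 1 + k)) u)"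
        by (simp only: h_phi_pow[symmetric] funpow_add comp_apply) simp
      also have "\<dots> = c" unfolding e(2,3) p by (simp add: c_def)
      finally show ?thesis .
    qed
    have c2: "c ^ (q ^ (2 * d)) = c"
    proof -
      have "c ^ (q ^ (2 * d)) = h ((phi ^^ d) ((phi ^^ k) u)) ((phi ^^ d) u)"
        by (simp add: c_def h_phi_pow)
      also have "(phi ^^ d) ((phi ^^ k) u) = (phi ^^ k) ((phi ^^ d) u)"
        by (metis add.commute comp_apply funpow_add)
      finally show ?thesis using u(3) by (simp add: c_def)
    qed
    obtain a :: 'b where a: "a ^ (q\<^sup>2) = a" "a + a ^ q = 1" using exists_half by blast
    have aQ: "a ^ (q ^ (2 * j)) = a" for j
    proof (induction j)
      case (Suc j)
      then show ?case using a(1) frob_pow_pow[of a "2 * j" 2] by (simp add: add.commute)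
    qed simp
    \<comment> \<open>Subtracting a multiple of \<open>(phi ^^ k) v\<close> changes c by minus the
      sum of the powers of the coefficient with exponents q and q^(2k). This choice makes them
      \<open>a * c\<close> and \<open>a ^ q * c\<close>, which add up to c as \<open>a\<close> has
      trace 1.\<close>
    define \<beta> where "\<beta> = a ^ q * c ^ (q ^ (2 * k - 2))"
    have b1: "\<beta> ^ q = a * c"
    proof -
      have "\<beta> ^ q = a ^ (q\<^sup>2) * c ^ (q ^ (2 * k - 2 + 1))"
        by (simp add: \<beta>_def power_mult_distrib power2_eq_square power_mult[symmetric] mult.commute)
      also have "2 * k - 2 + 1 = 2 * k - 1" using k(1) by simp
      finally show ?thesis using a(1) c1 by simp
    qed
    have cc: "(c ^ (q ^ (2 * k - 2))) ^ (q ^ (2 * k)) = c"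
    proof -
      have "2 * k - 2 + 2 * k = (2 * k - 1) + (2 * k - 1)" using k(1) by simp
      then have "(c ^ (q ^ (2 * k - 2))) ^ (q ^ (2 * k)) = (c ^ (q ^ (2 * k - 1))) ^ (q ^ (2 * k - 1))"
        by (simp only: frob_pow_pow)
      then show ?thesis using c1 by simp
    qed
    have b2: "\<beta> ^ (q ^ (2 * k)) = a ^ q * c"
    proof -
      have "(a ^ q) ^ (q ^ (2 * k)) = (a ^ (q ^ (2 * k))) ^ q" by (simp add: power_mult[symmetric] mult.commute)
      then show ?thesis using cc aQ[of k] by (simp add: \<beta>_def power_mult_distrib)
    qed
    have b3: "\<beta> ^ (q ^ (2 * d)) = \<beta>"
    proof -
      have "(a ^ q) ^ (q ^ (2 * d)) = (a ^ (q ^ (2 * d))) ^ q" by (simp add: power_mult[symmetric] mult.commute)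
      moreover have "(c ^ (q ^ (2 * k - 2))) ^ (q ^ (2 * d)) = (c ^ (q ^ (2 * d))) ^ (q ^ (2 * k - 2))"
        by (simp add: power_mult[symmetric] mult.commute)
      ultimately show ?thesis using c2 aQ[of d] by (simp add: \<beta>_def power_mult_distrib)
    qed
    define v' where "v' = u - \<beta> *s (phi ^^ k) v"
    have len: "length (sg \<chi>) = length \<rho>" using v(2) by (auto simp: Eig_def)
    have subE: "subspace (Eig \<rho> (sg \<chi>))" using subspace_Eig[OF len] rep by (auto simp: rep_def)
    have subW: "subspace W" using W(1) by (auto simp: stab_def)
    have kE: "(phi ^^ k) v \<in> Eig \<rho> (sg \<chi>)" using phi_pow_Eig[OF rep v(2), of k] k(2) by simp
    have v'W: "v' \<in> W" unfolding v'_def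
      using subspace_diff[OF subW u(1) subspace_scale[OF subW]] phi_pow_V_stab[OF W(1) v(1)] by blast
    have v'E: "v' \<in> Eig \<rho> (sg \<chi>)" unfolding v'_def
      using subspace_diff[OF subE u(2) subspace_scale[OF subE kE]] .
    have dk: "(phi ^^ d) ((phi ^^ k) v) = (phi ^^ k) v"
      using d(2) by (metis add.commute comp_apply funpow_add)
    have v'd: "(phi ^^ d) v' = v'"
      by (simp add: v'_def phi_pow_minus phi_pow_scale u(3) b3 dk)
    have hv': "h v' v = 1" using u(4) iso[of k 0] by (simp add: v'_def h_diff_left h_scale_left)
    have iso_k: "h ((phi ^^ k) v') v' = 0"
    proof -
      have e1: "(phi ^^ k) v' = (phi ^^ k) u - \<beta> ^ (q ^ (2 * k)) *s phi v"
      proof -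
        have "(phi ^^ k) ((phi ^^ k) v) = phi v" using phi2k[OF d(2)] by (simp add: mult_2 funpow_add)
        then show ?thesis by (simp add: v'_def phi_pow_minus phi_pow_scale)
      qed
      have "h ((phi ^^ k) u) ((phi ^^ k) v) = 1" using u(4) by (simp add: h_phi_pow)
      moreover have "h (phi v) u = 1" using h_herm[of u v] u(4) by simp
      moreover have "h (phi v) ((phi ^^ k) v) = 0" using iso[of 1 k] by simp
      ultimately have "h ((phi ^^ k) v') v' = c - \<beta> ^ q - \<beta> ^ (q ^ (2 * k))"
        unfolding e1 unfolding v'_def
        by (simp add: h_diff_left h_diff_right h_scale_left h_scale_right c_def)
      also have "\<dots> = c * (1 - (a + a ^ q))" unfolding b1 b2 by (simp add: algebra_simps)
      finally show ?thesis using a(2) by simp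
    qed
    have "h ((phi ^^ t) v') ((phi ^^ t') v') = 0" for t t'
    proof (rule ccontr)
      assume n0: "h ((phi ^^ t) v') ((phi ^^ t') v') \<noteq> 0"
      from h_phi_pow_Eig[OF rep v'E v'E n0]
      have "(sg ^^ (2 * t)) ((sg ^^ (2 * k)) \<chi>) = (sg ^^ (2 * (t' + 1))) \<chi>"
        by (simp add: sg_pow_Suc k(2)[symmetric])
      then have "(sg ^^ (2 * (t + k))) \<chi> = (sg ^^ (2 * (t' + 1))) \<chi>"
        by (simp add: distrib_left funpow_add)
      then have tk: "cong (t + k) (t' + 1) d" using per[of "t + k" "t' + 1"] unfolding cong_def by blast
      \<comment> \<open>Shifting by s makes the second index a multiple of d and hence the first one
        congruent to k.\<close>
      define s where "s = t' * (d - 1)"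
      have ts: "t' + s = t' * d" using d(1) by (cases d) (simp_all add: s_def)
      have "cong (t + s + k) (k + k) d"
      proof -
        have "cong (t + k + s) (t' + 1 + s) d" using tk by (simp only: cong_add_rcancel_nat)
        moreover have "t' + 1 + s = t' * d + 1" using ts by simp
        moreover have "cong (t' * d + 1) (k + k) d" using k2 unfolding cong_def by (simp only: mod_mult_self3 mult_2)
        ultimately show ?thesis by (metis cong_trans add.assoc add.commute)
      qed
      then have "cong (t + s) k d" by (simp only: cong_add_rcancel_nat)
      then have tsk: "(t + s) mod d = k mod d" by (simp add: cong_def)
      have "h ((phi ^^ t) v') ((phi ^^ t') v') ^ (q ^ (2 * s)) = h ((phi ^^ (t + s)) v') ((phi ^^ (t' + s)) v')"
        by (simp add: h_phi_pow[symmetric] add.commute funpow_add)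
      also have "(phi ^^ (t + s)) v' = (phi ^^ k) v'" using funpow_period_mod[OF v'd] tsk by metis
      also have "(phi ^^ (t' + s)) v' = v'" unfolding ts using funpow_period[OF v'd] by simp
      finally show False using iso_k n0 by simp
    qed
    then show ?thesis using that v'W v'E v'd hv' by blast
  qed
qed

lemma fixed_eigenvector:
  assumes rep: "rep \<rho>" and Z: "stab \<rho> Z" and v0: "v0 \<in> Z" "v0 \<in> Eig \<rho> \<chi>" "v0 \<noteq> 0"
    and d: "d > 0" "(sg ^^ (2 * d)) \<chi> = \<chi>"
  obtains v where "v \<in> Z" "v \<in> Eig \<rho> \<chi>" "v \<noteq> 0" "(phi ^^ d) v = v"
proof -
  have Zsub: "subspace Z" "Z \<subseteq> V" using Z by (auto simp: stab_def)
  have len: "length \<chi> = length \<rho>" using v0(2) by (auto simp: Eig_def)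
  have sub: "subspace (Z \<inter> Eig \<rho> \<chi>)"
    using subspace_inter[OF Zsub(1) subspace_Eig[OF len]] rep by (auto simp: rep_def)
  obtain y where y: "y \<in> V" "h v0 y \<noteq> 0" using h_nondeg[of v0] v0 Zsub(2) by blast
  have st: "(phi ^^ d) w \<in> Z \<inter> Eig \<rho> \<chi>" if "w \<in> Z \<inter> Eig \<rho> \<chi>" for w
    using phi_pow_V_stab[OF Z] phi_pow_Eig[OF rep, of w \<chi> d] that d(2) by auto
  obtain v where "v \<in> Z \<inter> Eig \<rho> \<chi>" "(phi ^^ d) v = v" "h v y \<noteq> 0"
    using fixed_vector[OF d(1) sub _ st, of "\<lambda>u. h u y" v0] v0 y Zsub(2) h_add_left h_scale_left by blast
  then show ?thesis using that[of v] by (metis Int_iff h_0(1))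
qed

text \<open>The length is twice the period d of \<open>sg\<close> squared, also when the
  \<open>sg\<close>-period of \<open>\<chi>\<close> is odd: the isotropic \<open>phi\<close>-orbit
  then cannot be dual to itself and needs a second copy of the same characters, so the block runs
  through the \<open>sg\<close>-orbit twice.\<close>

lemma isotropic_block:
  assumes rep: "rep \<rho>" and W: "stab \<rho> W" "nondeg_on W"
    and Z: "stab \<rho> Z" "Z \<subseteq> W" "\<And>x y. x \<in> Z \<Longrightarrow> y \<in> Z \<Longrightarrow> h x y = 0"
    and v0: "v0 \<in> Z" "v0 \<in> Eig \<rho> \<chi>" "v0 \<noteq> 0"
    and d: "d > 0" and per: "\<And>t t'. (sg ^^ (2 * t)) \<chi> = (sg ^^ (2 * t')) \<chi> \<longleftrightarrow> t mod d = t' mod d"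
  obtains b where "block \<rho> W (2 * d) \<chi> b" "\<And>t. b (2 * t) \<in> Z"
proof -
  have perd: "(sg ^^ (2 * d)) \<chi> = \<chi>" using per[of d 0] by simp
  obtain v where v: "v \<in> Z" "v \<in> Eig \<rho> \<chi>" "v \<noteq> 0" "(phi ^^ d) v = v"
    using fixed_eigenvector[OF rep Z(1) v0 d perd] by blast
  have vW: "v \<in> W" using v Z(2) by auto
  have iso: "h ((phi ^^ t) v) ((phi ^^ t') v) = 0" for t t'
    using Z(3) phi_pow_V_stab[OF Z(1) v(1)] by blast
  obtain v' where v': "v' \<in> W" "v' \<in> Eig \<rho> (sg \<chi>)" "(phi ^^ d) v' = v'" "h v' v = 1"
    "\<And>t t'. h ((phi ^^ t) v') ((phi ^^ t') v') = 0"
    using isotropic_dual_vector[OF rep W vW v(2,3) d v(4) per iso] by blast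
  have "block \<rho> W (2 * d) \<chi> (\<lambda>i. (phi ^^ (i div 2)) (if even i then v else v'))"
    using even_block[OF rep W(1) vW v(2) v'(1,2) d v(4) v'(3) _ v'(4) iso v'(5)] per by blast
  moreover have "(phi ^^ (2 * t div 2)) (if even (2 * t) then v else v') \<in> Z" for t
    using phi_pow_V_stab[OF Z(1) v(1)] by simp
  ultimately show ?thesis using that by blast
qed

text \<open>Here k inverts 2 modulo the odd number m, so \<open>b x y = h ((phi ^^ k) x) y\<close>
  pairs the eigenspace of \<open>\<chi>\<close> with itself. If \<open>b w w\<close> vanished for
  all w fixed by \<open>phi ^^ m\<close>, polarising with u + v and \<open>z *s u + v\<close> would
  give \<open>z ^ (q ^ (2 * k)) = z ^ q\<close>, that is \<open>z ^ (q ^ m) = z\<close>, for every z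
  with \<open>z ^ (q ^ (2 * m)) = z\<close>, contradicting the numbers of solutions. A norm equation
  then rescales the value to 1.\<close>

lemma anisotropic_vector:
  assumes rep: "rep \<rho>" and W: "stab \<rho> W" "nondeg_on W"
    and v0: "v0 \<in> W" "v0 \<in> Eig \<rho> \<chi>" "v0 \<noteq> 0"
    and m: "m = 2 * k - 1" "k > 0" "(sg ^^ m) \<chi> = \<chi>"
  obtains w where "w \<in> W" "w \<in> Eig \<rho> \<chi>" "(phi ^^ m) w = w" "h ((phi ^^ k) w) w = 1"
proof -
  have m0: "m > 0" "2 * k = m + 1" "m \<ge> k" using m by auto
  have per2: "(sg ^^ (2 * m)) \<chi> = \<chi>" using m(3) by (simp add: mult_2 funpow_add)
  obtain v where v: "v \<in> W" "v \<in> Eig \<rho> \<chi>" "v \<noteq> 0" "(phi ^^ m) v = v"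
    using fixed_eigenvector[OF rep W(1) v0 m0(1) per2] by blast
  obtain u1 where u1: "u1 \<in> W" "u1 \<in> Eig \<rho> (sg \<chi>)" "(phi ^^ m) u1 = u1" "h u1 v = 1"
    using dual_vector[OF rep W v(1-3) m0(1) v(4) per2] by blast
  \<comment> \<open>Moves the dual vector from the character \<open>sg \<chi>\<close> back to
    \<open>\<chi>\<close>, because 2(m - k) + 1 = m.\<close>
  define u where "u = (phi ^^ (m - k)) u1"
  have uW: "u \<in> W" unfolding u_def using phi_pow_V_stab[OF W(1) u1(1)] .
  have uE: "u \<in> Eig \<rho> \<chi>"
  proof -
    have "Suc (2 * (m - k)) = m" using m0 by simp
    then have "(sg ^^ (2 * (m - k))) (sg \<chi>) = \<chi>" unfolding sg_pow_Suc using m(3) by simp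
    then show ?thesis using phi_pow_Eig[OF rep u1(2), of "m - k"] by (simp add: u_def)
  qed
  have uk: "(phi ^^ k) u = u1"
    using u1(3) m0(3) by (simp add: u_def flip: funpow_add comp_apply[of "phi ^^ k"])
  have um: "(phi ^^ m) u = u"
    unfolding u_def using u1(3) by (metis add.commute comp_apply funpow_add)
  have len: "length \<chi> = length \<rho>" using v(2) by (auto simp: Eig_def)
  have sub: "subspace (W \<inter> Eig \<rho> \<chi>)"
    using subspace_inter[OF _ subspace_Eig[OF len]] rep W(1) by (auto simp: rep_def stab_def)
  define b where "b = (\<lambda>x y. h ((phi ^^ k) x) y)"
  have b_simps: "b (x + y) z = b x z + b y z" "b x (y + z) = b x y + b x z"
    "b (c *s x) y = c ^ (q ^ (2 * k)) * b x y" "b x (c *s y) = c ^ q * b x y" for x y z c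
    by (simp_all add: b_def phi_pow_add h_add_left h_add_right phi_pow_scale h_scale_left h_scale_right)
  have "\<exists>w. w \<in> W \<and> w \<in> Eig \<rho> \<chi> \<and> (phi ^^ m) w = w \<and> b w w \<noteq> 0"
  proof (rule ccontr)
    assume contr: "\<not> ?thesis"
    have zero: "b w w = 0" if "w \<in> W" "w \<in> Eig \<rho> \<chi>" "(phi ^^ m) w = w" for w
      using contr that by blast
    have "card {z::'b. z ^ (q ^ m) = z} < card {z::'b. z ^ (q ^ (2 * m)) = z}"
      using card_frob_fixed[of m] card_frob_fixed[of "2 * m"] m0(1) q2 by (simp add: power_strict_increasing)
    moreover have "finite {z::'b. z ^ (q ^ m) = z}"
      using card_frob_fixed[OF m0(1)] q_pos by (intro card_ge_0_finite) auto
    ultimately have "\<not> {z::'b. z ^ (q ^ (2 * m)) = z} \<subseteq> {z. z ^ (q ^ m) = z}"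
      using card_mono by (meson leD)
    then obtain z :: 'b where z: "z ^ (q ^ (2 * m)) = z" "z ^ (q ^ m) \<noteq> z" by blast
    have vv: "b v v = 0" using zero v by blast
    have uu: "b u u = 0" using zero uW uE um by blast
    have uv: "b u v = 1" using u1(4) uk by (simp add: b_def)
    have "b (u + v) (u + v) = 0"
      using zero[of "u + v"] subspace_add[OF sub, of u v] uW uE v um by (auto simp: phi_pow_add)
    then have vu: "b v u = - 1" using vv uu uv by (simp add: b_simps eq_neg_iff_add_eq_0 add.commute)
    have zuWE: "z *s u \<in> W \<inter> Eig \<rho> \<chi>" using subspace_scale[OF sub] uW uE by blast
    have zum: "(phi ^^ m) (z *s u) = z *s u" by (simp add: phi_pow_scale um z(1))
    have "b (z *s u + v) (z *s u + v) = 0"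
      using zero[of "z *s u + v"] subspace_add[OF sub zuWE, of v] v zum by (auto simp: phi_pow_add)
    moreover have "b (z *s u) (z *s u) = 0" using zero zuWE zum by blast
    moreover have "b (z *s u + v) (z *s u + v) =
        b (z *s u) (z *s u) + z ^ (q ^ (2 * k)) * b u v + (z ^ q * b v u + b v v)"
      by (simp add: b_simps algebra_simps)
    ultimately have "z ^ (q ^ (2 * k)) = z ^ q" using vv uv vu by simp
    then have "(z ^ (q ^ m)) ^ q = z ^ q" using m0(2) by (simp add: power_mult[symmetric] mult.commute)
    then show False using z(2) frob_inj[of "z ^ (q ^ m)" 1 z] by simp
  qed
  then obtain w where w: "w \<in> W" "w \<in> Eig \<rho> \<chi>" "(phi ^^ m) w = w" "b w w \<noteq> 0" by blast
  define y where "y = b w w"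
  have y: "y ^ (q ^ m) = y"
  proof -
    have e: "m = 1 + 2 * (k - 1)" "k - 1 + 1 = k" "k - 1 + k = m" using m0 m(2) by auto
    have "y ^ (q ^ m) = (y ^ q) ^ (q ^ (2 * (k - 1)))"
      using frob_pow_pow[of y 1 "2 * (k - 1)"] unfolding e(1)[symmetric] by simp
    also have "y ^ q = h (phi w) ((phi ^^ k) w)" by (simp add: y_def b_def h_herm)
    also have "h (phi w) ((phi ^^ k) w) ^ (q ^ (2 * (k - 1))) =
        h ((phi ^^ (k - 1 + 1)) w) ((phi ^^ (k - 1 + k)) w)"
      by (simp only: h_phi_pow[symmetric] funpow_add comp_apply) simp
    also have "\<dots> = y" unfolding e(2,3) w(3) by (simp add: y_def b_def)
    finally show ?thesis .
  qed
  \<comment> \<open>The norm from the field with q^(2m) elements to the one with q^m elements. A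
    solution taken in the closure lies in the larger field automatically, since y is fixed by the
    power q^m.\<close>
  obtain x where x: "x ^ (q ^ m + 1) = inverse y" using nth_root_exists[of "q ^ m + 1" "inverse y"] by auto
  have x0: "x \<noteq> 0" using x w(4) by (auto simp: y_def)
  have x2: "x ^ (q ^ (2 * m)) = x"
  proof -
    have "(x ^ (q ^ m + 1)) ^ (q ^ m) = x ^ (q ^ m + 1)" unfolding x by (simp add: power_inverse y)
    then have "x ^ (q ^ (2 * m)) * x ^ (q ^ m) = x * x ^ (q ^ m)"
      by (simp add: power_mult_distrib frob_pow_pow mult_2[symmetric] mult.commute)
    then show ?thesis using x0 by simp
  qed
  \<comment> \<open>The q-th root of x: scaling w by z multiplies \<open>b w w\<close> by z^(q^(2k))
    * z^q, the norm of z^q.\<close>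
  define z where "z = x ^ (q ^ (2 * m - 1))"
  have zq: "z ^ q = x"
    using frob_pow_pow[of x "2 * m - 1" 1] x2 m0(1) by (simp add: z_def)
  have z2: "z ^ (q ^ (2 * m)) = z"
  proof -
    have "z ^ (q ^ (2 * m)) = (x ^ (q ^ (2 * m))) ^ (q ^ (2 * m - 1))"
      by (simp add: z_def power_mult[symmetric] mult.commute)
    then show ?thesis by (simp add: x2 z_def)
  qed
  have zk: "z ^ (q ^ (2 * k)) = x ^ (q ^ m)"
    using zq m0(2) by (simp add: power_mult)
  have "b (z *s w) (z *s w) = x ^ (q ^ m + 1) * y"
    by (simp add: b_simps zk zq y_def)
  also have "\<dots> = 1" unfolding x using w(4) by (simp add: y_def)
  finally have "h ((phi ^^ k) (z *s w)) (z *s w) = 1" by (simp add: b_def)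
  moreover have "z *s w \<in> W \<inter> Eig \<rho> \<chi>" using subspace_scale[OF sub] w by blast
  moreover have "(phi ^^ m) (z *s w) = z *s w" by (simp add: phi_pow_scale z2 w(3))
  ultimately show ?thesis using that by blast
qed

text \<open>For even m the characters of the two \<open>phi\<close>-orbits sit at opposite parities
  of the \<open>sg\<close>-orbit, which alone forces both orbits to be isotropic. For odd m one
  orbit suffices: since 2k = m + 1, the vector \<open>(phi ^^ (i * k)) w\<close> has character
  \<open>(sg ^^ i) \<chi>\<close>.\<close>

lemma nondeg_block:
  assumes rep: "rep \<rho>" and W: "stab \<rho> W" "nondeg_on W"
    and v0: "v0 \<in> W" "v0 \<in> Eig \<rho> \<chi>" "v0 \<noteq> 0"
    and m: "m > 0" and per: "\<And>t t'. (sg ^^ t) \<chi> = (sg ^^ t') \<chi> \<longleftrightarrow> t mod m = t' mod m"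
  obtains b where "block \<rho> W m \<chi> b"
proof (cases "even m")
  case True
  then obtain d where md: "m = 2 * d" by (elim evenE)
  have d: "d > 0" using m md by simp
  have per2: "(sg ^^ (2 * t)) \<chi> = (sg ^^ (2 * t')) \<chi> \<Longrightarrow> t mod d = t' mod d" for t t'
    using per[of "2 * t" "2 * t'"] unfolding md by simp
  have perd: "(sg ^^ (2 * d)) \<chi> = \<chi>" using per[of "2 * d" 0] unfolding md by simp
  obtain v where v: "v \<in> W" "v \<in> Eig \<rho> \<chi>" "v \<noteq> 0" "(phi ^^ d) v = v"
    using fixed_eigenvector[OF rep W(1) v0 d perd] by blast
  obtain v' where v': "v' \<in> W" "v' \<in> Eig \<rho> (sg \<chi>)" "(phi ^^ d) v' = v'" "h v' v = 1"
    using dual_vector[OF rep W v(1-3) d v(4) perd] by blast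
  have par: "(sg ^^ (2 * t)) \<chi> \<noteq> (sg ^^ Suc (2 * t')) \<chi>" for t t'
  proof
    assume "(sg ^^ (2 * t)) \<chi> = (sg ^^ Suc (2 * t')) \<chi>"
    then have "(2 * t) mod (2 * d) = Suc (2 * t') mod (2 * d)" using per md by blast
    moreover have "even ((2 * t) mod (2 * d))" by simp
    moreover have "odd (Suc (2 * t') mod (2 * d))" by (subst dvd_mod_iff) auto
    ultimately show False by simp
  qed
  have iso: "h ((phi ^^ t) v) ((phi ^^ t') v) = 0" for t t'
    using h_phi_pow_Eig[OF rep v(2) v(2)] par by blast
  have iso': "h ((phi ^^ t) v') ((phi ^^ t') v') = 0" for t t'
  proof (rule ccontr)
    assume "h ((phi ^^ t) v') ((phi ^^ t') v') \<noteq> 0"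
    from h_phi_pow_Eig[OF rep v'(2) v'(2) this]
    have "sg ((sg ^^ (2 * t)) \<chi>) = sg ((sg ^^ Suc (2 * t')) \<chi>)" by (simp add: sg_pow_Suc)
    then show False using par by (auto dest!: sg_inj)
  qed
  show ?thesis
    using that even_block[OF rep W(1) v(1,2) v'(1,2) d v(4) v'(3) per2 v'(4) iso iso'] md by blast
next
  case False
  then obtain k0 where "m = 2 * k0 + 1" by (elim oddE)
  define k where "k = k0 + 1"
  have k: "m = 2 * k - 1" "k > 0" "2 * k = m + 1" using \<open>m = 2 * k0 + 1\<close> by (auto simp: k_def)
  have perm: "(sg ^^ m) \<chi> = \<chi>" using per[of m 0] by simp
  obtain w where w: "w \<in> W" "w \<in> Eig \<rho> \<chi>" "(phi ^^ m) w = w" "h ((phi ^^ k) w) w = 1"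
    using anisotropic_vector[OF rep W v0 k(1,2) perm] by blast
  define b where "b = (\<lambda>i. (phi ^^ (i * k)) w)"
  have bm: "b (i + m) = b i" for i
  proof -
    have "(phi ^^ (m * k)) w = w" using funpow_period[OF w(3), of k] by (simp add: mult.commute)
    then show ?thesis by (simp add: b_def distrib_right funpow_add)
  qed
  have bmod: "b i = b (i mod m)" for i
  proof -
    have "b (x + j * m) = b x" for x j
      by (induction j) (use bm in \<open>auto simp: add.assoc[symmetric] add.commute[of m]\<close>)
    from this[of "i mod m" "i div m"] show ?thesis by simp
  qed
  have bE: "b i \<in> Eig \<rho> ((sg ^^ i) \<chi>)" for i
  proof -
    have "2 * (i * k) = i * m + i" using k(3) by (metis distrib_left mult.left_commute mult_1_right)
    then have "(sg ^^ (2 * (i * k))) \<chi> = (sg ^^ i) \<chi>" using per by simp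
    then show ?thesis using phi_pow_Eig[OF rep w(2), of "i * k"] by (simp add: b_def)
  qed
  have "phi (b i) = b (i + 2)" for i
  proof -
    have e: "(i + 2) * k = i * k + 1 + m" using k(3) by (simp add: distrib_right mult.commute)
    have "b (i + 2) = (phi ^^ (i * k + 1)) w"
      unfolding b_def e using w(3) by (subst funpow_add) simp
    then show ?thesis by (simp add: b_def)
  qed
  moreover have "h (b (i + 1)) (b j) = (if i mod m = j mod m then 1 else 0)" for i j
  proof (cases "i mod m = j mod m")
    case True
    then have "b j = b i" using bmod by metis
    then have "h (b (i + 1)) (b j) = h ((phi ^^ (i * k)) ((phi ^^ k) w)) ((phi ^^ (i * k)) w)"
      by (simp add: b_def distrib_right funpow_add add.commute[of k])
    also have "\<dots> = 1" unfolding h_phi_pow w(4) by simp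
    finally show ?thesis using True by simp
  next
    case False
    have "h (b (i + 1)) (b j) = 0"
    proof (rule ccontr)
      assume "h (b (i + 1)) (b j) \<noteq> 0"
      from h_Eig[OF rep bE bE this] have "sg ((sg ^^ i) \<chi>) = sg ((sg ^^ j) \<chi>)" by simp
      then show False using False per by (auto dest!: sg_inj)
    qed
    then show ?thesis using False by simp
  qed
  moreover have "b i \<in> W" for i using phi_pow_V_stab[OF W(1) w(1)] by (simp add: b_def)
  ultimately have "block \<rho> W m \<chi> b" unfolding block_def using m bm bE by auto
  then show ?thesis using that by blast
qed

end

section \<open>Eigenbases adapted to isotropic flags\<close>

text \<open>Adjoins an m-cycle on the new indices, matching the cyclic shift in a block.\<close>

definition ext_perm :: "(nat \<Rightarrow> nat) \<Rightarrow> nat \<Rightarrow> nat \<Rightarrow> nat \<Rightarrow> nat" where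
  "ext_perm s N m i = (if i < N then s i else N + (i - N + 1) mod m)"

lemma bij_ext_perm:
  assumes "bij_betw s {..<N} {..<N}" "m > 0"
  shows "bij_betw (ext_perm s N m) {..<N + m} {..<N + m}"
proof -
  have "bij_betw (ext_perm s N m) {..<N} {..<N}"
    using assms(1) by (subst bij_betw_cong[of _ _ s]) (auto simp: ext_perm_def)
  moreover have "bij_betw (ext_perm s N m) {N..<N + m} {N..<N + m}"
  proof -
    have "inj_on (ext_perm s N m) {N..<N + m}"
    proof (rule inj_onI)
      fix x y assume xy: "x \<in> {N..<N + m}" "y \<in> {N..<N + m}" "ext_perm s N m x = ext_perm s N m y"
      then have "Suc (x - N) mod m = Suc (y - N) mod m" by (simp add: ext_perm_def)
      then have "x - N = y - N" using xy by (auto simp: mod_Suc split: if_splits)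
      then show "x = y" using xy by auto
    qed
    moreover have "ext_perm s N m ` {N..<N + m} \<subseteq> {N..<N + m}"
      using assms(2) by (auto simp: ext_perm_def)
    ultimately show ?thesis
      by (simp add: bij_betw_def endo_inj_surj)
  qed
  ultimately have "bij_betw (ext_perm s N m) ({..<N} \<union> {N..<N + m}) ({..<N} \<union> {N..<N + m})"
    by (rule bij_betw_combine) auto
  moreover have "{..<N} \<union> {N..<N + m} = {..<N + m}" by auto
  ultimately show ?thesis by simp
qed

context herm_space
begin

definition perp :: "nat \<Rightarrow> (nat \<Rightarrow> 'v) \<Rightarrow> 'v set" where
  "perp N e = {v \<in> V. \<forall>i<N. h v (e i) = 0}"

text \<open>The vectors \<open>e i\<close>, permuted by \<open>phi\<close> as the square of \<open>s\<close> permutes their indices,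
  are eigenvectors adapted to the flag \<open>U\<close>; \<open>A \<mu>\<close> indexes those lying in \<open>U \<mu>\<close>.\<close>
definition sys :: "('v \<Rightarrow> 'v) list \<Rightarrow> nat set \<Rightarrow> (nat \<Rightarrow> 'v set) \<Rightarrow> nat \<Rightarrow> (nat \<Rightarrow> nat) \<Rightarrow> (nat \<Rightarrow> 'b list) \<Rightarrow>
    (nat \<Rightarrow> nat set) \<Rightarrow> (nat \<Rightarrow> 'v) \<Rightarrow> bool" where
  "sys \<rho> D U N s \<chi> A e \<longleftrightarrow> bij_betw s {..<N} {..<N} \<and> (\<forall>i<N. e i \<in> Eig \<rho> (\<chi> i)) \<and>
     (\<forall>i<N. phi (e i) = e (s (s i))) \<and>
     (\<forall>i<N. \<forall>j<N. h (e (s i)) (e j) = (if i = j then 1 else 0)) \<and>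
     (\<forall>\<mu>\<in>D. \<forall>i<N. i \<in> A \<mu> \<longleftrightarrow> e i \<in> U \<mu>) \<and>
     (\<forall>\<mu>\<in>D. \<forall>u\<in>U \<mu>. \<forall>i<N. s i \<notin> A \<mu> \<longrightarrow> h u (e i) = 0)"

text \<open>Indexing by numbers lets chains belonging to two different tuples be compared member by
  member; the indices used later are dimensions.\<close>

definition flag :: "('v \<Rightarrow> 'v) list \<Rightarrow> nat set \<Rightarrow> (nat \<Rightarrow> 'v set) \<Rightarrow> bool" where
  "flag \<rho> D U \<longleftrightarrow> finite D \<and> (\<forall>\<mu>\<in>D. stab \<rho> (U \<mu>) \<and> (\<forall>x\<in>U \<mu>. \<forall>y\<in>U \<mu>. h x y = 0)) \<and>
     (\<forall>\<mu>\<in>D. \<forall>\<nu>\<in>D. \<mu> \<le> \<nu> \<longrightarrow> U \<mu> \<subseteq> U \<nu>)"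

text \<open>The projection onto \<open>perp N e\<close> along the span of the system, the
  \<open>e (s j)\<close> being dual to the \<open>e j\<close>.\<close>

definition proj :: "nat \<Rightarrow> (nat \<Rightarrow> nat) \<Rightarrow> (nat \<Rightarrow> 'v) \<Rightarrow> 'v \<Rightarrow> 'v" where
  "proj N s e u = u - (\<Sum>j<N. h u (e j) *s e (s j))"

lemma Eig_V: "v \<in> Eig \<rho> \<chi> \<Longrightarrow> v \<in> V" by (simp add: Eig_def)

lemma stab_inter: "stab \<rho> A \<Longrightarrow> stab \<rho> C \<Longrightarrow> stab \<rho> (A \<inter> C)"
  by (auto simp: stab_def subspace_inter)

lemma stab_eigenvector:
  assumes rep: "rep \<rho>" and Z: "stab \<rho> Z" and w: "w \<in> Z" "w \<noteq> 0"
  obtains \<chi> v where "v \<in> Z" "v \<in> Eig \<rho> \<chi>" "v \<noteq> 0"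
proof -
  have Z': "subspace Z" "Z \<subseteq> V" "\<And>Y w. Y \<in> set \<rho> \<Longrightarrow> w \<in> Z \<Longrightarrow> Y w \<in> Z" using Z by (auto simp: stab_def)
  obtain y where y: "y \<in> V" "h w y \<noteq> 0" using h_nondeg[of w] w Z'(2) by blast
  obtain \<chi> v where "v \<in> Z" "v \<in> Eig \<rho> \<chi>" "h v y \<noteq> 0"
    using joint_eigenvector[where l = "\<lambda>u. h u y" and W = Z and u = w and \<rho> = \<rho>]
      rep Z' y(2) w(1) h_add_left h_scale_left by blast
  then show ?thesis using that[of v] by (metis h_0(1))
qed

context
  fixes \<rho> D U N s \<chi> A e
  assumes rep: "rep \<rho>" and sys: "sys \<rho> D U N s \<chi> A e"
begin

lemma sysD:
  shows "bij_betw s {..<N} {..<N}"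
    and "i < N \<Longrightarrow> e i \<in> Eig \<rho> (\<chi> i)" "i < N \<Longrightarrow> phi (e i) = e (s (s i))"
    and "i < N \<Longrightarrow> j < N \<Longrightarrow> h (e (s i)) (e j) = (if i = j then 1 else 0)"
    and "\<mu> \<in> D \<Longrightarrow> i < N \<Longrightarrow> i \<in> A \<mu> \<longleftrightarrow> e i \<in> U \<mu>"
    and "\<mu> \<in> D \<Longrightarrow> u \<in> U \<mu> \<Longrightarrow> i < N \<Longrightarrow> s i \<notin> A \<mu> \<Longrightarrow> h u (e i) = 0"
    and "i < N \<Longrightarrow> s i < N"
proof -
  note * = sys[unfolded sys_def]
  show "bij_betw s {..<N} {..<N}" using * by (elim conjE)
  then show "i < N \<Longrightarrow> s i < N" using bij_betwE by blast
  show "i < N \<Longrightarrow> e i \<in> Eig \<rho> (\<chi> i)" using * by (elim conjE) blast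
  show "i < N \<Longrightarrow> phi (e i) = e (s (s i))" using * by (elim conjE) blast
  show "i < N \<Longrightarrow> j < N \<Longrightarrow> h (e (s i)) (e j) = (if i = j then 1 else 0)" using * by (elim conjE) blast
  show "\<mu> \<in> D \<Longrightarrow> i < N \<Longrightarrow> i \<in> A \<mu> \<longleftrightarrow> e i \<in> U \<mu>" using * by (elim conjE) blast
  show "\<mu> \<in> D \<Longrightarrow> u \<in> U \<mu> \<Longrightarrow> i < N \<Longrightarrow> s i \<notin> A \<mu> \<Longrightarrow> h u (e i) = 0" using * by (elim conjE) blast
qed

lemma sys_V: "i < N \<Longrightarrow> e i \<in> V" using sysD(2) Eig_V by blast

lemma sys_preimage: "i < N \<Longrightarrow> \<exists>j<N. s j = i"
  using bij_betw_imp_surj_on[OF sysD(1)] by (metis imageE lessThan_iff)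

lemma sys_preimage2: "i < N \<Longrightarrow> \<exists>j<N. e i = phi (e j)"
  using sys_preimage sysD(3) by metis

lemma sys_sg: "i < N \<Longrightarrow> \<chi> (s i) = sg (\<chi> i)"
  using h_Eig[OF rep sysD(2)[OF sysD(7)] sysD(2)] sysD(4) by simp

text \<open>The form is not symmetric, but \<open>h_herm\<close> exchanges the two sides at the cost
  of a \<open>phi\<close>, and \<open>phi\<close> permutes the system.\<close>

lemma perp_left:
  assumes "w \<in> perp N e" "i < N" shows "h (e i) w = 0"
proof -
  obtain j where "j < N" "e i = phi (e j)" using sys_preimage2 assms(2) by blast
  moreover from this have "h w (e j) = 0" using assms(1) by (simp add: perp_def)
  ultimately show ?thesis using h_sym_0 by simp
qed

lemma subspace_perp: "subspace (perp N e)"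
  unfolding perp_def subspace_def by (auto simp: h_add_left h_scale_left)

lemma stab_perp: "stab \<rho> (perp N e)"
  unfolding stab_def
proof (intro conjI ballI)
  show "subspace (perp N e)" by (rule subspace_perp)
  show "perp N e \<subseteq> V" by (auto simp: perp_def)
  fix w assume w: "w \<in> perp N e"
  show "phi w \<in> perp N e"
    unfolding perp_def
  proof (intro CollectI conjI allI impI)
    show "phi w \<in> V" using w by (auto simp: perp_def phi_in)
    fix i assume "i < N"
    then obtain j where "j < N" "e i = phi (e j)" using sys_preimage2 by blast
    then show "h (phi w) (e i) = 0" using w q_pos by (simp add: h_phi perp_def)
  qed
next
  fix Y w assume Y: "Y \<in> set \<rho>" and w: "w \<in> perp N e"
  obtain t where t: "t < length \<rho>" "Y = \<rho> ! t" using Y by (metis in_set_conv_nth)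
  have uY: "unit_op Y" using rep Y by (auto simp: rep_def)
  show "Y w \<in> perp N e"
    unfolding perp_def
  proof (intro CollectI conjI allI impI)
    show "Y w \<in> V" using w uY by (auto simp: perp_def unit_op_def)
    fix i assume i: "i < N"
    have Ye: "Y (e j) = \<chi> j ! t *s e j" if "j < N" for j using sysD(2)[OF that] t by (simp add: Eig_def)
    \<comment> \<open>The dual pair shows that the eigenvalue is nonzero, so it can be cancelled at
      the end.\<close>
    have "1 = h (Y (e (s i))) (Y (e i))"
      using uY sysD(4)[OF i i] sys_V i sysD(7) by (simp add: unit_op_def)
    also have "\<dots> = \<chi> (s i) ! t * (\<chi> i ! t) ^ q"
      using Ye i sysD(7) sysD(4)[OF i i] by (simp add: h_scale_left h_scale_right)
    finally have c0: "\<chi> i ! t \<noteq> 0" using q_pos by (auto simp: power_0_left)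
    have "(\<chi> i ! t) ^ q * h (Y w) (e i) = h (Y w) (Y (e i))" using Ye i by (simp add: h_scale_right)
    also have "\<dots> = h w (e i)" using uY w sys_V[OF i] by (auto simp: unit_op_def perp_def)
    also have "\<dots> = 0" using w i by (simp add: perp_def)
    finally show "h (Y w) (e i) = 0" using c0 by simp
  qed
qed

lemma h_sum_sys: "i < N \<Longrightarrow> h (\<Sum>j<N. a j *s e (s j)) (e i) = a i"
proof -
  assume i: "i < N"
  have "h (\<Sum>j<N. a j *s e (s j)) (e i) = (\<Sum>j<N. if j = i then a j else 0)"
    unfolding h_sum_left using i sysD(4) by (intro sum.cong) (auto simp: h_scale_left)
  then show ?thesis using i by simp
qed

lemma proj_perp: "u \<in> V \<Longrightarrow> proj N s e u \<in> perp N e"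
  unfolding perp_def proj_def
  by (auto simp: h_diff_left h_sum_sys intro!: V_closed subspace_sum[OF subspace_V] sys_V sysD(7))

lemma proj_id: "w \<in> perp N e \<Longrightarrow> proj N s e w = w"
  by (simp add: proj_def perp_def)

lemma nondeg_perp: "nondeg_on (perp N e)"
  unfolding nondeg_on_def
proof (intro ballI impI)
  fix w assume w: "w \<in> perp N e" "w \<noteq> 0"
  then obtain u where u: "u \<in> V" "h u w \<noteq> 0" using h_nondeg_right[of w] by (auto simp: perp_def)
  have "h (proj N s e u) w = h u w"
    using w perp_left sysD(7) by (simp add: proj_def h_diff_left h_sum_left h_scale_left)
  then show "\<exists>u\<in>perp N e. h u w \<noteq> 0" using proj_perp[OF u(1)] u(2) by metis
qed

lemma inj_on_sys: "inj_on e {..<N}"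
proof (rule inj_onI)
  fix i j assume ij: "i \<in> {..<N}" "j \<in> {..<N}" "e i = e j"
  then obtain i' j' where i': "i' < N" "s i' = i" "j' < N" "s j' = j" using sys_preimage[of i] sys_preimage[of j] by auto
  then have "h (e (s i')) (e i') = h (e (s j')) (e i')" using ij by simp
  then have "i' = j'" using sysD(4) i' by (auto split: if_splits)
  then show "i = j" using i' by simp
qed

lemma independent_sys: "J \<subseteq> {..<N} \<Longrightarrow> independent (e ` J)"
proof -
  have "independent (e ` {..<N})"
  proof (rule independent_if_scalars_zero)
    fix f x assume f: "(\<Sum>x\<in>e ` {..<N}. f x *s x) = 0" and x: "x \<in> e ` {..<N}"
    from x obtain k where "k < N" "x = e k" by auto
    then obtain i where i: "i < N" "x = e (s i)" using sys_preimage[of k] by auto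
    have "0 = (\<Sum>j<N. f (e j) *s e j)" using f by (simp add: sum.reindex[OF inj_on_sys] o_def)
    also have "\<dots> = (\<Sum>j<N. f (e (s j)) *s e (s j))"
      by (rule sum.reindex_bij_betw[OF sysD(1), symmetric])
    finally have "h (\<Sum>j<N. f (e (s j)) *s e (s j)) (e i) = 0" by simp
    then show "f x = 0" using h_sum_sys[OF i(1), of "\<lambda>j. f (e (s j))"] i by simp
  qed simp
  then show "J \<subseteq> {..<N} \<Longrightarrow> independent (e ` J)" by (meson image_mono independent_mono)
qed

lemma proj_span: "J \<subseteq> {..<N} \<Longrightarrow> x \<in> span (e ` J) \<Longrightarrow> proj N s e x = 0"
proof -
  assume J: "J \<subseteq> {..<N}" and x: "x \<in> span (e ` J)"
  have "proj N s e 0 = 0" by (simp add: proj_def)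
  moreover have "proj N s e (x + y) = proj N s e x + proj N s e y" for x y
    by (simp add: proj_def h_add_left scale_left_distrib sum.distrib)
  moreover have "proj N s e (c *s x) = c *s proj N s e x" for c x
    by (simp add: proj_def h_scale_left scale_right_diff_distrib scale_sum_right)
  ultimately have "subspace {x. proj N s e x = 0}" by (simp add: subspace_def)
  moreover have "e ` J \<subseteq> {x. proj N s e x = 0}"
  proof clarsimp
    fix i assume "i \<in> J"
    then obtain i' where i': "i' < N" "s i' = i" using J sys_preimage by blast
    have "(\<Sum>j<N. h (e i) (e j) *s e (s j)) = (\<Sum>j<N. if j = i' then e i else 0)"
      using i' sysD(4) by (intro sum.cong) auto
    then show "proj N s e (e i) = 0" using i' by (simp add: proj_def)
  qed
  ultimately show ?thesis using span_minimal x by blast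
qed

text \<open>Condition \<open>hJ\<close> keeps the projection of Z to \<open>perp N e\<close> inside
  Z. So either Z meets the complement of the system or Z is spanned by its \<open>e i\<close>, and
  the alternative is decided by comparing \<open>dim Z\<close> with \<open>card J\<close>. This
  makes the possibility of extending a system depend on dimensions only, hence the same for two
  tuples with equal dimensions.\<close>

lemma dim_sys:
  assumes Z: "subspace Z" "Z \<subseteq> V" and J: "J \<subseteq> {..<N}" "\<And>i. i \<in> J \<Longrightarrow> e i \<in> Z"
    and hJ: "\<And>u i. u \<in> Z \<Longrightarrow> i < N \<Longrightarrow> s i \<notin> J \<Longrightarrow> h u (e i) = 0"
  shows "(\<exists>w\<in>Z \<inter> perp N e. w \<noteq> 0) \<longleftrightarrow> dim Z > card J"
    and "\<not> (\<exists>w\<in>Z \<inter> perp N e. w \<noteq> 0) \<Longrightarrow> dim Z = card J"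
    and "\<not> (\<exists>w\<in>Z \<inter> perp N e. w \<noteq> 0) \<Longrightarrow> Z \<subseteq> span (e ` J)"
proof -
  have finJ: "finite J" using J(1) finite_subset by blast
  have cJ: "card (e ` J) = card J" using card_image inj_on_sys J(1) inj_on_subset by blast
  have sub: "e ` J \<subseteq> Z" using J(2) by auto
  show sp: "Z \<subseteq> span (e ` J)" if "\<not> (\<exists>w\<in>Z \<inter> perp N e. w \<noteq> 0)"
  proof
    fix u assume u: "u \<in> Z"
    have t: "h u (e j) *s e (s j) \<in> span (e ` J)" if "j < N" for j
      using hJ[OF u that] by (cases "s j \<in> J") (auto intro: span_scale span_base span_zero)
    have "(\<Sum>j<N. h u (e j) *s e (s j)) \<in> span (e ` J)" by (intro span_sum) (use t in auto)
    moreover have "span (e ` J) \<subseteq> Z" using span_minimal[OF sub Z(1)] .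
    ultimately have "proj N s e u \<in> Z" using u Z(1) unfolding proj_def by (auto intro: subspace_diff)
    moreover have "proj N s e u \<in> perp N e" using proj_perp u Z(2) by blast
    ultimately have "proj N s e u = 0" using that by blast
    then have "u = (\<Sum>j<N. h u (e j) *s e (s j))" by (simp add: proj_def)
    then show "u \<in> span (e ` J)" using \<open>(\<Sum>j<N. h u (e j) *s e (s j)) \<in> span (e ` J)\<close> by simp
  qed
  show eq: "dim Z = card J" if "\<not> (\<exists>w\<in>Z \<inter> perp N e. w \<noteq> 0)"
    using basis_card_eq_dim[OF sub sp[OF that] independent_sys[OF J(1)]] cJ by simp
  show "(\<exists>w\<in>Z \<inter> perp N e. w \<noteq> 0) \<longleftrightarrow> dim Z > card J"
  proof
    assume "\<exists>w\<in>Z \<inter> perp N e. w \<noteq> 0"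
    then obtain w where w: "w \<in> Z" "w \<in> perp N e" "w \<noteq> 0" by blast
    have nw: "w \<notin> span (e ` J)" using proj_id[OF w(2)] proj_span[OF J(1)] w(3) by metis
    have ind: "independent (insert w (e ` J))"
      using independent_insertI[OF nw independent_sys[OF J(1)]] .
    obtain C where C: "C \<subseteq> Z" "independent C" "Z \<subseteq> span C" "card C = dim Z" using basis_exists by blast
    have "finite C" using independent_span_bound[OF finite_B C(2)] C(1) Z(2) span_B by auto
    then have "card (insert w (e ` J)) \<le> card C"
      using independent_span_bound[OF _ ind, of C] w(1) sub C(3) by blast
    moreover have "w \<notin> e ` J" using nw span_base by blast
    ultimately show "dim Z > card J" using C(4) cJ finJ by simp
  qed (use eq in fastforce)
qed

lemma sys_le: "N \<le> card B"
proof -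
  have "card (e ` {..<N}) \<le> card B"
    using independent_span_bound[OF finite_B independent_sys[of "{..<N}"]] sys_V span_B by auto
  then show ?thesis using card_image[OF inj_on_sys] by simp
qed

lemma dim_sys_Eig:
  assumes "length \<psi> = length \<rho>" "J = {i. i < N \<and> \<chi> i = \<psi>}"
  shows "(\<exists>w\<in>Eig \<rho> \<psi> \<inter> perp N e. w \<noteq> 0) \<longleftrightarrow> dim (Eig \<rho> \<psi>) > card J"
    and "\<not> (\<exists>w\<in>Eig \<rho> \<psi> \<inter> perp N e. w \<noteq> 0) \<Longrightarrow> dim (Eig \<rho> \<psi>) = card J"
proof -
  have 1: "subspace (Eig \<rho> \<psi>)" using subspace_Eig[OF assms(1)] rep by (auto simp: rep_def)
  have 2: "h u (e i) = 0" if "u \<in> Eig \<rho> \<psi>" "i < N" "s i \<notin> J" for u i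
    using h_Eig[OF rep that(1) sysD(2)[OF that(2)]] sys_sg[OF that(2)] that sysD(7) assms(2) by fastforce
  have 3: "e i \<in> Eig \<rho> \<psi>" if "i \<in> J" for i using that assms(2) sysD(2) by auto
  have 4: "J \<subseteq> {..<N}" "Eig \<rho> \<psi> \<subseteq> V" using assms(2) by (auto simp: Eig_def)
  note dim_sys[OF 1 4(2,1) 3 2]
  then show "(\<exists>w\<in>Eig \<rho> \<psi> \<inter> perp N e. w \<noteq> 0) \<longleftrightarrow> dim (Eig \<rho> \<psi>) > card J"
    and "\<not> (\<exists>w\<in>Eig \<rho> \<psi> \<inter> perp N e. w \<noteq> 0) \<Longrightarrow> dim (Eig \<rho> \<psi>) = card J" by blast+
qed

lemma dim_sys_flag:
  assumes "length \<psi> = length \<rho>" "\<mu> \<in> D" "stab \<rho> (U \<mu>)" "J = {i. i < N \<and> i \<in> A \<mu> \<and> \<chi> i = \<psi>}"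
  shows "(\<exists>w\<in>(Eig \<rho> \<psi> \<inter> U \<mu>) \<inter> perp N e. w \<noteq> 0) \<longleftrightarrow> dim (Eig \<rho> \<psi> \<inter> U \<mu>) > card J"
    and "\<not> (\<exists>w\<in>(Eig \<rho> \<psi> \<inter> U \<mu>) \<inter> perp N e. w \<noteq> 0) \<Longrightarrow> dim (Eig \<rho> \<psi> \<inter> U \<mu>) = card J"
proof -
  have "subspace (Eig \<rho> \<psi>)" using subspace_Eig[OF assms(1)] rep by (auto simp: rep_def)
  then have 1: "subspace (Eig \<rho> \<psi> \<inter> U \<mu>)" using assms(3) by (auto simp: stab_def intro: subspace_inter)
  have 2: "h u (e i) = 0" if u: "u \<in> Eig \<rho> \<psi> \<inter> U \<mu>" "i < N" "s i \<notin> J" for u i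
  proof (cases "s i \<in> A \<mu>")
    case True
    then have "sg (\<chi> i) \<noteq> \<psi>" using that assms(4) sys_sg sysD(7) by auto
    then show ?thesis using h_Eig[OF rep _ sysD(2)[OF that(2)], of u \<psi>] u by blast
  next
    case False then show ?thesis using sysD(6)[OF assms(2)] u by blast
  qed
  have 3: "e i \<in> Eig \<rho> \<psi> \<inter> U \<mu>" if "i \<in> J" for i using that assms(2,4) sysD(2,5) by auto
  have 4: "J \<subseteq> {..<N}" "Eig \<rho> \<psi> \<inter> U \<mu> \<subseteq> V" using assms(4) by (auto simp: Eig_def)
  note dim_sys[OF 1 4(2,1) 3 2]
  then show "(\<exists>w\<in>(Eig \<rho> \<psi> \<inter> U \<mu>) \<inter> perp N e. w \<noteq> 0) \<longleftrightarrow> dim (Eig \<rho> \<psi> \<inter> U \<mu>) > card J"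
    and "\<not> (\<exists>w\<in>(Eig \<rho> \<psi> \<inter> U \<mu>) \<inter> perp N e. w \<noteq> 0) \<Longrightarrow> dim (Eig \<rho> \<psi> \<inter> U \<mu>) = card J" by blast+
qed

text \<open>A member with no vector left in the complement is spanned by vectors of the system, so
  it is orthogonal to that complement.\<close>

lemma flag_expansion:
  assumes "\<mu> \<in> D" "stab \<rho> (U \<mu>)" "\<not> (\<exists>w\<in>U \<mu> \<inter> perp N e. w \<noteq> 0)" "u \<in> U \<mu>" "w \<in> perp N e"
  shows "h u w = 0"
proof -
  have "U \<mu> \<subseteq> span (e ` {i. i < N \<and> i \<in> A \<mu>})"
    using assms(2) sysD(5)[OF assms(1)] sysD(6)[OF assms(1)] sysD(7)
    by (intro dim_sys(3) assms(3)) (auto simp: stab_def)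
  moreover have "subspace {u. h u w = 0}" unfolding subspace_def by (auto simp: h_add_left h_scale_left)
  moreover have "e ` {i. i < N \<and> i \<in> A \<mu>} \<subseteq> {u. h u w = 0}" using perp_left[OF assms(5)] by auto
  ultimately show ?thesis using span_minimal assms(4) by blast
qed

text \<open>\<open>hb\<close> is the last clause of \<open>sys\<close> for the new vectors; stated
  for the periodic sequence it covers the wrap-around from the last place of the block to the
  first.\<close>

lemma sys_extend:
  assumes b: "block \<rho> (perp N e) m \<chi>0 b"
    and A': "\<And>\<mu> i. \<mu> \<in> D \<Longrightarrow> i < N \<Longrightarrow> i \<in> A' \<mu> \<longleftrightarrow> i \<in> A \<mu>"
      "\<And>\<mu> i. \<mu> \<in> D \<Longrightarrow> i < m \<Longrightarrow> N + i \<in> A' \<mu> \<longleftrightarrow> b i \<in> U \<mu>"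
    and hb: "\<And>\<mu> u i. \<mu> \<in> D \<Longrightarrow> u \<in> U \<mu> \<Longrightarrow> b (Suc i) \<notin> U \<mu> \<Longrightarrow> h u (b i) = 0"
  shows "sys \<rho> D U (N + m) (ext_perm s N m) (\<lambda>i. if i < N then \<chi> i else (sg ^^ (i - N)) \<chi>0) A'
           (\<lambda>i. if i < N then e i else b (i - N))"
proof -
  define s' where "s' = ext_perm s N m"
  define e' where "e' = (\<lambda>i. if i < N then e i else b (i - N))"
  have m: "m > 0" using b by (simp add: block_def)
  have bmod: "b (i mod m) = b i" for i
  proof -
    have "b (x + j * m) = b x" for x j
      using b by (induction j) (auto simp: block_def add.assoc[symmetric] add.commute[of m])
    from this[of "i mod m" "i div m"] show ?thesis by simp
  qed
  have s'1: "s' i = s i" if "i < N" for i using that by (simp add: s'_def ext_perm_def)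
  have s'2: "s' i = N + Suc (i - N) mod m" if "\<not> i < N" for i using that by (simp add: s'_def ext_perm_def)
  have e's2: "e' (s' i) = b (Suc (i - N))" if "\<not> i < N" for i
    using that by (simp add: s'2 e'_def bmod)
  have e's1: "e' (s' i) = e (s i)" if "i < N" for i using that sysD(7) by (simp add: s'1 e'_def)
  have phi_e': "phi (e' i) = e' (s' (s' i))" if "i < N + m" for i
  proof (cases "i < N")
    case True then show ?thesis using sysD(3,7) by (simp add: s'1 e'_def)
  next
    case False
    have "e' (s' (s' i)) = b (Suc (Suc (i - N) mod m))"
      using e's2[of "s' i"] by (simp add: s'2[OF False])
    also have "\<dots> = b (Suc (Suc (i - N)))" by (metis bmod mod_Suc_eq)
    finally show ?thesis using b False by (simp add: block_def e'_def)
  qed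
  have bp: "b i \<in> perp N e" for i using b by (simp add: block_def)
  have pair: "h (e' (s' i)) (e' j) = (if i = j then 1 else 0)" if "i < N + m" "j < N + m" for i j
  proof -
    consider "i < N" "j < N" | "i < N" "\<not> j < N" | "\<not> i < N" "j < N" | "\<not> i < N" "\<not> j < N" by blast
    then show ?thesis
    proof cases
      case 1 then show ?thesis using e's1 sysD(4) by (simp add: e'_def)
    next
      case 2 then show ?thesis using e's1 perp_left[OF bp] sysD(7) by (auto simp: e'_def)
    next
      case 3 then show ?thesis using e's2 bp by (auto simp: e'_def perp_def)
    next
      case 4
      then have "h (e' (s' i)) (e' j) = (if (i - N) mod m = (j - N) mod m then 1 else 0)"
        using e's2 b by (simp add: e'_def block_def)
      then show ?thesis using 4 that by auto
    qed
  qed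
  have mem: "i \<in> A' \<mu> \<longleftrightarrow> e' i \<in> U \<mu>" if "\<mu> \<in> D" "i < N + m" for \<mu> i
    using A'(1)[OF that(1), of i] A'(2)[OF that(1), of "i - N"] that(2) sysD(5)[OF that(1), of i]
    by (cases "i < N") (auto simp: e'_def)
  have orth: "h u (e' i) = 0" if "\<mu> \<in> D" "u \<in> U \<mu>" "i < N + m" "s' i \<notin> A' \<mu>" for \<mu> u i
  proof (cases "i < N")
    case True
    then show ?thesis using that A'(1)[OF that(1), of "s i"] sysD(6,7) by (simp add: s'1 e'_def)
  next
    case False
    have "N + Suc (i - N) mod m < N + m" using m by simp
    then have "b (Suc (i - N)) \<notin> U \<mu>"
      using mem[OF that(1), of "s' i"] that(4) e's2[OF False] by (simp add: s'2[OF False])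
    then show ?thesis using hb[OF that(1,2)] False by (simp add: e'_def)
  qed
  have "e' i \<in> Eig \<rho> (if i < N then \<chi> i else (sg ^^ (i - N)) \<chi>0)" for i
    using b sysD(2) by (simp add: e'_def block_def)
  then show ?thesis
    unfolding sys_def s'_def[symmetric] e'_def[symmetric]
    using phi_e' pair mem orth bij_ext_perm[OF sysD(1) m] by (auto simp: s'_def)
qed

text \<open>The index \<open>\<mu>\<close> is minimal among members not yet exhausted, and the block
  starts inside \<open>U \<mu>\<close>. Its even places lie in \<open>U \<mu>\<close> and hence in
  all later members; an odd place pairs to 1 with an even one, so it lies in no isotropic member
  containing that one; earlier members are exhausted and contain neither. The new index sets are
  thus determined by N, d and \<open>\<mu>\<close> alone.\<close>

lemma sys_extend_isotropic:
  assumes flag: "flag \<rho> D U" and \<mu>: "\<mu> \<in> D" "\<And>\<nu>. \<nu> \<in> D \<Longrightarrow> \<nu> < \<mu> \<Longrightarrow> \<not> (\<exists>w\<in>U \<nu> \<inter> perp N e. w \<noteq> 0)"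
    and v0: "v0 \<in> U \<mu> \<inter> perp N e" "v0 \<in> Eig \<rho> \<chi>0" "v0 \<noteq> 0"
    and d: "d > 0" and per: "\<And>t t'. (sg ^^ (2 * t)) \<chi>0 = (sg ^^ (2 * t')) \<chi>0 \<longleftrightarrow> t mod d = t' mod d"
  obtains e' where "sys \<rho> D U (N + 2 * d) (ext_perm s N (2 * d)) (\<lambda>i. if i < N then \<chi> i else (sg ^^ (i - N)) \<chi>0)
    (\<lambda>\<nu>. if \<mu> \<le> \<nu> then A \<nu> \<inter> {..<N} \<union> {i. N \<le> i \<and> even (i - N)} else A \<nu> \<inter> {..<N}) e'"
proof -
  let ?A' = "\<lambda>\<nu>. if \<mu> \<le> \<nu> then A \<nu> \<inter> {..<N} \<union> {i. N \<le> i \<and> even (i - N)} else A \<nu> \<inter> {..<N}"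
  have Ust: "\<nu> \<in> D \<Longrightarrow> stab \<rho> (U \<nu>)" and Uiso: "\<nu> \<in> D \<Longrightarrow> x \<in> U \<nu> \<Longrightarrow> y \<in> U \<nu> \<Longrightarrow> h x y = 0"
    and Umono: "\<nu> \<in> D \<Longrightarrow> \<mu> \<le> \<nu> \<Longrightarrow> U \<mu> \<subseteq> U \<nu>" for \<nu> x y
    using flag \<mu>(1) by (auto simp: flag_def)
  obtain b where b: "block \<rho> (perp N e) (2 * d) \<chi>0 b" "\<And>t. b (2 * t) \<in> U \<mu> \<inter> perp N e"
    using isotropic_block[OF rep stab_perp nondeg_perp stab_inter[OF Ust[OF \<mu>(1)] stab_perp] _ _ v0 d per] Uiso[OF \<mu>(1)]
    by (metis Int_iff Int_lower2)
  have pair: "h (b (Suc i)) (b i) = 1" for i using b(1) unfolding block_def Suc_eq_plus1 by presburger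
  have b_perp: "b i \<in> perp N e" for i using b(1) by (simp add: block_def)
  have b0: "b i \<noteq> 0" for i using pair[of i] by auto
  have bU: "b i \<in> U \<nu> \<longleftrightarrow> \<mu> \<le> \<nu> \<and> even i" if "\<nu> \<in> D" for i \<nu>
  proof (cases "\<mu> \<le> \<nu>")
    case True
    show ?thesis
    proof (cases "even i")
      case True
      then obtain t where "i = 2 * t" by (elim evenE)
      then show ?thesis using b(2)[of t] Umono[OF that] \<open>\<mu> \<le> \<nu>\<close> by auto
    next
      case False
      then obtain t where i: "i = Suc (2 * t)" by (elim oddE) simp
      have "b (2 * t) \<in> U \<nu>" using b(2)[of t] Umono[OF that True] by auto
      then have "b i \<notin> U \<nu>" using pair[of "2 * t"] Uiso[OF that] i by fastforce
      then show ?thesis using False by simp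
    qed
  next
    case False
    then show ?thesis using \<mu>(2)[OF that] b0[of i] b_perp[of i] by auto
  qed
  have "sys \<rho> D U (N + 2 * d) (ext_perm s N (2 * d)) (\<lambda>i. if i < N then \<chi> i else (sg ^^ (i - N)) \<chi>0) ?A'
      (\<lambda>i. if i < N then e i else b (i - N))"
  proof (rule sys_extend[OF b(1)])
    fix \<nu> u i assume "\<nu> \<in> D" "u \<in> U \<nu>" "b (Suc i) \<notin> U \<nu>"
    show "h u (b i) = 0"
    proof (cases "\<mu> \<le> \<nu>")
      case True
      then have "b i \<in> U \<nu>" using bU[OF \<open>\<nu> \<in> D\<close>] \<open>b (Suc i) \<notin> U \<nu>\<close> by auto
      then show ?thesis using Uiso \<open>\<nu> \<in> D\<close> \<open>u \<in> U \<nu>\<close> by blast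
    next
      case False
      then show ?thesis
        using flag_expansion[OF \<open>\<nu> \<in> D\<close> Ust[OF \<open>\<nu> \<in> D\<close>] \<mu>(2)[OF \<open>\<nu> \<in> D\<close>] \<open>u \<in> U \<nu>\<close> b_perp] by simp
    qed
  qed (use bU in auto)
  then show ?thesis using that by blast
qed

text \<open>Once all members of the flag are exhausted, a new block in the complement avoids every
  one of them, and its length is the exact \<open>sg\<close>-period of the character.\<close>

lemma sys_extend_nondeg:
  assumes flag: "flag \<rho> D U" and \<mu>: "\<And>\<nu>. \<nu> \<in> D \<Longrightarrow> \<not> (\<exists>w\<in>U \<nu> \<inter> perp N e. w \<noteq> 0)"
    and v0: "v0 \<in> perp N e" "v0 \<in> Eig \<rho> \<chi>0" "v0 \<noteq> 0"
    and m: "m > 0" and per: "\<And>t t'. (sg ^^ t) \<chi>0 = (sg ^^ t') \<chi>0 \<longleftrightarrow> t mod m = t' mod m"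
  obtains e' where "sys \<rho> D U (N + m) (ext_perm s N m) (\<lambda>i. if i < N then \<chi> i else (sg ^^ (i - N)) \<chi>0)
    (\<lambda>\<nu>. A \<nu> \<inter> {..<N}) e'"
proof -
  obtain b where b: "block \<rho> (perp N e) m \<chi>0 b"
    using nondeg_block[OF rep stab_perp nondeg_perp v0 m per] by blast
  have "h (b (Suc i)) (b i) = 1" for i using b unfolding block_def Suc_eq_plus1 by presburger
  then have b0: "b i \<noteq> 0" for i by (metis h_0(2) zero_neq_one)
  have b_perp: "b i \<in> perp N e" for i using b(1) by (simp add: block_def)
  have "sys \<rho> D U (N + m) (ext_perm s N m) (\<lambda>i. if i < N then \<chi> i else (sg ^^ (i - N)) \<chi>0) (\<lambda>\<nu>. A \<nu> \<inter> {..<N})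
      (\<lambda>i. if i < N then e i else b (i - N))"
  proof (rule sys_extend[OF b])
    fix \<nu> u i assume "\<nu> \<in> D" "u \<in> U \<nu>"
    then show "h u (b i) = 0"
      using flag_expansion[OF \<open>\<nu> \<in> D\<close> _ \<mu>[OF \<open>\<nu> \<in> D\<close>] \<open>u \<in> U \<nu>\<close> b_perp] flag by (simp add: flag_def)
  qed (use \<mu> b0 b_perp in \<open>auto\<close>)
  then show ?thesis using that by blast
qed

end

lemma sg_min_period:
  obtains m where "m > 0" "\<And>t t'. (sg ^^ t) \<chi> = (sg ^^ t') \<chi> \<longleftrightarrow> t mod m = t' mod m"
proof -
  obtain N where "N > 0" "(sg ^^ N) \<chi> = \<chi>" using sg_period by blast
  then show ?thesis using funpow_minimal_period[of sg N \<chi>] sg_inj that by blast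
qed

lemma sg2_min_period:
  obtains d where "d > 0" "\<And>t t'. (sg ^^ (2 * t)) \<chi> = (sg ^^ (2 * t')) \<chi> \<longleftrightarrow> t mod d = t' mod d"
proof -
  obtain N where N: "N > 0" "(sg ^^ N) \<chi> = \<chi>" using sg_period by blast
  have "((sg ^^ 2) ^^ N) \<chi> = \<chi>" using funpow_period[OF N(2), of 2] by (simp add: funpow_mult mult.commute)
  moreover have "x = y" if "(sg ^^ 2) x = (sg ^^ 2) y" for x y using that sg_pow_inj by blast
  ultimately obtain d where "d > 0" "\<And>t t'. ((sg ^^ 2) ^^ t) \<chi> = ((sg ^^ 2) ^^ t') \<chi> \<longleftrightarrow> t mod d = t' mod d"
    using funpow_minimal_period[of "sg ^^ 2" N \<chi>] N(1) by blast
  then show ?thesis using that by (simp add: funpow_mult)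
qed

text \<open>A pair of systems with the same index data of maximal length N is taken; lengths are
  bounded by \<open>card B\<close>. By \<open>dim_sys\<close> and the equal dimensions, an
  eigenvector left over for one tuple has a counterpart with the same character and flag index for
  the other, and both extend by blocks of the same shape. The flag is exhausted before the rest of
  V, as the blocks inside it need room for their duals.\<close>

theorem simultaneous_system:
  assumes rep: "rep \<rho>" "rep \<rho>'" "length \<rho> = length \<rho>'" and flag: "flag \<rho> D U" "flag \<rho>' D U'"
    and dim_U: "\<And>\<psi> \<mu>. \<mu> \<in> D \<Longrightarrow> dim (Eig \<rho> \<psi> \<inter> U \<mu>) = dim (Eig \<rho>' \<psi> \<inter> U' \<mu>)"
    and dim_V: "\<And>\<psi>. dim (Eig \<rho> \<psi>) = dim (Eig \<rho>' \<psi>)"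
  obtains N s \<chi> A e e' where "sys \<rho> D U N s \<chi> A e" "sys \<rho>' D U' N s \<chi> A e'" "perp N e = {0}" "perp N e' = {0}"
proof -
  define P where "P N \<longleftrightarrow> (\<exists>s \<chi> A e e'. sys \<rho> D U N s \<chi> A e \<and> sys \<rho>' D U' N s \<chi> A e')" for N
  have "P 0" unfolding P_def sys_def by (intro exI[of _ id] exI) auto
  moreover have "N \<le> card B" if "P N" for N using that sys_le[OF rep(1)] unfolding P_def by blast
  ultimately obtain N where N: "P N" "\<And>M. P M \<Longrightarrow> M \<le> N"
    using GreatestI_nat[of P 0 "card B"] Greatest_le_nat[of P _ "card B"] by blast
  then obtain s \<chi> A e e' where s: "sys \<rho> D U N s \<chi> A e" and s': "sys \<rho>' D U' N s \<chi> A e'"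
    unfolding P_def by blast
  have st: "stab \<rho> (U \<mu>)" "stab \<rho>' (U' \<mu>)" if "\<mu> \<in> D" for \<mu> using flag that by (auto simp: flag_def)
  have len: "v \<in> Eig \<rho> \<psi> \<Longrightarrow> length \<psi> = length \<rho>" "v \<in> Eig \<rho>' \<psi> \<Longrightarrow> length \<psi> = length \<rho>" for v \<psi>
    using rep(3) by (auto simp: Eig_def)
  have tV: "(\<exists>w\<in>Eig \<rho> \<psi> \<inter> perp N e. w \<noteq> 0) \<longleftrightarrow> (\<exists>w\<in>Eig \<rho>' \<psi> \<inter> perp N e'. w \<noteq> 0)"
    if "length \<psi> = length \<rho>" for \<psi>
    using dim_sys_Eig(1)[OF rep(1) s that refl] dim_sys_Eig(1)[OF rep(2) s', of \<psi>] that rep(3) dim_V by simp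
  have tU: "(\<exists>w\<in>(Eig \<rho> \<psi> \<inter> U \<mu>) \<inter> perp N e. w \<noteq> 0) \<longleftrightarrow> (\<exists>w\<in>(Eig \<rho>' \<psi> \<inter> U' \<mu>) \<inter> perp N e'. w \<noteq> 0)"
    if "length \<psi> = length \<rho>" "\<mu> \<in> D" for \<psi> \<mu>
    using dim_sys_flag(1)[OF rep(1) s that st(1)[OF that(2)] refl]
      dim_sys_flag(1)[OF rep(2) s' _ that(2) st(2)[OF that(2)] refl, of \<psi>] that rep(3) dim_U by simp
  have ex1: "(\<exists>w\<in>U \<mu> \<inter> perp N e. w \<noteq> 0) \<longleftrightarrow> (\<exists>\<psi>. length \<psi> = length \<rho> \<and> (\<exists>w\<in>(Eig \<rho> \<psi> \<inter> U \<mu>) \<inter> perp N e. w \<noteq> 0))"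
    if "\<mu> \<in> D" for \<mu>
    using stab_eigenvector[OF rep(1) stab_inter[OF st(1)[OF that] stab_perp[OF rep(1) s]]] len
    by (metis Int_iff)
  have ex2: "(\<exists>w\<in>U' \<mu> \<inter> perp N e'. w \<noteq> 0) \<longleftrightarrow> (\<exists>\<psi>. length \<psi> = length \<rho> \<and> (\<exists>w\<in>(Eig \<rho>' \<psi> \<inter> U' \<mu>) \<inter> perp N e'. w \<noteq> 0))"
    if "\<mu> \<in> D" for \<mu>
    using stab_eigenvector[OF rep(2) stab_inter[OF st(2)[OF that] stab_perp[OF rep(2) s']]] len
    by (metis Int_iff)
  have noU: "\<not> (\<exists>w\<in>U \<mu> \<inter> perp N e. w \<noteq> 0)" if \<mu>D: "\<mu> \<in> D" for \<mu>
  proof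
    assume "\<exists>w\<in>U \<mu> \<inter> perp N e. w \<noteq> 0"
    then obtain \<mu> where \<mu>: "\<mu> \<in> D" "\<exists>w\<in>U \<mu> \<inter> perp N e. w \<noteq> 0"
      "\<And>\<nu>. \<nu> \<in> D \<Longrightarrow> \<nu> < \<mu> \<Longrightarrow> \<not> (\<exists>w\<in>U \<nu> \<inter> perp N e. w \<noteq> 0)"
      using exists_least_iff[of "\<lambda>\<mu>. \<mu> \<in> D \<and> (\<exists>w\<in>U \<mu> \<inter> perp N e. w \<noteq> 0)"] \<mu>D by blast
    then obtain \<psi> where \<psi>: "length \<psi> = length \<rho>" "\<exists>w\<in>(Eig \<rho> \<psi> \<inter> U \<mu>) \<inter> perp N e. w \<noteq> 0"
      using ex1 by blast
    then obtain w where w: "w \<in> U \<mu> \<inter> perp N e" "w \<in> Eig \<rho> \<psi>" "w \<noteq> 0" by blast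
    obtain w' where w': "w' \<in> U' \<mu> \<inter> perp N e'" "w' \<in> Eig \<rho>' \<psi>" "w' \<noteq> 0"
      using tU[OF \<psi>(1) \<mu>(1)] \<psi>(2) by blast
    have \<mu>': "\<not> (\<exists>w\<in>U' \<nu> \<inter> perp N e'. w \<noteq> 0)" if "\<nu> \<in> D" "\<nu> < \<mu>" for \<nu>
      using \<mu>(3)[OF that] ex1[OF that(1)] ex2[OF that(1)] tU[OF _ that(1)] by blast
    obtain d where d: "d > 0" "\<And>t t'. (sg ^^ (2 * t)) \<psi> = (sg ^^ (2 * t')) \<psi> \<longleftrightarrow> t mod d = t' mod d"
      using sg2_min_period by blast
    let ?s = "ext_perm s N (2 * d)" and ?\<chi> = "\<lambda>i. if i < N then \<chi> i else (sg ^^ (i - N)) \<psi>"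
    let ?A = "\<lambda>\<nu>. if \<mu> \<le> \<nu> then A \<nu> \<inter> {..<N} \<union> {i. N \<le> i \<and> even (i - N)} else A \<nu> \<inter> {..<N}"
    obtain e1 where e1: "sys \<rho> D U (N + 2 * d) ?s ?\<chi> ?A e1"
      by (rule sys_extend_isotropic[OF rep(1) s flag(1) \<mu>(1,3) w d])
    obtain e2 where e2: "sys \<rho>' D U' (N + 2 * d) ?s ?\<chi> ?A e2"
      by (rule sys_extend_isotropic[OF rep(2) s' flag(2) \<mu>(1) \<mu>' w' d])
    have "P (N + 2 * d)" unfolding P_def by (intro exI conjI) (rule e1, rule e2)
    then show False using N(2) d(1) by fastforce
  qed
  have noU': "\<not> (\<exists>w\<in>U' \<mu> \<inter> perp N e'. w \<noteq> 0)" if "\<mu> \<in> D" for \<mu>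
    using noU[OF that] ex1[OF that] ex2[OF that] tU[OF _ that] by blast
  have noE: "\<not> (\<exists>w\<in>Eig \<rho> \<psi> \<inter> perp N e. w \<noteq> 0)" for \<psi>
  proof
    assume "\<exists>w\<in>Eig \<rho> \<psi> \<inter> perp N e. w \<noteq> 0"
    then obtain w where w: "w \<in> perp N e" "w \<in> Eig \<rho> \<psi>" "w \<noteq> 0" by blast
    then obtain w' where w': "w' \<in> perp N e'" "w' \<in> Eig \<rho>' \<psi>" "w' \<noteq> 0"
      using tV[OF len(1)[OF w(2)]] by blast
    obtain m where m: "m > 0" "\<And>t t'. (sg ^^ t) \<psi> = (sg ^^ t') \<psi> \<longleftrightarrow> t mod m = t' mod m"
      using sg_min_period by blast
    let ?s = "ext_perm s N m" and ?\<chi> = "\<lambda>i. if i < N then \<chi> i else (sg ^^ (i - N)) \<psi>"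
    obtain e1 where e1: "sys \<rho> D U (N + m) ?s ?\<chi> (\<lambda>\<nu>. A \<nu> \<inter> {..<N}) e1"
      by (rule sys_extend_nondeg[OF rep(1) s flag(1) noU w m])
    obtain e2 where e2: "sys \<rho>' D U' (N + m) ?s ?\<chi> (\<lambda>\<nu>. A \<nu> \<inter> {..<N}) e2"
      by (rule sys_extend_nondeg[OF rep(2) s' flag(2) noU' w' m])
    have "P (N + m)" unfolding P_def by (intro exI conjI) (rule e1, rule e2)
    then show False using N(2) m(1) by fastforce
  qed
  have "w = 0" if w: "w \<in> perp N e" for w
  proof (rule ccontr)
    assume "w \<noteq> 0"
    then obtain \<psi> v where "v \<in> perp N e" "v \<in> Eig \<rho> \<psi>" "v \<noteq> 0"
      by (rule stab_eigenvector[OF rep(1) stab_perp[OF rep(1) s] w])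
    then show False using noE[of \<psi>] by blast
  qed
  then have "perp N e = {0}" using subspace_0[OF subspace_perp[OF rep(1) s]] by auto
  moreover have "w = 0" if w: "w \<in> perp N e'" for w
  proof (rule ccontr)
    assume "w \<noteq> 0"
    then obtain \<psi> v where v: "v \<in> perp N e'" "v \<in> Eig \<rho>' \<psi>" "v \<noteq> 0"
      by (rule stab_eigenvector[OF rep(2) stab_perp[OF rep(2) s'] w])
    then show False using noE[of \<psi>] tV[OF len(2)[OF v(2)]] by blast
  qed
  then have "perp N e' = {0}" using subspace_0[OF subspace_perp[OF rep(2) s']] by auto
  ultimately show ?thesis by (intro that[OF s s'])
qed

end

section \<open>Operators defined on an eigenbasis and coordinate spaces\<close>

context herm_space
begin

lemma rep_Nil: "rep []" by (simp add: rep_def)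

lemma Eig_Nil [simp]: "Eig [] [] = V" by (simp add: Eig_def)

text \<open>What remains is the geometry: a basis permuted by \<open>phi\<close> with prescribed
  pairings. Operators can be defined on it before any tuple is given.\<close>

lemma sys_forget:
  assumes "sys \<rho> D U N s \<chi> A e" shows "sys [] {} U' N s (\<lambda>_. []) A' e"
  using assms by (simp add: sys_def) (simp add: Eig_def)

lemma dim_V: "dim V = card B"
  using dim_span_eq_card_independent[OF indep_B] span_B by simp

lemma sys_full_iff:
  assumes "rep \<rho>" "sys \<rho> D U N s \<chi> A e"
  shows "perp N e = {0} \<longleftrightarrow> N = card B"
proof -
  note ds = dim_sys[OF assms subspace_V order_refl, of "{..<N}"]
  have "(\<exists>w\<in>V \<inter> perp N e. w \<noteq> 0) \<longleftrightarrow> card B > N"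
    using ds(1) sys_V[OF assms] sysD(7)[OF assms] dim_V by auto
  moreover have "(\<exists>w\<in>V \<inter> perp N e. w \<noteq> 0) \<longleftrightarrow> perp N e \<noteq> {0}"
    using subspace_0[OF subspace_perp[OF assms]] by (auto simp: perp_def)
  ultimately show ?thesis using sys_le[OF assms] by auto
qed

lemma sys_expansion:
  assumes "rep \<rho>" "sys \<rho> D U N s \<chi> A e" "perp N e = {0}" "u \<in> V"
  shows "u = (\<Sum>j<N. h u (e j) *s e (s j))"
  using proj_perp[OF assms(1,2,4)] assms(3) by (simp add: proj_def)

text \<open>A single index is fixed by \<open>sg\<close> when there are no operators, so all blocks have length 1.\<close>
lemma orthonormal_basis:
  obtains b where "\<And>k. k < card B \<Longrightarrow> b k \<in> V" "\<And>k. k < card B \<Longrightarrow> phi (b k) = b k"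
    "\<And>k l. k < card B \<Longrightarrow> l < card B \<Longrightarrow> h (b k) (b l) = (if k = l then 1 else 0)"
proof -
  define P where "P N \<longleftrightarrow> (\<exists>e. sys [] {} (\<lambda>_. {}) N id (\<lambda>_. []) (\<lambda>_. {}) e)" for N
  have "P 0" unfolding P_def sys_def by auto
  moreover have "N \<le> card B" if "P N" for N using that sys_le[OF rep_Nil] unfolding P_def by blast
  ultimately obtain N where N: "P N" "\<And>M. P M \<Longrightarrow> M \<le> N"
    using GreatestI_nat[of P 0 "card B"] Greatest_le_nat[of P _ "card B"] by blast
  then obtain e where e: "sys [] {} (\<lambda>_. {}) N id (\<lambda>_. []) (\<lambda>_. {}) e" unfolding P_def by blast
  have "perp N e = {0}"
  proof (rule ccontr)
    assume "perp N e \<noteq> {0}"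
    then obtain v where v: "v \<in> perp N e" "v \<noteq> 0"
      using subspace_0[OF subspace_perp[OF rep_Nil e]] by auto
    have sgNil: "(sg ^^ t) [] = []" for t by (induction t) (auto simp: sg_def)
    have fl: "flag [] {} (\<lambda>_. {})" by (simp add: flag_def)
    have vE: "v \<in> Eig [] []" using v by (simp add: perp_def)
    have noU: "\<not> (\<exists>w\<in>{} \<inter> perp N e. w \<noteq> 0)" if "\<nu> \<in> ({} :: nat set)" for \<nu> by simp
    have per: "((sg ^^ t) [] = (sg ^^ t') []) = (t mod 1 = t' mod 1)" for t t' by (simp add: sgNil)
    obtain e' where "sys [] {} (\<lambda>_. {}) (N + 1) (ext_perm id N 1)
        (\<lambda>i. if i < N then [] else (sg ^^ (i - N)) []) (\<lambda>\<nu>. {} \<inter> {..<N}) e'"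
      by (rule sys_extend_nondeg[OF rep_Nil e fl, of v "[]" 1]) (use v vE sgNil in \<open>auto\<close>)
    then have e': "sys [] {} (\<lambda>_. {}) (N + 1) (ext_perm id N 1) (\<lambda>_. []) (\<lambda>_. {}) e'"
      by (rule sys_forget)
    have id: "ext_perm id N 1 i = i" if "i < N + 1" for i using that by (auto simp: ext_perm_def)
    have "sys [] {} (\<lambda>_. {}) (N + 1) id (\<lambda>_. []) (\<lambda>_. {}) e'"
      using e' id unfolding sys_def by auto
    then show False using N(2)[of "N + 1"] unfolding P_def by auto
  qed
  then have "N = card B" using sys_full_iff[OF rep_Nil e] by simp
  then show ?thesis using that[of e] e by (auto simp: sys_def)
qed

text \<open>The map taking \<open>e i\<close> to \<open>a i *s e' i\<close>, written with
  coordinates read off by the dual basis so that it is linear on the whole type. With a = 1 it is a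
  change of basis, with e' = e a diagonal operator.\<close>

definition basis_op :: "nat \<Rightarrow> (nat \<Rightarrow> nat) \<Rightarrow> (nat \<Rightarrow> 'b) \<Rightarrow> (nat \<Rightarrow> 'v) \<Rightarrow> (nat \<Rightarrow> 'v) \<Rightarrow> 'v \<Rightarrow> 'v" where
  "basis_op N s a e e' v = (\<Sum>j<N. (a (s j) * h v (e j)) *s e' (s j))"

context
  fixes N s e e'
  assumes e: "sys [] {} (\<lambda>_. {}) N s (\<lambda>_. []) (\<lambda>_. {}) e" and e': "sys [] {} (\<lambda>_. {}) N s (\<lambda>_. []) (\<lambda>_. {}) e'"
begin

lemma basis_op_apply: "i < N \<Longrightarrow> basis_op N s a e e' (e i) = a i *s e' i"
proof -
  assume "i < N"
  then obtain k where k: "k < N" "s k = i" using sys_preimage[OF rep_Nil e] by blast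
  have "basis_op N s a e e' (e i) = (\<Sum>j<N. if j = k then a i *s e' i else 0)"
    unfolding basis_op_def using k sysD(4)[OF rep_Nil e, of k] by (intro sum.cong) auto
  then show ?thesis using k by simp
qed

lemma basis_op_add: "basis_op N s a e e' (x + y) = basis_op N s a e e' x + basis_op N s a e e' y"
  by (simp add: basis_op_def h_add_left distrib_left scale_left_distrib sum.distrib)

lemma basis_op_scale: "basis_op N s a e e' (c *s x) = c *s basis_op N s a e e' x"
  by (simp add: basis_op_def h_scale_left scale_sum_right mult.left_commute)

lemma basis_op_in: "basis_op N s a e e' x \<in> V"
  unfolding basis_op_def using sys_V[OF rep_Nil e'] sysD(7)[OF rep_Nil e']
  by (intro subspace_sum[OF subspace_V]) auto

lemma basis_op_phi:
  assumes a: "\<And>i. i < N \<Longrightarrow> a (s (s i)) = a i ^ (q\<^sup>2)"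
  shows "phi (basis_op N s a e e' x) = basis_op N s a e e' (phi x)"
proof -
  have sN: "i < N \<Longrightarrow> s i < N" for i using sysD(7)[OF rep_Nil e] .
  have "bij_betw (s \<circ> s) {..<N} {..<N}" using sysD(1)[OF rep_Nil e] bij_betw_trans by blast
  then have "basis_op N s a e e' (phi x) =
      (\<Sum>j<N. (a (s (s (s j))) * h (phi x) (e (s (s j)))) *s e' (s (s (s j))))"
    unfolding basis_op_def by (subst sum.reindex_bij_betw[symmetric]) (auto simp: comp_def)
  also have "\<dots> = (\<Sum>j<N. (a (s j) * h x (e j)) ^ (q\<^sup>2) *s phi (e' (s j)))"
    using a sN sysD(3)[OF rep_Nil e] sysD(3)[OF rep_Nil e']
    by (intro sum.cong) (auto simp: power_mult_distrib simp flip: h_phi)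
  also have "\<dots> = phi (basis_op N s a e e' x)"
    by (simp add: basis_op_def phi_sum phi_scale)
  finally show ?thesis by simp
qed

lemma basis_op_unitary:
  assumes full: "perp N e = {0}" and a: "\<And>i. i < N \<Longrightarrow> a (s i) * a i ^ q = 1" and v: "v \<in> V"
  shows "h (basis_op N s a e e' u) (basis_op N s a e e' v) = h u v"
proof -
  have sN: "i < N \<Longrightarrow> s i < N" for i using sysD(7)[OF rep_Nil e] .
  have "h (basis_op N s a e e' u) (basis_op N s a e e' v) =
      (\<Sum>k<N. \<Sum>j<N. (a (s j) * h u (e j)) * (a (s k) * h v (e k)) ^ q * h (e' (s j)) (e' (s k)))"
    unfolding basis_op_def h_sum_right h_sum_left
    by (simp add: h_scale_left h_scale_right ac_simps)
  also have "\<dots> = (\<Sum>k<N. (a (s (s k)) * h u (e (s k))) * (a (s k) * h v (e k)) ^ q)"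
  proof (intro sum.cong refl)
    fix k assume "k \<in> {..<N}"
    then have k: "k < N" by simp
    have "(\<Sum>j<N. (a (s j) * h u (e j)) * (a (s k) * h v (e k)) ^ q * h (e' (s j)) (e' (s k))) =
        (\<Sum>j<N. if j = s k then (a (s j) * h u (e j)) * (a (s k) * h v (e k)) ^ q else 0)"
      using sysD(4)[OF rep_Nil e'] sN k by (intro sum.cong) auto
    then show "(\<Sum>j<N. (a (s j) * h u (e j)) * (a (s k) * h v (e k)) ^ q * h (e' (s j)) (e' (s k))) =
        (a (s (s k)) * h u (e (s k))) * (a (s k) * h v (e k)) ^ q" using sN k by simp
  qed
  also have "\<dots> = (\<Sum>k<N. h v (e k) ^ q * h u (e (s k)))"
  proof (intro sum.cong refl)
    fix k assume "k \<in> {..<N}"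
    then have "a (s (s k)) * a (s k) ^ q = 1" using a sN by simp
    then show "(a (s (s k)) * h u (e (s k))) * (a (s k) * h v (e k)) ^ q = h v (e k) ^ q * h u (e (s k))"
      by (simp add: power_mult_distrib)
  qed
  also have "\<dots> = h u (\<Sum>k<N. h v (e k) *s e (s k))"
    by (simp add: h_sum_right h_scale_right)
  also have "(\<Sum>k<N. h v (e k) *s e (s k)) = v"
    using sys_expansion[OF rep_Nil e full v] by simp
  finally show ?thesis .
qed

lemma unit_op_basis_op:
  assumes "perp N e = {0}" "\<And>i. i < N \<Longrightarrow> a (s (s i)) = a i ^ (q\<^sup>2)" "\<And>i. i < N \<Longrightarrow> a (s i) * a i ^ q = 1"
  shows "unit_op (basis_op N s a e e')"
  unfolding unit_op_def
  using basis_op_add basis_op_scale basis_op_in basis_op_phi[where a = a, OF assms(2)] basis_op_unitary[where a = a, OF assms(1,3)] by simp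

end

lemma unit_op_ext:
  assumes "rep \<rho>" "sys \<rho> D U N s \<chi> A e" "perp N e = {0}"
    and lin: "\<And>x y. f (x + y) = f x + f y" "\<And>c x. f (c *s x) = c *s f x"
      "\<And>x y. g (x + y) = g x + g y" "\<And>c x. g (c *s x) = c *s g x"
    and eq: "\<And>i. i < N \<Longrightarrow> f (e i) = g (e i)" and u: "u \<in> V"
  shows "f u = g u"
proof -
  have f0: "f 0 = 0" "g 0 = 0" using lin(2)[of 0 0] lin(4)[of 0 0] by auto
  have sum: "f (\<Sum>i\<in>S. t i) = (\<Sum>i\<in>S. f (t i))" "g (\<Sum>i\<in>S. t i) = (\<Sum>i\<in>S. g (t i))" for t :: "nat \<Rightarrow> 'v" and S
    by (induction S rule: infinite_finite_induct) (auto simp: f0 lin)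
  show ?thesis
    by (subst (1 2) sys_expansion[OF assms(1,2,3) u])
      (use eq sysD(7)[OF assms(1,2)] in \<open>auto simp: sum lin intro!: sum.cong\<close>)
qed

end

section \<open>Coordinate spaces with a Hermitian form twisted by a permutation\<close>

definition fscale :: "'b::field \<Rightarrow> (nat \<Rightarrow> 'b) \<Rightarrow> nat \<Rightarrow> 'b" where
  "fscale c v = (\<lambda>i. c * v i)"

definition Vn :: "nat \<Rightarrow> (nat \<Rightarrow> 'b::field) set" where
  "Vn n = {v. \<forall>i\<ge>n. v i = 0}"

definition std :: "nat \<Rightarrow> nat \<Rightarrow> 'b::field" where
  "std i = (\<lambda>j. if j = i then 1 else 0)"

text \<open>Covers two cases at once: the given form, where s reverses the coordinates, and for any
  s with a = 1 a model whose standard basis is itself a system with permutation s.\<close>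

definition hform :: "nat \<Rightarrow> (nat \<Rightarrow> nat) \<Rightarrow> (nat \<Rightarrow> 'b::field) \<Rightarrow> nat \<Rightarrow> (nat \<Rightarrow> 'b) \<Rightarrow> (nat \<Rightarrow> 'b) \<Rightarrow> 'b" where
  "hform n s a q u v = (\<Sum>i<n. a i * u (s i) * v i ^ q)"

text \<open>Frobenius twisted so that \<open>std i\<close> goes to \<open>std (s (s i))\<close>;
  when s is an involution it is the plain coordinatewise Frobenius.\<close>

definition tphi :: "(nat \<Rightarrow> nat) \<Rightarrow> nat \<Rightarrow> (nat \<Rightarrow> 'b::field) \<Rightarrow> nat \<Rightarrow> 'b" where
  "tphi s q v = (\<lambda>i. v (inv_into UNIV s (inv_into UNIV s i)) ^ (q\<^sup>2))"

lemma sum_fun_apply [simp]: "(\<Sum>i\<in>S. f i :: 'c \<Rightarrow> 'd::comm_monoid_add) x = (\<Sum>i\<in>S. f i x)"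
  by (induction S rule: infinite_finite_induct) auto

global_interpretation fs: vector_space fscale
  by standard (auto simp: fscale_def fun_eq_iff algebra_simps)

lemma Vn_expansion: "v \<in> Vn n \<Longrightarrow> v = (\<Sum>i<n. fscale (v i) (std i))"
proof
  fix x assume v: "v \<in> Vn n"
  have "(\<Sum>i<n. fscale (v i) (std i)) x = (\<Sum>i<n. if i = x then v i else 0)"
    by (simp add: fscale_def std_def if_distrib cong: if_cong)
  then show "v x = (\<Sum>i<n. fscale (v i) (std i)) x" using v by (auto simp: Vn_def)
qed

lemma subspace_Vn: "fs.subspace (Vn n)"
  by (auto simp: fs.subspace_def Vn_def fscale_def)

lemma span_std: "fs.span (std ` {..<n}) = (Vn n :: (nat \<Rightarrow> 'b::field) set)"
proof
  show "fs.span (std ` {..<n}) \<subseteq> Vn n"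
    by (intro fs.span_minimal subspace_Vn) (auto simp: std_def Vn_def)
  have "v \<in> fs.span (std ` {..<n})" if v: "v \<in> Vn n" for v :: "nat \<Rightarrow> 'b"
  proof -
    have "(\<Sum>i<n. fscale (v i) (std i)) \<in> fs.span (std ` {..<n})"
      by (intro fs.span_sum fs.span_scale fs.span_base) auto
    then show ?thesis by (simp only: Vn_expansion[OF v, symmetric])
  qed
  then show "Vn n \<subseteq> fs.span (std ` {..<n} :: (nat \<Rightarrow> 'b) set)" by blast
qed

lemma inj_std: "inj (std :: nat \<Rightarrow> nat \<Rightarrow> 'b::field)"
  by (rule injI) (auto simp: std_def fun_eq_iff split: if_splits)

lemma card_std: "card (std ` {..<n} :: (nat \<Rightarrow> 'b::field) set) = n"
  using card_image[OF inj_on_subset[OF inj_std subset_UNIV], of "{..<n}"] by simp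

lemma indep_std: "fs.independent (std ` {..<n} :: (nat \<Rightarrow> 'b::field) set)"
proof (rule fs.independent_if_scalars_zero)
  fix f :: "(nat \<Rightarrow> 'b) \<Rightarrow> 'b" and x :: "nat \<Rightarrow> 'b"
  assume f: "(\<Sum>x\<in>std ` {..<n}. fscale (f x) x) = 0" and x: "x \<in> std ` {..<n}"
  then obtain i where i: "i < n" "x = std i" by auto
  have "(\<Sum>j<n. fscale (f (std j)) (std j)) = 0"
    using f by (simp add: sum.reindex[OF inj_on_subset[OF inj_std subset_UNIV]])
  then have "(\<Sum>j<n. fscale (f (std j)) (std j)) i = 0" by simp
  also have "(\<Sum>j<n. fscale (f (std j)) (std j)) i = (\<Sum>j<n. if j = i then f (std i) else 0)"
    unfolding sum_fun_apply by (intro sum.cong) (auto simp: fscale_def std_def)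
  finally show "f x = 0" using i by simp
qed simp

locale frob_field =
  fixes q :: nat and ty :: "'b::alg_closed_field itself"
  assumes q2: "2 \<le> q"
    and of_nat_q: "of_nat q = (0::'b)"
    and frob_add: "\<And>x y::'b. (x + y) ^ q = x ^ q + y ^ q"
    and frob_period: "\<And>x::'b. \<exists>N>0. x ^ (q ^ (2 * N)) = x"
begin

lemma frob_add2: "((x::'b) + y) ^ (q\<^sup>2) = x ^ (q\<^sup>2) + y ^ (q\<^sup>2)"
  by (simp only: power2_eq_square power_mult frob_add)

lemma frob_sum: "(\<Sum>i\<in>S. f i :: 'b) ^ q = (\<Sum>i\<in>S. f i ^ q)"
  using q2 by (induction S rule: infinite_finite_induct) (auto simp: frob_add power_0_left)

lemma frob_common_period: "finite S \<Longrightarrow> \<exists>N>0. \<forall>z\<in>S. (z::'b) ^ (q ^ (2 * N)) = z"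
proof (induction S rule: finite_induct)
  case (insert x S)
  then obtain N where N: "N > 0" "\<forall>z\<in>S. z ^ (q ^ (2 * N)) = z" by blast
  obtain M where M: "M > 0" "x ^ (q ^ (2 * M)) = x" using frob_period by blast
  have per: "z ^ (q ^ (2 * (j * k))) = z" if "z ^ (q ^ (2 * k)) = z" for z :: 'b and j k
  proof (induction j)
    case (Suc j)
    have "z ^ (q ^ (2 * (Suc j * k))) = (z ^ (q ^ (2 * (j * k)))) ^ (q ^ (2 * k))"
      by (simp add: algebra_simps power_add flip: power_mult)
    then show ?case using Suc that by simp
  qed simp
  have "\<forall>z\<in>insert x S. z ^ (q ^ (2 * (M * N))) = z"
    using per[of _ N M] per[of x M N] N(2) M(2) by (auto simp: mult.commute)
  then show ?case using N(1) M(1) by (intro exI[of _ "M * N"]) auto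
qed (auto intro: exI[of _ 1])

text \<open>Reindexing the form by s turns \<open>h_herm\<close> into the single condition
  \<open>a (s i) = a i ^ q\<close> on the weights. Periods of \<open>tphi\<close> come from a common
  period of the finitely many coordinates times the order of the permutation.\<close>

lemma herm_space_hform:
  assumes s: "s permutes {..<n}" and a: "\<And>i. i < n \<Longrightarrow> a i \<noteq> 0" "\<And>i. i < n \<Longrightarrow> a (s i) = a i ^ q"
  shows "herm_space fscale q (Vn n) (std ` {..<n}) (tphi s q) (hform n s a q :: _ \<Rightarrow> _ \<Rightarrow> 'b)"
proof unfold_locales
  show "2 \<le> q" "of_nat q = (0::'b)" by (rule q2, rule of_nat_q)
  show "(x + y) ^ q = x ^ q + y ^ q" "\<exists>N>0. x ^ (q ^ (2 * N)) = x" for x y :: 'b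
    by (rule frob_add, rule frob_period)
  show "fs.independent (std ` {..<n})" "fs.span (std ` {..<n}) = Vn n"
    by (rule indep_std, rule span_std)
  have inv_ge: "inv_into UNIV s i \<ge> n \<longleftrightarrow> i \<ge> n" for i
    using permutes_in_image[OF permutes_inv[OF s], of i] by auto
  show "tphi s q v \<in> Vn n" if "v \<in> Vn n" for v :: "nat \<Rightarrow> 'b"
    using that q2 by (auto simp: Vn_def tphi_def inv_ge power_0_left)
  show "tphi s q (u + v) = tphi s q u + tphi s q v" for u v :: "nat \<Rightarrow> 'b"
    by (auto simp: tphi_def frob_add2)
  show "tphi s q (fscale c v) = fscale (c ^ (q\<^sup>2)) (tphi s q v)" for c and v :: "nat \<Rightarrow> 'b"
    by (auto simp: tphi_def fscale_def power_mult_distrib)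
  show "hform n s a q (u + v) w = hform n s a q u w + hform n s a q v w" for u v w
    by (simp add: hform_def algebra_simps sum.distrib)
  show "hform n s a q (fscale c u) v = c * hform n s a q u v" for c u v
    by (simp add: hform_def fscale_def sum_distrib_left ac_simps)
  show "hform n s a q u (v + w) = hform n s a q u v + hform n s a q u w" for u v w
    by (simp add: hform_def frob_add algebra_simps sum.distrib)
  show "hform n s a q u (fscale c v) = c ^ q * hform n s a q u v" for c u v
    by (simp add: hform_def fscale_def power_mult_distrib sum_distrib_left ac_simps)
  have sn: "s i < n" if "i < n" for i using permutes_in_image[OF s, of i] that by simp
  show "hform n s a q u v ^ q = hform n s a q (tphi s q v) u" for u v :: "nat \<Rightarrow> 'b"
  proof -
    have "hform n s a q (tphi s q v) u = (\<Sum>i<n. a (s i) * tphi s q v (s (s i)) * u (s i) ^ q)"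
      unfolding hform_def by (rule sum.permute[OF s, unfolded comp_def])
    also have "\<dots> = (\<Sum>i<n. (a i * u (s i) * v i ^ q) ^ q)"
    proof (intro sum.cong refl)
      fix i assume "i \<in> {..<n}"
      have "tphi s q v (s (s i)) = (v i ^ q) ^ q"
        by (simp add: tphi_def permutes_inverses[OF s] power2_eq_square power_mult)
      then show "a (s i) * tphi s q v (s (s i)) * u (s i) ^ q = (a i * u (s i) * v i ^ q) ^ q"
        using a(2) \<open>i \<in> {..<n}\<close> by (simp add: power_mult_distrib)
    qed
    finally show ?thesis by (simp add: hform_def frob_sum)
  qed
  show "u = 0" if u: "u \<in> Vn n" "\<And>v. v \<in> Vn n \<Longrightarrow> hform n s a q u v = 0" for u
  proof
    fix x
    show "u x = 0 x"
    proof (cases "x < n")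
      case True
      define i where "i = inv_into UNIV s x"
      have i: "i < n" "s i = x" using True inv_ge[of x] by (auto simp: i_def permutes_inverses[OF s] not_le[symmetric])
      have "std i \<in> Vn n" using i by (auto simp: Vn_def std_def)
      then have "0 = hform n s a q u (std i)" using u(2) by simp
      also have "\<dots> = (\<Sum>j<n. if j = i then a i * u x else 0)"
        unfolding hform_def using i q2 by (intro sum.cong) (auto simp: std_def power_0_left)
      finally show ?thesis using a(1) i by simp
    qed (use u(1) in \<open>auto simp: Vn_def\<close>)
  qed
  show "\<exists>N>0. (tphi s q ^^ N) v = v" if v: "v \<in> Vn n" for v :: "nat \<Rightarrow> 'b"
  proof -
    obtain N where N: "N > 0" "\<forall>z\<in>v ` {..<n}. z ^ (q ^ (2 * N)) = z"
      using frob_common_period[of "v ` {..<n}"] by auto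
    have vN: "v i ^ (q ^ (2 * N)) = v i" for i
      using N(2) v q2 by (cases "i < n") (auto simp: Vn_def power_0_left)
    have "permutation (inv_into UNIV s)" using permutation_permutes permutes_inv[OF s] by blast
    then obtain M where M: "((inv_into UNIV s) ^^ M) = id" "M > 0" by (rule permutation_is_nilpotent)
    have pow: "(tphi s q ^^ k) v i = v (((inv_into UNIV s) ^^ (2 * k)) i) ^ (q ^ (2 * k))" for k i
    proof (induction k arbitrary: i)
      case (Suc k)
      have "(tphi s q ^^ Suc k) v i = (v (((inv_into UNIV s) ^^ (2 * k)) (inv_into UNIV s (inv_into UNIV s i))) ^ (q ^ (2 * k))) ^ (q\<^sup>2)"
        by (simp add: tphi_def Suc)
      then show ?case
        by (simp only: power_mult[symmetric] power_add[symmetric]) (simp add: funpow_swap1 power2_eq_square mult.commute mult.left_commute)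
    qed simp
    have "(tphi s q ^^ (M * N)) v = v"
    proof
      fix i
      have 1: "((inv_into UNIV s) ^^ (2 * (M * N))) = id"
        using M(1) by (metis funpow_mult id_funpow mult.assoc mult.commute)
      have 2: "z ^ (q ^ (2 * (j * N))) = z" if "z ^ (q ^ (2 * N)) = z" for z :: 'b and j
      proof (induction j)
        case (Suc j)
        have "z ^ (q ^ (2 * (Suc j * N))) = (z ^ (q ^ (2 * (j * N)))) ^ (q ^ (2 * N))"
          by (simp add: algebra_simps power_add flip: power_mult)
        then show ?case using Suc that by simp
      qed simp
      show "(tphi s q ^^ (M * N)) v i = v i" unfolding pow 1 using 2[OF vN] by simp
    qed
    then show ?thesis using M(2) N(1) by (intro exI[of _ "M * N"]) auto
  qed
qed simp

text \<open>Any permutation s occurs in the given space: this space and the twisted model for s both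
  have rational orthonormal bases, so they are isometric, and the standard basis of the model is
  carried over.\<close>

lemma exists_system:
  assumes s1: "s1 permutes {..<n}" and a: "\<And>i. i < n \<Longrightarrow> a i \<noteq> (0::'b)" "\<And>i. i < n \<Longrightarrow> a (s1 i) = a i ^ q"
    and s: "s permutes {..<n}"
  obtains e :: "nat \<Rightarrow> nat \<Rightarrow> 'b" where "\<And>i. i < n \<Longrightarrow> e i \<in> Vn n" "\<And>i. i < n \<Longrightarrow> tphi s1 q (e i) = e (s (s i))"
    "\<And>i j. i < n \<Longrightarrow> j < n \<Longrightarrow> hform n s1 a q (e (s i)) (e j) = (if i = j then 1 else 0)"
proof -
  interpret H: herm_space fscale q "Vn n" "std ` {..<n}" "tphi s1 q" "hform n s1 a q"
    using herm_space_hform[where a = a, OF s1 a] .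
  interpret H2: herm_space fscale q "Vn n" "std ` {..<n}" "tphi s q" "hform n s (\<lambda>_. 1::'b) q"
    by (rule herm_space_hform[where a = "\<lambda>_. 1", OF s]) auto
  obtain b where b: "\<And>k. k < n \<Longrightarrow> b k \<in> Vn n" "\<And>k. k < n \<Longrightarrow> tphi s1 q (b k) = b k"
    "\<And>k l. k < n \<Longrightarrow> l < n \<Longrightarrow> hform n s1 a q (b k) (b l) = (if k = l then 1 else 0)"
    using H.orthonormal_basis unfolding card_std by blast
  obtain b' where b': "\<And>k. k < n \<Longrightarrow> b' k \<in> Vn n" "\<And>k. k < n \<Longrightarrow> tphi s q (b' k) = b' k"
    "\<And>k l. k < n \<Longrightarrow> l < n \<Longrightarrow> hform n s (\<lambda>_. 1) q (b' k) (b' l) = (if k = l then 1 else (0::'b))"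
    using H2.orthonormal_basis unfolding card_std by blast
  have b'ss: "b' k (s (s i)) = (b' k i ^ q) ^ q" if "k < n" for k i
  proof -
    have "b' k (s (s i)) = tphi s q (b' k) (s (s i))" using b'(2)[OF that] by simp
    then show ?thesis by (simp add: tphi_def permutes_inverses[OF s] power2_eq_square power_mult)
  qed
  define P where "P = mat n n (\<lambda>(k, i). b' k (s i))"
  define R where "R = mat n n (\<lambda>(i, l). b' l i ^ q)"
  have PR: "P * R = 1\<^sub>m n"
  proof (rule eq_matI)
    fix k l assume "k < dim_row (1\<^sub>m n :: 'b mat)" "l < dim_col (1\<^sub>m n :: 'b mat)"
    then have kl: "k < n" "l < n" by auto
    have "(P * R) $$ (k, l) = (\<Sum>i<n. b' k (s i) * b' l i ^ q)"
      using kl by (simp add: P_def R_def scalar_prod_def atLeast0LessThan)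
    also have "\<dots> = hform n s (\<lambda>_. 1) q (b' k) (b' l)" by (simp add: hform_def)
    finally show "(P * R) $$ (k, l) = 1\<^sub>m n $$ (k, l)" using b'(3) kl by simp
  qed (auto simp: P_def R_def)
  \<comment> \<open>Orthonormality of the \<open>b' k\<close> is the product in the other order;
    reversing the factors gives the completeness relation \<open>ortho\<close>.\<close>
  have RP: "R * P = 1\<^sub>m n"
    by (rule mat_mult_left_right_inverse[OF _ _ PR]) (auto simp: P_def R_def)
  have ortho: "(\<Sum>k<n. b' k i ^ q * b' k (s j)) = (if i = j then 1 else 0)" if "i < n" "j < n" for i j
  proof -
    have "(R * P) $$ (i, j) = (\<Sum>k<n. b' k i ^ q * b' k (s j))"
      using that by (simp add: P_def R_def scalar_prod_def atLeast0LessThan)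
    then show ?thesis using that unfolding RP by simp
  qed
  \<comment> \<open>The coefficient is the pairing of \<open>std i\<close> with \<open>b' k\<close>
    in the model, so \<open>e i\<close> is the image of \<open>std i\<close> under the isometry
    taking \<open>b' k\<close> to \<open>b k\<close>.\<close>
  define e where "e = (\<lambda>i. \<Sum>k<n. fscale (b' k (inv_into UNIV s i) ^ q) (b k))"
  have "e i \<in> Vn n" for i
    unfolding e_def by (intro fs.subspace_sum[OF subspace_Vn] fs.subspace_scale[OF subspace_Vn]) (use b in auto)
  moreover have "tphi s1 q (e i) = e (s (s i))" for i
  proof -
    have "tphi s1 q (e i) = (\<Sum>k<n. fscale ((b' k (inv_into UNIV s i) ^ q) ^ (q\<^sup>2)) (b k))"
      unfolding e_def H.phi_sum using b(2) by (intro sum.cong) (auto simp: H.phi_scale)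
    also have "\<dots> = e (s (s i))"
      unfolding e_def
    proof (intro sum.cong refl)
      fix k assume "k \<in> {..<n}"
      have "b' k (inv_into UNIV s (s (s i))) = (b' k (inv_into UNIV s i) ^ q) ^ q"
        using b'ss[of k "inv_into UNIV s i"] \<open>k \<in> {..<n}\<close> by (simp add: permutes_inverses[OF s])
      then have "b' k (inv_into UNIV s (s (s i))) ^ q = (b' k (inv_into UNIV s i) ^ q) ^ (q\<^sup>2)"
        by (simp only: power2_eq_square power_mult)
      then show "fscale ((b' k (inv_into UNIV s i) ^ q) ^ (q\<^sup>2)) (b k) = fscale (b' k (inv_into UNIV s (s (s i))) ^ q) (b k)" by simp
    qed
    finally show ?thesis .
  qed
  moreover have "hform n s1 a q (e (s i)) (e j) = (if i = j then 1 else 0)" if ij: "i < n" "j < n" for i j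
  proof -
    have j: "inv_into UNIV s j < n" using permutes_in_image[OF permutes_inv[OF s], of j] ij by simp
    have "hform n s1 a q (e (s i)) (e j) = (\<Sum>l<n. \<Sum>k<n. b' k i ^ q * ((b' l (inv_into UNIV s j) ^ q) ^ q) * hform n s1 a q (b k) (b l))"
      unfolding e_def H.h_sum_right H.h_sum_left
      by (simp add: H.h_scale_left H.h_scale_right permutes_inverses[OF s] ac_simps)
    also have "\<dots> = (\<Sum>l<n. \<Sum>k<n. if k = l then b' l i ^ q * ((b' l (inv_into UNIV s j) ^ q) ^ q) else 0)"
      using b(3) by (intro sum.cong) auto
    also have "\<dots> = (\<Sum>l<n. b' l i ^ q * b' l (s j))"
      using b'ss[of _ "inv_into UNIV s j"] by (simp add: permutes_inverses[OF s])
    finally show ?thesis using ortho[OF ij] by simp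
  qed
  ultimately show ?thesis using that by blast
qed

end

section \<open>Euler characteristics and orbit sums\<close>

text \<open>The negative of the reduced Euler characteristic; the empty chain counts +1. The order
  is a parameter because it is also used for reversed inclusion and for inclusion of
  multisets.\<close>

definition esum :: "('a \<Rightarrow> 'a \<Rightarrow> bool) \<Rightarrow> 'a set \<Rightarrow> int" where
  "esum R A = (\<Sum>C\<in>{C. C \<subseteq> A \<and> Complete_Partial_Order.chain R C}. (-1) ^ card C)"

lemma finite_chains: "finite A \<Longrightarrow> finite {C. C \<subseteq> A \<and> Complete_Partial_Order.chain R C}"
  by (rule finite_subset[of _ "Pow A"]) auto

lemma reduced_euler_char_esum:
  assumes "finite A"
  shows "reduced_euler_char A = - esum (\<le>) A"
proof -
  define S where "S = {C. C \<subseteq> A \<and> Complete_Partial_Order.chain (\<le>) C}"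
  have fin: "finite S" unfolding S_def by (rule finite_chains[OF assms])
  have "esum (\<le>) A = (\<Sum>k\<le>card A. \<Sum>C\<in>{C \<in> S. card C = k}. (-1) ^ card C)"
    unfolding esum_def S_def[symmetric]
    by (rule sum.group[symmetric]) (use fin assms card_mono in \<open>auto simp: S_def\<close>)
  also have "\<dots> = (\<Sum>k\<le>card A. (-1) ^ k * int (card {C \<in> S. card C = k}))"
    by (intro sum.cong refl) simp
  also have "\<dots> = - reduced_euler_char A"
    unfolding reduced_euler_char_def sum_negf[symmetric]
    by (intro sum.cong refl) (auto simp: S_def conj_assoc)
  finally show ?thesis by simp
qed

lemma sum_involution_zero:
  fixes w :: "'c \<Rightarrow> int"
  assumes "\<And>C. C \<in> S \<Longrightarrow> t C \<in> S" "\<And>C. C \<in> S \<Longrightarrow> t (t C) = C" "\<And>C. C \<in> S \<Longrightarrow> w (t C) = - w C"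
  shows "sum w S = 0"
proof -
  have "sum w S = (\<Sum>C\<in>S. w (t C))"
    by (rule sum.reindex_bij_witness[of _ t t]) (use assms in auto)
  also have "\<dots> = - sum w S" using assms(3) by (simp add: sum_negf)
  finally show ?thesis by simp
qed

lemma card_toggle:
  assumes "finite C"
  shows "(-1) ^ card (if a \<in> C then C - {a} else insert a C) = - ((-1) ^ card C :: int)"
proof (cases "a \<in> C")
  case True
  then have c: "card C = Suc (card (C - {a}))" using assms by (metis card_Suc_Diff1)
  have "(-1) ^ card C = - ((-1) ^ card (C - {a}) :: int)" unfolding c power_Suc by (rule mult_minus1)
  then show ?thesis using True by (simp only: if_True minus_minus)
qed (use assms in simp)

text \<open>Adding or removing the point comparable to all others pairs chains of opposite
  sign.\<close>

lemma esum_cone: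
  assumes "finite A" "a \<in> A" "\<And>x. x \<in> A \<Longrightarrow> R a x \<or> R x a"
  shows "esum R A = 0"
  unfolding esum_def
proof (rule sum_involution_zero[where t = "\<lambda>C. if a \<in> C then C - {a} else insert a C"])
  fix C assume C: "C \<in> {C. C \<subseteq> A \<and> Complete_Partial_Order.chain R C}"
  then show "(if a \<in> C then C - {a} else insert a C) \<in> {C. C \<subseteq> A \<and> Complete_Partial_Order.chain R C}"
    using assms(2,3) unfolding Complete_Partial_Order.chain_def by auto
  show "(-1) ^ card (if a \<in> C then C - {a} else insert a C) = - ((-1) ^ card C :: int)"
    using C assms(1) by (intro card_toggle) (auto intro: finite_subset)
qed auto

lemma chain_least:
  assumes "finite C" "C \<noteq> {}" "Complete_Partial_Order.chain R C"
    and "\<And>x y z. x \<in> C \<Longrightarrow> y \<in> C \<Longrightarrow> z \<in> C \<Longrightarrow> R x y \<Longrightarrow> R y z \<Longrightarrow> R x z"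
  shows "\<exists>x\<in>C. \<forall>y\<in>C. R x y"
  using assms
proof (induction C rule: finite_ne_induct)
  case (singleton x)
  from singleton.prems(1) show ?case by (auto simp: Complete_Partial_Order.chain_def)
next
  case (insert a C)
  have "Complete_Partial_Order.chain R C" using insert.prems(1) by (auto simp: Complete_Partial_Order.chain_def)
  moreover have "R x z" if "x \<in> C" "y \<in> C" "z \<in> C" "R x y" "R y z" for x y z
    using insert.prems(2)[of x y z] that by blast
  ultimately obtain x where x: "x \<in> C" "\<forall>y\<in>C. R x y" using insert.IH by blast
  have "R a a" "R a x \<or> R x a" using insert.prems(1) x(1) by (auto simp: Complete_Partial_Order.chain_def)
  then show ?case
  proof (elim disjE)
    assume "R a x"
    then have "R a y" if "y \<in> C" for y using insert.prems(2)[of a x y] x that by blast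
    then show ?case using \<open>R a a\<close> by blast
  qed (use x in blast)
qed

text \<open>Toggling \<open>f x\<close> for the least \<open>x\<close> not fixed by \<open>f\<close> cancels all chains outside the fixed points.\<close>
lemma esum_retract:
  assumes fin: "finite A"
    and R: "\<And>x. x \<in> A \<Longrightarrow> R x x" "\<And>x y z. x \<in> A \<Longrightarrow> y \<in> A \<Longrightarrow> z \<in> A \<Longrightarrow> R x y \<Longrightarrow> R y z \<Longrightarrow> R x z"
      "\<And>x y. x \<in> A \<Longrightarrow> y \<in> A \<Longrightarrow> R x y \<Longrightarrow> R y x \<Longrightarrow> x = y"
    and f: "\<And>x. x \<in> A \<Longrightarrow> f x \<in> A" "\<And>x. x \<in> A \<Longrightarrow> R (f x) x" "\<And>x. x \<in> A \<Longrightarrow> f (f x) = f x"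
      "\<And>x y. x \<in> A \<Longrightarrow> y \<in> A \<Longrightarrow> R x y \<Longrightarrow> R (f x) (f y)"
  shows "esum R A = esum R {x \<in> A. f x = x}"
proof -
  define Ch where "Ch = {C. C \<subseteq> A \<and> Complete_Partial_Order.chain R C}"
  define nf where "nf C = {x \<in> C. f x \<noteq> x}" for C
  define m where "m N = (SOME x. x \<in> N \<and> (\<forall>y\<in>N. R x y))" for N
  define t where "t C = (if f (m (nf C)) \<in> C then C - {f (m (nf C))} else insert (f (m (nf C))) C)" for C
  define S where "S = {C \<in> Ch. nf C \<noteq> {}}"
  have m: "m (nf C) \<in> nf C" "\<And>y. y \<in> nf C \<Longrightarrow> R (m (nf C)) y" if "C \<in> S" for C
  proof -
    have "finite C" "C \<subseteq> A" using that fin by (auto simp: S_def Ch_def intro: finite_subset)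
    have "\<exists>x\<in>nf C. \<forall>y\<in>nf C. R x y"
    proof (rule chain_least)
      show "finite (nf C)" using \<open>finite C\<close> by (simp add: nf_def)
      show "nf C \<noteq> {}" using that by (simp add: S_def)
      show "Complete_Partial_Order.chain R (nf C)"
        using that by (auto simp: S_def Ch_def nf_def Complete_Partial_Order.chain_def)
      fix x y z assume "x \<in> nf C" "y \<in> nf C" "z \<in> nf C" "R x y" "R y z"
      then show "R x z" using R(2)[of x y z] \<open>C \<subseteq> A\<close> by (auto simp: nf_def)
    qed
    then have ex: "\<exists>x. x \<in> nf C \<and> (\<forall>y\<in>nf C. R x y)" by blast
    have "m (nf C) \<in> nf C \<and> (\<forall>y\<in>nf C. R (m (nf C)) y)"
      unfolding m_def by (rule someI_ex[OF ex])
    then show "m (nf C) \<in> nf C" "\<And>y. y \<in> nf C \<Longrightarrow> R (m (nf C)) y" by auto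
  qed
  have mA: "m (nf C) \<in> A" if "C \<in> S" for C using m(1)[OF that] that by (auto simp: nf_def S_def Ch_def)
  \<comment> \<open>The toggled element is fixed by f since f is idempotent, so the set of nonfixed
    elements, and with it the choice of m, is preserved: t is an involution.\<close>
  have nft: "nf (t C) = nf C" if "C \<in> S" for C
    using f(3)[OF mA[OF that]] by (auto simp: t_def nf_def)
  have comp: "R z (f (m (nf C))) \<or> R (f (m (nf C))) z" if C: "C \<in> S" and z: "z \<in> C" for C z
  proof -
    have zA: "z \<in> A" using C z by (auto simp: S_def Ch_def)
    have "R z (m (nf C)) \<or> R (m (nf C)) z"
      using C z m(1)[OF C] by (auto simp: S_def Ch_def nf_def Complete_Partial_Order.chain_def)
    then show ?thesis
    proof
      assume zm: "R z (m (nf C))"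
      show ?thesis
      proof (cases "f z = z")
        case True then show ?thesis using f(4)[OF zA mA[OF C] zm] by simp
      next
        case False
        then have "R (m (nf C)) z" using m(2)[OF C] z by (auto simp: nf_def)
        then show ?thesis using R(3)[OF zA mA[OF C] zm] f(2)[OF mA[OF C]] by auto
      qed
    next
      assume "R (m (nf C)) z"
      then show ?thesis using R(2)[OF f(1)[OF mA[OF C]] mA[OF C] zA f(2)[OF mA[OF C]]] by blast
    qed
  qed
  have "(\<Sum>C\<in>S. (-1) ^ card C :: int) = 0"
  proof (rule sum_involution_zero)
    fix C assume C: "C \<in> S"
    have "t C \<in> Ch"
      using C comp[OF C] R(1)[OF f(1)[OF mA[OF C]]] f(1)[OF mA[OF C]]
      unfolding t_def S_def Ch_def Complete_Partial_Order.chain_def by auto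
    then show "t C \<in> S" using nft[OF C] C by (auto simp: S_def)
    show "t (t C) = C" unfolding t_def[of "t C"] nft[OF C] by (auto simp: t_def)
    show "(-1) ^ card (t C) = - ((-1) ^ card C :: int)" unfolding t_def
      using C fin by (intro card_toggle) (auto simp: S_def Ch_def intro: finite_subset)
  qed
  moreover define F where "F = {C. C \<subseteq> {x \<in> A. f x = x} \<and> Complete_Partial_Order.chain R C}"
  moreover have "Ch = S \<union> F" by (auto simp: S_def Ch_def nf_def F_def)
  moreover have "S \<inter> F = {}" by (auto simp: S_def nf_def F_def)
  moreover have "finite S" "finite F"
    using finite_chains[OF fin, of R] finite_chains[of "{x \<in> A. f x = x}" R] fin by (auto simp: S_def Ch_def F_def)
  ultimately have "(\<Sum>C\<in>Ch. (-1) ^ card C :: int) = (\<Sum>C\<in>F. (-1) ^ card C)"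
    by (simp add: sum.union_disjoint)
  then show ?thesis unfolding esum_def Ch_def F_def .
qed

lemma esum_dual: "esum (\<lambda>x y. R y x) A = esum R A"
proof -
  have "Complete_Partial_Order.chain (\<lambda>x y. R y x) C = Complete_Partial_Order.chain R C" for C
    by (auto simp: Complete_Partial_Order.chain_def)
  then show ?thesis by (simp add: esum_def)
qed

text \<open>Retract downwards along f, then upwards along g on the fixed points of f (a downward
  retraction for the reversed order); what remains has the least element a.\<close>

lemma esum_conically_contractible:
  fixes A :: "'a::order set"
  assumes fin: "finite A"
    and f: "\<And>x. x \<in> A \<Longrightarrow> f x \<in> A" "\<And>x. x \<in> A \<Longrightarrow> f x \<le> x" "\<And>x. x \<in> A \<Longrightarrow> f (f x) = f x"
      "\<And>x y. x \<in> A \<Longrightarrow> y \<in> A \<Longrightarrow> x \<le> y \<Longrightarrow> f x \<le> f y"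
    and g: "\<And>x. x \<in> A \<Longrightarrow> f x = x \<Longrightarrow> g x \<in> A \<and> f (g x) = g x" "\<And>x. x \<in> A \<Longrightarrow> f x = x \<Longrightarrow> x \<le> g x"
      "\<And>x. x \<in> A \<Longrightarrow> f x = x \<Longrightarrow> g (g x) = g x"
      "\<And>x y. x \<in> A \<Longrightarrow> y \<in> A \<Longrightarrow> f x = x \<Longrightarrow> f y = y \<Longrightarrow> x \<le> y \<Longrightarrow> g x \<le> g y"
    and a: "a \<in> A" "f a = a" "g a = a" "\<And>x. x \<in> A \<Longrightarrow> f x = x \<Longrightarrow> a \<le> g x"
  shows "esum (\<le>) A = 0"
proof -
  define A1 where "A1 = {x \<in> A. f x = x}"
  have "esum (\<le>) A = esum (\<le>) A1" unfolding A1_def by (rule esum_retract) (use fin f in auto)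
  also have "\<dots> = esum (\<lambda>x y. y \<le> x) A1" by (rule esum_dual[symmetric])
  also have "\<dots> = esum (\<lambda>x y. y \<le> x) {x \<in> A1. g x = x}"
    by (rule esum_retract) (use fin g in \<open>auto simp: A1_def\<close>)
  also have "\<dots> = 0"
  proof (rule esum_cone[of _ a])
    fix x assume "x \<in> {x \<in> A1. g x = x}"
    then show "x \<le> a \<or> a \<le> x" using a(4)[of x] by (simp add: A1_def)
  qed (use fin a(1-3) in \<open>auto simp: A1_def\<close>)
  finally show ?thesis .
qed

text \<open>Each orbit contributes the order of the group. Orbits are represented by the values of a
  complete invariant \<open>cls\<close>, which is the form in which the classification of pairs is
  available.\<close>

lemma weighted_burnside:
  fixes act :: "'g \<Rightarrow> 'w \<Rightarrow> 'w" and wt :: "'z \<Rightarrow> int"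
  assumes G: "group G" "finite (carrier G)" and fin: "finite W"
    and act: "\<And>g w. g \<in> carrier G \<Longrightarrow> w \<in> W \<Longrightarrow> act g w \<in> W"
      "\<And>g k w. g \<in> carrier G \<Longrightarrow> k \<in> carrier G \<Longrightarrow> w \<in> W \<Longrightarrow> act (g \<otimes>\<^bsub>G\<^esub> k) w = act g (act k w)"
      "\<And>w. w \<in> W \<Longrightarrow> act \<one>\<^bsub>G\<^esub> w = w"
    and cls: "\<And>w w'. w \<in> W \<Longrightarrow> w' \<in> W \<Longrightarrow> cls w = cls w' \<longleftrightarrow> (\<exists>g\<in>carrier G. act g w = w')"
  shows "(\<Sum>w\<in>W. wt (cls w) * int (card {g \<in> carrier G. act g w = w})) =
    int (card (carrier G)) * (\<Sum>z\<in>cls ` W. wt z)"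
proof -
  interpret group G by (rule G(1))
  have "(\<Sum>w\<in>{w \<in> W. cls w = z}. card {g \<in> carrier G. act g w = w}) = card (carrier G)" if z: "z \<in> cls ` W" for z
  proof -
    obtain w0 where w0: "w0 \<in> W" "cls w0 = z" using z by auto
    \<comment> \<open>Right multiplication by an element taking w0 to w maps the stabiliser of w
      onto the coset of elements taking w0 to w; these cosets partition the group.\<close>
    have eq: "card {g \<in> carrier G. act g w = w} = card {k \<in> carrier G. act k w0 = w}"
      if w: "w \<in> W" "cls w = z" for w
    proof -
      obtain k0 where k0: "k0 \<in> carrier G" "act k0 w0 = w" using cls[OF w0(1) w(1)] w0 w by auto
      have ik0: "act (m_inv G k0) w = w0"
        using act(2)[of "m_inv G k0" k0 w0] act(3)[OF w0(1)] k0 w0 by simp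
      show ?thesis
      proof (rule bij_betw_same_card[of "\<lambda>g. g \<otimes>\<^bsub>G\<^esub> k0"], rule bij_betw_byWitness[of _ "\<lambda>k. k \<otimes>\<^bsub>G\<^esub> m_inv G k0"])
        show "\<forall>g\<in>{g \<in> carrier G. act g w = w}. g \<otimes>\<^bsub>G\<^esub> k0 \<otimes>\<^bsub>G\<^esub> m_inv G k0 = g"
          using k0 by (auto simp: m_assoc)
        show "\<forall>k\<in>{k \<in> carrier G. act k w0 = w}. k \<otimes>\<^bsub>G\<^esub> m_inv G k0 \<otimes>\<^bsub>G\<^esub> k0 = k"
          using k0 by (auto simp: m_assoc)
        show "(\<lambda>g. g \<otimes>\<^bsub>G\<^esub> k0) ` {g \<in> carrier G. act g w = w} \<subseteq> {k \<in> carrier G. act k w0 = w}"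
          using k0 w0 act(2) by auto
        show "(\<lambda>k. k \<otimes>\<^bsub>G\<^esub> m_inv G k0) ` {k \<in> carrier G. act k w0 = w} \<subseteq> {g \<in> carrier G. act g w = w}"
          using k0 w act(2) ik0 by auto
      qed
    qed
    have "(\<Sum>w\<in>{w \<in> W. cls w = z}. card {g \<in> carrier G. act g w = w}) =
        (\<Sum>w\<in>{w \<in> W. cls w = z}. card {k \<in> carrier G. act k w0 = w})"
      using eq by (intro sum.cong) auto
    also have "\<dots> = card (\<Union>w\<in>{w \<in> W. cls w = z}. {k \<in> carrier G. act k w0 = w})"
      by (rule card_UN_disjoint[symmetric]) (use fin G(2) in auto)
    also have "(\<Union>w\<in>{w \<in> W. cls w = z}. {k \<in> carrier G. act k w0 = w}) = carrier G"
      using act(1) cls w0 by fastforce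
    finally show ?thesis .
  qed note key = this
  have "(\<Sum>w\<in>W. wt (cls w) * int (card {g \<in> carrier G. act g w = w})) =
      (\<Sum>z\<in>cls ` W. \<Sum>w\<in>{w \<in> W. cls w = z}. wt (cls w) * int (card {g \<in> carrier G. act g w = w}))"
    by (rule sum.group[symmetric]) (use fin in auto)
  also have "\<dots> = (\<Sum>z\<in>cls ` W. wt z * int (\<Sum>w\<in>{w \<in> W. cls w = z}. card {g \<in> carrier G. act g w = w}))"
    by (intro sum.cong refl) (simp add: sum_distrib_left)
  also have "\<dots> = (\<Sum>z\<in>cls ` W. wt z * int (card (carrier G)))"
    using key by (intro sum.cong) auto
  finally show ?thesis by (simp add: sum_distrib_left mult.commute)
qed

text \<open>As C has no constant term, the equation determines n times the n-th coefficient from the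
  earlier ones.\<close>

lemma fps_log_deriv_unique:
  fixes A E C :: "'k::field_char_0 fps"
  assumes "fps_X * fps_deriv A = C * A" "fps_X * fps_deriv E = C * E" "fps_nth A 0 = fps_nth E 0" "fps_nth C 0 = 0"
  shows "A = E"
proof (rule fps_ext)
  fix n show "fps_nth A n = fps_nth E n"
  proof (induction n rule: less_induct)
    case (less n)
    show ?case
    proof (cases "n = 0")
      case False
      have rec: "of_nat n * fps_nth Z n = (\<Sum>i=0..n. fps_nth C i * fps_nth Z (n - i))"
        if "fps_X * fps_deriv Z = C * Z" for Z
      proof -
        have "fps_nth (fps_X * fps_deriv Z) n = of_nat n * fps_nth Z n" using False by (cases n) auto
        then show ?thesis unfolding that by (simp add: fps_mult_nth)
      qed
      have "(\<Sum>i=0..n. fps_nth C i * fps_nth A (n - i)) = (\<Sum>i=0..n. fps_nth C i * fps_nth E (n - i))"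
      proof (intro sum.cong refl)
        fix i show "fps_nth C i * fps_nth A (n - i) = fps_nth C i * fps_nth E (n - i)"
          using less[of "n - i"] False assms(4) by (cases "i = 0") auto
      qed
      then have "of_nat n * fps_nth A n = of_nat n * fps_nth E n"
        using rec[OF assms(1)] rec[OF assms(2)] by simp
      then show ?thesis using False by simp
    qed (use assms(3) in simp)
  qed
qed

section \<open>Generating function of stable multisets\<close>

text \<open>The set T will consist of the characters with p-power roots of unity as values, which is
  infinite in general; only the sets of points of a given period are finite.\<close>

locale periodic_map =
  fixes T :: "'c set" and s :: "'c \<Rightarrow> 'c"
  assumes s_inj: "\<And>x y. s x = s y \<Longrightarrow> x = y" and s_T: "\<And>x. x \<in> T \<Longrightarrow> s x \<in> T"
    and s_period: "\<And>x. x \<in> T \<Longrightarrow> \<exists>m>0. (s ^^ m) x = x"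
    and finite_Fix: "\<And>k. k > 0 \<Longrightarrow> finite {x \<in> T. (s ^^ k) x = x}"
begin

definition Fix :: "nat \<Rightarrow> 'c set" where "Fix k = {x \<in> T. (s ^^ k) x = x}"

definition stable :: "nat \<Rightarrow> 'c multiset set" where
  "stable n = {w. set_mset w \<subseteq> T \<and> image_mset s w = w \<and> size w = n}"

text \<open>For x of exact period d dividing k this is the orbit of x repeated k/d times. Admitting
  all multiples of the period is what lets the sizes k detect multiplicities.\<close>

definition cyc :: "'c \<Rightarrow> nat \<Rightarrow> 'c multiset" where
  "cyc x k = image_mset (\<lambda>i. (s ^^ i) x) (mset_set {..<k})"

lemma pow_inj: "(s ^^ k) x = (s ^^ k) y \<Longrightarrow> x = y"
  by (induction k) (auto dest: s_inj)

lemma pow_T: "x \<in> T \<Longrightarrow> (s ^^ k) x \<in> T"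
  by (induction k) (auto simp: s_T)

lemma count_s: "image_mset s w = w \<Longrightarrow> count w (s x) = count w x"
proof -
  have "count (image_mset s v) (s x) = count v x" for v by (induction v) (auto dest: s_inj)
  then show "image_mset s w = w \<Longrightarrow> count w (s x) = count w x" by metis
qed

lemma count_pow: "image_mset s w = w \<Longrightarrow> count w ((s ^^ i) x) = count w x"
  by (induction i) (auto simp: count_s)

lemma stable_cyc: "x \<in> Fix k \<Longrightarrow> cyc x k \<in> stable k"
proof -
  assume x: "x \<in> Fix k"
  have "image_mset s (cyc x k) = image_mset (\<lambda>i. (s ^^ Suc i) x) (mset_set {..<k})"
    by (simp add: cyc_def image_mset.compositionality comp_def)
  also have "\<dots> = image_mset (\<lambda>i. (s ^^ i) x) (image_mset Suc (mset_set {..<k}))"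
    by (simp add: image_mset.compositionality comp_def)
  also have "image_mset Suc (mset_set {..<k}) = mset_set {Suc 0..<Suc k}"
    by (simp add: image_mset_mset_set lessThan_atLeast0 del: upt_Suc)
  also have "image_mset (\<lambda>i. (s ^^ i) x) (mset_set {Suc 0..<Suc k}) = cyc x k"
  proof (cases "k = 0")
    case False
    then have "{Suc 0..<Suc k} = insert k {Suc 0..<k}" "{..<k} = insert 0 {Suc 0..<k}" by auto
    then show ?thesis using x by (simp add: cyc_def Fix_def)
  qed (simp add: cyc_def)
  finally show ?thesis using x by (auto simp: stable_def cyc_def pow_T Fix_def)
qed

lemma stable_add: "v \<in> stable j \<Longrightarrow> w \<in> stable k \<Longrightarrow> v + w \<in> stable (j + k)"
  by (auto simp: stable_def)

lemma stable_diff: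
  assumes "v \<in> stable j" "w \<in> stable k" "v \<subseteq># w" shows "w - v \<in> stable (k - j)"
  using assms by (auto simp: stable_def image_mset_Diff size_Diff_submset dest: in_diffD)

lemma card_stable_containing:
  assumes "v \<in> stable k" "k \<le> n"
  shows "card {w \<in> stable n. v \<subseteq># w} = card (stable (n - k))"
proof (rule bij_betw_same_card[of "\<lambda>w. w - v"], rule bij_betw_byWitness[of _ "\<lambda>w. w + v"])
  show "(\<lambda>w. w - v) ` {w \<in> stable n. v \<subseteq># w} \<subseteq> stable (n - k)" using stable_diff[OF assms(1)] by auto
  show "(\<lambda>w. w + v) ` stable (n - k) \<subseteq> {w \<in> stable n. v \<subseteq># w}"
    using stable_add[OF _ assms(1)] assms(2) by fastforce
qed auto

lemma minimal_period:
  assumes "x \<in> T"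
  obtains d where "d > 0" "\<And>k. (s ^^ k) x = x \<longleftrightarrow> d dvd k" "inj_on (\<lambda>i. (s ^^ i) x) {..<d}"
proof -
  define d where "d = (LEAST n. n > 0 \<and> (s ^^ n) x = x)"
  obtain m where "m > 0" "(s ^^ m) x = x" using s_period[OF assms] by blast
  then have d: "d > 0" "(s ^^ d) x = x"
    using LeastI[of "\<lambda>n. n > 0 \<and> (s ^^ n) x = x" m] by (auto simp: d_def)
  have least: "n = 0" if "n < d" "(s ^^ n) x = x" for n
    using not_less_Least[of n "\<lambda>n. n > 0 \<and> (s ^^ n) x = x"] that by (auto simp: d_def)
  have mult: "(s ^^ (j * d)) x = x" for j by (induction j) (auto simp: funpow_add d(2))
  have "(s ^^ k) x = x \<longleftrightarrow> d dvd k" for k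
  proof
    assume k: "(s ^^ k) x = x"
    have "(s ^^ k) x = (s ^^ (k mod d)) ((s ^^ (k div d * d)) x)"
      by (simp flip: funpow_add comp_apply[of "s ^^ (k mod d)"])
    then have "k mod d = 0" using k mult d(1) by (intro least) auto
    then show "d dvd k" by auto
  next
    assume "d dvd k"
    then show "(s ^^ k) x = x" using mult by (metis dvd_div_mult_self)
  qed
  moreover have "inj_on (\<lambda>i. (s ^^ i) x) {..<d}"
  proof (rule linorder_inj_onI)
    fix i j assume ij: "i < j" "i \<in> {..<d}" "j \<in> {..<d}"
    show "(s ^^ i) x \<noteq> (s ^^ j) x"
    proof
      assume "(s ^^ i) x = (s ^^ j) x"
      then have "(s ^^ i) x = (s ^^ i) ((s ^^ (j - i)) x)" using ij(1) by (simp flip: funpow_add comp_apply[of "s ^^ i"])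
      then have "(s ^^ (j - i)) x = x" using pow_inj by metis
      then show False using least[of "j - i"] ij less_imp_diff_less[of j d i] by auto
    qed
  qed auto
  ultimately show ?thesis using that d(1) by blast
qed

lemma count_cyc_period:
  assumes d: "d > 0" "\<And>k. (s ^^ k) x = x \<longleftrightarrow> d dvd k" "inj_on (\<lambda>i. (s ^^ i) x) {..<d}"
  shows "cyc x (j * d) = repeat_mset j (mset_set ((\<lambda>i. (s ^^ i) x) ` {..<d}))"
proof (induction j)
  case (Suc j)
  have "{..<Suc j * d} = {..<j * d} \<union> (\<lambda>i. i + j * d) ` {..<d}"
  proof (intro equalityI subsetI)
    fix y assume y: "y \<in> {..<Suc j * d}"
    then show "y \<in> {..<j * d} \<union> (\<lambda>i. i + j * d) ` {..<d}"
      by (cases "y < j * d") (auto intro!: image_eqI[of _ _ "y - j * d"])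
  qed auto
  moreover have "{..<j * d} \<inter> (\<lambda>i. i + j * d) ` {..<d} = {}" by auto
  ultimately have "mset_set {..<Suc j * d} = mset_set {..<j * d} + mset_set ((\<lambda>i. i + j * d) ` {..<d})"
    by (simp only:) (intro mset_set_Union, auto)
  moreover have "mset_set ((\<lambda>i. i + j * d) ` {..<d}) = image_mset (\<lambda>i. i + j * d) (mset_set {..<d})"
    by (intro image_mset_mset_set[symmetric]) (auto simp: inj_on_def)
  moreover have "(s ^^ (i + j * d)) x = (s ^^ i) x" for i
    using d(2)[of "j * d"] by (simp add: funpow_add)
  ultimately have "cyc x (Suc j * d) = cyc x (j * d) + image_mset (\<lambda>i. (s ^^ i) x) (mset_set {..<d})"
    by (simp add: cyc_def image_mset.compositionality comp_def)
  then show ?case using Suc by (simp add: image_mset_mset_set[OF d(3)])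
qed (simp add: cyc_def)

text \<open>With d the exact period of x, the admissible k are the multiples j * d, and j copies of
  the orbit fit into the stable multiset w precisely when j is at most the multiplicity of
  x.\<close>

lemma count_eq_card_cyc:
  assumes w: "w \<in> stable n" and x: "x \<in> T"
  shows "count w x = card {k \<in> {1..n}. x \<in> Fix k \<and> cyc x k \<subseteq># w}"
proof -
  obtain d where d: "d > 0" "\<And>k. (s ^^ k) x = x \<longleftrightarrow> d dvd k" "inj_on (\<lambda>i. (s ^^ i) x) {..<d}"
    using minimal_period[OF x] by blast
  have stw: "image_mset s w = w" "size w = n" using w by (auto simp: stable_def)
  have sub: "cyc x (j * d) \<subseteq># w \<longleftrightarrow> j \<le> count w x" for j
  proof
    assume "cyc x (j * d) \<subseteq># w"
    then have "count (cyc x (j * d)) x \<le> count w x" by (rule mset_subset_eq_count)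
    moreover have "x \<in> (\<lambda>i. (s ^^ i) x) ` {..<d}" using d(1) by (auto intro!: image_eqI[of _ _ 0])
    ultimately show "j \<le> count w x" unfolding count_cyc_period[OF d] by simp
  next
    assume j: "j \<le> count w x"
    show "cyc x (j * d) \<subseteq># w" unfolding count_cyc_period[OF d]
    proof (intro mset_subset_eqI)
      fix y show "count (repeat_mset j (mset_set ((\<lambda>i. (s ^^ i) x) ` {..<d}))) y \<le> count w y"
        using j count_pow[OF stw(1), of _ x] by (cases "y \<in> (\<lambda>i. (s ^^ i) x) ` {..<d}") auto
    qed
  qed
  have "{k \<in> {1..n}. x \<in> Fix k \<and> cyc x k \<subseteq># w} = (\<lambda>j. j * d) ` {1..count w x}"
  proof (intro equalityI subsetI)
    fix k assume k: "k \<in> {k \<in> {1..n}. x \<in> Fix k \<and> cyc x k \<subseteq># w}"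
    then obtain j where "k = j * d" using d(2) by (auto simp: Fix_def dvd_def mult.commute)
    then show "k \<in> (\<lambda>j. j * d) ` {1..count w x}" using k sub by (auto simp: Suc_le_eq)
  next
    fix k assume "k \<in> (\<lambda>j. j * d) ` {1..count w x}"
    then obtain j where "j \<in> {1..count w x}" "k = j * d" by blast
    then have j: "k = j * d" "j \<ge> 1" "j \<le> count w x" by auto
    then have "cyc x k \<subseteq># w" using sub by simp
    moreover have "x \<in> Fix k" using j d(2) x by (simp add: Fix_def)
    moreover have "k \<le> n" using size_mset_mono[OF \<open>cyc x k \<subseteq># w\<close>] stw by (simp add: cyc_def)
    ultimately show "k \<in> {k \<in> {1..n}. x \<in> Fix k \<and> cyc x k \<subseteq># w}" using j d(1) by (auto simp: Suc_le_eq)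
  qed
  moreover have "card ((\<lambda>j. j * d) ` {1..count w x}) = count w x"
    using d(1) by (subst card_image) (auto simp: inj_on_def)
  ultimately show ?thesis by simp
qed

lemma stable_support:
  assumes w: "w \<in> stable n" and x: "x \<in># w" shows "x \<in> (\<Union>k\<in>{1..n}. Fix k)"
proof -
  have "x \<in> T" using w x by (auto simp: stable_def)
  then have "card {k \<in> {1..n}. x \<in> Fix k \<and> cyc x k \<subseteq># w} \<noteq> 0"
    using count_eq_card_cyc[OF w] x by (metis not_in_iff)
  then have "{k \<in> {1..n}. x \<in> Fix k \<and> cyc x k \<subseteq># w} \<noteq> {}" by (metis card.empty)
  then show ?thesis by blast
qed

lemma finite_Fix': "k > 0 \<Longrightarrow> finite (Fix k)" using finite_Fix by (simp add: Fix_def)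

lemma finite_stable: "finite (stable n)"
proof (rule finite_subset)
  let ?F = "\<Union>k\<in>{1..n}. Fix k"
  show "stable n \<subseteq> mset ` {xs. set xs \<subseteq> ?F \<and> length xs = n}"
  proof
    fix w assume w: "w \<in> stable n"
    obtain xs where xs: "w = mset xs" using ex_mset by metis
    then have "set xs \<subseteq> ?F" using stable_support[OF w] by auto
    moreover have "length xs = n" using w xs by (auto simp: stable_def)
    ultimately show "w \<in> mset ` {xs. set xs \<subseteq> ?F \<and> length xs = n}" using xs by blast
  qed
  have "finite ?F" using finite_Fix' by auto
  then show "finite (mset ` {xs. set xs \<subseteq> ?F \<and> length xs = n})"
    by (intro finite_imageI finite_lists_length_eq)
qed

text \<open>Double counting of triples (w, x, k) with \<open>cyc x k\<close> contained in w: for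
  fixed w there are n of them by \<open>count_eq_card_cyc\<close>, and for fixed x and k removing
  \<open>cyc x k\<close> leaves an arbitrary stable multiset of size n - k. This is the coefficient
  form of the logarithmic derivative.\<close>

lemma stable_recurrence: "n * card (stable n) = (\<Sum>k=1..n. card (Fix k) * card (stable (n - k)))"
proof -
  let ?F = "\<Union>k\<in>{1..n}. Fix k"
  have finF: "finite ?F" using finite_Fix' by auto
  have FT: "x \<in> T" if "x \<in> ?F" for x using that by (auto simp: Fix_def)
  have "n * card (stable n) = (\<Sum>w\<in>stable n. size w)" by (simp add: stable_def)
  also have "\<dots> = (\<Sum>w\<in>stable n. \<Sum>x\<in>?F. count w x)"
    using stable_support finF by (intro sum.cong refl) (auto simp: size_multiset_overloaded_eq not_in_iff intro!: sum.mono_neutral_left)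
  also have "\<dots> = (\<Sum>w\<in>stable n. \<Sum>x\<in>?F. \<Sum>k=1..n. if x \<in> Fix k \<and> cyc x k \<subseteq># w then 1 else 0)"
    using FT by (intro sum.cong refl) (simp add: count_eq_card_cyc sum.If_cases Int_def)
  also have "\<dots> = (\<Sum>k=1..n. \<Sum>x\<in>?F. \<Sum>w\<in>stable n. if x \<in> Fix k \<and> cyc x k \<subseteq># w then 1 else 0)"
    by (subst sum.swap, subst (2) sum.swap, subst sum.swap) (rule refl)
  also have "\<dots> = (\<Sum>k=1..n. \<Sum>x\<in>?F. if x \<in> Fix k then card (stable (n - k)) else 0)"
  proof (intro sum.cong refl)
    fix k x assume k: "k \<in> {1..n}" and x: "x \<in> ?F"
    show "(\<Sum>w\<in>stable n. if x \<in> Fix k \<and> cyc x k \<subseteq># w then 1 else 0) = (if x \<in> Fix k then card (stable (n - k)) else 0)"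
    proof (cases "x \<in> Fix k")
      case True
      then show ?thesis using card_stable_containing[OF stable_cyc[OF True], of n] k finite_stable
        by (simp add: sum.If_cases Int_def)
    qed simp
  qed
  also have "\<dots> = (\<Sum>k=1..n. card (Fix k) * card (stable (n - k)))"
  proof (intro sum.cong refl)
    fix k assume k: "k \<in> {1..n}"
    then have "?F \<inter> {x. x \<in> Fix k} = Fix k" by auto
    then show "(\<Sum>x\<in>?F. if x \<in> Fix k then card (stable (n - k)) else 0) = card (Fix k) * card (stable (n - k))"
      using finF by (simp add: sum.If_cases)
  qed
  finally show ?thesis .
qed

definition stable_fps :: "rat fps" where "stable_fps = Abs_fps (\<lambda>n. of_nat (card (stable n)))"
definition fix_fps :: "rat fps" where "fix_fps = Abs_fps (\<lambda>n. if n = 0 then 0 else of_nat (card (Fix n)))"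

lemma stable_fps_deriv: "fps_X * fps_deriv stable_fps = fix_fps * stable_fps"
proof (rule fps_ext)
  fix n
  have "fps_nth (fix_fps * stable_fps) n = (\<Sum>i=0..n. fps_nth fix_fps i * fps_nth stable_fps (n - i))"
    by (simp add: fps_mult_nth)
  also have "\<dots> = (\<Sum>i=1..n. of_nat (card (Fix i)) * of_nat (card (stable (n - i))))"
    by (intro sum.mono_neutral_cong_right) (auto simp: fix_fps_def stable_fps_def)
  also have "\<dots> = of_nat (n * card (stable n))" unfolding stable_recurrence by simp
  also have "\<dots> = fps_nth (fps_X * fps_deriv stable_fps) n"
    by (cases n) (auto simp: stable_fps_def algebra_simps)
  finally show "fps_nth (fps_X * fps_deriv stable_fps) n = fps_nth (fix_fps * stable_fps) n" by simp
qed

lemma stable_0: "stable 0 = {{#}}" by (auto simp: stable_def)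

end

section \<open>Types of isotropic subspaces and the product identity\<close>

context periodic_map
begin

lemma periodic_square: "periodic_map T (s \<circ> s)"
proof
  show "x = y" if "(s \<circ> s) x = (s \<circ> s) y" for x y using that by (auto dest!: s_inj)
  show "(s \<circ> s) x \<in> T" if "x \<in> T" for x using that s_T by simp
  have pow: "((s \<circ> s) ^^ k) = s ^^ (2 * k)" for k
    by (induction k) (auto simp: fun_eq_iff)
  show "\<exists>m>0. ((s \<circ> s) ^^ m) x = x" if x: "x \<in> T" for x
  proof -
    obtain m where m: "m > 0" "(s ^^ m) x = x" using s_period[OF x] by blast
    then have "(s ^^ (2 * m)) x = x" by (simp add: mult_2 funpow_add)
    then show ?thesis using m(1) pow by metis
  qed
  show "finite {x \<in> T. ((s \<circ> s) ^^ k) x = x}" if "k > 0" for k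
    using finite_Fix[of "2 * k"] that by (simp add: pow)
qed

interpretation sq: periodic_map T "s \<circ> s" by (rule periodic_square)

lemma sq_Fix: "sq.Fix k = Fix (2 * k)"
proof -
  have pow: "((s \<circ> s) ^^ k) = s ^^ (2 * k)" for k
    by (induction k) (auto simp: fun_eq_iff)
  show ?thesis by (simp add: sq.Fix_def Fix_def pow)
qed

text \<open>The summand \<open>image_mset s f\<close> accounts for vectors dual to a subspace of
  type f; both must fit into w with multiplicities, even where they share characters.\<close>

definition isotypes :: "'c multiset \<Rightarrow> 'c multiset set" where
  "isotypes w = {f. f \<noteq> {#} \<and> image_mset (s \<circ> s) f = f \<and> f + image_mset s f \<subseteq># w}"

definition wt :: "'c multiset \<Rightarrow> int" where "wt w = esum (\<subseteq>#) (isotypes w)"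

lemma finite_subset_mset: "finite {f. f \<subseteq># (w :: 'c multiset)}"
proof (rule finite_subset)
  show "{f. f \<subseteq># w} \<subseteq> mset ` {xs. set xs \<subseteq> set_mset w \<and> length xs \<le> size w}"
  proof
    fix f assume f: "f \<in> {f. f \<subseteq># w}"
    obtain xs where xs: "f = mset xs" using ex_mset by metis
    have "set xs \<subseteq> set_mset w" using f xs by (auto dest: mset_subset_eqD)
    moreover have "length xs \<le> size w" using f xs size_mset_mono by fastforce
    ultimately show "f \<in> mset ` {xs. set xs \<subseteq> set_mset w \<and> length xs \<le> size w}" using xs by blast
  qed
  show "finite (mset ` {xs. set xs \<subseteq> set_mset w \<and> length xs \<le> size w})"
    by (intro finite_imageI finite_lists_length_le) simp
qed

lemma finite_isotypes: "finite (isotypes w)"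
  by (rule finite_subset[OF _ finite_subset_mset[of w]])
    (auto simp: isotypes_def intro: subset_mset.order_trans[OF mset_subset_eq_add_left])

text \<open>The counterpart for types of passing from an isotropic subspace U to the quotient of its
  orthogonal complement by U: types strictly above f correspond to types in w with f and its dual
  removed.\<close>

lemma isotypes_shift:
  assumes f: "image_mset (s \<circ> s) f = f" "f + image_mset s f \<subseteq># w"
  shows "(\<lambda>g. g + f) ` isotypes (w - (f + image_mset s f)) = {g \<in> isotypes w. f \<subset># g}"
proof (intro equalityI subsetI)
  fix g' assume "g' \<in> (\<lambda>g. g + f) ` isotypes (w - (f + image_mset s f))"
  then obtain g where g: "g' = g + f" "g \<in> isotypes (w - (f + image_mset s f))" by blast
  have "(g + image_mset s g) + (f + image_mset s f) \<subseteq># w"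
    using g(2) f(2) by (simp add: isotypes_def subset_mset.le_diff_conv2)
  then have "g' + image_mset s g' \<subseteq># w" using g(1) by (simp add: ac_simps)
  moreover have "f \<subset># g'" using g by (auto simp: isotypes_def subset_mset_def)
  ultimately show "g' \<in> {g \<in> isotypes w. f \<subset># g}"
    using g f by (auto simp: isotypes_def comp_def)
next
  fix g assume g: "g \<in> {g \<in> isotypes w. f \<subset># g}"
  then obtain k where k: "g = k + f" "k \<noteq> {#}" by (metis (no_types, lifting) mem_Collect_eq subset_mset.less_imp_le subset_mset.le_iff_add subset_mset.less_irrefl add.commute add_0)
  have "image_mset (s \<circ> s) k + f = k + f" using g k f by (simp add: isotypes_def)
  then have "image_mset (s \<circ> s) k = k" by simp
  moreover have "(k + image_mset s k) + (f + image_mset s f) \<subseteq># w"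
    using g k by (simp add: isotypes_def ac_simps)
  then have "k + image_mset s k \<subseteq># w - (f + image_mset s f)"
    using f(2) by (simp add: subset_mset.le_diff_conv2)
  ultimately show "g \<in> (\<lambda>g. g + f) ` isotypes (w - (f + image_mset s f))"
    using k by (auto simp: isotypes_def)
qed

lemma esum_image:
  assumes "inj_on m A" "\<And>x y. x \<in> A \<Longrightarrow> y \<in> A \<Longrightarrow> R (m x) (m y) \<longleftrightarrow> R' x y"
  shows "esum R (m ` A) = esum R' A"
proof -
  have "bij_betw ((`) m) {C. C \<subseteq> A \<and> Complete_Partial_Order.chain R' C} {C. C \<subseteq> m ` A \<and> Complete_Partial_Order.chain R C}"
  proof (rule bij_betw_imageI)
    show "inj_on ((`) m) {C. C \<subseteq> A \<and> Complete_Partial_Order.chain R' C}"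
    proof (rule inj_onI)
      fix C D assume "C \<in> {C. C \<subseteq> A \<and> Complete_Partial_Order.chain R' C}"
        "D \<in> {C. C \<subseteq> A \<and> Complete_Partial_Order.chain R' C}" "m ` C = m ` D"
      then show "C = D" using inj_on_image_eq_iff[OF assms(1), of C D] by auto
    qed
    show "(`) m ` {C. C \<subseteq> A \<and> Complete_Partial_Order.chain R' C} = {C. C \<subseteq> m ` A \<and> Complete_Partial_Order.chain R C}"
    proof (intro equalityI subsetI)
      fix C assume "C \<in> {C. C \<subseteq> m ` A \<and> Complete_Partial_Order.chain R C}"
      then obtain C' where C': "C' \<subseteq> A" "C = m ` C'" "Complete_Partial_Order.chain R C" by (auto simp: subset_image_iff)
      then have "Complete_Partial_Order.chain R' C'" using assms(2) unfolding Complete_Partial_Order.chain_def by blast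
      then show "C \<in> (`) m ` {C. C \<subseteq> A \<and> Complete_Partial_Order.chain R' C}" using C' by blast
    next
      fix C assume "C \<in> (`) m ` {C. C \<subseteq> A \<and> Complete_Partial_Order.chain R' C}"
      then show "C \<in> {C. C \<subseteq> m ` A \<and> Complete_Partial_Order.chain R C}"
        using assms(2) unfolding Complete_Partial_Order.chain_def by blast
    qed
  qed
  then have "esum R (m ` A) = (\<Sum>C\<in>{C. C \<subseteq> A \<and> Complete_Partial_Order.chain R' C}. (-1) ^ card (m ` C))"
    unfolding esum_def by (rule sum.reindex_bij_betw[symmetric])
  also have "\<dots> = esum R' A"
    unfolding esum_def by (intro sum.cong refl) (use assms(1) in \<open>auto simp: card_image inj_on_subset\<close>)
  finally show ?thesis .
qed

lemma wt_shift:
  assumes "image_mset (s \<circ> s) f = f" "f + image_mset s f \<subseteq># w"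
  shows "wt (w - (f + image_mset s f)) = esum (\<subseteq>#) {g \<in> isotypes w. f \<subset># g}"
  unfolding isotypes_shift[OF assms, symmetric] wt_def
  by (rule esum_image[symmetric]) auto

text \<open>A nonempty chain is its least element together with a chain strictly above it, which
  flips the sign. So the left side is minus the signed count of nonempty chains, and the count of
  all chains vanishes because of the bottom element; the empty chain leaves 1.\<close>

lemma sum_upper_esum:
  assumes fin: "finite (A :: 'c multiset set)" and bot: "{#} \<in> A"
  shows "(\<Sum>f\<in>A. esum (\<subseteq>#) {g \<in> A. f \<subset># g}) = 1"
proof -
  define S where "S = {C. C \<subseteq> A \<and> Complete_Partial_Order.chain (\<subseteq>#) C}"
  have finS: "finite S" unfolding S_def by (rule finite_chains[OF fin])
  define S' where "S' = Sigma A (\<lambda>f. {C. C \<subseteq> {g \<in> A. f \<subset># g} \<and> Complete_Partial_Order.chain (\<subseteq>#) C})"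
  have "(\<Sum>f\<in>A. esum (\<subseteq>#) {g \<in> A. f \<subset># g}) = (\<Sum>(f, C)\<in>S'. (-1) ^ card C)"
    unfolding esum_def S'_def by (rule sum.Sigma) (use fin in \<open>auto intro: finite_chains\<close>)
  also have "\<dots> = (\<Sum>x\<in>S'. - ((-1) ^ card (case x of (f, C) \<Rightarrow> insert f C)))"
  proof (intro sum.cong refl)
    fix x assume xS: "x \<in> S'"
    obtain f C where x: "x = (f, C)" by (cases x)
    have "f \<notin> C" "finite C" using xS x fin by (auto simp: S'_def intro: finite_subset)
    then show "(case x of (f, C) \<Rightarrow> (-1) ^ card C) = - ((-1) ^ card (case x of (f, C) \<Rightarrow> insert f C) :: int)"
      by (simp add: x)
  qed
  also have "\<dots> = (\<Sum>C\<in>S - {{}}. - ((-1) ^ card C))"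
  proof (rule sum.reindex_bij_betw)
    show "bij_betw (\<lambda>(f, C). insert f C) S' (S - {{}})"
    proof (rule bij_betw_imageI)
      show "inj_on (\<lambda>(f, C). insert f C) S'"
      proof (rule inj_onI, clarsimp)
        fix f C g D assume a: "(f, C) \<in> S'" "(g, D) \<in> S'" "insert f C = insert g D"
        have C: "\<And>x. x \<in> C \<Longrightarrow> f \<subset># x" and D: "\<And>x. x \<in> D \<Longrightarrow> g \<subset># x" using a by (auto simp: S'_def)
        have "f = g" using C D a(3) by (metis insert_iff subset_mset.less_asym)
        moreover have "f \<notin> C" "g \<notin> D" using C D by blast+
        ultimately show "f = g \<and> C = D" using a(3) by (metis insert_ident)
      qed
      show "(\<lambda>(f, C). insert f C) ` S' = S - {{}}"
      proof (intro equalityI subsetI)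
        fix E assume "E \<in> (\<lambda>(f, C). insert f C) ` S'"
        then show "E \<in> S - {{}}"
          by (auto simp: S'_def S_def Complete_Partial_Order.chain_def dest: subset_mset.less_imp_le)
      next
        fix E assume E: "E \<in> S - {{}}"
        then have "finite E" using fin by (auto simp: S_def intro: finite_subset)
        have "E \<noteq> {}" "Complete_Partial_Order.chain (\<subseteq>#) E" using E by (auto simp: S_def)
        then have "\<exists>x\<in>E. \<forall>y\<in>E. x \<subseteq># y"
          using chain_least[OF \<open>finite E\<close>, of "(\<subseteq>#)"] subset_mset.order_trans by blast
        then obtain f where f: "f \<in> E" "\<forall>y\<in>E. f \<subseteq># y" by blast
        have "(f, E - {f}) \<in> S'"
          using E f by (auto simp: S'_def S_def Complete_Partial_Order.chain_def subset_mset.less_le)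
        then show "E \<in> (\<lambda>(f, C). insert f C) ` S'" using f(1) by (intro image_eqI[of _ _ "(f, E - {f})"]) auto
      qed
    qed
  qed
  also have "\<dots> = - (esum (\<subseteq>#) A - 1)"
    unfolding esum_def S_def[symmetric] using finS by (simp add: sum_negf sum_diff1 S_def Complete_Partial_Order.chain_def)
  also have "esum (\<subseteq>#) A = 0" by (rule esum_cone[OF fin bot]) simp
  finally show ?thesis by simp
qed

lemma sum_wt_shift: "(\<Sum>f\<in>insert {#} (isotypes w). wt (w - (f + image_mset s f))) = 1"
proof -
  have fin: "finite (insert {#} (isotypes w))" using finite_isotypes by simp
  have "(\<Sum>f\<in>insert {#} (isotypes w). wt (w - (f + image_mset s f))) =
      (\<Sum>f\<in>insert {#} (isotypes w). esum (\<subseteq>#) {g \<in> insert {#} (isotypes w). f \<subset># g})"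
  proof (intro sum.cong refl)
    fix f assume "f \<in> insert {#} (isotypes w)"
    then have "image_mset (s \<circ> s) f = f" "f + image_mset s f \<subseteq># w" by (auto simp: isotypes_def)
    moreover have "{g \<in> insert {#} (isotypes w). f \<subset># g} = {g \<in> isotypes w. f \<subset># g}" by auto
    ultimately show "wt (w - (f + image_mset s f)) = esum (\<subseteq>#) {g \<in> insert {#} (isotypes w). f \<subset># g}"
      using wt_shift by simp
  qed
  also have "\<dots> = 1" by (rule sum_upper_esum[OF fin]) simp
  finally show ?thesis .
qed

definition wt_sum :: "nat \<Rightarrow> int" where "wt_sum n = (\<Sum>w\<in>stable n. wt w)"

text \<open>Each stable w is counted once by \<open>sum_wt_shift\<close>; substituting w' for w with
  f and its image removed separates f, which ranges over multisets stable under the square of s,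
  from w'. The size of f enters twice, whence the argument x^2.\<close>

lemma stable_eq_wt_sum: "int (card (stable n)) = (\<Sum>d\<in>{d. 2 * d \<le> n}. int (card (sq.stable d)) * wt_sum (n - 2 * d))"
proof -
  define S1 where "S1 = Sigma (stable n) (\<lambda>w. insert {#} (isotypes w))"
  define S2 where "S2 = (\<Union>d\<in>{d. 2 * d \<le> n}. sq.stable d \<times> stable (n - 2 * d))"
  have fin2: "finite {d. 2 * d \<le> n}" by (rule finite_subset[of _ "{..n}"]) auto
  have "int (card (stable n)) = (\<Sum>w\<in>stable n. \<Sum>f\<in>insert {#} (isotypes w). wt (w - (f + image_mset s f)))"
    by (simp add: sum_wt_shift)
  also have "\<dots> = (\<Sum>(w, f)\<in>S1. wt (w - (f + image_mset s f)))"
    unfolding S1_def by (rule sum.Sigma) (use finite_stable finite_isotypes in auto)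
  also have "\<dots> = (\<Sum>(f, w')\<in>S2. wt w')"
  proof (rule sum.reindex_bij_witness[of _ "\<lambda>(f, w'). (w' + (f + image_mset s f), f)" "\<lambda>(w, f). (f, w - (f + image_mset s f))"]; clarsimp)
    fix w f assume wf: "(w, f) \<in> S1"
    then have w: "w \<in> stable n" and f: "image_mset (s \<circ> s) f = f" "f + image_mset s f \<subseteq># w"
      by (auto simp: S1_def isotypes_def)
    show "w - (f + image_mset s f) + (f + image_mset s f) = w" using f(2) by simp
    have st: "f + image_mset s f \<in> stable (2 * size f)"
    proof -
      have "image_mset s (f + image_mset s f) = f + image_mset s f"
        using f(1) by (simp add: multiset.map_comp add.commute)
      moreover have "set_mset (f + image_mset s f) \<subseteq> T"
        using w f(2) set_mset_mono by (fastforce simp: stable_def)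
      ultimately show ?thesis by (simp add: stable_def)
    qed
    have "2 * size f \<le> n" using size_mset_mono[OF f(2)] w by (simp add: stable_def)
    moreover have "f \<in> sq.stable (size f)" using f(1) st by (auto simp: sq.stable_def stable_def)
    moreover have "w - (f + image_mset s f) \<in> stable (n - 2 * size f)" using stable_diff[OF st w f(2)] .
    ultimately show "(f, w - (f + image_mset s f)) \<in> S2" by (auto simp: S2_def)
  next
    fix f w' assume "(f, w') \<in> S2"
    then obtain d where d: "2 * d \<le> n" "f \<in> sq.stable d" "w' \<in> stable (n - 2 * d)" by (auto simp: S2_def)
    have f: "image_mset (s \<circ> s) f = f" "set_mset f \<subseteq> T" "size f = d" using d(2) by (auto simp: sq.stable_def)
    have "f + image_mset s f \<in> stable (2 * d)"
      using f s_T by (auto simp: stable_def image_mset.compositionality)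
    from stable_add[OF d(3) this] have "w' + (f + image_mset s f) \<in> stable n" using d(1) by simp
    moreover have "f = {#} \<or> f \<in> isotypes (w' + (f + image_mset s f))" using f by (auto simp: isotypes_def)
    ultimately show "(w' + (f + image_mset s f), f) \<in> S1" by (auto simp: S1_def)
  qed
  also have "\<dots> = (\<Sum>d\<in>{d. 2 * d \<le> n}. \<Sum>(f, w')\<in>sq.stable d \<times> stable (n - 2 * d). wt w')"
    unfolding S2_def
  proof (rule sum.UNION_disjoint)
    show "finite {d. 2 * d \<le> n}" by (rule fin2)
    show "\<forall>i\<in>{d. 2 * d \<le> n}. finite (sq.stable i \<times> stable (n - 2 * i))" using finite_stable sq.finite_stable by auto
    show "\<forall>i\<in>{d. 2 * d \<le> n}. \<forall>j\<in>{d. 2 * d \<le> n}. i \<noteq> j \<longrightarrow> (sq.stable i \<times> stable (n - 2 * i)) \<inter> (sq.stable j \<times> stable (n - 2 * j)) = {}"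
      by (auto simp: sq.stable_def)
  qed
  also have "\<dots> = (\<Sum>d\<in>{d. 2 * d \<le> n}. int (card (sq.stable d)) * wt_sum (n - 2 * d))"
    by (intro sum.cong refl) (simp add: sum.cartesian_product[symmetric] wt_sum_def)
  finally show ?thesis .
qed

theorem wt_sum_fps:
  "Abs_fps (\<lambda>n. of_int (wt_sum n)) = fps_exp 1 oo
     (- Abs_fps (\<lambda>n. if n = 0 then 0 else (-1) ^ n * of_nat (card (Fix n)) / of_nat n) :: rat fps)"
proof -
  define G where "G = (Abs_fps (\<lambda>n. of_int (wt_sum n)) :: rat fps)"
  define M2 where "M2 = sq.stable_fps oo (fps_X ^ 2)"
  define S2 where "S2 = sq.fix_fps oo (fps_X ^ 2)"
  define L where "L = (- Abs_fps (\<lambda>n. if n = 0 then 0 else (-1) ^ n * of_nat (card (Fix n)) / of_nat n) :: rat fps)"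
  have M2n: "fps_nth M2 n = (if even n then of_nat (card (sq.stable (n div 2))) else 0)" for n
    by (simp add: M2_def fps_nth_compose_X_power sq.stable_fps_def)
  have S2n: "fps_nth S2 n = (if even n \<and> n \<noteq> 0 then of_nat (card (Fix n)) else 0)" for n
    by (auto simp: S2_def fps_nth_compose_X_power sq.fix_fps_def sq_Fix)
  have H: "stable_fps = M2 * G"
  proof (rule fps_ext)
    fix n
    have "fps_nth (M2 * G) n = (\<Sum>i=0..n. fps_nth M2 i * of_int (wt_sum (n - i)))"
      by (simp add: fps_mult_nth G_def)
    also have "\<dots> = (\<Sum>d\<in>{d. 2 * d \<le> n}. of_nat (card (sq.stable d)) * of_int (wt_sum (n - 2 * d)))"
    proof -
      have "(\<Sum>i=0..n. fps_nth M2 i * of_int (wt_sum (n - i))) =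
          (\<Sum>i\<in>{i\<in>{0..n}. even i}. fps_nth M2 i * of_int (wt_sum (n - i)))"
        by (rule sum.mono_neutral_right) (auto simp: M2n)
      also have "\<dots> = (\<Sum>d\<in>{d. 2 * d \<le> n}. of_nat (card (sq.stable d)) * of_int (wt_sum (n - 2 * d)))"
        by (rule sum.reindex_bij_witness[of _ "\<lambda>d. 2 * d" "\<lambda>i. i div 2"]) (auto simp: M2n)
      finally show ?thesis .
    qed
    also have "\<dots> = of_int (int (card (stable n)))" unfolding stable_eq_wt_sum by simp
    finally show "fps_nth stable_fps n = fps_nth (M2 * G) n" by (simp add: stable_fps_def)
  qed
  have dM2: "fps_X * fps_deriv M2 = 2 * S2 * M2"
  proof -
    have "fps_X * fps_deriv M2 = 2 * ((fps_deriv sq.stable_fps oo fps_X ^ 2) * (fps_X ^ 2))"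
      by (simp add: M2_def fps_compose_deriv fps_deriv_power power2_eq_square)
    also have "(fps_deriv sq.stable_fps oo fps_X ^ 2) * (fps_X ^ 2) = (fps_X * fps_deriv sq.stable_fps) oo fps_X ^ 2"
      by (simp add: fps_compose_mult_distrib mult.commute)
    also have "\<dots> = S2 * M2"
      by (simp add: sq.stable_fps_deriv fps_compose_mult_distrib S2_def M2_def)
    finally show ?thesis by (simp add: mult.assoc)
  qed
  have M20: "fps_nth M2 0 = 1" by (simp add: M2n sq.stable_0)
  have G0: "fps_nth G 0 = 1"
    using arg_cong[OF H, of "\<lambda>f. fps_nth f 0"] M20 by (simp add: stable_fps_def stable_0)
  have "M2 * (fps_X * fps_deriv G) = M2 * ((fix_fps - 2 * S2) * G)"
  proof -
    have "fps_X * fps_deriv stable_fps = (fps_X * fps_deriv M2) * G + M2 * (fps_X * fps_deriv G)"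
      by (simp add: H algebra_simps)
    then have "fix_fps * (M2 * G) = 2 * S2 * M2 * G + M2 * (fps_X * fps_deriv G)"
      unfolding stable_fps_deriv dM2 by (simp add: H)
    then show ?thesis by (simp add: algebra_simps)
  qed
  moreover have "M2 \<noteq> 0" using M20 by auto
  ultimately have dG: "fps_X * fps_deriv G = (fix_fps - 2 * S2) * G" by simp
  have L0: "fps_nth L 0 = 0" by (simp add: L_def)
  \<comment> \<open>At odd n the right side is the number of fixed points of the n-th power, at even
    n it is that number minus twice itself: the sign is -(-1)^n.\<close>
  have dL: "fps_X * fps_deriv L = fix_fps - 2 * S2"
  proof (rule fps_ext)
    fix n
    have rhs: "fps_nth (fix_fps - 2 * S2) n = fps_nth fix_fps n - (fps_nth S2 n + fps_nth S2 n)"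
      by (simp only: mult_2 fps_sub_nth fps_add_nth)
    show "fps_nth (fps_X * fps_deriv L) n = fps_nth (fix_fps - 2 * S2) n"
    proof (cases n)
      case (Suc m)
      have "fps_nth (fps_X * fps_deriv L) n = of_nat n * fps_nth L n" by (simp add: Suc)
      then show ?thesis unfolding rhs by (auto simp: L_def fix_fps_def S2n Suc field_simps)
    qed (simp only: rhs, simp add: fix_fps_def S2n)
  qed
  have dE: "fps_X * fps_deriv (fps_exp 1 oo L) = (fix_fps - 2 * S2) * (fps_exp 1 oo L)"
    using dL by (simp add: fps_compose_deriv[OF L0] mult.left_commute mult.commute)
  have "fps_nth (fix_fps - 2 * S2) 0 = 0"
    by (simp only: mult_2 fps_sub_nth fps_add_nth) (simp add: fix_fps_def S2n)
  moreover have "fps_nth G 0 = fps_nth (fps_exp 1 oo L) 0" using G0 by simp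
  ultimately have "G = fps_exp 1 oo L" by (intro fps_log_deriv_unique[OF dG dE])
  then show ?thesis unfolding G_def L_def .
qed

end

section \<open>Descent and conjugacy classification\<close>

context herm_space
begin

text \<open>Galois descent: averaging over the powers of \<open>phi\<close> turns coefficients into fixed scalars.\<close>
lemma span_fixed:
  assumes U: "U \<subseteq> V" "0 \<in> U" "\<And>u. u \<in> U \<Longrightarrow> phi u = u" "\<And>u v. u \<in> U \<Longrightarrow> v \<in> U \<Longrightarrow> u + v \<in> U"
      "\<And>c u. u \<in> U \<Longrightarrow> c ^ (q\<^sup>2) = c \<Longrightarrow> c *s u \<in> U"
    and x: "x \<in> span U" "phi x = x"
  shows "x \<in> U"
proof -
  obtain S r where S: "finite S" "S \<subseteq> U" "x = (\<Sum>u\<in>S. r u *s u)"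
    using x(1) unfolding span_explicit by blast
  obtain N where N: "N > 0" "\<forall>z\<in>r ` S. z ^ (q ^ (2 * N)) = z"
    using exists_common_period[of "r ` S"] S(1) by auto
  \<comment> \<open>A scalar of nonzero trace: averaging \<open>c *s x\<close> gives
    \<open>tr c *s x\<close> as a combination with fixed coefficients, and \<open>tr c\<close> is
    itself fixed and can be divided out.\<close>
  obtain c :: 'b where c0: "c ^ (q ^ (2 * N)) = c" "(\<Sum>i<N. 1 * c ^ (q ^ (2 * i))) \<noteq> 0"
    by (rule exists_trace_functional[of 2 N "\<lambda>_. 1"]) (use N in auto)
  define tr where "tr z = (\<Sum>i<N. z ^ (q ^ (2 * i)))" for z :: 'b
  have c: "tr c \<noteq> 0" using c0(2) by (simp add: tr_def)
  have tr_fixed: "tr z ^ (q\<^sup>2) = tr z" if "z ^ (q ^ (2 * N)) = z" for z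
  proof -
    have "tr z ^ (q\<^sup>2) = (\<Sum>i<N. z ^ (q ^ (2 * Suc i)))"
      unfolding tr_def frob_pow_sum frob_pow_pow by (simp add: add.commute)
    also have "\<dots> = (\<Sum>i<Suc N. z ^ (q ^ (2 * i))) - z"
      by (subst sum.lessThan_Suc_shift) simp
    finally show ?thesis using that by (simp add: tr_def)
  qed
  have fx: "(phi ^^ i) u = u" if "phi u = u" for i u using that by (induction i) auto
  have "tr c *s x = (\<Sum>i<N. (phi ^^ i) (c *s x))"
    by (simp add: tr_def phi_pow_scale fx[OF x(2)] scale_sum_left)
  also have "\<dots> = (\<Sum>u\<in>S. \<Sum>i<N. (phi ^^ i) ((c * r u) *s u))"
    unfolding S(3) scale_sum_right phi_pow_sum scale_scale by (rule sum.swap)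
  also have "\<dots> = (\<Sum>u\<in>S. tr (c * r u) *s u)"
    using S(2) U(3) fx by (intro sum.cong refl) (auto simp: tr_def phi_pow_scale scale_sum_left)
  finally have tx: "tr c *s x = (\<Sum>u\<in>S. tr (c * r u) *s u)" .
  have U_sum: "(\<Sum>u\<in>F. f u) \<in> U" if "\<And>u. u \<in> F \<Longrightarrow> f u \<in> U" for f and F :: "'v set"
    using that by (induction F rule: infinite_finite_induct) (auto simp: U(2,4))
  have "(\<Sum>u\<in>S. tr (c * r u) *s u) \<in> U"
  proof (rule U_sum)
    fix u assume u: "u \<in> S"
    have "(c * r u) ^ (q ^ (2 * N)) = c * r u" using N(2) u c0(1) by (simp add: power_mult_distrib)
    then show "tr (c * r u) *s u \<in> U" using U(5) tr_fixed u S(2) by blast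
  qed
  then have "inverse (tr c) *s (tr c *s x) \<in> U"
    unfolding tx using tr_fixed[OF c0(1)] by (intro U(5)) (auto simp: power_inverse)
  then show ?thesis using c by simp
qed

text \<open>Otherwise a coordinate functional vanishes on all fixed vectors of W but not on some u
  in W, and \<open>fixed_vector\<close> produces a fixed vector on which it is nonzero.\<close>

lemma stab_eq_span_fixed:
  assumes W: "stab \<rho> W"
  shows "W = span {w \<in> W. phi w = w}"
proof
  have subW: "subspace W" "W \<subseteq> V" "\<And>w. w \<in> W \<Longrightarrow> (phi ^^ 1) w \<in> W" using W by (auto simp: stab_def)
  show "span {w \<in> W. phi w = w} \<subseteq> W" by (rule span_minimal[OF _ subW(1)]) auto
  show "W \<subseteq> span {w \<in> W. phi w = w}"
  proof (rule ccontr)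
    assume "\<not> W \<subseteq> span {w \<in> W. phi w = w}"
    then obtain u where u: "u \<in> W" "u \<notin> span {w \<in> W. phi w = w}" by blast
    obtain C where C: "C \<subseteq> {w \<in> W. phi w = w}" "independent C" "{w \<in> W. phi w = w} \<subseteq> span C"
      by (rule basis_exists[of "{w \<in> W. phi w = w}"])
    have "span C = span {w \<in> W. phi w = w}"
      using span_mono[OF C(1)] span_minimal[OF C(3) subspace_span] by blast
    then have "u \<notin> span C" using u(2) by simp
    then have ind: "independent (insert u C)" using C(2) by (rule independent_insertI)
    define E where "E = extend_basis (insert u C)"
    have E: "independent E" "span E = UNIV" "insert u C \<subseteq> E"
      using independent_extend_basis[OF ind] span_extend_basis[OF ind] extend_basis_superset[OF ind]
      by (auto simp: E_def)
    define l where "l v = representation E v u" for v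
    have l: "l (x + y) = l x + l y" "l (c *s x) = c * l x" for x y c
      using representation_add[OF E(1), of y x] representation_scale[OF E(1), of x c] E(2) by (auto simp: l_def)
    have lu: "l u = 1" using representation_basis[OF E(1), of u] E(3) by (simp add: l_def)
    obtain u' where u': "u' \<in> W" "(phi ^^ 1) u' = u'" "l u' \<noteq> 0"
      using fixed_vector[of 1 W l u] subW l u(1) lu by auto
    have "u' \<in> span C" using u'(1,2) C(3) by auto
    moreover have "l x = 0" if "x \<in> span C" for x
    proof -
      have "subspace {x. l x = 0}" using l(2)[of 0 0] by (auto simp: subspace_def l)
      moreover have "C \<subseteq> {x. l x = 0}"
      proof
        fix x assume "x \<in> C"
        moreover have "x \<noteq> u" using u(2) \<open>x \<in> C\<close> C(1) span_base by blast
        ultimately show "x \<in> {x. l x = 0}" using representation_basis[OF E(1), of x] E(3) by (auto simp: l_def)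
      qed
      ultimately show ?thesis using span_minimal that by blast
    qed
    ultimately show False using u'(3) by blast
  qed
qed

lemma dim_strict_mono:
  assumes "subspace W" "W \<subset> W'" "W' \<subseteq> V"
  shows "dim W < dim W'"
proof -
  obtain x where x: "x \<in> W'" "x \<notin> W" using assms(2) by blast
  obtain C where C: "C \<subseteq> W" "independent C" "W \<subseteq> span C" "card C = dim W" using basis_exists by blast
  obtain C' where C': "C' \<subseteq> W'" "independent C'" "W' \<subseteq> span C'" "card C' = dim W'" using basis_exists by blast
  have "span C = W" using C(1,3) assms(1) span_minimal by blast
  then have nx: "x \<notin> span C" using x(2) by simp
  have ind: "independent (insert x C)" using independent_insertI[OF nx C(2)] .
  have "finite C'" using independent_span_bound[OF finite_B C'(2)] C'(1) assms(3) span_B by auto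
  then have "finite (insert x C) \<and> card (insert x C) \<le> card C'"
  proof (rule independent_span_bound[OF _ ind])
    show "insert x C \<subseteq> span C'" using x(1) C(1) C'(3) assms(2) by auto
  qed
  moreover have "x \<notin> C" using nx span_base by blast
  ultimately show ?thesis using C(4) C'(4) by auto
qed

text \<open>Meaningful when the dimensions vanish for almost all characters; for spans of parts of
  an eigenbasis this is shown together with the value in \<open>ityp_span\<close>.\<close>

definition ityp :: "('v \<Rightarrow> 'v) list \<Rightarrow> 'v set \<Rightarrow> 'b list multiset" where
  "ityp \<rho> W = Abs_multiset (\<lambda>\<chi>. dim (Eig \<rho> \<chi> \<inter> W))"

definition ichain :: "('v \<Rightarrow> 'v) list \<Rightarrow> 'v set set \<Rightarrow> bool" where
  "ichain \<rho> K \<longleftrightarrow> finite K \<and> (\<forall>W\<in>K. stab \<rho> W \<and> (\<forall>x\<in>W. \<forall>y\<in>W. h x y = 0)) \<and>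
     (\<forall>W\<in>K. \<forall>W'\<in>K. W \<subseteq> W' \<or> W' \<subseteq> W)"

definition eigsys :: "('v \<Rightarrow> 'v) list \<Rightarrow> (nat \<Rightarrow> nat) \<Rightarrow> (nat \<Rightarrow> 'b list) \<Rightarrow> (nat \<Rightarrow> 'v) \<Rightarrow> bool" where
  "eigsys \<rho> s \<chi> e \<longleftrightarrow> sys \<rho> {} (\<lambda>_. {}) (card B) s \<chi> (\<lambda>_. {}) e"

lemma dim_Nil [simp]: "dim {} = 0"
  using dim_le_card[of "{}" "{}"] by simp

context
  fixes \<rho> s \<chi> e
  assumes rep: "rep \<rho>" and es: "eigsys \<rho> s \<chi> e"
begin

lemmas es_sys = es[unfolded eigsys_def]
lemmas es_simps = sysD(1-4,7)[OF rep es_sys] sys_V[OF rep es_sys] sys_sg[OF rep es_sys]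

lemma es_full: "perp (card B) e = {0}"
  using sys_full_iff[OF rep es_sys] by simp

lemma h_span_sys:
  assumes "A \<subseteq> {..<card B}" "u \<in> span (e ` A)" "i < card B" "s i \<notin> A" shows "h u (e i) = 0"
proof -
  have "subspace {u. h u (e i) = 0}" unfolding subspace_def by (auto simp: h_add_left h_scale_left)
  moreover have "e ` A \<subseteq> {u. h u (e i) = 0}"
  proof clarsimp
    fix j assume j: "j \<in> A"
    then obtain k where k: "k < card B" "s k = j" using sys_preimage[OF rep es_sys] assms(1) by blast
    then show "h (e j) (e i) = 0" using es_simps(4)[OF k(1) assms(3)] assms(4) j by auto
  qed
  ultimately show ?thesis using span_minimal assms(2) by blast
qed

lemma dim_Eig_span:
  assumes A: "A \<subseteq> {..<card B}"
  shows "dim (Eig \<rho> \<psi> \<inter> span (e ` A)) = card {i \<in> A. \<chi> i = \<psi>}"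
proof (cases "length \<psi> = length \<rho>")
  case False
  then have "Eig \<rho> \<psi> = {}" by (auto simp: Eig_def)
  moreover have "{i \<in> A. \<chi> i = \<psi>} = {}"
    using False es_simps(2) A by (auto simp: Eig_def)
  ultimately show ?thesis by (simp only: Int_empty_left dim_Nil card.empty)
next
  case True
  have "subspace (Eig \<rho> \<psi>)" using subspace_Eig[OF True] rep by (auto simp: rep_def)
  then have 1: "subspace (Eig \<rho> \<psi> \<inter> span (e ` A))" by (intro subspace_inter subspace_span)
  have 2: "h u (e i) = 0" if u: "u \<in> Eig \<rho> \<psi> \<inter> span (e ` A)" "i < card B" "s i \<notin> {i \<in> A. \<chi> i = \<psi>}" for u i
  proof (cases "s i \<in> A")
    case True
    then have "sg (\<chi> i) \<noteq> \<psi>" using u(2,3) es_simps(7) by auto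
    then show ?thesis using h_Eig[OF rep _ es_simps(2)[OF u(2)], of u \<psi>] u by blast
  next
    case False then show ?thesis using h_span_sys[OF A] u by blast
  qed
  have 3: "e i \<in> Eig \<rho> \<psi> \<inter> span (e ` A)" if "i \<in> {i \<in> A. \<chi> i = \<psi>}" for i
    using that es_simps(2) A by (auto intro: span_base)
  have 4: "{i \<in> A. \<chi> i = \<psi>} \<subseteq> {..<card B}" "Eig \<rho> \<psi> \<inter> span (e ` A) \<subseteq> V" using A by (auto simp: Eig_def)
  show ?thesis
    using dim_sys(2)[OF rep es_sys 1 4(2,1) 3 2] es_full by blast
qed

lemma count_image_index: "finite A \<Longrightarrow> count (image_mset \<chi> (mset_set A)) \<psi> = card {i \<in> A. \<chi> i = \<psi>}"
proof (induction A rule: finite_induct)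
  case (insert x A)
  then have "{i \<in> insert x A. \<chi> i = \<psi>} = (if \<chi> x = \<psi> then insert x {i \<in> A. \<chi> i = \<psi>} else {i \<in> A. \<chi> i = \<psi>})"
    by auto
  then show ?case using insert by simp
qed simp

lemma ityp_span:
  assumes A: "A \<subseteq> {..<card B}"
  shows "ityp \<rho> (span (e ` A)) = image_mset \<chi> (mset_set A)"
proof -
  have "finite A" using A finite_subset by blast
  then have "(\<lambda>\<psi>. dim (Eig \<rho> \<psi> \<inter> span (e ` A))) = count (image_mset \<chi> (mset_set A))"
    by (intro ext) (simp add: dim_Eig_span[OF A] count_image_index)
  then show ?thesis by (simp add: ityp_def count_inverse)
qed

lemma span_es: "span (e ` {..<card B}) = V"
proof
  show "span (e ` {..<card B}) \<subseteq> V" by (rule span_minimal[OF _ subspace_V]) (use es_simps(6) in auto)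
  show "V \<subseteq> span (e ` {..<card B})"
    using es_full es_simps by (intro dim_sys(3)[OF rep es_sys subspace_V]) auto
qed

lemma ityp_V: "ityp \<rho> V = image_mset \<chi> (mset_set {..<card B})"
  using ityp_span[of "{..<card B}"] span_es by simp

lemma dim_span_sys: "A \<subseteq> {..<card B} \<Longrightarrow> dim (span (e ` A)) = card A"
  using dim_span_eq_card_independent[OF independent_sys[OF rep es_sys]] inj_on_sys[OF rep es_sys]
  by (metis card_image inj_on_subset)

end

text \<open>Dimension is strictly increasing along the chain, so it serves as the numerical
  index.\<close>

lemma flag_of_ichain:
  assumes K: "ichain \<rho> K"
  shows "flag \<rho> (dim ` K) (inv_into K dim)" "inj_on dim K"
proof -
  have st: "W \<in> K \<Longrightarrow> subspace W \<and> W \<subseteq> V" for W using K by (auto simp: ichain_def stab_def)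
  have mono: "dim W < dim W'" if "W \<in> K" "W' \<in> K" "W \<subset> W'" for W W'
    using dim_strict_mono st that by blast
  show inj: "inj_on dim K"
  proof (rule inj_onI)
    fix W W' assume a: "W \<in> K" "W' \<in> K" "dim W = dim W'"
    then have "W \<subseteq> W' \<or> W' \<subseteq> W" using K by (auto simp: ichain_def)
    then show "W = W'" using mono[of W W'] mono[of W' W] a by force
  qed
  have "W \<subseteq> W'" if "W \<in> K" "W' \<in> K" "dim W \<le> dim W'" for W W'
  proof -
    have "W \<subseteq> W' \<or> W' \<subseteq> W" using K that by (auto simp: ichain_def)
    then show ?thesis using mono[of W' W] that by force
  qed
  then show "flag \<rho> (dim ` K) (inv_into K dim)"
    using K inj unfolding flag_def ichain_def by (auto simp: inv_into_f_f)
qed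

lemma sys_adapted:
  assumes rep: "rep \<rho>" and s: "sys \<rho> D U N s \<chi> A e" "perp N e = {0}" and \<mu>: "\<mu> \<in> D" "stab \<rho> (U \<mu>)"
  shows "eigsys \<rho> s \<chi> e" "U \<mu> = span (e ` {i. i < card B \<and> i \<in> A \<mu>})"
proof -
  have N: "N = card B" using sys_full_iff[OF rep s(1)] s(2) by simp
  show "eigsys \<rho> s \<chi> e" using s(1) unfolding eigsys_def N sys_def by simp
  show "U \<mu> = span (e ` {i. i < card B \<and> i \<in> A \<mu>})"
  proof
    show "span (e ` {i. i < card B \<and> i \<in> A \<mu>}) \<subseteq> U \<mu>"
      using \<mu> sysD(5)[OF rep s(1) \<mu>(1)] N by (intro span_minimal) (auto simp: stab_def)
    show "U \<mu> \<subseteq> span (e ` {i. i < card B \<and> i \<in> A \<mu>})"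
      using \<mu>(2) sysD(5)[OF rep s(1) \<mu>(1)] sysD(6)[OF rep s(1) \<mu>(1)] sysD(7)[OF rep s(1)] s(2)
      unfolding N[symmetric] by (intro dim_sys(3)[OF rep s(1)]) (auto simp: stab_def)
  qed
qed

text \<open>\<open>simultaneous_system\<close> with the tuple and its chain compared with
  themselves.\<close>

theorem adapted_eigsys:
  assumes rep: "rep \<rho>" and K: "ichain \<rho> K"
  obtains s \<chi> e where "eigsys \<rho> s \<chi> e" "\<And>W. W \<in> K \<Longrightarrow> W = span (e ` {i. i < card B \<and> e i \<in> W})"
proof -
  note fl = flag_of_ichain[OF K]
  obtain N s \<chi> A e where s: "sys \<rho> (dim ` K) (inv_into K dim) N s \<chi> A e" "perp N e = {0}"
    using simultaneous_system[OF rep rep refl fl(1) fl(1)] by metis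
  have N: "N = card B" using sys_full_iff[OF rep s(1)] s(2) by simp
  have "eigsys \<rho> s \<chi> e" using s(1) unfolding eigsys_def N sys_def by simp
  moreover have "W = span (e ` {i. i < card B \<and> e i \<in> W})" if W: "W \<in> K" for W
  proof -
    have iW: "inv_into K dim (dim W) = W" using inv_into_f_f[OF fl(2) W] .
    have st: "stab \<rho> (inv_into K dim (dim W))" using K W unfolding iW by (auto simp: ichain_def)
    have "W = span (e ` {i. i < card B \<and> i \<in> A (dim W)})"
      using sys_adapted(2)[OF rep s _ st] W iW by auto
    moreover have "{i. i < card B \<and> i \<in> A (dim W)} = {i. i < card B \<and> e i \<in> W}"
      using sysD(5)[OF rep s(1), of "dim W"] W iW N by auto
    ultimately show ?thesis by simp
  qed
  ultimately show ?thesis using that by blast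
qed

lemma dim_ityp:
  assumes rep: "rep \<rho>" and K: "ichain \<rho> K" and W: "W \<in> K"
  shows "dim W = size (ityp \<rho> W)" "count (ityp \<rho> W) \<psi> = dim (Eig \<rho> \<psi> \<inter> W)"
    and "count (ityp \<rho> V) \<psi> = dim (Eig \<rho> \<psi>)"
proof -
  obtain s \<chi> e where e: "eigsys \<rho> s \<chi> e" "W = span (e ` {i. i < card B \<and> e i \<in> W})"
    using adapted_eigsys[OF rep K] W by metis
  define A where "A = {i. i < card B \<and> e i \<in> W}"
  have A: "A \<subseteq> {..<card B}" "finite A" by (auto simp: A_def)
  have W': "W = span (e ` A)" using e(2) by (simp add: A_def)
  show "dim W = size (ityp \<rho> W)"
    unfolding W' using ityp_span[OF rep e(1) A(1)] dim_span_sys[OF rep e(1) A(1)] by simp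
  show "count (ityp \<rho> W) \<psi> = dim (Eig \<rho> \<psi> \<inter> W)"
    unfolding W' using ityp_span[OF rep e(1) A(1)] dim_Eig_span[OF rep e(1) A(1)] count_image_index[OF rep e(1) A(2)] by simp
  have "Eig \<rho> \<psi> \<inter> V = Eig \<rho> \<psi>" by (auto simp: Eig_def)
  then show "count (ityp \<rho> V) \<psi> = dim (Eig \<rho> \<psi>)"
    using ityp_V[OF rep e(1)] dim_Eig_span[OF rep e(1), of "{..<card B}" \<psi>]
      count_image_index[OF rep e(1), of "{..<card B}"] span_es[OF rep e(1)] by simp
qed

lemma count_ityp_V: "rep \<rho> \<Longrightarrow> count (ityp \<rho> V) \<psi> = dim (Eig \<rho> \<psi>)"
proof -
  assume rep: "rep \<rho>"
  \<comment> \<open>The chain consisting of the zero space supplies a member to which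
    \<open>dim_ityp\<close> can be applied.\<close>
  have "subspace {0}" by simp
  then have "ichain \<rho> {{0}}" using rep by (auto simp: ichain_def stab_def rep_def unit_op_lin)
  then show ?thesis using dim_ityp(3)[OF rep] by blast
qed

text \<open>Sizes of types are dimensions, so equal sets of types match the two chains member by
  member and give all dimensions needed for \<open>simultaneous_system\<close>. The map between the
  resulting bases is unitary because both have the same pairings and the same permutation,
  intertwines the tuples because the characters agree, and matches the chains because the index sets
  agree.\<close>

theorem conjugating_op:
  assumes rep: "rep \<rho>" "rep \<rho>'" "length \<rho> = length \<rho>'" and K: "ichain \<rho> K" "ichain \<rho>' K'"
    and tyeq: "ityp \<rho> V = ityp \<rho>' V" "ityp \<rho> ` K = ityp \<rho>' ` K'"
  obtains g where "unit_op g" "\<And>t v. t < length \<rho> \<Longrightarrow> v \<in> V \<Longrightarrow> g ((\<rho> ! t) v) = (\<rho>' ! t) (g v)"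
    "(\<lambda>W. g ` W) ` K = K'"
proof -
  note fl = flag_of_ichain[OF K(1)] and fl' = flag_of_ichain[OF K(2)]
  have D: "dim ` K = dim ` K'"
  proof -
    have "dim ` K = size ` ityp \<rho> ` K" using dim_ityp(1)[OF rep(1) K(1)] by (simp add: image_image)
    also have "\<dots> = dim ` K'" unfolding tyeq(2) using dim_ityp(1)[OF rep(2) K(2)] by (simp add: image_image)
    finally show ?thesis .
  qed
  have tW: "ityp \<rho> (inv_into K dim \<mu>) = ityp \<rho>' (inv_into K' dim \<mu>)" if \<mu>: "\<mu> \<in> dim ` K" for \<mu>
  proof -
    define W where "W = inv_into K dim \<mu>"
    have W: "W \<in> K" "dim W = \<mu>" using \<mu> by (auto simp: W_def inv_into_into f_inv_into_f)
    obtain W' where W': "W' \<in> K'" "ityp \<rho> W = ityp \<rho>' W'" using tyeq(2) W(1) by blast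
    have "dim W' = \<mu>" using dim_ityp(1)[OF rep(1) K(1) W(1)] dim_ityp(1)[OF rep(2) K(2) W'(1)] W'(2) W(2) by simp
    then have "inv_into K' dim \<mu> = W'" using inv_into_f_f[OF fl'(2) W'(1)] by simp
    then show ?thesis using W'(2) by (simp add: W_def)
  qed
  have in1: "inv_into K dim \<mu> \<in> K" "inv_into K' dim \<mu> \<in> K'" if "\<mu> \<in> dim ` K" for \<mu>
    using that D by (auto simp: inv_into_into)
  have dU: "dim (Eig \<rho> \<psi> \<inter> inv_into K dim \<mu>) = dim (Eig \<rho>' \<psi> \<inter> inv_into K' dim \<mu>)" if "\<mu> \<in> dim ` K" for \<psi> \<mu>
    using tW[OF that] dim_ityp(2)[OF rep(1) K(1) in1(1)[OF that], of \<psi>]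
      dim_ityp(2)[OF rep(2) K(2) in1(2)[OF that], of \<psi>] by simp
  have dV: "dim (Eig \<rho> \<psi>) = dim (Eig \<rho>' \<psi>)" for \<psi>
    using tyeq(1) count_ityp_V[OF rep(1)] count_ityp_V[OF rep(2)] by metis
  have fl'': "flag \<rho>' (dim ` K) (inv_into K' dim)" using fl'(1) by (simp add: D)
  obtain N s \<chi> A e e' where s: "sys \<rho> (dim ` K) (inv_into K dim) N s \<chi> A e" "perp N e = {0}"
      and s': "sys \<rho>' (dim ` K) (inv_into K' dim) N s \<chi> A e'" "perp N e' = {0}"
    by (rule simultaneous_system[OF rep fl(1) fl'' dU dV])
  have t: "sys [] {} (\<lambda>_. {}) N s (\<lambda>_. []) (\<lambda>_. {}) e" "sys [] {} (\<lambda>_. {}) N s (\<lambda>_. []) (\<lambda>_. {}) e'"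
    using sys_forget s(1) s'(1) by blast+
  define g where "g = basis_op N s (\<lambda>_. 1) e e'"
  have g: "unit_op g" unfolding g_def by (rule unit_op_basis_op[OF t s(2)]) auto
  have ge: "g (e i) = e' i" if "i < N" for i using basis_op_apply[OF t that, of "\<lambda>_. 1"] by (simp add: g_def)
  have "g ((\<rho> ! k) v) = (\<rho>' ! k) (g v)" if k: "k < length \<rho>" and v: "v \<in> V" for k v
  proof (rule unit_op_ext[OF rep(1) s _ _ _ _ _ v])
    have ops: "unit_op (\<rho> ! k)" "unit_op (\<rho>' ! k)" using k rep by (auto simp: rep_def)
    note lin = unit_op_lin(1,2)[OF g] unit_op_lin(1,2)[OF ops(1)] unit_op_lin(1,2)[OF ops(2)]
    show "g ((\<rho> ! k) (x + y)) = g ((\<rho> ! k) x) + g ((\<rho> ! k) y)" "g ((\<rho> ! k) (c *s x)) = c *s g ((\<rho> ! k) x)"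
      "(\<rho>' ! k) (g (x + y)) = (\<rho>' ! k) (g x) + (\<rho>' ! k) (g y)" "(\<rho>' ! k) (g (c *s x)) = c *s (\<rho>' ! k) (g x)" for x y c
      by (simp_all only: lin)
    fix i assume i: "i < N"
    have "(\<rho> ! k) (e i) = \<chi> i ! k *s e i" "(\<rho>' ! k) (e' i) = \<chi> i ! k *s e' i"
      using sysD(2)[OF rep(1) s(1) i] sysD(2)[OF rep(2) s'(1) i] k rep(3) by (auto simp: Eig_def)
    then show "g ((\<rho> ! k) (e i)) = (\<rho>' ! k) (g (e i))" by (simp add: ge[OF i] unit_op_lin(2)[OF g])
  qed
  moreover have "(\<lambda>W. g ` W) ` K = K'"
  proof -
    have gs: "g ` span (e ` J) = span (e' ` J)" if "J \<subseteq> {..<N}" for J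
    proof -
      have "Vector_Spaces.linear (*s) (*s) g"
        by unfold_locales (simp_all add: unit_op_lin[OF g])
      then have "g ` span (e ` J) = span (g ` e ` J)"
        using module_hom.span_image module_hom_iff_linear by metis
      also have "g ` e ` J = e' ` J" using ge that by (auto simp: image_image intro!: image_cong)
      finally show ?thesis .
    qed
    have N: "N = card B" using sys_full_iff[OF rep(1) s(1)] s(2) by simp
    have "g ` inv_into K dim \<mu> = inv_into K' dim \<mu>" if \<mu>: "\<mu> \<in> dim ` K" for \<mu>
    proof -
      have "stab \<rho> (inv_into K dim \<mu>)" "stab \<rho>' (inv_into K' dim \<mu>)"
        using in1[OF \<mu>] K by (auto simp: ichain_def)
      then have "inv_into K dim \<mu> = span (e ` {i. i < card B \<and> i \<in> A \<mu>})"
        "inv_into K' dim \<mu> = span (e' ` {i. i < card B \<and> i \<in> A \<mu>})"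
        using sys_adapted(2)[OF rep(1) s \<mu>] sys_adapted(2)[OF rep(2) s' \<mu>] by auto
      then show ?thesis using gs[of "{i. i < card B \<and> i \<in> A \<mu>}"] N by auto
    qed
    then have "(\<lambda>\<mu>. g ` inv_into K dim \<mu>) ` dim ` K = inv_into K' dim ` dim ` K'"
      unfolding D[symmetric] by (intro image_cong) auto
    then show ?thesis using fl(2) fl'(2) by (simp add: image_image inv_into_f_f cong: image_cong)
  qed
  ultimately show ?thesis using that g by blast
qed

context
  fixes s e
  assumes e: "sys [] {} (\<lambda>_. {}) (card B) s (\<lambda>_. []) (\<lambda>_. {}) e"
begin

lemma eig_op:
  fixes \<chi> :: "nat \<Rightarrow> 'b list"
  assumes len: "\<And>i. i < card B \<Longrightarrow> length (\<chi> i) = r" and sg: "\<And>i. i < card B \<Longrightarrow> \<chi> (s i) = sg (\<chi> i)"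
    and M: "of_nat M \<noteq> (0::'b)" "\<And>i z. i < card B \<Longrightarrow> z \<in> set (\<chi> i) \<Longrightarrow> z ^ M = 1"
    and \<rho>: "length \<rho> = r" "\<And>t. t < r \<Longrightarrow> unit_op (\<rho> ! t)" "\<And>t i. t < r \<Longrightarrow> i < card B \<Longrightarrow> (\<rho> ! t) (e i) = \<chi> i ! t *s e i"
  shows "rep \<rho>" "eigsys \<rho> s \<chi> e" "\<And>t v. t < r \<Longrightarrow> v \<in> V \<Longrightarrow> ((\<rho> ! t) ^^ M) v = v"
proof -
  have M0: "M > 0" using M(1) by (cases M) auto
  have full: "perp (card B) e = {0}" using sys_full_iff[OF rep_Nil e] by simp
  note ext = unit_op_ext[OF rep_Nil e full]
  have lin: "(\<rho> ! t) (x + y) = (\<rho> ! t) x + (\<rho> ! t) y" "(\<rho> ! t) (c *s x) = c *s (\<rho> ! t) x" if "t < r" for t x y c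
    using unit_op_lin(1,2)[OF \<rho>(2)[OF that]] by auto
  have linp: "((\<rho> ! t) ^^ k) (x + y) = ((\<rho> ! t) ^^ k) x + ((\<rho> ! t) ^^ k) y"
      "((\<rho> ! t) ^^ k) (c *s x) = c *s ((\<rho> ! t) ^^ k) x" if "t < r" for t x y c k
    by (induction k) (simp_all add: lin[OF that])
  show pow: "((\<rho> ! t) ^^ M) v = v" if t: "t < r" and v: "v \<in> V" for t v
  proof -
    have "((\<rho> ! t) ^^ k) (e i) = (\<chi> i ! t) ^ k *s e i" if "i < card B" for i k
      by (induction k) (simp_all add: lin[OF t] \<rho>(3)[OF t that] mult.commute)
    then have "((\<rho> ! t) ^^ M) (e i) = id (e i)" if "i < card B" for i
      using that M(2)[OF that, of "\<chi> i ! t"] len[OF that] t by simp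
    then show ?thesis using ext[of "(\<rho> ! t) ^^ M" id, OF linp[OF t] _ _ _ v] by simp
  qed
  have comm: "(\<rho> ! t) ((\<rho> ! t') v) = (\<rho> ! t') ((\<rho> ! t) v)" if t: "t < r" "t' < r" and v: "v \<in> V" for t t' v
  proof (rule ext[OF _ _ _ _ _ v])
    fix i assume "i < card B"
    then show "(\<rho> ! t) ((\<rho> ! t') (e i)) = (\<rho> ! t') ((\<rho> ! t) (e i))"
      using \<rho>(3) t by (simp add: lin mult.commute)
  qed (simp_all add: lin t)
  show "rep \<rho>" unfolding rep_def
  proof (intro conjI ballI)
    fix Y assume "Y \<in> set \<rho>"
    then obtain t where t: "t < r" "Y = \<rho> ! t" using \<rho>(1) by (metis in_set_conv_nth)
    show "unit_op Y" using \<rho>(2) t by simp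
    show "\<exists>M>0. of_nat M \<noteq> (0::'b) \<and> (\<forall>v\<in>V. (Y ^^ M) v = v)"
      using M(1) M0 pow t by blast
    fix Z v assume "Z \<in> set \<rho>" "v \<in> V"
    then obtain t' where "t' < r" "Z = \<rho> ! t'" using \<rho>(1) by (metis in_set_conv_nth)
    then show "Y (Z v) = Z (Y v)" using comm t \<open>v \<in> V\<close> by simp
  qed
  have "e i \<in> Eig \<rho> (\<chi> i)" if "i < card B" for i
    using that len \<rho> sys_V[OF rep_Nil e] by (simp add: Eig_def)
  then show "eigsys \<rho> s \<chi> e" using e unfolding eigsys_def sys_def by simp
qed

end

text \<open>Closure of A under the square of s is stability under \<open>phi\<close>; the condition
  that \<open>s i\<close> lies outside A for i in A is isotropy, as \<open>e (s i)\<close> is the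
  only basis vector pairing with \<open>e i\<close> from the left.\<close>

lemma eig_span_stab:
  assumes rep: "rep \<rho>" and es: "eigsys \<rho> s \<chi> e"
    and A: "A \<subseteq> {..<card B}" "\<And>i. i \<in> A \<Longrightarrow> s (s i) \<in> A" "\<And>i. i \<in> A \<Longrightarrow> s i \<notin> A"
  shows "stab \<rho> (span (e ` A))" "\<And>x y. x \<in> span (e ` A) \<Longrightarrow> y \<in> span (e ` A) \<Longrightarrow> h x y = 0"
proof -
  note es_simps = es_simps[OF rep es]
  have closed: "f x \<in> span (e ` A)" if f: "\<And>x y. f (x + y) = f x + f y" "\<And>c x. \<exists>d. f (c *s x) = d *s f x"
      "\<And>i. i \<in> A \<Longrightarrow> f (e i) \<in> span (e ` A)" and x: "x \<in> span (e ` A)" for f x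
  proof -
    have f0: "f 0 = 0" using f(1)[of 0 0] by simp
    have "subspace {x. f x \<in> span (e ` A)}"
      unfolding subspace_def
    proof (intro conjI allI ballI)
      show "0 \<in> {x. f x \<in> span (e ` A)}" by (simp add: f0 span_zero)
      show "x + y \<in> {x. f x \<in> span (e ` A)}" if "x \<in> {x. f x \<in> span (e ` A)}" "y \<in> {x. f x \<in> span (e ` A)}" for x y
        using that by (simp add: f(1) span_add)
      show "c *s x \<in> {x. f x \<in> span (e ` A)}" if "x \<in> {x. f x \<in> span (e ` A)}" for c x
        using that f(2)[of c x] span_scale by auto
    qed
    then show ?thesis using span_minimal[of "e ` A" "{x. f x \<in> span (e ` A)}"] f(3) x by blast
  qed
  show "stab \<rho> (span (e ` A))"
    unfolding stab_def
  proof (intro conjI ballI)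
    show "subspace (span (e ` A))" by (rule subspace_span)
    show "span (e ` A) \<subseteq> V" using A(1) es_simps(6) by (intro span_minimal subspace_V) auto
    show "phi w \<in> span (e ` A)" if "w \<in> span (e ` A)" for w
    proof (rule closed[OF phi_add _ _ that])
      show "\<exists>d. phi (c *s x) = d *s phi x" for c x using phi_scale by blast
      fix i assume i: "i \<in> A"
      then have "phi (e i) = e (s (s i))" using es_simps(3)[of i] A(1) by blast
      then show "phi (e i) \<in> span (e ` A)" using A(2)[OF i] by (simp add: span_base)
    qed
    show "Y w \<in> span (e ` A)" if Yw: "Y \<in> set \<rho>" "w \<in> span (e ` A)" for Y w
    proof -
      have Y: "unit_op Y" using rep Yw by (auto simp: rep_def)
      obtain t where t: "t < length \<rho>" "Y = \<rho> ! t" using Yw(1) by (metis in_set_conv_nth)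
      show ?thesis
      proof (rule closed[OF _ _ _ Yw(2)])
        fix i assume "i \<in> A"
        then have "Y (e i) = \<chi> i ! t *s e i" using es_simps(2)[of i] A(1) t by (auto simp: Eig_def)
        then show "Y (e i) \<in> span (e ` A)" using \<open>i \<in> A\<close> by (auto intro!: span_base span_scale)
      qed (auto simp: unit_op_lin[OF Y])
    qed
  qed
  fix x y assume x: "x \<in> span (e ` A)" and y: "y \<in> span (e ` A)"
  have "subspace {y. h x y = 0}" unfolding subspace_def by (auto simp: h_add_right h_scale_right)
  moreover have "e ` A \<subseteq> {y. h x y = 0}"
    using h_span_sys[OF rep es A(1) x] A by auto
  ultimately show "h x y = 0" using span_minimal y by blast
qed

end

section \<open>The unitary group over an algebraic closure\<close>

hide_const (open) Divisibility.prime

section \<open>Finite fields inside an algebraic closure\<close>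

lemma power_card_finite_field: "(x :: 'a::{field,finite}) ^ card (UNIV :: 'a set) = x"
proof (cases "x = 0")
  case True
  then show ?thesis by (simp add: power_0_left finite_UNIV_card_ge_0)
next
  case False
  define m where "m = card (UNIV - {0 :: 'a})"
  have card: "card (UNIV :: 'a set) = Suc m"
    unfolding m_def by (metis UNIV_I card_Suc_Diff1 finite)
  have "(\<Prod>y\<in>UNIV - {0 :: 'a}. y) = (\<Prod>y\<in>UNIV - {0 :: 'a}. x * y)"
    by (rule prod.reindex_bij_witness[of _ "\<lambda>y. x * y" "\<lambda>y. y / x"]) (use False in auto)
  also have "\<dots> = x ^ m * (\<Prod>y\<in>UNIV - {0 :: 'a}. y)"
    by (simp add: prod.distrib m_def)
  finally have "x ^ m = 1" by (auto simp: prod_zero_iff)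
  then show ?thesis by (simp add: card)
qed

text \<open>An algebraic z satisfies a monic equation of degree d, so its powers lie in the finite
  set of combinations of the first d of them.\<close>

lemma alg_closure_finite_powers:
  fixes z :: "'a::{field,finite} alg_closure"
  shows "finite (range (\<lambda>k::nat. z ^ k))"
proof -
  obtain p :: "'a poly" where p: "p \<noteq> 0" "poly (map_poly to_ac p) z = 0" by (rule alg_closure_algebraic)
  define d where "d = degree p"
  define F where "F c = (\<Sum>i<d. to_ac (c i) * z ^ i)" for c :: "nat \<Rightarrow> 'a"
  define S where "S = F ` (PiE {..<d} (\<lambda>_. UNIV))"
  have finS: "finite S" unfolding S_def by (intro finite_imageI finite_PiE) auto
  have FS: "F c \<in> S" for c
  proof -
    have "F c = F (restrict c {..<d})" unfolding F_def by (intro sum.cong) auto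
    then show ?thesis unfolding S_def by auto
  qed
  have cf: "coeff (map_poly to_ac p) i = to_ac (coeff p i)" for i by (simp add: coeff_map_poly)
  have deg: "degree (map_poly to_ac p) = d" unfolding d_def by (rule degree_map_poly) simp
  have lc: "coeff p d \<noteq> 0" using p(1) by (simp add: d_def)
  define b where "b i = - (coeff p i / coeff p d)" for i
  have zd: "z ^ d = F b"
  proof -
    have "0 = (\<Sum>i\<le>d. to_ac (coeff p i) * z ^ i)" using p(2) by (simp add: poly_altdef deg cf)
    also have "\<dots> = (\<Sum>i<d. to_ac (coeff p i) * z ^ i) + to_ac (coeff p d) * z ^ d"
      by (simp add: lessThan_Suc_atMost[symmetric])
    finally have "to_ac (coeff p d) * z ^ d = - (\<Sum>i<d. to_ac (coeff p i) * z ^ i)"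
      by (simp add: eq_neg_iff_add_eq_0 add.commute)
    also have "\<dots> = to_ac (coeff p d) * F b"
      using lc by (simp add: F_def b_def sum_distrib_left sum_negf[symmetric] field_simps)
    finally show ?thesis using lc by simp
  qed
  have d0: "d > 0"
  proof (rule ccontr)
    assume "\<not> d > 0"
    then have "z ^ d = 0" using zd by (simp add: F_def)
    then show False using \<open>\<not> d > 0\<close> by simp
  qed
  have closed: "z * F c \<in> S" for c
  proof -
    obtain d' where d': "d = Suc d'" using d0 by (cases d) auto
    have "z * F c = (\<Sum>i<d'. to_ac (c i) * z ^ Suc i) + to_ac (c d') * z ^ d"
      by (simp add: F_def d' sum_distrib_left algebra_simps)
    also have "(\<Sum>i<d'. to_ac (c i) * z ^ Suc i) = (\<Sum>i<d. to_ac (if i = 0 then 0 else c (i - 1)) * z ^ i)"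
      unfolding d' by (subst sum.lessThan_Suc_shift) simp
    also have "\<dots> + to_ac (c d') * z ^ d = F (\<lambda>i. (if i = 0 then 0 else c (i - 1)) + c d' * b i)"
      unfolding zd F_def by (simp add: sum_distrib_left sum.distrib algebra_simps)
    finally show ?thesis using FS by simp
  qed
  have one: "1 \<in> S"
  proof -
    have "F (\<lambda>i. if i = 0 then 1 else 0) = (\<Sum>i<d. if i = 0 then 1 else 0)"
      unfolding F_def by (intro sum.cong) auto
    also have "\<dots> = 1" using d0 by simp
    finally show ?thesis using FS by metis
  qed
  have "z ^ k \<in> S" for k
  proof (induction k)
    case (Suc k)
    then obtain c where "z ^ k = F c" by (auto simp: S_def)
    then show ?case using closed by simp
  qed (use one in simp)
  then have "range (\<lambda>k::nat. z ^ k) \<subseteq> S" by auto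
  then show ?thesis using finS by (rule finite_subset)
qed

lemma CHAR_primepow:
  assumes "primepow q" "card (UNIV :: 'a::{field,finite} set) = q ^ 2"
  obtains k where "k > 0" "q = CHAR('a) ^ k"
proof -
  obtain l k where l: "prime l" "k > 0" "q = l ^ k" using assms(1) by (auto simp: primepow_def)
  \<comment> \<open>The sum of all elements is invariant under translation by 1.\<close>
  have "of_nat (card (UNIV :: 'a set)) = (0 :: 'a)"
  proof -
    have "(\<Sum>x\<in>(UNIV :: 'a set). x) = (\<Sum>x\<in>(UNIV :: 'a set). 1 + x)"
      by (rule sum.reindex_bij_witness[of _ "\<lambda>x. 1 + x" "\<lambda>x. x - 1"]) auto
    then show ?thesis by (simp add: sum.distrib)
  qed
  then have dvd: "CHAR('a) dvd q ^ 2" unfolding assms(2) by (simp only: of_nat_eq_0_iff_char_dvd)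
  have pr: "prime CHAR('a)" by (rule prime_CHAR_semidom[OF finite_imp_CHAR_pos]) simp
  have "CHAR('a) dvd q" using prime_dvd_power[OF pr dvd] .
  then have "CHAR('a) dvd l" unfolding l(3) by (rule prime_dvd_power[OF pr])
  then have "CHAR('a) = l" using primes_dvd_imp_eq[OF pr l(1)] by simp
  then show ?thesis using that l by blast
qed

lemma frob_field_alg_closure:
  assumes "primepow q" "card (UNIV :: 'a::{field,finite} set) = q ^ 2"
  shows "frob_field TYPE('a alg_closure) q"
proof
  obtain k where k: "k > 0" "q = CHAR('a) ^ k" by (rule CHAR_primepow[OF assms])
  show q2: "2 \<le> q" using assms(1) primepow_gt_Suc_0[of q] by simp
  show "of_nat q = (0 :: 'a alg_closure)"
    using k of_nat_CHAR[where ?'a = "'a alg_closure"] by (simp add: power_0_left)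
  show add: "(x + y) ^ q = x ^ q + y ^ q" for x y :: "'a alg_closure"
  proof -
    have "prime CHAR('a)" by (rule prime_CHAR_semidom[OF finite_imp_CHAR_pos]) simp
    then show ?thesis unfolding k(2) by (intro freshmans_dream'[where m = "CHAR('a) ^ k" and n = k]) simp_all
  qed
  fix x :: "'a alg_closure"
  have addk: "(u + v) ^ (q ^ j) = u ^ (q ^ j) + v ^ (q ^ j)" for u v :: "'a alg_closure" and j
  proof (induction j)
    case (Suc j)
    have p: "w ^ (q ^ Suc j) = (w ^ (q ^ j)) ^ q" for w :: "'a alg_closure"
      by (simp only: power_Suc mult.commute[of q] power_mult)
    show ?case unfolding p Suc by (rule add)
  qed simp
  have inj: "u = v" if "u ^ (q ^ j) = v ^ (q ^ j)" for u v :: "'a alg_closure" and j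
  proof -
    have "(u - v) ^ (q ^ j) + v ^ (q ^ j) = u ^ (q ^ j)" using addk[of "u - v" v j] by simp
    then show ?thesis using that by simp
  qed
  \<comment> \<open>Two Frobenius iterates of x coincide by finiteness, and injectivity of Frobenius
    cancels the smaller one.\<close>
  have "finite (range (\<lambda>k. x ^ (q ^ (2 * k))))"
    by (rule finite_subset[OF _ alg_closure_finite_powers[of x]]) auto
  then have "\<not> inj (\<lambda>k. x ^ (q ^ (2 * k)))" using finite_imageD infinite_UNIV_nat by blast
  then obtain i j where ij: "i \<noteq> j" "x ^ (q ^ (2 * i)) = x ^ (q ^ (2 * j))" by (auto simp: inj_def)
  define a where "a = min i j"
  define n where "n = max i j - min i j"
  have eq: "x ^ (q ^ (2 * a)) = x ^ (q ^ (2 * (a + n)))"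
    using ij(2) by (cases "i \<le> j") (auto simp: a_def n_def min_def max_def)
  have pw: "x ^ (q ^ (2 * (a + n))) = (x ^ (q ^ (2 * n))) ^ (q ^ (2 * a))"
    by (simp only: power_mult[symmetric] power_add[symmetric] distrib_left add.commute)
  have "x ^ (q ^ (2 * n)) = x" by (rule inj[OF trans[OF pw[symmetric] eq[symmetric]]])
  moreover have "n > 0" using ij(1) by (auto simp: n_def)
  ultimately show "\<exists>N>0. x ^ (q ^ (2 * N)) = x" by blast
qed

text \<open>The image of the finite field already supplies q^2 roots of a polynomial of that degree.
  This is the link between \<open>phi\<close>-fixed and rational.\<close>

lemma range_to_ac_iff:
  fixes z :: "'a::{field,finite} alg_closure"
  assumes "primepow q" "card (UNIV :: 'a set) = q ^ 2"
  shows "z \<in> range to_ac \<longleftrightarrow> z ^ (q ^ 2) = z"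
proof -
  have q2: "2 \<le> q" using assms(1) primepow_gt_Suc_0[of q] by simp
  define f where "f = monom (1 :: 'a alg_closure) (q ^ 2) - [:0, 1:]"
  have q1: "1 < q ^ 2" using q2 by (metis one_less_power less_le_trans one_less_numeral_iff semiring_norm(76) zero_less_numeral)
  have deg: "degree f = q ^ 2"
    unfolding f_def using q1 by (subst degree_diff_eq_left) (auto simp: degree_monom_eq)
  have f0: "f \<noteq> 0" using deg q1 by (metis degree_0 not_one_less_zero)
  have roots: "{z. poly f z = 0} = {z. z ^ (q ^ 2) = z}" by (simp add: f_def poly_monom)
  have "card {z :: 'a alg_closure. z ^ (q ^ 2) = z} \<le> q ^ 2"
    using card_poly_roots_bound[OF f0] unfolding roots deg .
  moreover have fin: "finite {z :: 'a alg_closure. z ^ (q ^ 2) = z}"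
    using poly_roots_finite[OF f0] unfolding roots .
  moreover have sub: "range to_ac \<subseteq> {z :: 'a alg_closure. z ^ (q ^ 2) = z}"
    using power_card_finite_field[where ?'a = 'a] unfolding assms(2) by (auto simp flip: to_ac_power)
  moreover have "card (range (to_ac :: 'a \<Rightarrow> 'a alg_closure)) = q ^ 2"
    using card_image[OF inj_to_ac] assms(2) by metis
  ultimately have "range to_ac = {z :: 'a alg_closure. z ^ (q ^ 2) = z}"
    by (metis card_seteq)
  then show ?thesis by blast
qed

definition ksub :: "nat \<Rightarrow> 'a::field vec set \<Rightarrow> bool" where
  "ksub n U \<longleftrightarrow> U \<subseteq> carrier_vec n \<and> 0\<^sub>v n \<in> U \<and> (\<forall>u\<in>U. \<forall>v\<in>U. u + v \<in> U) \<and> (\<forall>k. \<forall>u\<in>U. k \<cdot>\<^sub>v u \<in> U)"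

lemma subspace_iff_ksub: "VectorSpace.subspace class_ring U (module_vec TYPE('a::field) n) \<longleftrightarrow> ksub n U"
proof -
  interpret vec_space "TYPE('a)" n .
  have "Module.module class_ring (module_vec TYPE('a) n)" by (rule vec_module)
  moreover have "vectorspace class_ring (module_vec TYPE('a) n)" by (rule vec_vs)
  ultimately show ?thesis
    unfolding VectorSpace.subspace_def submodule_def ksub_def
    by (auto simp: module_vec_simps class_ring_simps)
qed

lemma additive_sum:
  fixes f :: "'u::ab_group_add \<Rightarrow> 'w::ab_group_add"
  assumes "\<And>x y. f (x + y) = f x + f y"
  shows "f (sum t S) = (\<Sum>i\<in>S. f (t i))"
proof -
  have "f 0 = 0" using assms[of 0 0] by simp
  then show ?thesis by (induction S rule: infinite_finite_induct) (simp_all add: assms)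
qed

lemma finite_carrier_vec: "finite (carrier_vec n :: 'a::finite vec set)"
proof (rule finite_subset)
  show "carrier_vec n \<subseteq> vec_of_list ` {xs :: 'a list. set xs \<subseteq> UNIV \<and> length xs = n}"
    by (auto intro!: image_eqI[of _ _ "list_of_vec _"] simp: vec_list)
  show "finite (vec_of_list ` {xs :: 'a list. set xs \<subseteq> UNIV \<and> length xs = n})"
    by (intro finite_imageI finite_lists_length_eq) simp
qed

lemma finite_carrier_mat: "finite (carrier_mat n m :: 'a::finite mat set)"
proof (rule finite_subset)
  show "(carrier_mat n m :: 'a mat set) \<subseteq> (\<lambda>f. mat n m f) ` (PiE ({..<n} \<times> {..<m}) (\<lambda>_. UNIV))"
  proof
    fix A :: "'a mat" assume "A \<in> carrier_mat n m"
    then have A: "A = mat n m (restrict (\<lambda>ij. A $$ ij) ({..<n} \<times> {..<m}))" by (intro eq_matI) auto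
    have "restrict (\<lambda>ij. A $$ ij) ({..<n} \<times> {..<m}) \<in> PiE ({..<n} \<times> {..<m}) (\<lambda>_. UNIV)"
      by simp
    then show "A \<in> (\<lambda>f. mat n m f) ` (PiE ({..<n} \<times> {..<m}) (\<lambda>_. UNIV))"
      by (rule rev_image_eqI) (rule A)
  qed
  show "finite ((\<lambda>f. mat n m f) ` (PiE ({..<n} \<times> {..<m}) (\<lambda>_. UNIV :: 'a set)))"
    by (intro finite_imageI finite_PiE) auto
qed

text \<open>The reversal of coordinates in the given Hermitian form, extended by the identity to a
  permutation of all numbers.\<close>

definition rv :: "nat \<Rightarrow> nat \<Rightarrow> nat" where "rv n i = (if i < n then n - 1 - i else i)"

lemma rv_rv [simp]: "rv n (rv n i) = i" by (auto simp: rv_def)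

lemma rv_permutes: "rv n permutes {..<n}"
proof -
  have "bij_betw (rv n) {..<n} {..<n}"
    by (rule bij_betw_byWitness[of _ "rv n"]) (auto, auto simp: rv_def)
  then show ?thesis by (rule bij_imp_permutes) (auto simp: rv_def)
qed

lemma inv_rv [simp]: "inv_into UNIV (rv n) = rv n"
  by (rule inv_equality) auto

section \<open>The unitary group as operators on the scalar extension\<close>

locale unitary_space =
  fixes q n :: nat and c :: "'a::{field,finite}"
  assumes primepow_q: "primepow q" and card_UNIV_q: "card (UNIV :: 'a set) = q ^ 2"
    and c0: "c \<noteq> 0" and c_power: "c ^ (q - 1) = (-1) ^ (n + 1)"
begin

text \<open>The given form attaches the sign (-1)^i to the index of u; here j is the index of v, so
  i = n - 1 - j.\<close>

definition wts :: "nat \<Rightarrow> 'a alg_closure" where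
  "wts j = to_ac c * (-1) ^ (n - 1 - j)"

sublocale ff: frob_field q "TYPE('a alg_closure)"
  by (rule frob_field_alg_closure[OF primepow_q card_UNIV_q])

text \<open>The hypothesis on c enters here: c^q equals c times (-1)^(n+1), and this sign
  compensates the one produced by reversing the coordinates, since n + 1 + (n - 1 - j) and j have
  the same parity.\<close>

lemma wts_props: "j < n \<Longrightarrow> wts j \<noteq> 0" "j < n \<Longrightarrow> wts (rv n j) = wts j ^ q"
proof -
  show "j < n \<Longrightarrow> wts j \<noteq> 0" using c0 by (simp add: wts_def)
  assume j: "j < n"
  have m1: "(-1 :: 'a alg_closure) ^ q = -1"
  proof -
    have "(1 + (-1 :: 'a alg_closure)) ^ q = 1 ^ q + (-1) ^ q" by (rule ff.frob_add)
    then have "1 + (-1 :: 'a alg_closure) ^ q = 0" using ff.q2 by (simp add: power_0_left)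
    then show ?thesis by (simp add: eq_neg_iff_add_eq_0 add.commute)
  qed
  have "c ^ q = c * (-1) ^ (n + 1)"
    using c_power ff.q2 by (metis One_nat_def Suc_pred less_le_trans pos2 power_Suc)
  then have cq: "to_ac c ^ q = to_ac c * (-1) ^ (n + 1)"
    by (metis to_ac_power to_ac_mult to_ac_minus to_ac_1)
  have "wts j ^ q = to_ac c * ((-1) ^ (n + 1) * (-1) ^ (n - 1 - j))"
  proof -
    have "((-1 :: 'a alg_closure) ^ k) ^ q = ((-1) ^ q) ^ k" for k by (metis mult.commute power_mult)
    then show ?thesis by (simp only: wts_def power_mult_distrib cq m1 mult.assoc)
  qed
  also have "(-1 :: 'a alg_closure) ^ (n + 1) * (-1) ^ (n - 1 - j) = (-1) ^ j"
  proof -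
    have "n + 1 + (n - 1 - j) = 2 * (n - j) + j" using j by simp
    then show ?thesis by (simp only: power_add[symmetric]) (simp add: power_add)
  qed
  finally show "wts (rv n j) = wts j ^ q" using j by (simp add: rv_def wts_def)
qed

sublocale H: herm_space fscale q "Vn n" "std ` {..<n}" "tphi (rv n) q" "hform n (rv n) wts q"
  by (rule ff.herm_space_hform[where a = wts, OF rv_permutes wts_props])

abbreviation "hL \<equiv> hform n (rv n) wts q"
abbreviation "phiL \<equiv> tphi (rv n) q :: (nat \<Rightarrow> 'a alg_closure) \<Rightarrow> _"

definition emb :: "'a vec \<Rightarrow> nat \<Rightarrow> 'a alg_closure" where
  "emb v = (\<lambda>i. if i < n then to_ac (v $ i) else 0)"

definition opm :: "'a mat \<Rightarrow> (nat \<Rightarrow> 'a alg_closure) \<Rightarrow> nat \<Rightarrow> 'a alg_closure" where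
  "opm A v = (\<lambda>i. if i < n then \<Sum>j<n. to_ac (A $$ (i, j)) * v j else 0)"

lemma phiL_apply: "phiL v i = v i ^ (q\<^sup>2)" by (simp add: tphi_def)

lemma emb_in: "emb v \<in> Vn n" by (simp add: emb_def Vn_def)
lemma emb_0: "emb (0\<^sub>v n) = 0" by (auto simp: emb_def fun_eq_iff)
lemma emb_add: "u \<in> carrier_vec n \<Longrightarrow> v \<in> carrier_vec n \<Longrightarrow> emb (u + v) = emb u + emb v"
  by (auto simp: emb_def fun_eq_iff)
lemma emb_smult: "v \<in> carrier_vec n \<Longrightarrow> emb (k \<cdot>\<^sub>v v) = fscale (to_ac k) (emb v)"
  by (auto simp: emb_def fun_eq_iff fscale_def)
lemma emb_inj: "u \<in> carrier_vec n \<Longrightarrow> v \<in> carrier_vec n \<Longrightarrow> emb u = emb v \<Longrightarrow> u = v"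
  by (intro eq_vecI) (auto simp: emb_def fun_eq_iff split: if_splits)

lemma phi_emb: "phiL (emb v) = emb v"
proof
  fix i
  have "to_ac (v $ i) \<in> range to_ac" by simp
  then have "to_ac (v $ i) ^ (q ^ 2) = to_ac (v $ i)" using range_to_ac_iff[OF primepow_q card_UNIV_q] by blast
  then show "phiL (emb v) i = emb v i" using ff.q2 by (simp add: phiL_apply emb_def power_0_left)
qed

lemma fixed_imp_emb:
  assumes "v \<in> Vn n" "phiL v = v" shows "\<exists>u\<in>carrier_vec n. v = emb u"
proof -
  have "v i \<in> range to_ac" for i
    using fun_cong[OF assms(2), of i] range_to_ac_iff[OF primepow_q card_UNIV_q] by (simp add: phiL_apply)
  then have "to_ac (of_ac (v i)) = v i" for i by (rule to_ac_of_ac)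
  then have "v = emb (vec n (\<lambda>i. of_ac (v i)))"
    using assms(1) by (auto simp: emb_def fun_eq_iff Vn_def)
  then show ?thesis by (intro bexI[of _ "vec n (\<lambda>i. of_ac (v i))"]) auto
qed

lemma std_emb: "i < n \<Longrightarrow> std i = emb (unit_vec n i)"
  by (auto simp: std_def emb_def fun_eq_iff unit_vec_def)

lemma h_emb: "u \<in> carrier_vec n \<Longrightarrow> v \<in> carrier_vec n \<Longrightarrow> hL (emb u) (emb v) = to_ac (herm_form n q c u v)"
proof -
  assume uv: "u \<in> carrier_vec n" "v \<in> carrier_vec n"
  have "hL (emb u) (emb v) = (\<Sum>i<n. wts i * emb u (rv n i) * emb v i ^ q)" by (simp add: hform_def)
  also have "\<dots> = (\<Sum>i<n. to_ac c * ((-1) ^ i * to_ac (u $ i) * to_ac (v $ (n - 1 - i)) ^ q))"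
    by (rule sum.reindex_bij_witness[of _ "rv n" "rv n"]) (auto simp: rv_def emb_def wts_def ac_simps)
  also have "\<dots> = to_ac (herm_form n q c u v)"
    by (simp add: herm_form_def to_ac_sum sum_distrib_left)
  finally show ?thesis .
qed

lemma opm_add: "opm A (u + v) = opm A u + opm A v"
  by (auto simp: opm_def fun_eq_iff algebra_simps sum.distrib)
lemma opm_scale: "opm A (fscale k v) = fscale k (opm A v)"
  by (auto simp: opm_def fun_eq_iff fscale_def sum_distrib_left algebra_simps)
lemma opm_in: "opm A v \<in> Vn n" by (simp add: opm_def Vn_def)

lemma opm_emb: "A \<in> carrier_mat n n \<Longrightarrow> v \<in> carrier_vec n \<Longrightarrow> opm A (emb v) = emb (A *\<^sub>v v)"
  by (auto simp: opm_def emb_def fun_eq_iff scalar_prod_def to_ac_sum atLeast0LessThan intro!: sum.cong)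

lemma lin_ext:
  assumes "\<And>x y. f (x + y) = f x + f y" "\<And>k x. f (fscale k x) = fscale k (f x)"
    and "\<And>x y. g (x + y) = g x + g y" "\<And>k x. g (fscale k x) = fscale k (g x)"
    and eq: "\<And>i. i < n \<Longrightarrow> f (std i) = g (std i :: nat \<Rightarrow> 'a alg_closure)" and v: "v \<in> Vn n"
  shows "f v = (g v :: nat \<Rightarrow> 'a alg_closure)"
proof -
  have sum: "f (\<Sum>i\<in>S. t i) = (\<Sum>i\<in>S. f (t i))" "g (\<Sum>i\<in>S. t i) = (\<Sum>i\<in>S. g (t i))" for t :: "nat \<Rightarrow> _" and S
    using additive_sum[of f t S] additive_sum[of g t S] assms(1,3) by blast+
  have "f (\<Sum>i<n. fscale (v i) (std i)) = g (\<Sum>i<n. fscale (v i) (std i))"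
    by (simp add: sum assms eq)
  then show ?thesis using Vn_expansion[OF v] by metis
qed

lemma opm_mult:
  assumes "A \<in> carrier_mat n n" "C \<in> carrier_mat n n" "v \<in> Vn n"
  shows "opm (A * C) v = opm A (opm C v)"
proof (rule lin_ext[OF _ _ _ _ _ assms(3)])
  fix i assume i: "i < n"
  show "opm (A * C) (std i) = opm A (opm C (std i))"
    unfolding std_emb[OF i] using assms i by (simp add: opm_emb assoc_mult_mat_vec)
qed (simp_all only: opm_add opm_scale)

lemma opm_one:
  assumes "v \<in> Vn n" shows "opm (1\<^sub>m n) v = v"
proof (rule lin_ext[OF opm_add opm_scale _ _ _ assms])
  fix i assume "i < n"
  then show "opm (1\<^sub>m n) (std i) = (\<lambda>a. std i a)" by (simp add: std_emb opm_emb)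
qed (simp_all add: plus_fun_def fscale_def)

lemma opm_phi: "v \<in> Vn n \<Longrightarrow> phiL (opm A v) = opm A (phiL v)"
proof
  fix i
  have A: "to_ac (A $$ (i, j)) ^ (q\<^sup>2) = to_ac (A $$ (i, j))" for j
    using range_to_ac_iff[OF primepow_q card_UNIV_q] by blast
  have s: "(\<Sum>j<n. f j) ^ (q\<^sup>2) = (\<Sum>j<n. f j ^ (q\<^sup>2))" for f :: "nat \<Rightarrow> 'a alg_closure"
    using H.frob_pow_sum[of f "{..<n}" 2] .
  show "phiL (opm A v) i = opm A (phiL v) i"
    using ff.q2 by (simp add: phiL_apply opm_def s power_mult_distrib A power_0_left)
qed

lemma opm_eqD:
  assumes "A \<in> carrier_mat n n" "C \<in> carrier_mat n n" "\<And>v. v \<in> Vn n \<Longrightarrow> opm A v = opm C v"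
  shows "A = C"
proof (rule eq_matI)
  fix i j assume ij: "i < dim_row C" "j < dim_col C"
  then have ij': "i < n" "j < n" using assms(2) by auto
  have "opm A (std j) i = opm C (std j) i"
    using assms(3)[of "std j"] ij' by (simp add: Vn_def std_def)
  moreover have "opm D (std j) i = to_ac (D $$ (i, j))" for D
    using ij' by (simp add: opm_def std_def if_distrib cong: if_cong)
  ultimately show "A $$ (i, j) = C $$ (i, j)" by simp
qed (use assms in auto)

text \<open>Standard basis vectors are fixed by \<open>phi\<close>, so are their images, and hence
  all matrix entries are rational.\<close>

lemma lin_phi_imp_opm:
  assumes "\<And>x y. f (x + y) = f x + f y" "\<And>k x. f (fscale k x) = fscale k (f x)"
    and "\<And>v. v \<in> Vn n \<Longrightarrow> f v \<in> Vn n" "\<And>v. v \<in> Vn n \<Longrightarrow> phiL (f v) = f (phiL v)"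
  shows "\<exists>A\<in>carrier_mat n n. \<forall>v\<in>Vn n. f v = opm A v"
proof -
  have sV: "std j \<in> Vn n" if "j < n" for j using that by (simp add: Vn_def std_def)
  have "f (std j) i \<in> range to_ac" if "j < n" for i j
  proof -
    have "phiL (f (std j)) = f (std j)" using assms(4)[OF sV[OF that]] std_emb[OF that] phi_emb by simp
    then show ?thesis using range_to_ac_iff[OF primepow_q card_UNIV_q] phiL_apply by metis
  qed
  then have r: "to_ac (of_ac (f (std j) i)) = f (std j) i" if "j < n" for i j using that to_ac_of_ac by blast
  define A where "A = mat n n (\<lambda>(i, j). of_ac (f (std j) i))"
  have "f v = opm A v" if "v \<in> Vn n" for v
  proof (rule lin_ext[OF assms(1,2) opm_add opm_scale _ that])
    fix j assume j: "j < n"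
    show "f (std j) = opm A (std j)"
      using assms(3)[OF sV[OF j]] r[OF j] j
      by (auto simp: opm_def A_def std_def fun_eq_iff Vn_def if_distrib cong: if_cong)
  qed
  then show ?thesis by (intro bexI[of _ A]) (auto simp: A_def)
qed

abbreviation "G \<equiv> unitary_group n q c"

lemma h_sesq_ext:
  fixes f :: "(nat \<Rightarrow> 'a alg_closure) \<Rightarrow> nat \<Rightarrow> 'a alg_closure"
  assumes "\<And>x y. f (x + y) = f x + f y" "\<And>k x. f (fscale k x) = fscale k (f x)"
    and eq: "\<And>i j. i < n \<Longrightarrow> j < n \<Longrightarrow> hL (f (std i)) (f (std j)) = hL (std i) (std j)"
    and u: "u \<in> Vn n" and v: "v \<in> Vn n"
  shows "hL (f u) (f v) = hL u v"
proof -
  have sum: "f (\<Sum>i\<in>S. t i) = (\<Sum>i\<in>S. f (t i))" for t :: "nat \<Rightarrow> _" and S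
    using additive_sum[of f t S] assms(1) by blast
  have "hL (f (\<Sum>i<n. fscale (u i) (std i))) (f (\<Sum>i<n. fscale (v i) (std i))) =
      hL (\<Sum>i<n. fscale (u i) (std i)) (\<Sum>i<n. fscale (v i) (std i))"
    by (simp add: sum assms(2) H.h_sum_left H.h_sum_right H.h_scale_left H.h_scale_right eq)
  then show ?thesis using Vn_expansion[OF u] Vn_expansion[OF v] by metis
qed

text \<open>The form is determined on basis vectors, which are rational; conversely a
  form-preserving matrix has trivial kernel by nondegeneracy.\<close>

lemma carrier_G_iff: "A \<in> carrier G \<longleftrightarrow> A \<in> carrier_mat n n \<and> (\<forall>u\<in>Vn n. \<forall>v\<in>Vn n. hL (opm A u) (opm A v) = hL u v)"
proof
  assume A: "A \<in> carrier G"
  then have Ac: "A \<in> carrier_mat n n" by (simp add: unitary_group_def)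
  have "hL (opm A u) (opm A v) = hL u v" if "u \<in> Vn n" "v \<in> Vn n" for u v
  proof (rule h_sesq_ext[OF opm_add opm_scale _ that])
    fix i j assume "i < n" "j < n"
    then show "hL (opm A (std i)) (opm A (std j)) = hL (std i) (std j)"
      using A Ac by (simp add: std_emb opm_emb h_emb unitary_group_def)
  qed
  then show "A \<in> carrier_mat n n \<and> (\<forall>u\<in>Vn n. \<forall>v\<in>Vn n. hL (opm A u) (opm A v) = hL u v)" using Ac by blast
next
  assume A: "A \<in> carrier_mat n n \<and> (\<forall>u\<in>Vn n. \<forall>v\<in>Vn n. hL (opm A u) (opm A v) = hL u v)"
  have pres: "herm_form n q c (A *\<^sub>v u) (A *\<^sub>v v) = herm_form n q c u v" if "u \<in> carrier_vec n" "v \<in> carrier_vec n" for u v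
  proof -
    have "to_ac (herm_form n q c (A *\<^sub>v u) (A *\<^sub>v v)) = hL (opm A (emb u)) (opm A (emb v))"
      using A that by (simp add: opm_emb h_emb mult_mat_vec_carrier[of A n n])
    also have "\<dots> = to_ac (herm_form n q c u v)" using A that emb_in by (simp add: h_emb)
    finally show ?thesis by simp
  qed
  have "det A \<noteq> 0"
  proof
    assume "det A = 0"
    then obtain v where v: "v \<in> carrier_vec n" "v \<noteq> 0\<^sub>v n" "A *\<^sub>v v = 0\<^sub>v n"
      using det_0_iff_vec_prod_zero_field[of A n] A by blast
    have "emb v = 0"
    proof (rule H.h_nondeg[OF emb_in])
      fix u :: "nat \<Rightarrow> 'a alg_closure" assume "u \<in> Vn n"
      then have "hL (emb v) u = hL (opm A (emb v)) (opm A u)" using A emb_in by simp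
      also have "opm A (emb v) = 0" using A v by (simp add: opm_emb emb_0)
      finally show "hL (emb v) u = 0" by (simp only: H.h_0)
    qed
    then show False using emb_inj[of v "0\<^sub>v n"] v emb_0 by simp
  qed
  then have "A \<in> Units (ring_mat TYPE('a) n ())" using det_non_zero_imp_unit[of A n "()"] A by simp
  then obtain C where "C \<in> carrier_mat n n" "C * A = 1\<^sub>m n" "A * C = 1\<^sub>m n"
    by (auto simp: Units_def ring_mat_def)
  then have "invertible_mat A" using A by (auto simp: invertible_mat_def inverts_mat_def)
  then show "A \<in> carrier G" using A pres by (simp add: unitary_group_def)
qed

lemma G_simps [simp]: "monoid.mult G = (*)" "one G = 1\<^sub>m n"
  by (simp_all add: unitary_group_def)

lemma G_carrier_mat: "A \<in> carrier G \<Longrightarrow> A \<in> carrier_mat n n" by (simp add: carrier_G_iff)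

lemma unit_op_opm: "A \<in> carrier G \<Longrightarrow> H.unit_op (opm A)"
  unfolding H.unit_op_def by (simp add: opm_add opm_scale opm_in opm_phi carrier_G_iff)

lemma unit_op_imp_opm:
  assumes "H.unit_op f" shows "\<exists>A\<in>carrier G. \<forall>v\<in>Vn n. f v = opm A v"
proof -
  obtain A where A: "A \<in> carrier_mat n n" "\<forall>v\<in>Vn n. f v = opm A v"
    using lin_phi_imp_opm[of f] assms by (auto simp: H.unit_op_def)
  then have "A \<in> carrier G" unfolding carrier_G_iff using assms by (auto simp: H.unit_op_def)
  then show ?thesis using A by blast
qed

lemma group_G: "group G"
proof (rule groupI)
  fix A C assume AC: "A \<in> carrier G" "C \<in> carrier G"
  then have m: "A \<in> carrier_mat n n" "C \<in> carrier_mat n n" using G_carrier_mat by auto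
  show "A \<otimes>\<^bsub>G\<^esub> C \<in> carrier G"
    using AC m unfolding carrier_G_iff by (simp add: opm_mult opm_in)
next
  show "\<one>\<^bsub>G\<^esub> \<in> carrier G" by (simp add: carrier_G_iff opm_one)
next
  fix A C D assume "A \<in> carrier G" "C \<in> carrier G" "D \<in> carrier G"
  then show "A \<otimes>\<^bsub>G\<^esub> C \<otimes>\<^bsub>G\<^esub> D = A \<otimes>\<^bsub>G\<^esub> (C \<otimes>\<^bsub>G\<^esub> D)"
    using G_carrier_mat by (simp add: assoc_mult_mat[of _ n n _ n _ n])
next
  fix A assume A: "A \<in> carrier G"
  then show "\<one>\<^bsub>G\<^esub> \<otimes>\<^bsub>G\<^esub> A = A" using G_carrier_mat[OF A] by simp
  have Ac: "A \<in> carrier_mat n n" using A G_carrier_mat by simp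
  obtain C where C: "inverts_mat A C" "inverts_mat C A" using A by (auto simp: unitary_group_def invertible_mat_def)
  have Cc: "C \<in> carrier_mat n n"
    using C Ac unfolding inverts_mat_def
    by (metis carrier_matD carrier_matI index_mult_mat(2,3) index_one_mat(2,3))
  have CA: "C * A = 1\<^sub>m n" "A * C = 1\<^sub>m n" using C Ac Cc by (auto simp: inverts_mat_def)
  have "hL (opm C u) (opm C v) = hL u v" if "u \<in> Vn n" "v \<in> Vn n" for u v
  proof -
    have "hL (opm C u) (opm C v) = hL (opm A (opm C u)) (opm A (opm C v))"
      using A opm_in unfolding carrier_G_iff by simp
    then show ?thesis using that Ac Cc CA(2) by (simp flip: opm_mult add: opm_one)
  qed
  then have "C \<in> carrier G" using Cc by (simp add: carrier_G_iff)
  then show "\<exists>C\<in>carrier G. C \<otimes>\<^bsub>G\<^esub> A = \<one>\<^bsub>G\<^esub>" using CA by auto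
qed

lemma finite_G: "finite (carrier G)"
  by (rule finite_subset[OF _ finite_carrier_mat[of n n]]) (auto simp: G_carrier_mat)

end

section \<open>Subspaces: scalar extension and rational points\<close>

context unitary_space
begin

lemma module_hom_fscale:
  fixes f :: "(nat \<Rightarrow> 'a alg_closure) \<Rightarrow> nat \<Rightarrow> 'a alg_closure"
  assumes "\<And>x y. f (x + y) = f x + f y" "\<And>k x. f (fscale k x) = fscale k (f x)"
  shows "module_hom fscale fscale f"
  by (simp add: module_hom_def module_hom_axioms_def fs.module_axioms assms)

text \<open>Extension of scalars; with \<open>ufix\<close>, taking rational points, it forms the
  inclusion-preserving descent correspondence between subspaces over the small field and
  \<open>phi\<close>-stable subspaces.\<close>

definition Ubar :: "'a vec set \<Rightarrow> (nat \<Rightarrow> 'a alg_closure) set" where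
  "Ubar U = fs.span (emb ` U)"

definition ufix :: "(nat \<Rightarrow> 'a alg_closure) set \<Rightarrow> 'a vec set" where
  "ufix W = {u \<in> carrier_vec n. emb u \<in> W}"

lemma ksub_carrier: "ksub n U \<Longrightarrow> U \<subseteq> carrier_vec n" by (simp add: ksub_def)

lemma emb_Ubar_iff:
  assumes U: "ksub n (U :: 'a vec set)" and v: "v \<in> carrier_vec n"
  shows "emb v \<in> Ubar U \<longleftrightarrow> v \<in> U"
proof
  assume "v \<in> U" then show "emb v \<in> Ubar U" unfolding Ubar_def by (intro fs.span_base) auto
next
  assume a: "emb v \<in> Ubar U"
  have "emb v \<in> emb ` U"
  proof (rule H.span_fixed[OF _ _ _ _ _ a[unfolded Ubar_def] phi_emb])
    show "emb ` U \<subseteq> Vn n" using emb_in by auto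
    show "0 \<in> emb ` U" using U emb_0 unfolding ksub_def by (metis imageI)
    show "phiL u = u" if "u \<in> emb ` U" for u using that phi_emb by auto
    show "u + w \<in> emb ` U" if "u \<in> emb ` U" "w \<in> emb ` U" for u w
    proof -
      obtain x y where "x \<in> U" "y \<in> U" "u = emb x" "w = emb y" using \<open>u \<in> _\<close> \<open>w \<in> _\<close> by auto
      then have "u + w = emb (x + y)" "x + y \<in> U" using U by (auto simp: ksub_def emb_add subset_iff)
      then show ?thesis by blast
    qed
    show "fscale k u \<in> emb ` U" if "u \<in> emb ` U" "k ^ (q\<^sup>2) = k" for u k
    proof -
      obtain x where x: "x \<in> U" "u = emb x" using \<open>u \<in> _\<close> by auto
      obtain k' where "k = to_ac k'" using range_to_ac_iff[OF primepow_q card_UNIV_q, of k] \<open>k ^ _ = k\<close> by auto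
      then have "fscale k u = emb (k' \<cdot>\<^sub>v x)" using x U by (auto simp: emb_smult ksub_def subset_iff)
      then show ?thesis using U x by (auto simp: ksub_def)
    qed
  qed
  then show "v \<in> U" using emb_inj[OF v] U unfolding ksub_def by auto
qed

lemma ufix_Ubar: "ksub n U \<Longrightarrow> ufix (Ubar U) = U"
  unfolding ufix_def using emb_Ubar_iff ksub_carrier by blast

lemma Ubar_subset_iff: "ksub n U \<Longrightarrow> ksub n U' \<Longrightarrow> Ubar U \<subseteq> Ubar U' \<longleftrightarrow> U \<subseteq> U'"
proof
  assume U: "ksub n U" "ksub n U'" "Ubar U \<subseteq> Ubar U'"
  then have "ufix (Ubar U) \<subseteq> ufix (Ubar U')" by (auto simp: ufix_def)
  then show "U \<subseteq> U'" using U by (simp add: ufix_Ubar)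
next
  assume "U \<subseteq> U'" then show "Ubar U \<subseteq> Ubar U'" unfolding Ubar_def by (intro fs.span_mono image_mono)
qed

lemma Ubar_inj: "ksub n U \<Longrightarrow> ksub n U' \<Longrightarrow> Ubar U = Ubar U' \<Longrightarrow> U = U'"
  using ufix_Ubar by metis

lemma ksub_carrier_vec: "ksub n (carrier_vec n)" by (simp add: ksub_def)

lemma ksub_zero: "ksub n {0\<^sub>v n}" by (auto simp: ksub_def)

lemma Ubar_zero: "Ubar {0\<^sub>v n} = {0}" by (simp add: Ubar_def emb_0)

lemma Ubar_eq_zero_iff: "ksub n U \<Longrightarrow> Ubar U = {0} \<longleftrightarrow> U = {0\<^sub>v n}"
  using Ubar_inj[of U "{0\<^sub>v n}"] ksub_zero Ubar_zero by auto

lemma Ubar_subset_V: "Ubar U \<subseteq> Vn n"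
  unfolding Ubar_def by (rule fs.span_minimal) (use emb_in subspace_Vn in auto)

lemma Ubar_isotropic:
  assumes U: "U \<subseteq> carrier_vec n" "\<And>u v. u \<in> U \<Longrightarrow> v \<in> U \<Longrightarrow> herm_form n q c u v = 0"
    and x: "x \<in> Ubar U" and y: "y \<in> Ubar U"
  shows "hL x y = 0"
proof -
  have 1: "hL x (emb v) = 0" if v: "v \<in> U" for v
  proof -
    have "fs.span (emb ` U) \<subseteq> {x. hL x (emb v) = 0}"
    proof (rule fs.span_minimal)
      show "emb ` U \<subseteq> {x. hL x (emb v) = 0}" using U v by (auto simp: h_emb subset_iff)
      show "fs.subspace {x. hL x (emb v) = 0}"
        unfolding fs.subspace_def by (auto simp: H.h_add_left H.h_scale_left)
    qed
    then show ?thesis using x by (auto simp: Ubar_def)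
  qed
  have "fs.span (emb ` U) \<subseteq> {y. hL x y = 0}"
  proof (rule fs.span_minimal)
    show "emb ` U \<subseteq> {y. hL x y = 0}" using 1 by auto
    show "fs.subspace {y. hL x y = 0}"
      unfolding fs.subspace_def using H.q2 by (auto simp: H.h_add_right H.h_scale_right)
  qed
  then show ?thesis using y by (auto simp: Ubar_def)
qed

lemma Ubar_image:
  assumes "g \<in> carrier_mat n n" "U \<subseteq> carrier_vec n"
  shows "opm g ` Ubar U = Ubar ((\<lambda>v. g *\<^sub>v v) ` U)"
proof -
  have "opm g ` emb ` U = emb ` (\<lambda>v. g *\<^sub>v v) ` U"
    unfolding image_image using assms by (intro image_cong) (auto simp: opm_emb subset_iff)
  then show ?thesis unfolding Ubar_def
    using module_hom.span_image[OF module_hom_fscale[of "opm g", OF opm_add opm_scale], of "emb ` U"] by simp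
qed

lemma Ubar_stab:
  assumes U: "ksub n U" and \<rho>: "\<And>A. A \<in> set \<rho> \<Longrightarrow> A \<in> carrier_mat n n"
    "\<And>A u. A \<in> set \<rho> \<Longrightarrow> u \<in> U \<Longrightarrow> A *\<^sub>v u \<in> U"
  shows "H.stab (map opm \<rho>) (Ubar U)"
  unfolding H.stab_def
proof (intro conjI ballI)
  show "fs.subspace (Ubar U)" by (simp add: Ubar_def)
  show "Ubar U \<subseteq> Vn n" by (rule Ubar_subset_V)
next
  fix w assume w: "w \<in> Ubar U"
  have "fs.span (emb ` U) \<subseteq> {x. phiL x \<in> Ubar U}"
  proof (rule fs.span_minimal)
    show "emb ` U \<subseteq> {x. phiL x \<in> Ubar U}" by (auto simp: phi_emb Ubar_def fs.span_base)
    show "fs.subspace {x. phiL x \<in> Ubar U}"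
      unfolding fs.subspace_def
      by (auto simp: H.phi_add H.phi_scale Ubar_def fs.span_zero fs.span_add fs.span_scale)
  qed
  then show "phiL w \<in> Ubar U" using w by (auto simp: Ubar_def)
next
  fix Y w assume "Y \<in> set (map opm \<rho>)" and w: "w \<in> Ubar U"
  then obtain A where A: "A \<in> set \<rho>" "Y = opm A" by auto
  have "opm A ` Ubar U = Ubar ((\<lambda>v. A *\<^sub>v v) ` U)"
    using \<rho>(1)[OF A(1)] ksub_carrier[OF U] by (rule Ubar_image)
  also have "\<dots> \<subseteq> Ubar U" unfolding Ubar_def using \<rho>(2)[OF A(1)] by (intro fs.span_mono) auto
  finally show "Y w \<in> Ubar U" using A w by auto
qed

lemma Ubar_ufix:
  assumes "H.stab \<rho> W" shows "Ubar (ufix W) = W" "ksub n (ufix W)"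
proof -
  have W: "fs.subspace W" "W \<subseteq> Vn n" using assms by (auto simp: H.stab_def)
  have "emb ` ufix W = {w \<in> W. phiL w = w}"
  proof (intro equalityI subsetI)
    fix x assume "x \<in> emb ` ufix W" then show "x \<in> {w \<in> W. phiL w = w}" by (auto simp: ufix_def phi_emb)
  next
    fix x assume "x \<in> {w \<in> W. phiL w = w}"
    then show "x \<in> emb ` ufix W" using fixed_imp_emb[of x] W by (auto simp: ufix_def)
  qed
  then show "Ubar (ufix W) = W" unfolding Ubar_def using H.stab_eq_span_fixed[OF assms] by simp
  show "ksub n (ufix W)" unfolding ksub_def ufix_def using W(1)
    by (auto simp: emb_0 emb_add emb_smult fs.subspace_0 fs.subspace_add fs.subspace_scale)
qed

lemma isotropic_iff:
  "U \<in> isotropic_subspaces n q c \<longleftrightarrow>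
     ksub n U \<and> U \<noteq> {0\<^sub>v n} \<and> (\<forall>u\<in>U. \<forall>v\<in>U. herm_form n q c u v = 0)"
  unfolding isotropic_subspaces_def herm_perp_def by (auto simp: subspace_iff_ksub ksub_def subset_iff)

lemma finite_isotropic: "finite (isotropic_subspaces n q c)"
  by (rule finite_subset[of _ "Pow (carrier_vec n)"]) (auto simp: isotropic_iff ksub_def finite_carrier_vec)

lemma G_mult_vec: "A \<in> carrier G \<Longrightarrow> C \<in> carrier G \<Longrightarrow> v \<in> carrier_vec n \<Longrightarrow> (A * C) *\<^sub>v v = A *\<^sub>v (C *\<^sub>v v)"
  using G_carrier_mat by (simp add: assoc_mult_mat_vec[of _ n n _ n])

lemma G_image_mult:
  assumes "A \<in> carrier G" "C \<in> carrier G" "U \<subseteq> carrier_vec n"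
  shows "(\<lambda>v. (A * C) *\<^sub>v v) ` U = (\<lambda>v. A *\<^sub>v v) ` (\<lambda>v. C *\<^sub>v v) ` U"
  unfolding image_image using assms G_mult_vec by (intro image_cong) auto

lemma G_image_one: "U \<subseteq> carrier_vec n \<Longrightarrow> (\<lambda>v. (1\<^sub>m n :: 'a mat) *\<^sub>v v) ` U = U"
  by (auto simp: subset_iff image_iff)

lemma G_image_inv:
  assumes "A \<in> carrier G" "U \<subseteq> carrier_vec n"
  shows "(\<lambda>v. (inv\<^bsub>G\<^esub> A) *\<^sub>v v) ` (\<lambda>v. A *\<^sub>v v) ` U = U"
    "(\<lambda>v. A *\<^sub>v v) ` (\<lambda>v. (inv\<^bsub>G\<^esub> A) *\<^sub>v v) ` U = U"
  using assms G_image_mult[of "inv\<^bsub>G\<^esub> A" A U] G_image_mult[of A "inv\<^bsub>G\<^esub> A" U]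
    group.l_inv[OF group_G assms(1)] group.r_inv[OF group_G assms(1)] group.inv_closed[OF group_G assms(1)]
  by (simp_all add: G_image_one)

lemma invariant_generate:
  assumes S: "S \<subseteq> carrier G"
  shows "invariant_subposet (isotropic_subspaces n q c) (generate G S) =
    invariant_subposet (isotropic_subspaces n q c) S"
proof -
  have gen: "(\<lambda>v. A *\<^sub>v v) ` U = U"
    if U: "U \<subseteq> carrier_vec n" "\<And>A. A \<in> S \<Longrightarrow> (\<lambda>v. A *\<^sub>v v) ` U = U" and A: "A \<in> generate G S" for U A
    using A
  proof (induction rule: generate.induct)
    case one then show ?case using G_image_one[OF U(1)] by simp
  next
    case (incl h) then show ?case by (rule U(2))
  next
    case (inv h)
    have "h \<in> carrier G" using inv S by blast
    from G_image_inv(1)[OF this U(1)] U(2)[OF inv] show ?case by simp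
  next
    case (eng h1 h2)
    have "h1 \<in> carrier G" "h2 \<in> carrier G"
      using eng(1,2) group.generate_in_carrier[OF group_G S] by auto
    from G_image_mult[OF this U(1)] eng(3,4) show ?case by simp
  qed
  have "(\<forall>A\<in>generate G S. (\<lambda>v. A *\<^sub>v v) ` U = U) \<longleftrightarrow> (\<forall>A\<in>S. (\<lambda>v. A *\<^sub>v v) ` U = U)"
    if "U \<in> isotropic_subspaces n q c" for U
  proof
    assume "\<forall>A\<in>generate G S. (\<lambda>v. A *\<^sub>v v) ` U = U"
    then show "\<forall>A\<in>S. (\<lambda>v. A *\<^sub>v v) ` U = U" using generate.incl[of _ S G] by fast
  next
    assume *: "\<forall>A\<in>S. (\<lambda>v. A *\<^sub>v v) ` U = U"
    have Uc: "U \<subseteq> carrier_vec n" using that by (simp add: isotropic_iff ksub_def)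
    show "\<forall>A\<in>generate G S. (\<lambda>v. A *\<^sub>v v) ` U = U"
    proof
      fix A assume "A \<in> generate G S"
      then show "(\<lambda>v. A *\<^sub>v v) ` U = U" by (rule gen[OF Uc *[rule_format], rotated])
    qed
  qed
  then show ?thesis unfolding invariant_subposet_def by blast
qed

definition inv_iso :: "'a mat list \<Rightarrow> 'a vec set set" where
  "inv_iso \<rho> = invariant_subposet (isotropic_subspaces n q c) (set \<rho>)"

lemma inv_iso_iff:
  "U \<in> inv_iso \<rho> \<longleftrightarrow> ksub n U \<and> U \<noteq> {0\<^sub>v n} \<and> (\<forall>u\<in>U. \<forall>v\<in>U. herm_form n q c u v = 0) \<and>
     (\<forall>A\<in>set \<rho>. (\<lambda>v. A *\<^sub>v v) ` U = U)"
  by (auto simp: inv_iso_def invariant_subposet_def isotropic_iff)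

lemma inv_iso_Cons: "U \<in> inv_iso (A # \<rho>) \<longleftrightarrow> U \<in> inv_iso \<rho> \<and> (\<lambda>v. A *\<^sub>v v) ` U = U"
  unfolding inv_iso_iff by (simp only: list.set ball_simps conj_ac)

lemma finite_inv_iso: "finite (inv_iso \<rho>)"
  using finite_isotropic unfolding inv_iso_def invariant_subposet_def by simp

definition ptuples :: "nat \<Rightarrow> nat \<Rightarrow> 'a mat list set" where
  "ptuples p r = {\<rho>. length \<rho> = r \<and> set \<rho> \<subseteq> carrier G \<and> (\<forall>A\<in>set \<rho>. \<forall>C\<in>set \<rho>. A * C = C * A) \<and>
     (\<forall>A\<in>set \<rho>. \<exists>k. group.ord G A = p ^ k)}"

definition centr :: "'a mat list \<Rightarrow> 'a mat set" where
  "centr \<rho> = {A \<in> carrier G. \<forall>C\<in>set \<rho>. A * C = C * A}"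

text \<open>The entry without a condition on its order is split off, leaving an r-tuple of
  p-elements and an arbitrary element of its centraliser.\<close>

lemma hom_tuples_Suc: "hom_tuples p (Suc r) G = (\<lambda>(\<rho>, A). A # \<rho>) ` (SIGMA \<rho>:ptuples p r. centr \<rho>)"
proof (intro equalityI subsetI)
  fix Xs assume Xs: "Xs \<in> hom_tuples p (Suc r) G"
  then obtain A \<rho> where e: "Xs = A # \<rho>" by (cases Xs) (auto simp: hom_tuples_def)
  have "\<rho> \<in> ptuples p r" "A \<in> centr \<rho>"
    using Xs unfolding e hom_tuples_def ptuples_def centr_def mem_Collect_eq G_simps list.set list.sel length_Cons nat.inject
    by blast+
  then show "Xs \<in> (\<lambda>(\<rho>, A). A # \<rho>) ` (SIGMA \<rho>:ptuples p r. centr \<rho>)" unfolding e by (intro image_eqI[of _ _ "(\<rho>, A)"]) auto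
next
  fix Xs assume "Xs \<in> (\<lambda>(\<rho>, A). A # \<rho>) ` (SIGMA \<rho>:ptuples p r. centr \<rho>)"
  then obtain A \<rho> where e: "Xs = A # \<rho>" and "\<rho> \<in> ptuples p r" "A \<in> centr \<rho>" by auto
  then have l: "length \<rho> = r" "set \<rho> \<subseteq> carrier G" "A \<in> carrier G" "\<forall>A\<in>set \<rho>. \<exists>k. group.ord G A = p ^ k"
    and cm: "\<And>C D. C \<in> set \<rho> \<Longrightarrow> D \<in> set \<rho> \<Longrightarrow> C * D = D * C" "\<And>C. C \<in> set \<rho> \<Longrightarrow> A * C = C * A"
    unfolding ptuples_def centr_def mem_Collect_eq by blast+
  have "C * D = D * C" if "C \<in> insert A (set \<rho>)" "D \<in> insert A (set \<rho>)" for C D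
    using that(1)
  proof
    assume C: "C = A" then show ?thesis using that(2) cm(2) by (cases "D = A") simp_all
  next
    assume C: "C \<in> set \<rho>"
    show ?thesis using that(2)
    proof
      assume "D = A" then show ?thesis using cm(2)[OF C] by simp
    next
      assume "D \<in> set \<rho>" then show ?thesis by (rule cm(1)[OF C])
    qed
  qed
  then show "Xs \<in> hom_tuples p (Suc r) G"
    unfolding e hom_tuples_def mem_Collect_eq G_simps list.set list.sel length_Cons nat.inject
    using l by (intro conjI ballI) simp_all
qed

lemma finite_ptuples: "finite (ptuples p r)"
  by (rule finite_subset[OF _ finite_lists_length_eq[OF finite_G, of r]]) (auto simp: ptuples_def)

lemma finite_centr: "finite (centr \<rho>)" using finite_G by (auto simp: centr_def)

definition pairs :: "nat \<Rightarrow> nat \<Rightarrow> ('a mat list \<times> 'a vec set set) set" where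
  "pairs p r = (SIGMA \<rho>:ptuples p r. {C. C \<subseteq> inv_iso \<rho> \<and> Complete_Partial_Order.chain (\<le>) C})"

lemma finite_pairs: "finite (pairs p r)"
  unfolding pairs_def by (intro finite_SigmaI finite_ptuples finite_chains finite_inv_iso)

lemma sum_hom_tuples_Sigma:
  "(\<Sum>Xs\<in>hom_tuples p (Suc r) G. esum (\<le>) (invariant_subposet (isotropic_subspaces n q c) (generate G (set Xs)))) =
    (\<Sum>\<rho>\<in>ptuples p r. \<Sum>A\<in>centr \<rho>. esum (\<le>) (inv_iso (A # \<rho>)))"
proof -
  have inj: "inj_on (\<lambda>(\<rho>, A). A # \<rho>) (SIGMA \<rho>:ptuples p r. centr \<rho>)" by (auto simp: inj_on_def)
  have "(\<Sum>Xs\<in>hom_tuples p (Suc r) G. esum (\<le>) (invariant_subposet (isotropic_subspaces n q c) (generate G (set Xs)))) =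
      (\<Sum>Xs\<in>hom_tuples p (Suc r) G. esum (\<le>) (inv_iso Xs))"
    by (intro sum.cong refl) (auto simp: hom_tuples_def invariant_generate inv_iso_def)
  also have "\<dots> = (\<Sum>(\<rho>, A)\<in>(SIGMA \<rho>:ptuples p r. centr \<rho>). esum (\<le>) (inv_iso (A # \<rho>)))"
    unfolding hom_tuples_Suc by (subst sum.reindex[OF inj]) (simp add: case_prod_unfold)
  also have "\<dots> = (\<Sum>\<rho>\<in>ptuples p r. \<Sum>A\<in>centr \<rho>. esum (\<le>) (inv_iso (A # \<rho>)))"
    using finite_ptuples finite_centr by (subst sum.Sigma) auto
  finally show ?thesis .
qed

text \<open>Exchanging the sum over A with the sum over chains leaves, for each tuple with an
  invariant chain, the number of centralising elements that preserve every member: the order of a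
  stabiliser, as \<open>weighted_burnside\<close> requires.\<close>

lemma sum_hom_tuples:
  "(\<Sum>Xs\<in>hom_tuples p (Suc r) G. esum (\<le>) (invariant_subposet (isotropic_subspaces n q c) (generate G (set Xs)))) =
    (\<Sum>(\<rho>, C)\<in>pairs p r. (-1) ^ card C * int (card {A \<in> centr \<rho>. \<forall>U\<in>C. (\<lambda>v. A *\<^sub>v v) ` U = U}))"
proof -
  have "(\<Sum>\<rho>\<in>ptuples p r. \<Sum>A\<in>centr \<rho>. esum (\<le>) (inv_iso (A # \<rho>))) =
      (\<Sum>\<rho>\<in>ptuples p r. \<Sum>C\<in>{C. C \<subseteq> inv_iso \<rho> \<and> Complete_Partial_Order.chain (\<le>) C}.
      (-1) ^ card C * int (card {A \<in> centr \<rho>. \<forall>U\<in>C. (\<lambda>v. A *\<^sub>v v) ` U = U}))"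
  proof (intro sum.cong refl)
    fix \<rho> assume "\<rho> \<in> ptuples p r"
    let ?K = "{C. C \<subseteq> inv_iso \<rho> \<and> Complete_Partial_Order.chain (\<le>) C}"
    have finK: "finite ?K" by (rule finite_chains[OF finite_inv_iso])
    have "(\<Sum>A\<in>centr \<rho>. esum (\<le>) (inv_iso (A # \<rho>))) =
        (\<Sum>A\<in>centr \<rho>. \<Sum>C\<in>?K. if \<forall>U\<in>C. (\<lambda>v. A *\<^sub>v v) ` U = U then (-1) ^ card C else 0)"
    proof (intro sum.cong refl)
      fix A assume "A \<in> centr \<rho>"
      have "{C. C \<subseteq> inv_iso (A # \<rho>) \<and> Complete_Partial_Order.chain (\<le>) C} =
          {C \<in> ?K. \<forall>U\<in>C. (\<lambda>v. A *\<^sub>v v) ` U = U}"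
      proof -
        define P where "P U \<longleftrightarrow> (\<lambda>v. A *\<^sub>v v) ` U = U" for U
        have "U \<in> inv_iso (A # \<rho>) \<longleftrightarrow> U \<in> inv_iso \<rho> \<and> P U" for U unfolding P_def by (rule inv_iso_Cons)
        then have "{C. C \<subseteq> inv_iso (A # \<rho>) \<and> Complete_Partial_Order.chain (\<le>) C} = {C \<in> ?K. \<forall>U\<in>C. P U}" by blast
        then show ?thesis unfolding P_def .
      qed
      then show "esum (\<le>) (inv_iso (A # \<rho>)) = (\<Sum>C\<in>?K. if \<forall>U\<in>C. (\<lambda>v. A *\<^sub>v v) ` U = U then (-1) ^ card C else 0)"
        unfolding esum_def by (simp only: sum.inter_filter[OF finK])
    qed
    also have "\<dots> = (\<Sum>C\<in>?K. \<Sum>A\<in>centr \<rho>. if \<forall>U\<in>C. (\<lambda>v. A *\<^sub>v v) ` U = U then (-1) ^ card C else 0)"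
      by (rule sum.swap)
    also have "\<dots> = (\<Sum>C\<in>?K. (-1) ^ card C * int (card {A \<in> centr \<rho>. \<forall>U\<in>C. (\<lambda>v. A *\<^sub>v v) ` U = U}))"
      by (intro sum.cong refl, subst sum.inter_filter[OF finite_centr, symmetric])
        (simp only: sum_constant of_nat_mult mult.commute of_nat_id)
    finally show "(\<Sum>A\<in>centr \<rho>. esum (\<le>) (inv_iso (A # \<rho>))) =
      (\<Sum>C\<in>?K. (-1) ^ card C * int (card {A \<in> centr \<rho>. \<forall>U\<in>C. (\<lambda>v. A *\<^sub>v v) ` U = U}))" .
  qed
  also have "\<dots> = (\<Sum>(\<rho>, C)\<in>pairs p r. (-1) ^ card C * int (card {A \<in> centr \<rho>. \<forall>U\<in>C. (\<lambda>v. A *\<^sub>v v) ` U = U}))"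
    unfolding pairs_def using finite_ptuples finite_chains[OF finite_inv_iso] by (subst sum.Sigma) auto
  finally show ?thesis unfolding sum_hom_tuples_Sigma .
qed

definition act :: "'a mat \<Rightarrow> 'a mat list \<times> 'a vec set set \<Rightarrow> 'a mat list \<times> 'a vec set set" where
  "act g w = (map (\<lambda>A. g * A * inv\<^bsub>G\<^esub> g) (fst w), (\<lambda>U. (\<lambda>v. g *\<^sub>v v) ` U) ` snd w)"

lemma G_conj_eq_iff:
  assumes "g \<in> carrier G" "A \<in> carrier G" "A' \<in> carrier G"
  shows "g * A * inv\<^bsub>G\<^esub> g = A' \<longleftrightarrow> g * A = A' * g"
proof -
  interpret group G by (rule group_G)
  have "(g \<otimes>\<^bsub>G\<^esub> A) \<otimes>\<^bsub>G\<^esub> inv\<^bsub>G\<^esub> g = A' \<longleftrightarrow> g \<otimes>\<^bsub>G\<^esub> A = A' \<otimes>\<^bsub>G\<^esub> g"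
    by (rule inv_solve_right') (use assms m_closed in blast)+
  then show ?thesis by (simp only: G_simps)
qed

lemma ksub_image:
  assumes "g \<in> carrier_mat n n" "ksub n U" shows "ksub n ((\<lambda>v. g *\<^sub>v v) ` U)"
proof -
  have s: "\<And>u. u \<in> U \<Longrightarrow> u \<in> carrier_vec n" using assms(2) by (auto simp: ksub_def)
  have 0: "0\<^sub>v n = g *\<^sub>v 0\<^sub>v n" using assms(1) by (intro eq_vecI) (auto simp: scalar_prod_def)
  show ?thesis unfolding ksub_def
  proof (intro conjI ballI allI)
    show "(\<lambda>v. g *\<^sub>v v) ` U \<subseteq> carrier_vec n" using s assms(1) by (auto intro!: mult_mat_vec_carrier)
    show "0\<^sub>v n \<in> (\<lambda>v. g *\<^sub>v v) ` U" using assms(2) 0 unfolding ksub_def by blast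
  next
    fix u v assume "u \<in> (\<lambda>v. g *\<^sub>v v) ` U" "v \<in> (\<lambda>v. g *\<^sub>v v) ` U"
    then obtain x y where xy: "x \<in> U" "y \<in> U" "u = g *\<^sub>v x" "v = g *\<^sub>v y" by auto
    then have "u + v = g *\<^sub>v (x + y)" using mult_add_distrib_mat_vec[OF assms(1) s s] by simp
    then show "u + v \<in> (\<lambda>v. g *\<^sub>v v) ` U" using xy assms(2) unfolding ksub_def by blast
  next
    fix k u assume "u \<in> (\<lambda>v. g *\<^sub>v v) ` U"
    then obtain x where xy: "x \<in> U" "u = g *\<^sub>v x" by auto
    then have "k \<cdot>\<^sub>v u = g *\<^sub>v (k \<cdot>\<^sub>v x)" using mult_mat_vec[OF assms(1) s] by simp
    then show "k \<cdot>\<^sub>v u \<in> (\<lambda>v. g *\<^sub>v v) ` U" using xy assms(2) unfolding ksub_def by blast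
  qed
qed

end

section \<open>Realising a chain of types by index sets\<close>

lemma count_image_mset_set:
  "finite A \<Longrightarrow> count (image_mset f (mset_set A)) x = card {i \<in> A. f i = x}"
  by (simp add: count_image_mset Int_def conj_commute vimage_def)

lemma image_mset_mset_set_bij:
  assumes "bij_betw b A A'" shows "image_mset (\<lambda>i. f (b i)) (mset_set A) = image_mset f (mset_set A')"
proof -
  have "image_mset b (mset_set A) = mset_set A'"
    using assms image_mset_mset_set[of b A] by (simp add: bij_betw_def)
  then show ?thesis by (metis (no_types, lifting) multiset.map_comp o_def multiset.map_cong0)
qed

context periodic_map
begin

lemma count_image_s: "count (image_mset s w) (s x) = count w x"
  by (induction w) (auto dest: s_inj)

lemma top_isotype:
  assumes D: "finite D" "Complete_Partial_Order.chain (\<subseteq>#) D" "D \<subseteq> isotypes w"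
  obtains F where "image_mset (s \<circ> s) F = F" "F + image_mset s F \<subseteq># w" "\<And>f. f \<in> D \<Longrightarrow> f \<subseteq># F"
proof (cases "D = {}")
  case True
  then show ?thesis using that[of "{#}"] by simp
next
  case False
  have "Complete_Partial_Order.chain (\<lambda>x y. y \<subseteq># x) D" using D(2) by (auto simp: chain_def)
  from chain_least[OF D(1) False this] obtain F where "F \<in> D" "\<forall>f\<in>D. f \<subseteq># F"
    by (meson subset_mset.order_trans)
  then show ?thesis using D(3) that[of F] by (auto simp: isotypes_def)
qed

text \<open>With F the largest type of the chain, w splits into F, its image under s, and an
  s-stable rest R. Multiset elements are made into distinct cells (x, layer, i), and the lift of s
  swaps the first two layers. Initial segments of layer 0 then represent the members of the chain,
  nested automatically, and moving one step leaves layer 0.\<close>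

lemma realize:
  assumes w: "w \<in> stable n" and D: "D \<subseteq> isotypes w" "Complete_Partial_Order.chain (\<subseteq>#) D"
  obtains \<sigma> \<chi> A where "\<sigma> permutes {..<n}" "\<And>i. i < n \<Longrightarrow> \<chi> (\<sigma> i) = s (\<chi> i)"
    "image_mset \<chi> (mset_set {..<n}) = w" "\<And>f. f \<in> D \<Longrightarrow> A f \<subseteq> {..<n}"
    "\<And>f. f \<in> D \<Longrightarrow> image_mset \<chi> (mset_set (A f)) = f"
    "\<And>f i. f \<in> D \<Longrightarrow> i \<in> A f \<Longrightarrow> \<sigma> (\<sigma> i) \<in> A f" "\<And>f i. f \<in> D \<Longrightarrow> i \<in> A f \<Longrightarrow> \<sigma> i \<notin> A f"
    "\<And>f f'. f \<in> D \<Longrightarrow> f' \<in> D \<Longrightarrow> f \<subseteq># f' \<Longrightarrow> A f \<subseteq> A f'"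
proof -
  have finD: "finite D" using D(1) finite_isotypes finite_subset by blast
  obtain F where F: "image_mset (s \<circ> s) F = F" "F + image_mset s F \<subseteq># w" "\<And>f. f \<in> D \<Longrightarrow> f \<subseteq># F"
    using top_isotype[OF finD D(2,1)] by blast
  have sw: "image_mset s w = w" "size w = n" using w by (auto simp: stable_def)
  define R where "R = w - (F + image_mset s F)"
  have FF: "image_mset s (image_mset s F) = F" using F(1) by (simp add: multiset.map_comp)
  have wR: "w = F + image_mset s F + R" using F(2) by (simp add: R_def)
  have sR: "image_mset s R = R"
    unfolding R_def using F(2) sw(1) FF by (simp add: image_mset_Diff add.commute)
  \<comment> \<open>Layer 0 holds F, layer 1 its image, layer 2 the rest; \<open>a x j\<close> is
    the number of cells over x in layer j.\<close>
  define a where "a x j = (if j = 0 then count F x else if j = 1 then count (image_mset s F) x else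
      if j = 2 then count R x else 0)" for x and j :: nat
  define \<tau> :: "nat \<Rightarrow> nat" where "\<tau> j = (if j = 0 then 1 else if j = 1 then 0 else j)" for j
  define I where "I b = {(x, j, i). j < (3::nat) \<and> i < (b x j :: nat)}" for b :: "'c \<Rightarrow> nat \<Rightarrow> nat"
  define g where "g f x j = (if j = (0::nat) then count f x else 0)" for f :: "'c multiset" and x j
  have fib: "{y \<in> I b. fst y = x} = Pair x ` (SIGMA j:{..<3}. {..<b x j})" for b x
    by (auto simp: I_def)
  have cardfib: "card {y \<in> I b. fst y = x} = b x 0 + b x 1 + b x 2" for b x
    unfolding fib by (subst card_image) (auto simp: inj_on_def numeral_3_eq_3 lessThan_Suc numeral_2_eq_2)
  have fin: "finite (I b)" if "\<And>x j. b x j \<le> a x j" for b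
  proof (rule finite_subset)
    show "I b \<subseteq> (\<Union>x\<in>set_mset w. {y \<in> I b. fst y = x})"
    proof
      fix y assume y: "y \<in> I b"
      then obtain x j i where "y = (x, j, i)" "i < b x j" by (auto simp: I_def)
      then have "a x j > 0" using that[of x j] by simp
      then have "x \<in># w" unfolding wR by (auto simp: a_def split: if_splits)
      then show "y \<in> (\<Union>x\<in>set_mset w. {y \<in> I b. fst y = x})" using y \<open>y = _\<close> by auto
    qed
    show "finite (\<Union>x\<in>set_mset w. {y \<in> I b. fst y = x})" unfolding fib by auto
  qed
  have ga: "g f x j \<le> a x j" if "f \<in> D" for f x j
    using F(3)[OF that] by (auto simp: g_def a_def mset_subset_eq_count)
  note finI = fin[of a, OF order_refl] and fing = fin[of "g _", OF ga]
  have ims: "image_mset fst (mset_set (I a)) = w"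
    by (rule multiset_eqI, subst wR) (simp add: count_image_mset_set[OF finI] cardfib a_def)
  have img: "image_mset fst (mset_set (I (g f))) = f" if "f \<in> D" for f
    by (rule multiset_eqI) (simp add: count_image_mset_set[OF fing[OF that]] cardfib g_def)
  have cardI: "card (I a) = n" using arg_cong[OF ims, of size] sw(2) by simp
  define S where "S y = (s (fst y), \<tau> (fst (snd y)), snd (snd y))" for y :: "'c \<times> nat \<times> nat"
  have a\<tau>: "a (s x) (\<tau> j) = a x j" for x j
  proof -
    have "count (image_mset s F) (s x) = count F x" "count F (s x) = count (image_mset s F) x"
      "count R (s x) = count R x"
      using count_image_s[of F x] count_image_s[of "image_mset s F" x] count_image_s[of R x] FF sR by simp_all
    then show ?thesis by (simp add: a_def \<tau>_def)
  qed
  have S_I: "S y \<in> I a" if "y \<in> I a" for y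
  proof -
    obtain x j i where y: "y = (x, j, i)" "j < 3" "i < a x j" using \<open>y \<in> I a\<close> by (auto simp: I_def)
    have "\<tau> j < 3" using y(2) by (auto simp: \<tau>_def)
    then show ?thesis using y a\<tau>[of x j] by (simp add: S_def I_def)
  qed
  have \<tau>\<tau>: "\<tau> (\<tau> j) = j" for j by (simp add: \<tau>_def)
  have S_inj: "inj S"
  proof
    fix y y' assume "S y = S y'"
    then have "s (fst y) = s (fst y')" "\<tau> (fst (snd y)) = \<tau> (fst (snd y'))" "snd (snd y) = snd (snd y')"
      by (auto simp: S_def)
    then show "y = y'" using s_inj \<tau>\<tau> by (metis prod.collapse)
  qed
  have SSg: "S (S y) \<in> I (g f)" "S y \<notin> I (g f)" if f: "f \<in> D" and y: "y \<in> I (g f)" for f y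
  proof -
    obtain x i where x: "y = (x, 0, i)" "i < count f x" using y by (auto simp: I_def g_def split: if_splits)
    have "image_mset s (image_mset s f) = f" using f D(1) by (auto simp: isotypes_def multiset.map_comp)
    then have "count f (s (s x)) = count f x"
      using count_image_s[of "image_mset s f" "s x"] count_image_s[of f x] by simp
    then show "S (S y) \<in> I (g f)" "S y \<notin> I (g f)" using x by (auto simp: S_def \<tau>_def I_def g_def)
  qed
  have bijS: "bij_betw S (I a) (I a)"
    unfolding bij_betw_def using endo_inj_surj[OF finI, of S] S_I inj_on_subset[OF S_inj subset_UNIV, of "I a"] by blast
  \<comment> \<open>There are n cells in total, so they can be numbered; the permutation and the
    index sets are transported along this numbering.\<close>
  obtain \<beta> where \<beta>: "bij_betw \<beta> {..<n} (I a)"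
    using ex_bij_betw_nat_finite[OF finI] by (auto simp: cardI atLeast0LessThan)
  define \<gamma> where "\<gamma> = inv_into {..<n} \<beta>"
  have \<gamma>: "bij_betw \<gamma> (I a) {..<n}" "\<And>y. y \<in> I a \<Longrightarrow> \<beta> (\<gamma> y) = y" "\<And>i. i < n \<Longrightarrow> \<gamma> (\<beta> i) = i"
    using bij_betw_inv_into[OF \<beta>] bij_betw_inv_into_right[OF \<beta>] bij_betw_inv_into_left[OF \<beta>] by (auto simp: \<gamma>_def)
  have \<beta>I: "\<beta> i \<in> I a" if "i < n" for i using \<beta> that by (auto simp: bij_betw_def)
  have \<gamma>n: "\<gamma> y < n" if "y \<in> I a" for y using \<gamma>(1) that by (auto simp: bij_betw_def)
  define \<sigma> where "\<sigma> i = (if i < n then \<gamma> (S (\<beta> i)) else i)" for i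
  define A where "A f = \<gamma> ` I (g f)" for f
  have gI: "I (g f) \<subseteq> I a" if "f \<in> D" for f
  proof -
    have "i < a x j" if "i < g f x j" for x j i using ga[OF \<open>f \<in> D\<close>, of x j] that by linarith
    then show ?thesis by (auto simp: I_def)
  qed
  have \<beta>\<sigma>: "\<beta> (\<sigma> i) = S (\<beta> i)" if "i < n" for i
    using that \<gamma>(2)[OF S_I[OF \<beta>I[OF that]]] by (simp add: \<sigma>_def)
  have \<sigma>n: "\<sigma> i < n" if "i < n" for i using that \<gamma>n[OF S_I[OF \<beta>I[OF that]]] by (simp add: \<sigma>_def)
  have A_iff: "i \<in> A f \<longleftrightarrow> i < n \<and> \<beta> i \<in> I (g f)" if "f \<in> D" for f i
  proof
    assume "i \<in> A f"
    then obtain y where y: "y \<in> I (g f)" "i = \<gamma> y" by (auto simp: A_def)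
    then show "i < n \<and> \<beta> i \<in> I (g f)" using \<gamma>n \<gamma>(2) subsetD[OF gI[OF that] y(1)] by simp
  next
    assume i: "i < n \<and> \<beta> i \<in> I (g f)"
    then show "i \<in> A f" unfolding A_def using \<gamma>(3)[of i] by (intro image_eqI[of _ _ "\<beta> i"]) simp_all
  qed
  show ?thesis
  proof (rule that[of \<sigma> "\<lambda>i. fst (\<beta> i)" A])
    show "\<sigma> permutes {..<n}"
    proof (rule bij_imp_permutes)
      have "bij_betw (\<lambda>i. \<gamma> (S (\<beta> i))) {..<n} {..<n}"
        using bij_betw_trans[OF bij_betw_trans[OF \<beta> bijS] \<gamma>(1)] by (simp add: o_def)
      then show "bij_betw \<sigma> {..<n} {..<n}" by (rule bij_betw_cong[THEN iffD1, rotated]) (simp add: \<sigma>_def)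
    qed (simp add: \<sigma>_def)
    show "fst (\<beta> (\<sigma> i)) = s (fst (\<beta> i))" if "i < n" for i using \<beta>\<sigma>[OF that] by (simp add: S_def)
    show "image_mset (\<lambda>i. fst (\<beta> i)) (mset_set {..<n}) = w"
      using image_mset_mset_set_bij[OF \<beta>, of fst] ims by simp
  next
    fix f assume f: "f \<in> D"
    show "A f \<subseteq> {..<n}" using A_iff[OF f] by auto
    have "bij_betw \<beta> (A f) (I (g f))"
      using gI[OF f] \<gamma>(2) unfolding A_def
      by (intro bij_betwI[where g = \<gamma>]) (auto simp: subset_iff)
    from image_mset_mset_set_bij[OF this, of fst]
    show "image_mset (\<lambda>i. fst (\<beta> i)) (mset_set (A f)) = f" using img[OF f] by simp
    fix i assume "i \<in> A f"
    then have i: "i < n" "\<beta> i \<in> I (g f)" using A_iff[OF f] by auto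
    show "\<sigma> (\<sigma> i) \<in> A f" "\<sigma> i \<notin> A f"
      unfolding A_iff[OF f] using i \<sigma>n[OF i(1)] \<sigma>n[OF \<sigma>n[OF i(1)]] \<beta>\<sigma>[OF i(1)] \<beta>\<sigma>[OF \<sigma>n[OF i(1)]] SSg[OF f i(2)] by simp_all
  next
    fix f f' assume f: "f \<in> D" "f' \<in> D" "f \<subseteq># f'"
    have "count f x \<le> count f' x" for x using f(3) by (rule mset_subset_eq_count)
    then have "I (g f) \<subseteq> I (g f')" by (force simp: I_def g_def split: if_splits intro: less_le_trans)
    then show "A f \<subseteq> A f'" by (auto simp: A_def)
  qed
qed

end

section \<open>Invariance of types under unitary operators\<close>

context herm_space
begin

lemma eigsys_transport:
  assumes rep: "rep \<rho>" and es: "eigsys \<rho> s \<chi> e" and g: "unit_op g" and len: "length \<rho> = length \<rho>'"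
    and eq: "\<And>t v. t < length \<rho> \<Longrightarrow> v \<in> V \<Longrightarrow> g ((\<rho> ! t) v) = (\<rho>' ! t) (g v)"
  shows "eigsys \<rho>' s \<chi> (g \<circ> e)"
proof -
  note E = es_simps[OF rep es]
  have V: "v \<in> V \<Longrightarrow> g v \<in> V" and ph: "v \<in> V \<Longrightarrow> phi (g v) = g (phi v)"
    and hh: "u \<in> V \<Longrightarrow> v \<in> V \<Longrightarrow> h (g u) (g v) = h u v" for u v using g by (auto simp: unit_op_def)
  have ev: "e i \<in> V" if "i < card B" for i using E(6) that .
  show ?thesis unfolding eigsys_def sys_def
  proof (intro conjI allI impI ballI)
    show "bij_betw s {..<card B} {..<card B}" by (rule E(1))
    fix i assume i: "i < card B"
    show "(g \<circ> e) i \<in> Eig \<rho>' (\<chi> i)"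
      using E(2)[OF i] V[OF ev[OF i]] len eq[OF _ ev[OF i]] unit_op_lin(2)[OF g] unfolding Eig_def
      by (simp flip: eq add: ev[OF i])
    show "phi ((g \<circ> e) i) = (g \<circ> e) (s (s i))" using E(3)[OF i] ph[OF ev[OF i]] by simp
    fix j assume j: "j < card B"
    show "h ((g \<circ> e) (s i)) ((g \<circ> e) j) = (if i = j then 1 else 0)"
      using E(4)[OF i j] hh[OF ev[OF E(5)[OF i]] ev[OF j]] by simp
  qed auto
qed

lemma unit_op_span: "unit_op g \<Longrightarrow> g ` span S = span (g ` S)"
  using module_hom.span_image[of scale scale g S] unit_op_lin(1,2)[of g]
  by (simp add: module_hom_def module_hom_axioms_def module_axioms)

lemma ityp_transport:
  assumes rep: "rep \<rho>" "rep \<rho>'" and K: "ichain \<rho> K" and g: "unit_op g" and len: "length \<rho> = length \<rho>'"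
    and eq: "\<And>t v. t < length \<rho> \<Longrightarrow> v \<in> V \<Longrightarrow> g ((\<rho> ! t) v) = (\<rho>' ! t) (g v)"
  shows "ityp \<rho>' V = ityp \<rho> V" "\<And>W. W \<in> K \<Longrightarrow> ityp \<rho>' (g ` W) = ityp \<rho> W"
proof -
  obtain s \<chi> e where e: "eigsys \<rho> s \<chi> e" "\<And>W. W \<in> K \<Longrightarrow> W = span (e ` {i. i < card B \<and> e i \<in> W})"
    using adapted_eigsys[OF rep(1) K] by metis
  note t = eigsys_transport[OF rep(1) e(1) g len eq]
  show "ityp \<rho>' V = ityp \<rho> V" using ityp_V[OF rep(2) t] ityp_V[OF rep(1) e(1)] by simp
  fix W assume W: "W \<in> K"
  define A where "A = {i. i < card B \<and> e i \<in> W}"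
  have A: "A \<subseteq> {..<card B}" by (auto simp: A_def)
  have W': "W = span (e ` A)" using e(2)[OF W] by (simp add: A_def)
  have "g ` W = span ((g \<circ> e) ` A)" unfolding W' unit_op_span[OF g] by (simp add: image_comp)
  then show "ityp \<rho>' (g ` W) = ityp \<rho> W"
    using ityp_span[OF rep(2) t A] ityp_span[OF rep(1) e(1) A] W' by simp
qed

end

section \<open>Orbit invariants of tuples with a chain\<close>

context herm_space
begin

lemma adapted_eigsys_ex:
  assumes rep: "rep \<rho>" and K: "ichain \<rho> K"
  shows "\<exists>s \<chi> e. eigsys \<rho> s \<chi> e \<and> (\<forall>W\<in>K. W = span (e ` {i. i < card B \<and> e i \<in> W}))"
  using adapted_eigsys[OF rep K] by metis

end

context unitary_space
begin

definition proots :: "nat \<Rightarrow> nat \<Rightarrow> 'a alg_closure list set" where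
  "proots p r = {\<chi>. length \<chi> = r \<and> (\<forall>z\<in>set \<chi>. \<exists>k. z ^ (p ^ k) = 1)}"

text \<open>A character fixed by the k-th power of \<open>sg\<close> is fixed by the 2k-th, which is
  a Frobenius power, so its entries lie in the field with q^(2k) elements; this gives
  finiteness.\<close>

lemma periodic_map_proots: "periodic_map (proots p r) H.sg"
proof
  show "\<chi> = \<psi>" if "H.sg \<chi> = H.sg \<psi>" for \<chi> \<psi> by (rule H.sg_inj[OF that])
  show "H.sg \<chi> \<in> proots p r" if "\<chi> \<in> proots p r" for \<chi>
  proof -
    have "inverse (z ^ q) ^ (p ^ k) = 1" if "z ^ (p ^ k) = 1" for z :: "'a alg_closure" and k
    proof -
      have "inverse (z ^ q) ^ (p ^ k) = inverse ((z ^ (p ^ k)) ^ q)"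
        by (simp add: power_inverse flip: power_mult) (simp add: mult.commute)
      then show ?thesis using that by simp
    qed
    then have "\<exists>k. inverse (z ^ q) ^ (p ^ k) = 1" if "\<exists>k. z ^ (p ^ k) = 1" for z :: "'a alg_closure"
      using that by blast
    then show ?thesis using that by (simp add: proots_def H.sg_def)
  qed
  show "\<exists>m>0. (H.sg ^^ m) \<chi> = \<chi>" for \<chi> by (rule H.sg_period)
  show "finite {\<chi> \<in> proots p r. (H.sg ^^ k) \<chi> = \<chi>}" if "k > 0" for k
  proof (rule finite_subset)
    have "finite {z :: 'a alg_closure. z ^ (q ^ (2 * k)) = z}"
      using H.card_frob_fixed[of "2 * k"] H.q_pos that by (intro card_ge_0_finite) simp
    then show "finite {\<chi>. set \<chi> \<subseteq> {z :: 'a alg_closure. z ^ (q ^ (2 * k)) = z} \<and> length \<chi> = r}"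
      by (rule finite_lists_length_eq)
    have "(H.sg ^^ (2 * k)) \<chi> = \<chi>" if "(H.sg ^^ k) \<chi> = \<chi>" for \<chi>
      using that by (simp add: mult_2 funpow_add)
    then have "map (\<lambda>z. z ^ (q ^ (2 * k))) \<chi> = \<chi>" if "(H.sg ^^ k) \<chi> = \<chi>" for \<chi>
      using that by (simp add: H.sg_pow_even)
    then have pe: "z ^ (q ^ (2 * k)) = z" if "(H.sg ^^ k) \<chi> = \<chi>" "z \<in> set \<chi>" for \<chi> z
      using that(2) map_idI[of \<chi>] map_eq_conv[of "\<lambda>z. z ^ (q ^ (2 * k))" \<chi> "\<lambda>z. z"] that(1) by (simp only: list.map_ident) blast
    show "{\<chi> \<in> proots p r. (H.sg ^^ k) \<chi> = \<chi>} \<subseteq> {\<chi>. set \<chi> \<subseteq> {z. z ^ (q ^ (2 * k)) = z} \<and> length \<chi> = r}"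
    proof
      fix \<chi> assume \<chi>: "\<chi> \<in> {\<chi> \<in> proots p r. (H.sg ^^ k) \<chi> = \<chi>}"
      then have "set \<chi> \<subseteq> {z. z ^ (q ^ (2 * k)) = z}" using pe[of \<chi>] by blast
      moreover have "length \<chi> = r" using \<chi> unfolding proots_def by blast
      ultimately show "\<chi> \<in> {\<chi>. set \<chi> \<subseteq> {z. z ^ (q ^ (2 * k)) = z} \<and> length \<chi> = r}" by blast
    qed
  qed
qed

lemma opm_pow:
  assumes "A \<in> carrier G" "v \<in> Vn n"
  shows "opm (A [^]\<^bsub>G\<^esub> (m::nat)) v = (opm A ^^ m) v"
proof (induction m)
  case 0 then show ?case using assms(2) by (simp add: opm_one)
next
  case (Suc m)
  interpret group G by (rule group_G)
  have c: "A [^]\<^bsub>G\<^esub> m \<in> carrier G" using assms(1) by (rule nat_pow_closed)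
  have "A [^]\<^bsub>G\<^esub> Suc m = A [^]\<^bsub>G\<^esub> m * A" by simp
  also have "\<dots> = A * A [^]\<^bsub>G\<^esub> m" using nat_pow_Suc2[OF assms(1), of m] by simp
  finally show ?case using opm_mult[OF G_carrier_mat[OF assms(1)] G_carrier_mat[OF c] assms(2)] Suc by simp
qed

lemma opm_pow_eq_iff:
  assumes "A \<in> carrier G"
  shows "A [^]\<^bsub>G\<^esub> (m::nat) = \<one>\<^bsub>G\<^esub> \<longleftrightarrow> (\<forall>v\<in>Vn n. (opm A ^^ m) v = v)"
proof -
  interpret group G by (rule group_G)
  have c: "A [^]\<^bsub>G\<^esub> m \<in> carrier_mat n n" using nat_pow_closed[OF assms] by (rule G_carrier_mat)
  show ?thesis
  proof
    assume "A [^]\<^bsub>G\<^esub> m = \<one>\<^bsub>G\<^esub>"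
    then show "\<forall>v\<in>Vn n. (opm A ^^ m) v = v" using opm_pow[OF assms, of _ m] by (simp add: opm_one)
  next
    assume *: "\<forall>v\<in>Vn n. (opm A ^^ m) v = v"
    have "A [^]\<^bsub>G\<^esub> m = 1\<^sub>m n"
      by (rule opm_eqD[OF c one_carrier_mat]) (use * opm_pow[OF assms, of _ m] in \<open>simp add: opm_one\<close>)
    then show "A [^]\<^bsub>G\<^esub> m = \<one>\<^bsub>G\<^esub>" by simp
  qed
qed

lemma ptuples_D:
  assumes "\<rho> \<in> ptuples p r"
  shows "length \<rho> = r" "A \<in> set \<rho> \<Longrightarrow> A \<in> carrier G" "A \<in> set \<rho> \<Longrightarrow> C \<in> set \<rho> \<Longrightarrow> A * C = C * A"
    "A \<in> set \<rho> \<Longrightarrow> \<exists>k. group.ord G A = p ^ k"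
  using assms unfolding ptuples_def by blast+

lemma ptuples_pow:
  assumes "\<rho> \<in> ptuples p r" "A \<in> set \<rho>"
  obtains k where "\<forall>v\<in>Vn n. (opm A ^^ (p ^ k)) v = v"
proof -
  obtain k where "group.ord G A = p ^ k" using ptuples_D(4)[OF assms] by blast
  then have "A [^]\<^bsub>G\<^esub> (p ^ k) = \<one>\<^bsub>G\<^esub>"
    using group.pow_ord_eq_1[OF group_G ptuples_D(2)[OF assms]] by metis
  then show ?thesis using opm_pow_eq_iff[OF ptuples_D(2)[OF assms]] that by blast
qed

context
  fixes p r :: nat
  assumes p: "prime p" and good: "of_nat p \<noteq> (0 :: 'a alg_closure) \<or> r = 0"
begin

interpretation PM: periodic_map "proots p r" H.sg by (rule periodic_map_proots)

lemma rep_opm: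
  assumes \<rho>: "\<rho> \<in> ptuples p r" shows "H.rep (map opm \<rho>)"
proof (cases "r = 0")
  case True then show ?thesis using ptuples_D(1)[OF \<rho>] H.rep_Nil by simp
next
  case False
  show ?thesis unfolding H.rep_def
  proof (intro conjI ballI)
    fix Y assume "Y \<in> set (map opm \<rho>)"
    then obtain A where A: "A \<in> set \<rho>" "Y = opm A" by auto
    show "H.unit_op Y" using unit_op_opm ptuples_D(2)[OF \<rho> A(1)] A(2) by simp
    obtain k where "\<forall>v\<in>Vn n. (opm A ^^ (p ^ k)) v = v" using ptuples_pow[OF \<rho> A(1)] .
    then show "\<exists>M>0. of_nat M \<noteq> (0 :: 'a alg_closure) \<and> (\<forall>v\<in>Vn n. (Y ^^ M) v = v)"
      using good False A(2) prime_gt_0_nat[OF p] by (intro exI[of _ "p ^ k"]) simp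
  next
    fix Y Z and v :: "nat \<Rightarrow> 'a alg_closure"
    assume "Y \<in> set (map opm \<rho>)" "Z \<in> set (map opm \<rho>)" and v: "v \<in> Vn n"
    then obtain A C where AC: "A \<in> set \<rho>" "C \<in> set \<rho>" "Y = opm A" "Z = opm C" by auto
    note m = G_carrier_mat[OF ptuples_D(2)[OF \<rho> AC(1)]] G_carrier_mat[OF ptuples_D(2)[OF \<rho> AC(2)]]
    show "Y (Z v) = Z (Y v)"
      using opm_mult[OF m v] opm_mult[OF m(2,1) v] ptuples_D(3)[OF \<rho> AC(1,2)] AC(3,4) by simp
  qed
qed

lemma Eig_proots:
  assumes \<rho>: "\<rho> \<in> ptuples p r" and v: "v \<in> H.Eig (map opm \<rho>) \<chi>" "v \<noteq> 0"
  shows "\<chi> \<in> proots p r"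
proof -
  have len: "length \<chi> = r" using v(1) ptuples_D(1)[OF \<rho>] by (simp add: H.Eig_def)
  have "\<exists>k. z ^ (p ^ k) = 1" if "z \<in> set \<chi>" for z
  proof -
    obtain t where t: "t < r" "z = \<chi> ! t" using \<open>z \<in> set \<chi>\<close> len unfolding in_set_conv_nth by auto
    have At: "\<rho> ! t \<in> set \<rho>" using t ptuples_D(1)[OF \<rho>] by simp
    obtain k where k: "\<forall>v\<in>Vn n. (opm (\<rho> ! t) ^^ (p ^ k)) v = v" using ptuples_pow[OF \<rho> At] .
    have e: "opm (\<rho> ! t) v = fscale z v" "v \<in> Vn n" using v(1) t ptuples_D(1)[OF \<rho>] by (auto simp: H.Eig_def)
    have "(opm (\<rho> ! t) ^^ m) v = fscale (z ^ m) v" for m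
      by (induction m) (simp_all add: opm_scale e(1) mult.commute)
    then have "fscale (z ^ (p ^ k)) v = fscale 1 v" using bspec[OF k e(2)] by simp
    then have "z ^ (p ^ k) = 1" using v(2) by (simp only: fs.scale_right_imp_eq)
    then show ?thesis by blast
  qed
  then show ?thesis using len by (simp add: proots_def)
qed

definition ty :: "'a mat list \<Rightarrow> 'a vec set \<Rightarrow> 'a alg_closure list multiset" where
  "ty \<rho> U = H.ityp (map opm \<rho>) (Ubar U)"

text \<open>The complete orbit invariant: characters of the whole space, and the set of types of the
  members of the chain. As types increase strictly along a chain, the set already records the
  order.\<close>

definition cls :: "'a mat list \<times> 'a vec set set \<Rightarrow> 'a alg_closure list multiset \<times> 'a alg_closure list multiset set" where
  "cls w = (H.ityp (map opm (fst w)) (Vn n), ty (fst w) ` snd w)"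

lemma pairs_D:
  assumes "(\<rho>, C) \<in> pairs p r"
  shows "\<rho> \<in> ptuples p r" "finite C" "H.ichain (map opm \<rho>) (Ubar ` C)" "\<And>U. U \<in> C \<Longrightarrow> ksub n U"
    "\<And>U. U \<in> C \<Longrightarrow> Ubar U \<noteq> {0}" "\<And>U U'. U \<in> C \<Longrightarrow> U' \<in> C \<Longrightarrow> U \<subseteq> U' \<or> U' \<subseteq> U"
proof -
  have C: "\<rho> \<in> ptuples p r" "C \<subseteq> inv_iso \<rho>" "Complete_Partial_Order.chain (\<le>) C"
    using assms by (auto simp: pairs_def)
  show "\<rho> \<in> ptuples p r" by (rule C(1))
  show fin: "finite C" using finite_subset[OF C(2) finite_inv_iso] .
  have U: "ksub n U" "U \<noteq> {0\<^sub>v n}" "\<And>u v. u \<in> U \<Longrightarrow> v \<in> U \<Longrightarrow> herm_form n q c u v = 0"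
    "\<And>A. A \<in> set \<rho> \<Longrightarrow> (\<lambda>v. A *\<^sub>v v) ` U = U" if "U \<in> C" for U
    using subsetD[OF C(2) that] unfolding inv_iso_iff by blast+
  show "ksub n U" if "U \<in> C" for U using U(1)[OF that] .
  show "Ubar U \<noteq> {0}" if "U \<in> C" for U using U(1,2)[OF that] Ubar_eq_zero_iff by blast
  show ch: "U \<subseteq> U' \<or> U' \<subseteq> U" if "U \<in> C" "U' \<in> C" for U U' using chainD[OF C(3) that] by blast
  show "H.ichain (map opm \<rho>) (Ubar ` C)" unfolding H.ichain_def
  proof (intro conjI ballI)
    show "finite (Ubar ` C)" using fin by simp
    fix W assume "W \<in> Ubar ` C"
    then obtain W0 where W: "W0 \<in> C" "W = Ubar W0" by auto
    show "H.stab (map opm \<rho>) W" unfolding W(2)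
    proof (rule Ubar_stab[OF U(1)[OF W(1)]])
      show "A \<in> carrier_mat n n" if "A \<in> set \<rho>" for A using G_carrier_mat[OF ptuples_D(2)[OF C(1) that]] .
      show "A *\<^sub>v u \<in> W0" if "A \<in> set \<rho>" "u \<in> W0" for A u using U(4)[OF W(1) that(1)] that(2) by blast
    qed
    show "hL x y = 0" if "x \<in> W" "y \<in> W" for x y
      by (rule Ubar_isotropic[OF ksub_carrier[OF U(1)[OF W(1)]] U(3)[OF W(1)] that[unfolded W(2)]])
    fix W' assume "W' \<in> Ubar ` C"
    then obtain W1 where W': "W1 \<in> C" "W' = Ubar W1" by auto
    show "W \<subseteq> W' \<or> W' \<subseteq> W"
      using ch[OF W(1) W'(1)] Ubar_subset_iff[OF U(1)[OF W(1)] U(1)[OF W'(1)]]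
        Ubar_subset_iff[OF U(1)[OF W'(1)] U(1)[OF W(1)]] unfolding W(2) W'(2) by blast
  qed
qed

text \<open>In an adapted eigenbasis a member U of the chain is spanned by the vectors with index in
  \<open>A U\<close>. Stability under \<open>phi\<close> makes \<open>A U\<close> stable under the
  square of s, isotropy makes it disjoint from its image under s, and so its type and the image of
  the type fit side by side into the total type.\<close>

lemma cls_props:
  assumes P: "(\<rho>, C) \<in> pairs p r"
  shows "H.ityp (map opm \<rho>) (Vn n) \<in> PM.stable n"
    "ty \<rho> ` C \<subseteq> PM.isotypes (H.ityp (map opm \<rho>) (Vn n))"
    "Complete_Partial_Order.chain (\<subseteq>#) (ty \<rho> ` C)" "card (ty \<rho> ` C) = card C"
proof -
  note D = pairs_D[OF P]
  have rep: "H.rep (map opm \<rho>)" by (rule rep_opm[OF D(1)])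
  obtain s \<chi> e where es: "H.eigsys (map opm \<rho>) s \<chi> e"
    and sp: "\<forall>W\<in>Ubar ` C. W = fs.span (e ` {i. i < card (std ` {..<n} :: (nat \<Rightarrow> 'a alg_closure) set) \<and> e i \<in> W})"
    using H.adapted_eigsys_ex[OF rep D(3)] by (elim exE conjE) (rule that)
  note E = H.es_simps[OF rep es, unfolded card_std]
  define A where "A U = {i. i < n \<and> e i \<in> Ubar U}" for U
  have AU: "A U \<subseteq> {..<n}" "finite (A U)" for U by (auto simp: A_def)
  have UA: "Ubar U = fs.span (e ` A U)" if "U \<in> C" for U
    using bspec[OF sp imageI[OF that]] unfolding A_def card_std .
  have tyA: "ty \<rho> U = image_mset \<chi> (mset_set (A U))" if "U \<in> C" for U
    unfolding ty_def UA[OF that] using H.ityp_span[OF rep es, unfolded card_std, OF AU(1)] .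
  have tyV: "H.ityp (map opm \<rho>) (Vn n) = image_mset \<chi> (mset_set {..<n})"
    using H.ityp_V[OF rep es, unfolded card_std] .
  have e0: "e i \<noteq> 0" if "i < n" for i using E(4)[OF that that] by auto
  have inj_s: "inj_on s {..<n}" using E(1) by (auto simp: bij_betw_def)
  have sA: "image_mset H.sg (image_mset \<chi> (mset_set J)) = image_mset \<chi> (mset_set (s ` J))" if "J \<subseteq> {..<n}" for J
  proof -
    have "image_mset H.sg (image_mset \<chi> (mset_set J)) = image_mset (\<lambda>i. \<chi> (s i)) (mset_set J)"
      unfolding multiset.map_comp using that E(7) finite_subset[OF that] by (intro image_mset_cong) (auto simp: subset_iff)
    also have "\<dots> = image_mset \<chi> (mset_set (s ` J))"
      using inj_on_subset[OF inj_s that] by (intro image_mset_mset_set_bij) (simp add: bij_betw_def)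
    finally show ?thesis .
  qed
  show st: "H.ityp (map opm \<rho>) (Vn n) \<in> PM.stable n"
    unfolding PM.stable_def mem_Collect_eq tyV
  proof (intro conjI)
    show "set_mset (image_mset \<chi> (mset_set {..<n})) \<subseteq> proots p r"
      using Eig_proots[OF D(1) E(2) e0] by auto
    show "image_mset H.sg (image_mset \<chi> (mset_set {..<n})) = image_mset \<chi> (mset_set {..<n})"
      using sA[of "{..<n}"] E(1) by (simp add: bij_betw_def)
  qed simp
  have stab: "H.stab (map opm \<rho>) (Ubar U)" and iso: "\<And>x y. x \<in> Ubar U \<Longrightarrow> y \<in> Ubar U \<Longrightarrow> hL x y = 0" if "U \<in> C" for U
    using D(3) that unfolding H.ichain_def by blast+
  have ssA: "s (s i) \<in> A U" and nsA: "s i \<notin> A U" if "U \<in> C" "i \<in> A U" for U i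
  proof -
    have i: "i < n" "e i \<in> Ubar U" using that(2) by (auto simp: A_def)
    have "phiL (e i) \<in> Ubar U" using stab[OF that(1)] i(2) unfolding H.stab_def by blast
    then show "s (s i) \<in> A U" using E(3)[OF i(1)] E(5)[OF E(5)[OF i(1)]] by (simp add: A_def)
    show "s i \<notin> A U"
    proof
      assume "s i \<in> A U"
      then have "hL (e (s i)) (e i) = 0" using iso[OF that(1)] i by (simp add: A_def)
      then show False using E(4)[OF i(1) i(1)] by simp
    qed
  qed
  show "ty \<rho> ` C \<subseteq> PM.isotypes (H.ityp (map opm \<rho>) (Vn n))"
  proof
    fix f assume "f \<in> ty \<rho> ` C"
    then obtain U where U: "U \<in> C" "f = image_mset \<chi> (mset_set (A U))" using tyA by auto
    have sAU: "s ` A U \<subseteq> {..<n}" using AU(1) E(5) by auto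
    have "(s ` s ` A U) = A U"
    proof -
      have "(\<lambda>i. s (s i)) ` A U = A U"
      proof (rule endo_inj_surj)
        show "inj_on (\<lambda>i. s (s i)) (A U)"
          using comp_inj_on[OF inj_on_subset[OF inj_s AU(1)] inj_on_subset[OF inj_s sAU]] by (simp add: o_def)
      qed (use AU ssA[OF U(1)] in auto)
      then show ?thesis by (simp add: image_image)
    qed
    then have 1: "image_mset (H.sg \<circ> H.sg) f = f"
      unfolding U(2) using sA[OF AU(1), of U] sA[OF sAU] by (simp flip: multiset.map_comp)
    have dis: "A U \<inter> s ` A U = {}" using nsA[OF U(1)] by auto
    have "f + image_mset H.sg f = image_mset \<chi> (mset_set (A U \<union> s ` A U))"
      unfolding U(2) sA[OF AU(1)] using AU(2) dis by (simp add: mset_set_Union)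
    also have "\<dots> \<subseteq># image_mset \<chi> (mset_set {..<n})"
      using AU(1)[of U] sAU by (intro image_mset_subseteq_mono) (simp add: subset_imp_msubset_mset_set)
    finally have 2: "f + image_mset H.sg f \<subseteq># H.ityp (map opm \<rho>) (Vn n)" unfolding tyV .
    have "A U \<noteq> {}" using UA[OF U(1)] D(5)[OF U(1)] by auto
    then have "f \<noteq> {#}" unfolding U(2) using AU(2) by (simp add: mset_set_empty_iff)
    then show "f \<in> PM.isotypes (H.ityp (map opm \<rho>) (Vn n))" using 1 2 by (simp add: PM.isotypes_def)
  qed
  have mono: "ty \<rho> U \<subseteq># ty \<rho> U'" if "U \<in> C" "U' \<in> C" "U \<subseteq> U'" for U U'
  proof -
    have "A U \<subseteq> A U'" using Ubar_subset_iff[OF D(4)[OF that(1)] D(4)[OF that(2)]] that(3) by (auto simp: A_def)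
    then show ?thesis unfolding tyA[OF that(1)] tyA[OF that(2)]
      by (intro image_mset_subseteq_mono subset_imp_msubset_mset_set) (simp_all add: AU)
  qed
  show "Complete_Partial_Order.chain (\<subseteq>#) (ty \<rho> ` C)"
  proof (rule chainI)
    fix x y assume "x \<in> ty \<rho> ` C" "y \<in> ty \<rho> ` C"
    then obtain U U' where U: "U \<in> C" "U' \<in> C" "x = ty \<rho> U" "y = ty \<rho> U'" by auto
    show "x \<subseteq># y \<or> y \<subseteq># x" using D(6)[OF U(1,2)] mono[OF U(1,2)] mono[OF U(2,1)] U(3,4) by blast
  qed
  \<comment> \<open>Nested index sets of the same size are equal.\<close>
  have inj: "U = U'" if "U \<in> C" "U' \<in> C" "U \<subseteq> U'" "ty \<rho> U = ty \<rho> U'" for U U'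
  proof -
    have "A U \<subseteq> A U'" using Ubar_subset_iff[OF D(4)[OF that(1)] D(4)[OF that(2)]] that(3) by (auto simp: A_def)
    moreover have "card (A U) = card (A U')"
      using arg_cong[OF that(4), of size] tyA[OF that(1)] tyA[OF that(2)] by simp
    ultimately have "A U = A U'" using AU(2) card_subset_eq by blast
    then have "Ubar U = Ubar U'" using UA[OF that(1)] UA[OF that(2)] by simp
    then show ?thesis using Ubar_inj[OF D(4)[OF that(1)] D(4)[OF that(2)]] by blast
  qed
  have "inj_on (ty \<rho>) C"
  proof (rule inj_onI)
    fix U U' assume U: "U \<in> C" "U' \<in> C" "ty \<rho> U = ty \<rho> U'"
    show "U = U'" using D(6)[OF U(1,2)]
    proof
      assume "U \<subseteq> U'" then show ?thesis by (rule inj[OF U(1,2) _ U(3)])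
    next
      assume "U' \<subseteq> U" then show ?thesis using inj[OF U(2,1) _ U(3)[symmetric]] by simp
    qed
  qed
  then show "card (ty \<rho> ` C) = card C" by (rule card_image)
qed

end

end

context periodic_map
begin

lemma realize_ex:
  assumes w: "w \<in> stable n" and D: "D \<subseteq> isotypes w" "Complete_Partial_Order.chain (\<subseteq>#) D"
  shows "\<exists>\<sigma> \<chi> A. \<sigma> permutes {..<n} \<and> (\<forall>i<n. \<chi> (\<sigma> i) = s (\<chi> i)) \<and>
    image_mset \<chi> (mset_set {..<n}) = w \<and> (\<forall>f\<in>D. A f \<subseteq> {..<n} \<and> image_mset \<chi> (mset_set (A f)) = f \<and>
    (\<forall>i\<in>A f. \<sigma> (\<sigma> i) \<in> A f \<and> \<sigma> i \<notin> A f) \<and> (\<forall>f'\<in>D. f \<subseteq># f' \<longrightarrow> A f \<subseteq> A f'))"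
proof (rule realize[OF w D])
  fix \<sigma> \<chi> A
  assume a: "\<sigma> permutes {..<n}" "\<And>i. i < n \<Longrightarrow> \<chi> (\<sigma> i) = s (\<chi> i)"
    "image_mset \<chi> (mset_set {..<n}) = w" "\<And>f. f \<in> D \<Longrightarrow> A f \<subseteq> {..<n}"
    "\<And>f. f \<in> D \<Longrightarrow> image_mset \<chi> (mset_set (A f)) = f"
    "\<And>f i. f \<in> D \<Longrightarrow> i \<in> A f \<Longrightarrow> \<sigma> (\<sigma> i) \<in> A f" "\<And>f i. f \<in> D \<Longrightarrow> i \<in> A f \<Longrightarrow> \<sigma> i \<notin> A f"
    "\<And>f f'. f \<in> D \<Longrightarrow> f' \<in> D \<Longrightarrow> f \<subseteq># f' \<Longrightarrow> A f \<subseteq> A f'"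
  show ?thesis
    by (intro exI[of _ \<sigma>] exI[of _ \<chi>] exI[of _ A] conjI allI impI ballI) (rule a; assumption)+
qed

end

section \<open>Conjugation action on tuples with a chain\<close>

context unitary_space
begin

lemma G_inj_on: "g \<in> carrier G \<Longrightarrow> inj_on (\<lambda>v. g *\<^sub>v v) (carrier_vec n)"
proof (rule inj_on_inverseI)
  fix v :: "'a vec" assume "g \<in> carrier G" "v \<in> carrier_vec n"
  then show "inv\<^bsub>G\<^esub> g *\<^sub>v (g *\<^sub>v v) = v"
    using G_mult_vec[OF group.inv_closed[OF group_G, of g], of g v] group.l_inv[OF group_G, of g] by simp
qed

lemma G_image_eqI:
  assumes g: "g \<in> carrier G" and U: "U \<subseteq> carrier_vec n" and sub: "(\<lambda>v. g *\<^sub>v v) ` U \<subseteq> U"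
  shows "(\<lambda>v. g *\<^sub>v v) ` U = U"
  using finite_subset[OF U finite_carrier_vec] sub inj_on_subset[OF G_inj_on[OF g] U] by (rule endo_inj_surj)

lemma act_mult:
  assumes "g \<in> carrier G" "k \<in> carrier G" "set (fst w) \<subseteq> carrier G" "\<And>U. U \<in> snd w \<Longrightarrow> U \<subseteq> carrier_vec n"
  shows "act (g * k) w = act g (act k w)"
proof -
  interpret group G by (rule group_G)
  have "g * k * A * inv\<^bsub>G\<^esub> (g * k) = g * (k * A * inv\<^bsub>G\<^esub> k) * inv\<^bsub>G\<^esub> g" if "A \<in> carrier G" for A
  proof -
    have "(g \<otimes>\<^bsub>G\<^esub> k) \<otimes>\<^bsub>G\<^esub> A \<otimes>\<^bsub>G\<^esub> inv\<^bsub>G\<^esub> (g \<otimes>\<^bsub>G\<^esub> k) =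
        g \<otimes>\<^bsub>G\<^esub> (k \<otimes>\<^bsub>G\<^esub> A \<otimes>\<^bsub>G\<^esub> inv\<^bsub>G\<^esub> k) \<otimes>\<^bsub>G\<^esub> inv\<^bsub>G\<^esub> g"
      using assms(1,2) that by (simp add: m_assoc inv_mult_group del: G_simps)
    then show ?thesis by (simp only: G_simps)
  qed
  then have 1: "map (\<lambda>A. g * k * A * inv\<^bsub>G\<^esub> (g * k)) (fst w) = map (\<lambda>A. g * A * inv\<^bsub>G\<^esub> g) (map (\<lambda>A. k * A * inv\<^bsub>G\<^esub> k) (fst w))"
    using assms(3) by (simp add: subset_iff)
  have 2: "(\<lambda>U. (\<lambda>v. (g * k) *\<^sub>v v) ` U) ` snd w = (\<lambda>U. (\<lambda>v. g *\<^sub>v v) ` U) ` (\<lambda>U. (\<lambda>v. k *\<^sub>v v) ` U) ` snd w"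
    unfolding image_image[of "\<lambda>U. (\<lambda>v. g *\<^sub>v v) ` U"]
    by (rule image_cong[OF refl]) (rule G_image_mult[OF assms(1,2) assms(4)])
  show ?thesis unfolding act_def using 1 2 by simp
qed

lemma act_one:
  assumes "set (fst w) \<subseteq> carrier G" "\<And>U. U \<in> snd w \<Longrightarrow> U \<subseteq> carrier_vec n"
  shows "act (1\<^sub>m n) w = w"
proof -
  interpret group G by (rule group_G)
  have "1\<^sub>m n * A * inv\<^bsub>G\<^esub> (1\<^sub>m n) = A" if "A \<in> carrier G" for A
  proof -
    have "\<one>\<^bsub>G\<^esub> \<otimes>\<^bsub>G\<^esub> A \<otimes>\<^bsub>G\<^esub> inv\<^bsub>G\<^esub> \<one>\<^bsub>G\<^esub> = A" using that by (simp del: G_simps)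
    then show ?thesis by (simp only: G_simps)
  qed
  then have 1: "map (\<lambda>A. 1\<^sub>m n * A * inv\<^bsub>G\<^esub> (1\<^sub>m n)) (fst w) = fst w"
    using assms(1) by (intro map_idI) (simp add: subset_iff)
  have 2: "(\<lambda>U. (\<lambda>v. (1\<^sub>m n :: 'a mat) *\<^sub>v v) ` U) ` snd w = snd w"
  proof -
    have "(\<lambda>U. (\<lambda>v. (1\<^sub>m n :: 'a mat) *\<^sub>v v) ` U) ` snd w = (\<lambda>U. U) ` snd w"
      by (rule image_cong[OF refl]) (rule G_image_one[OF assms(2)])
    then show ?thesis by simp
  qed
  show ?thesis unfolding act_def 1 2 by simp
qed

lemma act_pairs:
  assumes g: "g \<in> carrier G" and P: "(\<rho>, C) \<in> pairs p r"
  shows "act g (\<rho>, C) \<in> pairs p r"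
proof -
  interpret group G by (rule group_G)
  have \<rho>: "\<rho> \<in> ptuples p r" and C: "C \<subseteq> inv_iso \<rho>" "Complete_Partial_Order.chain (\<le>) C"
    using P by (auto simp: pairs_def)
  define cj where "cj A = g \<otimes>\<^bsub>G\<^esub> A \<otimes>\<^bsub>G\<^esub> inv\<^bsub>G\<^esub> g" for A
  have cj': "(\<lambda>A. g * A * inv\<^bsub>G\<^esub> g) = cj" by (simp add: cj_def fun_eq_iff)
  have cjG: "cj A \<in> carrier G" if "A \<in> carrier G" for A
    unfolding cj_def using g that by (intro m_closed inv_closed)
  have cjm: "cj (A \<otimes>\<^bsub>G\<^esub> A') = cj A \<otimes>\<^bsub>G\<^esub> cj A'" if "A \<in> carrier G" "A' \<in> carrier G" for A A'
  proof -
    have "inv\<^bsub>G\<^esub> g \<otimes>\<^bsub>G\<^esub> (g \<otimes>\<^bsub>G\<^esub> x) = x" if "x \<in> carrier G" for x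
      using g that by (simp add: m_assoc[symmetric] del: G_simps)
    then show ?thesis unfolding cj_def using g that by (simp add: m_assoc del: G_simps)
  qed
  have cj1: "cj \<one>\<^bsub>G\<^esub> = \<one>\<^bsub>G\<^esub>" unfolding cj_def using g by (simp del: G_simps)
  have inj: "inj_on cj (carrier G)"
    unfolding cj_def using g by (intro inj_onI) (simp del: G_simps)
  have ordcj: "ord (cj A) = ord A" if A: "A \<in> carrier G" for A
  proof -
    have pw: "(cj A) [^]\<^bsub>G\<^esub> (m::nat) = cj (A [^]\<^bsub>G\<^esub> m)" for m
      by (induction m) (simp_all add: cj1 cjm A del: G_simps)
    have "(cj A) [^]\<^bsub>G\<^esub> (m::nat) = \<one>\<^bsub>G\<^esub> \<longleftrightarrow> A [^]\<^bsub>G\<^esub> m = \<one>\<^bsub>G\<^esub>" for m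
      unfolding pw using inj_on_eq_iff[OF inj nat_pow_closed[OF A, of m] one_closed] cj1 by metis
    then have dv: "ord (cj A) dvd m \<longleftrightarrow> ord A dvd m" for m
      using pow_eq_id[OF A, of m] pow_eq_id[OF cjG[OF A], of m] by blast
    show ?thesis using dv[of "ord A"] dv[of "ord (cj A)"] by (intro dvd_antisym) simp_all
  qed
  have pt: "map cj \<rho> \<in> ptuples p r"
    unfolding ptuples_def mem_Collect_eq
  proof (intro conjI ballI)
    show "length (map cj \<rho>) = r" using ptuples_D(1)[OF \<rho>] by simp
    show "set (map cj \<rho>) \<subseteq> carrier G" using cjG ptuples_D(2)[OF \<rho>] by auto
  next
    fix x y assume "x \<in> set (map cj \<rho>)" "y \<in> set (map cj \<rho>)"
    then obtain A A' where A: "A \<in> set \<rho>" "A' \<in> set \<rho>" "x = cj A" "y = cj A'" by auto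
    have "cj (A \<otimes>\<^bsub>G\<^esub> A') = cj (A' \<otimes>\<^bsub>G\<^esub> A)" using ptuples_D(3)[OF \<rho> A(1,2)] by simp
    then have "cj A \<otimes>\<^bsub>G\<^esub> cj A' = cj A' \<otimes>\<^bsub>G\<^esub> cj A"
      unfolding cjm[OF ptuples_D(2)[OF \<rho> A(1)] ptuples_D(2)[OF \<rho> A(2)]] cjm[OF ptuples_D(2)[OF \<rho> A(2)] ptuples_D(2)[OF \<rho> A(1)]] .
    then show "x * y = y * x" using A(3,4) by (simp only: G_simps)
  next
    fix x assume "x \<in> set (map cj \<rho>)"
    then obtain A where A: "A \<in> set \<rho>" "x = cj A" by auto
    show "\<exists>k. ord x = p ^ k" using ptuples_D(4)[OF \<rho> A(1)] ordcj[OF ptuples_D(2)[OF \<rho> A(1)]] A(2) by simp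
  qed
  have inC: "(\<lambda>v. g *\<^sub>v v) ` U \<in> inv_iso (map cj \<rho>)" if "U \<in> C" for U
  proof -
    have U: "ksub n U" "U \<noteq> {0\<^sub>v n}" "\<And>u v. u \<in> U \<Longrightarrow> v \<in> U \<Longrightarrow> herm_form n q c u v = 0"
      "\<And>A. A \<in> set \<rho> \<Longrightarrow> (\<lambda>v. A *\<^sub>v v) ` U = U"
      using subsetD[OF C(1) that] unfolding inv_iso_iff by blast+
    have Uc: "U \<subseteq> carrier_vec n" by (rule ksub_carrier[OF U(1)])
    show ?thesis unfolding inv_iso_iff
    proof (intro conjI ballI)
      show "ksub n ((\<lambda>v. g *\<^sub>v v) ` U)" by (rule ksub_image[OF G_carrier_mat[OF g] U(1)])
      show "(\<lambda>v. g *\<^sub>v v) ` U \<noteq> {0\<^sub>v n}"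
      proof
        assume z: "(\<lambda>v. g *\<^sub>v v) ` U = {0\<^sub>v n}"
        have "U = (\<lambda>v. (inv\<^bsub>G\<^esub> g) *\<^sub>v v) ` {0\<^sub>v n}" using G_image_inv(1)[OF g Uc] unfolding z by simp
        also have "\<dots> = {0\<^sub>v n}" using G_carrier_mat[OF inv_closed[OF g]] by (auto intro!: eq_vecI simp: scalar_prod_def)
        finally show False using U(2) by simp
      qed
      show "herm_form n q c u v = 0" if uv: "u \<in> (\<lambda>v. g *\<^sub>v v) ` U" "v \<in> (\<lambda>v. g *\<^sub>v v) ` U" for u v
      proof -
        obtain x y where xy: "x \<in> U" "y \<in> U" "u = g *\<^sub>v x" "v = g *\<^sub>v y" using uv by auto
        have "herm_form n q c u v = herm_form n q c x y"
          using g subsetD[OF Uc xy(1)] subsetD[OF Uc xy(2)] unfolding xy(3,4) unitary_group_def by simp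
        then show ?thesis using U(3)[OF xy(1,2)] by simp
      qed
      show "(\<lambda>v. B *\<^sub>v v) ` (\<lambda>v. g *\<^sub>v v) ` U = (\<lambda>v. g *\<^sub>v v) ` U" if B: "B \<in> set (map cj \<rho>)" for B
      proof -
        obtain A where A: "A \<in> set \<rho>" "B = cj A" using B by auto
        have AG: "A \<in> carrier G" by (rule ptuples_D(2)[OF \<rho> A(1)])
        have "cj A * g = g * A" using G_conj_eq_iff[OF g AG cjG[OF AG]] by (simp add: cj_def)
        then have "(\<lambda>v. (B * g) *\<^sub>v v) ` U = (\<lambda>v. (g * A) *\<^sub>v v) ` U" using A(2) by simp
        then show ?thesis
          unfolding G_image_mult[OF cjG[OF AG, folded A(2)] g Uc] G_image_mult[OF g AG Uc] U(4)[OF A(1)] .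
      qed
    qed
  qed
  have ch: "Complete_Partial_Order.chain (\<le>) ((\<lambda>U. (\<lambda>v. g *\<^sub>v v) ` U) ` C)"
  proof (rule chainI)
    fix x y assume "x \<in> (\<lambda>U. (\<lambda>v. g *\<^sub>v v) ` U) ` C" "y \<in> (\<lambda>U. (\<lambda>v. g *\<^sub>v v) ` U) ` C"
    then obtain U U' where U: "U \<in> C" "U' \<in> C" "x = (\<lambda>v. g *\<^sub>v v) ` U" "y = (\<lambda>v. g *\<^sub>v v) ` U'" by auto
    show "x \<subseteq> y \<or> y \<subseteq> x" using chainD[OF C(2) U(1,2)] image_mono[of U U'] image_mono[of U' U] unfolding U(3,4) by blast
  qed
  show ?thesis unfolding act_def pairs_def fst_conv snd_conv cj' using pt inC ch by auto
qed

text \<open>An element preserving the chain as a set preserves each member: U and its image are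
  comparable and have the same finite cardinality.\<close>

lemma Stab_pairs:
  assumes P: "(\<rho>, C) \<in> pairs p r"
  shows "{g \<in> carrier G. act g (\<rho>, C) = (\<rho>, C)} = {A \<in> centr \<rho>. \<forall>U\<in>C. (\<lambda>v. A *\<^sub>v v) ` U = U}"
proof (intro equalityI subsetI)
  have \<rho>: "\<rho> \<in> ptuples p r" and C: "C \<subseteq> inv_iso \<rho>" "Complete_Partial_Order.chain (\<le>) C"
    using P by (auto simp: pairs_def)
  have Uc: "U \<subseteq> carrier_vec n" if "U \<in> C" for U using subsetD[OF C(1) that] unfolding inv_iso_iff by (blast dest: ksub_carrier)
  have map_iff: "map (\<lambda>A. g * A * inv\<^bsub>G\<^esub> g) \<rho> = \<rho> \<longleftrightarrow> (\<forall>A\<in>set \<rho>. g * A = A * g)" if "g \<in> carrier G" for g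
  proof -
    have "map (\<lambda>A. g * A * inv\<^bsub>G\<^esub> g) \<rho> = map (\<lambda>A. A) \<rho> \<longleftrightarrow> (\<forall>A\<in>set \<rho>. g * A * inv\<^bsub>G\<^esub> g = A)" by (rule map_eq_conv)
    also have "\<dots> \<longleftrightarrow> (\<forall>A\<in>set \<rho>. g * A = A * g)"
      using G_conj_eq_iff[OF that ptuples_D(2)[OF \<rho>] ptuples_D(2)[OF \<rho>]] by (intro ball_cong refl)
    finally show ?thesis by (simp only: list.map_ident)
  qed
  {
    fix g assume g: "g \<in> {g \<in> carrier G. act g (\<rho>, C) = (\<rho>, C)}"
    then have gG: "g \<in> carrier G" and a: "map (\<lambda>A. g * A * inv\<^bsub>G\<^esub> g) \<rho> = \<rho>" "(\<lambda>U. (\<lambda>v. g *\<^sub>v v) ` U) ` C = C"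
      unfolding act_def by simp_all
    note inj = G_inj_on[OF gG]
    have "(\<lambda>v. g *\<^sub>v v) ` U = U" if U: "U \<in> C" for U
    proof -
      have gU: "(\<lambda>v. g *\<^sub>v v) ` U \<in> C" using imageI[OF U, of "\<lambda>U. (\<lambda>v. g *\<^sub>v v) ` U"] unfolding a(2) .
      have fin: "finite U" using finite_subset[OF Uc[OF U] finite_carrier_vec] .
      have cd: "card ((\<lambda>v. g *\<^sub>v v) ` U) = card U" by (rule card_image[OF inj_on_subset[OF inj Uc[OF U]]])
      from chainD[OF C(2) gU U] show ?thesis
        using card_subset_eq[OF fin _ cd] card_subset_eq[OF finite_imageI[OF fin] _ cd[symmetric]] by blast
    qed
    then show "g \<in> {A \<in> centr \<rho>. \<forall>U\<in>C. (\<lambda>v. A *\<^sub>v v) ` U = U}"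
      using gG a(1) unfolding map_iff[OF gG] centr_def by simp
  next
    fix g assume "g \<in> {A \<in> centr \<rho>. \<forall>U\<in>C. (\<lambda>v. A *\<^sub>v v) ` U = U}"
    then have g: "g \<in> carrier G" "\<forall>A\<in>set \<rho>. g * A = A * g" "\<forall>U\<in>C. (\<lambda>v. g *\<^sub>v v) ` U = U"
      unfolding centr_def by blast+
    have "(\<lambda>U. (\<lambda>v. g *\<^sub>v v) ` U) ` C = (\<lambda>U. U) ` C" by (rule image_cong[OF refl]) (rule bspec[OF g(3)])
    then show "g \<in> {g \<in> carrier G. act g (\<rho>, C) = (\<rho>, C)}"
      using g(1) map_iff[OF g(1), THEN iffD2, OF g(2)] unfolding act_def by simp
  }
qed

section \<open>Completeness and range of the orbit invariant\<close>

context
  fixes p r :: nat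
  assumes p: "prime p" and good: "of_nat p \<noteq> (0 :: 'a alg_closure) \<or> r = 0"
begin

interpretation PM: periodic_map "proots p r" H.sg by (rule periodic_map_proots)

text \<open>Equal invariants give a conjugating unitary operator over the closure that commutes with
  \<open>phi\<close>, hence a matrix in the group; injectivity of scalar extension brings the
  equality of chains back to the small field.\<close>

lemma cls_eq_iff:
  assumes P: "(\<rho>, C) \<in> pairs p r" and P': "(\<rho>', C') \<in> pairs p r"
  shows "cls (\<rho>, C) = cls (\<rho>', C') \<longleftrightarrow> (\<exists>g\<in>carrier G. act g (\<rho>, C) = (\<rho>', C'))"
proof -
  note D = pairs_D[OF p good P] and D' = pairs_D[OF p good P']
  note rep = rep_opm[OF p good D(1)] and rep' = rep_opm[OF p good D'(1)]
  have len: "length (map opm \<rho>) = length (map opm \<rho>')" "length \<rho> = r" "length \<rho>' = r"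
    using ptuples_D(1)[OF D(1)] ptuples_D(1)[OF D'(1)] by simp_all
  show ?thesis
  proof
    assume "cls (\<rho>, C) = cls (\<rho>', C')"
    then have ty: "H.ityp (map opm \<rho>) (Vn n) = H.ityp (map opm \<rho>') (Vn n)"
        "H.ityp (map opm \<rho>) ` Ubar ` C = H.ityp (map opm \<rho>') ` Ubar ` C'"
      unfolding cls_def[OF p good] ty_def[OF p good] by (simp_all add: image_image)
    obtain f where f: "H.unit_op f" "\<forall>t v. t < r \<longrightarrow> v \<in> Vn n \<longrightarrow> f ((map opm \<rho> ! t) v) = (map opm \<rho>' ! t) (f v)"
      "(\<lambda>W. f ` W) ` Ubar ` C = Ubar ` C'"
      by (rule H.conjugating_op[OF rep rep' len(1) D(3) D'(3) ty]) (simp add: len)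
    obtain g where g: "g \<in> carrier G" "\<forall>v\<in>Vn n. f v = opm g v" using unit_op_imp_opm[OF f(1)] by blast
    note gm = G_carrier_mat[OF g(1)]
    have "g * (\<rho> ! t) * inv\<^bsub>G\<^esub> g = \<rho>' ! t" if t: "t < r" for t
    proof -
      have tG: "\<rho> ! t \<in> carrier G" "\<rho>' ! t \<in> carrier G"
        using t len ptuples_D(2)[OF D(1)] ptuples_D(2)[OF D'(1)] by simp_all
      note m = G_carrier_mat[OF tG(1)] G_carrier_mat[OF tG(2)]
      have "g * (\<rho> ! t) = (\<rho>' ! t) * g"
      proof (rule opm_eqD)
        fix v :: "nat \<Rightarrow> 'a alg_closure" assume v: "v \<in> Vn n"
        have "f (opm (\<rho> ! t) v) = opm (\<rho>' ! t) (f v)" using f(2) t v len by simp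
        then show "opm (g * (\<rho> ! t)) v = opm ((\<rho>' ! t) * g) v"
          using g(2) v opm_in[of "\<rho> ! t" v] opm_mult[OF gm m(1) v] opm_mult[OF m(2) gm v] by simp
      qed (use gm m in auto)
      then show ?thesis using G_conj_eq_iff[OF g(1) tG] by blast
    qed
    then have 1: "map (\<lambda>A. g * A * inv\<^bsub>G\<^esub> g) \<rho> = \<rho>'" using len by (intro nth_equalityI) simp_all
    have "f ` Ubar U = Ubar ((\<lambda>v. g *\<^sub>v v) ` U)" if "U \<in> C" for U
    proof -
      have "f ` Ubar U = opm g ` Ubar U"
        by (rule image_cong[OF refl]) (rule bspec[OF g(2) subsetD[OF Ubar_subset_V]])
      then show ?thesis unfolding Ubar_image[OF gm ksub_carrier[OF D(4)[OF that]]] .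
    qed
    then have "(\<lambda>U. f ` Ubar U) ` C = (\<lambda>U. Ubar ((\<lambda>v. g *\<^sub>v v) ` U)) ` C"
      by (rule image_cong[OF refl])
    then have "(\<lambda>W. f ` W) ` Ubar ` C = Ubar ` (\<lambda>U. (\<lambda>v. g *\<^sub>v v) ` U) ` C"
      unfolding image_image[of "(`) f" Ubar] image_image[of Ubar "\<lambda>U. (\<lambda>v. g *\<^sub>v v) ` U"] .
    then have "Ubar ` (\<lambda>U. (\<lambda>v. g *\<^sub>v v) ` U) ` C = Ubar ` C'" unfolding f(3) by (rule sym)
    then have 2: "(\<lambda>U. (\<lambda>v. g *\<^sub>v v) ` U) ` C = C'"
    proof (rule inj_on_image_eq_iff[THEN iffD1, rotated 3])
      show "inj_on Ubar {U. ksub n U}" by (rule inj_onI) (use Ubar_inj in blast)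
      show "(\<lambda>U. (\<lambda>v. g *\<^sub>v v) ` U) ` C \<subseteq> {U. ksub n U}" using ksub_image[OF gm D(4)] by blast
      show "C' \<subseteq> {U. ksub n U}" using D'(4) by blast
    qed
    show "\<exists>g\<in>carrier G. act g (\<rho>, C) = (\<rho>', C')" using g(1) 1 2 unfolding act_def by auto
  next
    assume "\<exists>g\<in>carrier G. act g (\<rho>, C) = (\<rho>', C')"
    then obtain g where g: "g \<in> carrier G" and a: "map (\<lambda>A. g * A * inv\<^bsub>G\<^esub> g) \<rho> = \<rho>'" "(\<lambda>U. (\<lambda>v. g *\<^sub>v v) ` U) ` C = C'"
      unfolding act_def by auto
    note gm = G_carrier_mat[OF g]
    have eq: "opm g ((map opm \<rho> ! t) v) = (map opm \<rho>' ! t) (opm g v)" if "t < length (map opm \<rho>)" "v \<in> Vn n" for t v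
    proof -
      have t: "t < r" using that(1) len by simp
      have tG: "\<rho> ! t \<in> carrier G" "\<rho>' ! t \<in> carrier G"
        using t len ptuples_D(2)[OF D(1)] ptuples_D(2)[OF D'(1)] by simp_all
      note m = G_carrier_mat[OF tG(1)] G_carrier_mat[OF tG(2)]
      have "g * (\<rho> ! t) * inv\<^bsub>G\<^esub> g = \<rho>' ! t" using a(1) t len by (metis nth_map)
      then have "g * (\<rho> ! t) = (\<rho>' ! t) * g" using G_conj_eq_iff[OF g tG] by blast
      then show ?thesis using opm_mult[OF gm m(1) that(2)] opm_mult[OF m(2) gm that(2)] t len by simp
    qed
    note tr = H.ityp_transport[OF rep rep' D(3) unit_op_opm[OF g] len(1) eq]
    have "ty \<rho>' ((\<lambda>v. g *\<^sub>v v) ` U) = ty \<rho> U" if "U \<in> C" for U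
      unfolding ty_def[OF p good] using tr(2)[OF _ _ imageI[OF that]] Ubar_image[OF gm ksub_carrier[OF D(4)[OF that]]] by simp
    then have "ty \<rho>' ` C' = ty \<rho> ` C" unfolding a(2)[symmetric] by (simp add: image_image)
    then show "cls (\<rho>, C) = cls (\<rho>', C')" unfolding cls_def[OF p good] using tr(1) by simp
  qed
qed

text \<open>\<open>realize\<close> provides the permutation, \<open>exists_system\<close> a basis
  with that permutation in the given space, and the prescribed characters define diagonal operators
  on it. The relation between \<open>\<chi> (\<sigma> i)\<close> and \<open>\<chi> i\<close> is
  exactly unitarity, and applied twice it is compatibility with \<open>phi\<close>, so the operators
  descend to matrices.\<close>

lemma exists_pair:
  assumes w: "w \<in> PM.stable n" and Dw: "D \<subseteq> PM.isotypes w" "Complete_Partial_Order.chain (\<subseteq>#) D"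
  shows "\<exists>\<rho> C. (\<rho>, C) \<in> pairs p r \<and> cls (\<rho>, C) = (w, D)"
proof -
  obtain \<sigma> \<chi> A where \<sigma>: "\<sigma> permutes {..<n}" and \<chi>1: "\<forall>i<n. \<chi> (\<sigma> i) = H.sg (\<chi> i)"
    and \<chi>2: "image_mset \<chi> (mset_set {..<n}) = w"
    and A': "\<forall>f\<in>D. A f \<subseteq> {..<n} \<and> image_mset \<chi> (mset_set (A f)) = f \<and>
      (\<forall>i\<in>A f. \<sigma> (\<sigma> i) \<in> A f \<and> \<sigma> i \<notin> A f) \<and> (\<forall>f'\<in>D. f \<subseteq># f' \<longrightarrow> A f \<subseteq> A f')"
    using PM.realize_ex[OF w Dw] by (elim exE conjE) (rule that)
  note \<chi> = \<chi>1[rule_format] \<chi>2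
  have A: "\<And>f. f \<in> D \<Longrightarrow> A f \<subseteq> {..<n}" "\<And>f. f \<in> D \<Longrightarrow> image_mset \<chi> (mset_set (A f)) = f"
      "\<And>f i. f \<in> D \<Longrightarrow> i \<in> A f \<Longrightarrow> \<sigma> (\<sigma> i) \<in> A f" "\<And>f i. f \<in> D \<Longrightarrow> i \<in> A f \<Longrightarrow> \<sigma> i \<notin> A f"
      "\<And>f f'. f \<in> D \<Longrightarrow> f' \<in> D \<Longrightarrow> f \<subseteq># f' \<Longrightarrow> A f \<subseteq> A f'"
    subgoal by (rule bspec[OF A', THEN conjunct1])
    subgoal by (rule bspec[OF A', THEN conjunct2, THEN conjunct1])
    subgoal by (rule bspec[OF bspec[OF A', THEN conjunct2, THEN conjunct2, THEN conjunct1], THEN conjunct1])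
    subgoal by (rule bspec[OF bspec[OF A', THEN conjunct2, THEN conjunct2, THEN conjunct1], THEN conjunct2])
    subgoal by (rule bspec[OF bspec[OF A', THEN conjunct2, THEN conjunct2, THEN conjunct2], THEN mp])
    done
  have \<chi>T: "\<chi> i \<in> proots p r" if "i < n" for i
    using w that unfolding PM.stable_def \<chi>(2)[symmetric] by auto
  have len: "length (\<chi> i) = r" if "i < n" for i using \<chi>T[OF that] by (simp add: proots_def)
  have "\<exists>e :: nat \<Rightarrow> nat \<Rightarrow> 'a alg_closure. (\<forall>i<n. e i \<in> Vn n) \<and> (\<forall>i<n. phiL (e i) = e (\<sigma> (\<sigma> i))) \<and>
    (\<forall>i<n. \<forall>j<n. hL (e (\<sigma> i)) (e j) = (if i = j then 1 else 0))"
  proof (rule ff.exists_system[where ?s1.0 = "rv n" and a = wts and s = \<sigma>, OF rv_permutes wts_props \<sigma>])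
    fix e :: "nat \<Rightarrow> nat \<Rightarrow> 'a alg_closure"
    assume a: "\<And>i. i < n \<Longrightarrow> e i \<in> Vn n" "\<And>i. i < n \<Longrightarrow> phiL (e i) = e (\<sigma> (\<sigma> i))"
      "\<And>i j. i < n \<Longrightarrow> j < n \<Longrightarrow> hL (e (\<sigma> i)) (e j) = (if i = j then 1 else 0)"
    show ?thesis by (intro exI[of _ e] conjI allI impI) (rule a; assumption)+
  qed
  then obtain e :: "nat \<Rightarrow> nat \<Rightarrow> 'a alg_closure" where e': "\<forall>i<n. e i \<in> Vn n" "\<forall>i<n. phiL (e i) = e (\<sigma> (\<sigma> i))"
    "\<forall>i<n. \<forall>j<n. hL (e (\<sigma> i)) (e j) = (if i = j then 1 else 0)"
    by (elim exE conjE) (rule that)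
  note e = e'[rule_format]
  have es0: "H.sys [] {} (\<lambda>_. {}) n \<sigma> (\<lambda>_. []) (\<lambda>_. {}) e"
    unfolding H.sys_def using e permutes_imp_bij[OF \<sigma>] by simp
  have full: "H.perp n e = {0}" using H.sys_full_iff[OF H.rep_Nil es0] by (simp add: card_std)
  define Z where "Z = (\<Union>i<n. set (\<chi> i))"
  have "\<forall>z\<in>Z. \<exists>k. z ^ (p ^ k) = 1" using \<chi>T unfolding Z_def proots_def by blast
  from bchoice[OF this] obtain k where k: "\<forall>z\<in>Z. z ^ (p ^ k z) = 1" by (elim exE)
  \<comment> \<open>A sum dominates each of its terms, so p^K is a common exponent for all
    eigenvalues.\<close>
  define K where "K = (\<Sum>z\<in>Z. k z)"
  have K: "z ^ (p ^ K) = 1" if iz: "i < n" "z \<in> set (\<chi> i)" for i z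
  proof -
    have z: "z \<in> Z" using iz by (auto simp: Z_def)
    have "finite Z" unfolding Z_def by auto
    then have "K = k z + (\<Sum>z\<in>Z - {z}. k z)" unfolding K_def using z by (rule sum.remove)
    then have "z ^ (p ^ K) = (z ^ (p ^ k z)) ^ (p ^ (\<Sum>z\<in>Z - {z}. k z))"
      by (simp add: power_add power_mult)
    then show ?thesis using bspec[OF k z] by simp
  qed
  have nz: "z \<noteq> 0" if "i < n" "z \<in> set (\<chi> i)" for i z
    using K[OF that] prime_gt_0_nat[OF p] by (auto simp: power_0_left)
  have \<sigma>n: "\<sigma> i < n" if "i < n" for i using \<sigma> that permutes_in_image[OF \<sigma>, of i] by simp
  have uop: "H.unit_op (H.basis_op n \<sigma> (\<lambda>i. \<chi> i ! t) e e)" if t: "t < r" for t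
  proof (rule H.unit_op_basis_op[OF es0 es0 full])
    fix i assume i: "i < n"
    have s1: "\<chi> (\<sigma> j) ! t = inverse ((\<chi> j ! t) ^ q)" if "j < n" for j
      using \<chi>(1)[OF that] len[OF that] t by (simp add: H.sg_def)
    have z: "\<chi> i ! t \<noteq> 0" using nz[OF i] t len[OF i] by simp
    show "\<chi> (\<sigma> (\<sigma> i)) ! t = (\<chi> i ! t) ^ q\<^sup>2"
      unfolding s1[OF \<sigma>n[OF i]] s1[OF i] by (simp add: power_inverse power2_eq_square flip: power_mult)
    show "\<chi> (\<sigma> i) ! t * (\<chi> i ! t) ^ q = 1" unfolding s1[OF i] using z by simp
  qed
  have "\<exists>A\<in>carrier G. \<forall>v\<in>Vn n. H.basis_op n \<sigma> (\<lambda>i. \<chi> i ! t) e e v = opm A v" if "t < r" for t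
    using unit_op_imp_opm[OF uop[OF that]] .
  then obtain Y where Y: "\<And>t. t < r \<Longrightarrow> Y t \<in> carrier G"
    "\<And>t v. t < r \<Longrightarrow> v \<in> Vn n \<Longrightarrow> H.basis_op n \<sigma> (\<lambda>i. \<chi> i ! t) e e v = opm (Y t) v" by metis
  define \<rho> where "\<rho> = map Y [0..<r]"
  have \<rho>l: "length (map opm \<rho>) = r" "\<And>t. t < r \<Longrightarrow> map opm \<rho> ! t = opm (Y t)" by (simp_all add: \<rho>_def)
  \<comment> \<open>For r = 0 the prime may vanish in the field; there are no eigenvalues then, and
    1 is an admissible exponent.\<close>
  define M where "M = (if r = 0 then 1 else p ^ K)"
  have M: "of_nat M \<noteq> (0 :: 'a alg_closure)" using good by (auto simp: M_def)
  have es0': "H.sys [] {} (\<lambda>_. {}) (card (std ` {..<n} :: (nat \<Rightarrow> 'a alg_closure) set)) \<sigma> (\<lambda>_. []) (\<lambda>_. {}) e"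
    unfolding card_std by (rule es0)
  have R: "H.rep (map opm \<rho>)" "H.eigsys (map opm \<rho>) \<sigma> \<chi> e"
    "t < r \<Longrightarrow> v \<in> Vn n \<Longrightarrow> ((map opm \<rho> ! t) ^^ M) v = v" for t v
  proof -
    have a: "length (\<chi> i) = r" "\<chi> (\<sigma> i) = H.sg (\<chi> i)" if "i < card (std ` {..<n} :: (nat \<Rightarrow> 'a alg_closure) set)" for i
      using that len \<chi>(1) by (simp_all add: card_std)
    have b: "z ^ M = 1" if "i < card (std ` {..<n} :: (nat \<Rightarrow> 'a alg_closure) set)" "z \<in> set (\<chi> i)" for i z
      using that K len[of i] by (auto simp: card_std M_def)
    have c: "H.unit_op (map opm \<rho> ! t)" if "t < r" for t using unit_op_opm[OF Y(1)[OF that]] \<rho>l(2)[OF that] by simp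
    have d: "(map opm \<rho> ! t) (e i) = fscale (\<chi> i ! t) (e i)"
      if "t < r" "i < card (std ` {..<n} :: (nat \<Rightarrow> 'a alg_closure) set)" for t i
      using Y(2)[OF that(1) e(1)] H.basis_op_apply[OF es0 es0] that \<rho>l(2)[OF that(1)] by (simp add: card_std)
    note E = H.eig_op[OF es0' a M b \<rho>l(1) c d]
    show "H.rep (map opm \<rho>)" by (rule E(1))
    show "H.eigsys (map opm \<rho>) \<sigma> \<chi> e" by (rule E(2))
    show "t < r \<Longrightarrow> v \<in> Vn n \<Longrightarrow> ((map opm \<rho> ! t) ^^ M) v = v" for t v by (rule E(3))
  qed
  have set\<rho>: "set \<rho> = Y ` {..<r}" by (auto simp: \<rho>_def)
  have pt: "\<rho> \<in> ptuples p r" unfolding ptuples_def mem_Collect_eq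
  proof (intro conjI ballI)
    show "length \<rho> = r" by (simp add: \<rho>_def)
    show "set \<rho> \<subseteq> carrier G" using Y(1) set\<rho> by auto
  next
    fix A1 A2 assume "A1 \<in> set \<rho>" "A2 \<in> set \<rho>"
    then have AG: "A1 \<in> carrier G" "A2 \<in> carrier G" and in1: "opm A1 \<in> set (map opm \<rho>)" "opm A2 \<in> set (map opm \<rho>)"
      using Y(1) set\<rho> by auto
    note m = G_carrier_mat[OF AG(1)] G_carrier_mat[OF AG(2)]
    show "A1 * A2 = A2 * A1"
    proof (rule opm_eqD)
      fix v :: "nat \<Rightarrow> 'a alg_closure" assume v: "v \<in> Vn n"
      have "opm A1 (opm A2 v) = opm A2 (opm A1 v)" using R(1) in1 v unfolding H.rep_def by blast
      then show "opm (A1 * A2) v = opm (A2 * A1) v" using opm_mult[OF m v] opm_mult[OF m(2,1) v] by simp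
    qed (use m in auto)
  next
    fix A1 assume "A1 \<in> set \<rho>"
    then obtain t where t: "t < r" "A1 = Y t" using set\<rho> by auto
    have M': "M = p ^ K" using t(1) by (simp add: M_def)
    have "(opm (Y t) ^^ (p ^ K)) v = v" if "v \<in> Vn n" for v using R(3)[OF t(1) that] \<rho>l(2)[OF t(1)] M' by simp
    then have "A1 [^]\<^bsub>G\<^esub> (p ^ K) = \<one>\<^bsub>G\<^esub>" using opm_pow_eq_iff[OF Y(1)[OF t(1)]] t(2) by blast
    then have "group.ord G A1 dvd p ^ K" using group.pow_eq_id[OF group_G Y(1)[OF t(1)]] t(2) by blast
    then show "\<exists>k. group.ord G A1 = p ^ k" using divides_primepow_nat[OF p] by blast
  qed
  have Asub: "A f \<subseteq> {..<card (std ` {..<n} :: (nat \<Rightarrow> 'a alg_closure) set)}" if "f \<in> D" for f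
    using A(1)[OF that] by (simp add: card_std)
  define U where "U f = ufix (fs.span (e ` A f))" for f
  have ss: "H.stab (map opm \<rho>) (fs.span (e ` A f))"
    "\<And>x y. x \<in> fs.span (e ` A f) \<Longrightarrow> y \<in> fs.span (e ` A f) \<Longrightarrow> hL x y = 0" if "f \<in> D" for f
    using H.eig_span_stab[OF R(1,2) Asub[OF that] A(3)[OF that] A(4)[OF that]] by blast+
  have UB: "Ubar (U f) = fs.span (e ` A f)" "ksub n (U f)" if "f \<in> D" for f
    unfolding U_def using Ubar_ufix[OF ss(1)[OF that]] by simp_all
  have tyU: "ty \<rho> (U f) = f" if "f \<in> D" for f
    unfolding ty_def[OF p good] UB(1)[OF that] using H.ityp_span[OF R(1,2) Asub[OF that]] A(2)[OF that] by simp
  have tyV: "H.ityp (map opm \<rho>) (Vn n) = w" using H.ityp_V[OF R(1,2)] \<chi>(2) by (simp add: card_std)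
  have "(\<rho>, U ` D) \<in> pairs p r"
  proof -
    have "U f \<in> inv_iso \<rho>" if f: "f \<in> D" for f
      unfolding inv_iso_iff
    proof (intro conjI ballI)
      show "ksub n (U f)" by (rule UB(2)[OF f])
      show "U f \<noteq> {0\<^sub>v n}"
      proof
        assume "U f = {0\<^sub>v n}"
        then have "fs.span (e ` A f) = fs.span (e ` {})" using UB(1)[OF f] Ubar_zero by simp
        then have "f = image_mset \<chi> (mset_set {})"
          using H.ityp_span[OF R(1,2) Asub[OF f]] H.ityp_span[OF R(1,2), of "{}"] A(2)[OF f] by simp
        then show False using f Dw(1) unfolding PM.isotypes_def by auto
      qed
      show "herm_form n q c u v = 0" if uv: "u \<in> U f" "v \<in> U f" for u v
      proof -
        have "u \<in> carrier_vec n" "v \<in> carrier_vec n" "emb u \<in> fs.span (e ` A f)" "emb v \<in> fs.span (e ` A f)"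
          using uv unfolding U_def ufix_def by blast+
        then show ?thesis using ss(2)[OF f, of "emb u" "emb v"] h_emb[of u v] by simp
      qed
      show "(\<lambda>v. B *\<^sub>v v) ` U f = U f" if B: "B \<in> set \<rho>" for B
      proof -
        have BG: "B \<in> carrier G" using ptuples_D(2)[OF pt B] .
        note Bm = G_carrier_mat[OF BG]
        have Uc: "U f \<subseteq> carrier_vec n" by (rule ksub_carrier[OF UB(2)[OF f]])
        have sub: "(\<lambda>v. B *\<^sub>v v) ` U f \<subseteq> U f"
        proof
          fix x assume "x \<in> (\<lambda>v. B *\<^sub>v v) ` U f"
          then obtain v where v: "v \<in> U f" "x = B *\<^sub>v v" by auto
          have "opm B (emb v) \<in> fs.span (e ` A f)"
            using ss(1)[OF f] B v(1) unfolding H.stab_def U_def ufix_def by auto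
          then show "x \<in> U f" using v Uc Bm opm_emb[OF Bm, of v] unfolding U_def ufix_def by auto
        qed
        show ?thesis by (rule G_image_eqI[OF BG Uc sub])
      qed
    qed
    moreover have "Complete_Partial_Order.chain (\<le>) (U ` D)"
    proof (rule chainI)
      fix x y assume "x \<in> U ` D" "y \<in> U ` D"
      then obtain f f' where f: "f \<in> D" "f' \<in> D" "x = U f" "y = U f'" by auto
      have "U f \<subseteq> U f'" if "f \<in> D" "f' \<in> D" "f \<subseteq># f'" for f f'
        using fs.span_mono[OF image_mono[OF A(5)[OF that], of e]] unfolding U_def ufix_def by blast
      then show "x \<subseteq> y \<or> y \<subseteq> x" using chainD[OF Dw(2) f(1,2)] f by blast
    qed
    ultimately show ?thesis unfolding pairs_def using pt by auto
  qed
  moreover have "cls (\<rho>, U ` D) = (w, D)"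
    unfolding cls_def[OF p good] using tyV tyU by (simp add: image_image)
  ultimately show ?thesis by blast
qed

text \<open>The invariants that occur are exactly the pairs of a stable w and a chain of isotypes of
  w, so the orbit sum of signs is the sum of the weights of the w. The minus sign is the one between
  \<open>esum\<close> and the reduced Euler characteristic.\<close>

theorem equiv_reduced_euler_char_eq:
  "equiv_reduced_euler_char (Suc r) p n q c = - of_int (PM.wt_sum n)"
proof -
  interpret group G by (rule group_G)
  have fst_ok: "set (fst w) \<subseteq> carrier G" "\<And>U. U \<in> snd w \<Longrightarrow> U \<subseteq> carrier_vec n" if "w \<in> pairs p r" for w
  proof -
    have P: "(fst w, snd w) \<in> pairs p r" using that by simp
    show "set (fst w) \<subseteq> carrier G" using ptuples_D(2)[OF pairs_D(1)[OF p good P]] by blast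
    show "\<And>U. U \<in> snd w \<Longrightarrow> U \<subseteq> carrier_vec n" using ksub_carrier[OF pairs_D(4)[OF p good P]] .
  qed
  define W where "W z = (-1 :: int) ^ card (snd z)" for z :: "'a alg_closure list multiset \<times> 'a alg_closure list multiset set"
  have img: "cls ` pairs p r = (SIGMA w:PM.stable n. {D. D \<subseteq> PM.isotypes w \<and> Complete_Partial_Order.chain (\<subseteq>#) D})"
  proof (intro equalityI subsetI)
    fix z assume "z \<in> cls ` pairs p r"
    then obtain \<rho> C where P: "(\<rho>, C) \<in> pairs p r" "z = cls (\<rho>, C)" by auto
    show "z \<in> (SIGMA w:PM.stable n. {D. D \<subseteq> PM.isotypes w \<and> Complete_Partial_Order.chain (\<subseteq>#) D})"
      unfolding P(2) cls_def[OF p good] fst_conv snd_conv using cls_props[OF p good P(1)] by blast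
  next
    fix z assume "z \<in> (SIGMA w:PM.stable n. {D. D \<subseteq> PM.isotypes w \<and> Complete_Partial_Order.chain (\<subseteq>#) D})"
    then obtain w D where z: "z = (w, D)" "w \<in> PM.stable n" "D \<subseteq> PM.isotypes w" "Complete_Partial_Order.chain (\<subseteq>#) D" by auto
    obtain \<rho> C where "(\<rho>, C) \<in> pairs p r" "cls (\<rho>, C) = (w, D)" using exists_pair[OF z(2-4)] by blast
    then show "z \<in> cls ` pairs p r" unfolding z(1) by (intro image_eqI[of _ _ "(\<rho>, C)"]) simp_all
  qed
  have "(\<Sum>(\<rho>, C)\<in>pairs p r. (-1) ^ card C * int (card {A \<in> centr \<rho>. \<forall>U\<in>C. (\<lambda>v. A *\<^sub>v v) ` U = U})) =
      (\<Sum>w\<in>pairs p r. W (cls w) * int (card {g \<in> carrier G. act g w = w}))"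
  proof (rule sum.cong[OF refl])
    fix w assume "w \<in> pairs p r"
    moreover obtain \<rho> C where w: "w = (\<rho>, C)" by fastforce
    ultimately have P: "(\<rho>, C) \<in> pairs p r" by simp
    have "W (cls w) = (-1) ^ card C" unfolding w W_def cls_def[OF p good] snd_conv fst_conv cls_props(4)[OF p good P] ..
    then show "(case w of (\<rho>, C) \<Rightarrow> (-1) ^ card C * int (card {A \<in> centr \<rho>. \<forall>U\<in>C. (\<lambda>v. A *\<^sub>v v) ` U = U})) =
       W (cls w) * int (card {g \<in> carrier G. act g w = w})"
      unfolding w prod.case Stab_pairs[OF P] by (simp only:)
  qed
  also have "\<dots> = int (card (carrier G)) * (\<Sum>z\<in>cls ` pairs p r. W z)"
  proof (rule weighted_burnside[OF group_G finite_G finite_pairs])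
    show "act g w \<in> pairs p r" if "g \<in> carrier G" "w \<in> pairs p r" for g w
      using act_pairs[OF that(1), of "fst w" "snd w"] that(2) by simp
    show "act (g \<otimes>\<^bsub>G\<^esub> k) w = act g (act k w)" if "g \<in> carrier G" "k \<in> carrier G" "w \<in> pairs p r" for g k w
      unfolding G_simps by (rule act_mult[OF that(1,2) fst_ok[OF that(3)]])
    show "act \<one>\<^bsub>G\<^esub> w = w" if "w \<in> pairs p r" for w
      unfolding G_simps by (rule act_one[OF fst_ok[OF that]])
    show "cls w = cls w' \<longleftrightarrow> (\<exists>g\<in>carrier G. act g w = w')" if "w \<in> pairs p r" "w' \<in> pairs p r" for w w'
      using cls_eq_iff[of "fst w" "snd w" "fst w'" "snd w'"] that by simp
  qed
  also have "(\<Sum>z\<in>cls ` pairs p r. W z) = PM.wt_sum n"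
    unfolding img PM.wt_sum_def PM.wt_def esum_def W_def
    using PM.finite_stable finite_chains[OF PM.finite_isotypes] by (subst sum.Sigma) (auto simp: case_prod_unfold)
  finally have main: "(\<Sum>(\<rho>, C)\<in>pairs p r. (-1) ^ card C * int (card {A \<in> centr \<rho>. \<forall>U\<in>C. (\<lambda>v. A *\<^sub>v v) ` U = U})) =
     int (card (carrier G)) * PM.wt_sum n" .
  have "(\<Sum>Xs\<in>hom_tuples p (Suc r) G. reduced_euler_char (invariant_subposet (isotropic_subspaces n q c) (generate G (set Xs)))) =
     - (int (card (carrier G)) * PM.wt_sum n)"
    unfolding main[symmetric] sum_hom_tuples[symmetric] sum_negf[symmetric]
    by (intro sum.cong refl reduced_euler_char_esum) (simp add: invariant_subposet_def finite_isotropic)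
  moreover have "card (carrier G) \<noteq> 0" using finite_G one_closed by auto
  ultimately show ?thesis unfolding equiv_reduced_euler_char_def
    by (simp flip: of_int_sum)
qed

end

end

section \<open>Unipotent elements in the defining characteristic\<close>

context vector_space
begin

lemma funpow_id_plus_binomial:
  assumes N: "\<And>x y. N (x + y) = N x + N y" and Y: "\<And>v. Y v = v + N v" and scale: "\<And>a x. N (a *s x) = a *s N x"
  shows "(Y ^^ m) v = (\<Sum>i\<le>m. of_nat (m choose i) *s (N ^^ i) v)"
proof (induction m)
  case 0 then show ?case by simp
next
  case (Suc m)
  have Nsum: "N (\<Sum>i\<in>S. t i) = (\<Sum>i\<in>S. N (t i))" for t :: "nat \<Rightarrow> 'b" and S
    using additive_sum[of N t S] N by blast
  have "(Y ^^ Suc m) v = (\<Sum>i\<le>m. of_nat (m choose i) *s (N ^^ i) v) + (\<Sum>i\<le>m. of_nat (m choose i) *s (N ^^ Suc i) v)"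
    by (simp add: Suc Y Nsum scale)
  also have "(\<Sum>i\<le>m. of_nat (m choose i) *s (N ^^ i) v) = (\<Sum>i\<le>Suc m. of_nat (m choose i) *s (N ^^ i) v)"
    by (simp add: binomial_eq_0)
  also have "\<dots> = v + (\<Sum>i\<le>m. of_nat (m choose Suc i) *s (N ^^ Suc i) v)"
    by (subst sum.atMost_Suc_shift) simp
  also have "\<dots> + (\<Sum>i\<le>m. of_nat (m choose i) *s (N ^^ Suc i) v) =
      v + (\<Sum>i\<le>m. of_nat (Suc m choose Suc i) *s (N ^^ Suc i) v)"
    by (simp add: sum.distrib scale_left_distrib add_ac)
  also have "\<dots> = (\<Sum>i\<le>Suc m. of_nat (Suc m choose i) *s (N ^^ i) v)"
    by (subst sum.atMost_Suc_shift) simp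
  finally show ?case .
qed

text \<open>Freshman's dream for the commuting operators 1 and N, iterated k times.\<close>

lemma funpow_prime_power_id_plus:
  fixes p :: nat
  assumes p: "prime p" "of_nat p = (0 :: 'a)"
    and N: "\<And>x y. N (x + y) = N x + N y" and scale: "\<And>a x. N (a *s x) = a *s N x" and Y: "\<And>v. Y v = v + N v"
  shows "(Y ^^ (p ^ k)) v = v + (N ^^ (p ^ k)) v"
proof (induction k arbitrary: v)
  case 0 then show ?case by (simp add: Y)
next
  case (Suc k)
  define N' where "N' = N ^^ (p ^ k)"
  have N': "N' (x + y) = N' x + N' y" "N' (a *s x) = a *s N' x" for x y a
  proof -
    have "(N ^^ j) (x + y) = (N ^^ j) x + (N ^^ j) y" "(N ^^ j) (a *s x) = a *s (N ^^ j) x" for j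
      by (induction j) (simp_all add: N scale)
    then show "N' (x + y) = N' x + N' y" "N' (a *s x) = a *s N' x" unfolding N'_def by blast+
  qed
  have pw: "(f ^^ (p ^ Suc k)) v = ((f ^^ (p ^ k)) ^^ p) v" for f :: "'b \<Rightarrow> 'b"
    by (simp add: funpow_mult mult.commute)
  have "((Y ^^ (p ^ k)) ^^ p) v = (\<Sum>i\<le>p. of_nat (p choose i) *s (N' ^^ i) v)"
    by (rule funpow_id_plus_binomial) (simp_all add: N' Suc flip: N'_def)
  also have "\<dots> = (\<Sum>i\<in>{0, p}. of_nat (p choose i) *s (N' ^^ i) v)"
  proof (rule sum.mono_neutral_right)
    show "\<forall>i\<in>{..p} - {0, p}. of_nat (p choose i) *s (N' ^^ i) v = 0"
    proof
      fix i assume "i \<in> {..p} - {0, p}"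
      then have "p dvd (p choose i)" by (intro dvd_choose_prime) (use p(1) in auto)
      then obtain l where "p choose i = p * l" by (auto elim: dvdE)
      then have "of_nat (p choose i) = (0 :: 'a)" using p(2) by simp
      then show "of_nat (p choose i) *s (N' ^^ i) v = 0" by simp
    qed
  qed auto
  also have "\<dots> = v + (N' ^^ p) v" using prime_gt_0_nat[OF p(1)] by simp
  finally show ?case unfolding pw by (simp add: N'_def)
qed

end

section \<open>Contractibility in the presence of a unipotent element\<close>

context unitary_space
begin

lemma ksub_minus: "ksub n U \<Longrightarrow> u \<in> U \<Longrightarrow> v \<in> U \<Longrightarrow> u - v \<in> U"
proof -
  assume U: "ksub n U" "u \<in> U" "v \<in> U"
  then have c: "u \<in> carrier_vec n" "v \<in> carrier_vec n" by (auto simp: ksub_def)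
  have "u - v = u + (-1) \<cdot>\<^sub>v v" using c by (intro eq_vecI) auto
  then show "u - v \<in> U" using U unfolding ksub_def by simp
qed

lemma vec_minus_eq_0: "u \<in> carrier_vec n \<Longrightarrow> v \<in> carrier_vec n \<Longrightarrow> u - v = 0\<^sub>v n \<Longrightarrow> u = v"
  for u v :: "'a vec"
proof -
  assume c: "u \<in> carrier_vec n" "v \<in> carrier_vec n" and e: "u - v = 0\<^sub>v n"
  show "u = v"
  proof (rule eq_vecI)
    fix i assume "i < dim_vec v"
    then have "i < n" using c by simp
    then have "u $ i - v $ i = 0" using c arg_cong[OF e, of "\<lambda>x. vec_index x i"] by simp
    then show "u $ i = v $ i" by (simp only: right_minus_eq)
  qed (use c in auto)
qed

context
  fixes p k :: nat and Y :: "'a mat"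
  assumes p: "prime p" "of_nat p = (0 :: 'a alg_closure)" and Y: "Y \<in> carrier G" and Ypow: "Y [^]\<^bsub>G\<^esub> (p ^ k) = \<one>\<^bsub>G\<^esub>"
begin

lemma Ym: "Y \<in> carrier_mat n n" by (rule G_carrier_mat[OF Y])

definition nil :: "'a vec \<Rightarrow> 'a vec" where "nil v = Y *\<^sub>v v - v"

lemma nil_carrier: "v \<in> carrier_vec n \<Longrightarrow> nil v \<in> carrier_vec n" using Ym by (simp add: nil_def)

lemma nil_eq_0_iff: "v \<in> carrier_vec n \<Longrightarrow> nil v = 0\<^sub>v n \<longleftrightarrow> Y *\<^sub>v v = v"
  using vec_minus_eq_0[of "Y *\<^sub>v v" v] Ym by (auto simp: nil_def)

text \<open>In characteristic p the p^k-th power of Y - 1 is Y^(p^k) - 1 = 0; the computation is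
  done on the scalar extension.\<close>

lemma nil_nilpotent:
  assumes v: "v \<in> carrier_vec n" shows "(nil ^^ (p ^ k)) v = 0\<^sub>v n"
proof -
  define N where "N v = opm Y v - v" for v
  have N: "N (x + y) = N x + N y" "N (fscale a x) = fscale a (N x)" for x y a
    unfolding N_def by (simp_all add: opm_add opm_scale fs.scale_right_diff_distrib)
  have c: "(nil ^^ i) v \<in> carrier_vec n" for i by (induction i) (simp_all add: v nil_carrier)
  have e: "emb (nil u) = N (emb u)" if "u \<in> carrier_vec n" for u
  proof -
    have "emb (Y *\<^sub>v u) = emb (nil u + u)"
      using that Ym by (intro arg_cong[where f = emb] eq_vecI) (auto simp: nil_def)
    also have "\<dots> = emb (nil u) + emb u" by (rule emb_add[OF nil_carrier[OF that] that])
    finally show ?thesis unfolding N_def using opm_emb[OF Ym that] by simp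
  qed
  have eN: "emb ((nil ^^ i) v) = (N ^^ i) (emb v)" for i
    by (induction i) (simp_all add: e[OF c])
  have "(opm Y ^^ (p ^ k)) (emb v) = emb v + (N ^^ (p ^ k)) (emb v)"
    by (rule fs.funpow_prime_power_id_plus[OF p N]) (simp add: N_def fun_eq_iff)
  moreover have "(opm Y ^^ (p ^ k)) (emb v) = emb v" using opm_pow_eq_iff[OF Y, of "p ^ k"] Ypow emb_in by blast
  ultimately have "emb ((nil ^^ (p ^ k)) v) = emb (0\<^sub>v n)" unfolding eN emb_0 by simp
  then show ?thesis using emb_inj[OF c zero_carrier_vec] by blast
qed

text \<open>The last nonzero iterate of Y - 1 on a nonzero vector of U is fixed by Y.\<close>

lemma exists_fixed:
  assumes U: "ksub n U" "U \<noteq> {0\<^sub>v n}" "\<And>u. u \<in> U \<Longrightarrow> Y *\<^sub>v u \<in> U"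
  obtains u where "u \<in> U" "u \<noteq> 0\<^sub>v n" "Y *\<^sub>v u = u"
proof -
  obtain u where u: "u \<in> U" "u \<noteq> 0\<^sub>v n" using U(1,2) unfolding ksub_def by blast
  have uc: "u \<in> carrier_vec n" using u(1) ksub_carrier[OF U(1)] by blast
  have inU: "(nil ^^ i) u \<in> U" for i
    by (induction i) (simp_all add: u(1) nil_def ksub_minus[OF U(1)] U(3))
  define m where "m = (LEAST m. (nil ^^ m) u = 0\<^sub>v n)"
  have m: "(nil ^^ m) u = 0\<^sub>v n" unfolding m_def by (rule LeastI[of _ "p ^ k"]) (rule nil_nilpotent[OF uc])
  have "m \<noteq> 0"
  proof
    assume "m = 0" then show False using m u(2) by simp
  qed
  then obtain l where l: "m = Suc l" by (cases m) auto
  have nz: "(nil ^^ l) u \<noteq> 0\<^sub>v n" using not_less_Least[of l "\<lambda>m. (nil ^^ m) u = 0\<^sub>v n"] l by (simp add: m_def)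
  have "(nil ^^ l) u \<in> carrier_vec n" using inU ksub_carrier[OF U(1)] by blast
  from nil_eq_0_iff[OF this] have "Y *\<^sub>v ((nil ^^ l) u) = (nil ^^ l) u" using m l by simp
  then show ?thesis by (rule that[OF inU nz])
qed

definition fixY :: "'a vec set" where "fixY = {v \<in> carrier_vec n. Y *\<^sub>v v = v}"
definition imY :: "'a vec set" where "imY = nil ` carrier_vec n"

lemma ksub_fixY: "ksub n fixY"
  unfolding ksub_def
proof (intro conjI ballI allI)
  show "fixY \<subseteq> carrier_vec n" by (auto simp: fixY_def)
  show "0\<^sub>v n \<in> fixY" using Ym by (auto simp: fixY_def intro!: eq_vecI simp: scalar_prod_def)
  show "u + v \<in> fixY" if "u \<in> fixY" "v \<in> fixY" for u v
    using that mult_add_distrib_mat_vec[OF Ym, of u v] by (simp add: fixY_def)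
  show "a \<cdot>\<^sub>v u \<in> fixY" if "u \<in> fixY" for a u
    using that mult_mat_vec[OF Ym, of u a] by (simp add: fixY_def)
qed

lemma ksub_imY: "ksub n imY"
proof -
  have "imY = (\<lambda>v. (Y - 1\<^sub>m n) *\<^sub>v v) ` carrier_vec n"
    unfolding imY_def using Ym by (intro image_cong refl) (simp add: nil_def minus_mult_distrib_mat_vec[of Y n n])
  also have "ksub n \<dots>" by (rule ksub_image[OF _ ksub_carrier_vec]) (rule minus_carrier_mat[OF one_carrier_mat])
  finally show ?thesis .
qed

text \<open>For u fixed by Y, pairing u with Yv is pairing Yu with Yv, hence the same as pairing u
  with v.\<close>

lemma herm_fix_im:
  assumes "u \<in> fixY" "w \<in> imY" shows "herm_form n q c u w = 0" "herm_form n q c w u = 0"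
proof -
  obtain v where v: "v \<in> carrier_vec n" "w = nil v" using assms(2) by (auto simp: imY_def)
  have u: "u \<in> carrier_vec n" "Y *\<^sub>v u = u" using assms(1) by (auto simp: fixY_def)
  have Yv: "Y *\<^sub>v v \<in> carrier_vec n" using Ym v(1) by simp
  have wc: "w \<in> carrier_vec n" using v nil_carrier by simp
  have pres: "hL (opm Y x) (opm Y y) = hL x y" if "x \<in> Vn n" "y \<in> Vn n" for x y
    using Y that unfolding carrier_G_iff by blast
  have e: "emb w = opm Y (emb v) - emb v"
  proof -
    have "emb (Y *\<^sub>v v) = emb (w + v)"
      using v Ym by (intro arg_cong[where f = emb] eq_vecI) (auto simp: nil_def)
    then show ?thesis using emb_add[OF wc v(1)] opm_emb[OF Ym v(1)] by simp
  qed
  have eu: "opm Y (emb u) = emb u" using opm_emb[OF Ym u(1)] u(2) by simp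
  have "to_ac (herm_form n q c u w) = 0"
    using pres[OF emb_in emb_in, of u v] unfolding h_emb[OF u(1) wc, symmetric] e H.h_diff_right eu by simp
  then show "herm_form n q c u w = 0" by simp
  have "to_ac (herm_form n q c w u) = 0"
    using pres[OF emb_in emb_in, of v u] unfolding h_emb[OF wc u(1), symmetric] e H.h_diff_left eu by simp
  then show "herm_form n q c w u = 0" by simp
qed

definition vsum :: "'a vec set \<Rightarrow> 'a vec set \<Rightarrow> 'a vec set" where
  "vsum U W = {u + w | u w. u \<in> U \<and> w \<in> W}"

lemma herm_form_add:
  assumes "u \<in> carrier_vec n" "v \<in> carrier_vec n" "w \<in> carrier_vec n"
  shows "herm_form n q c (u + v) w = herm_form n q c u w + herm_form n q c v w"
    "herm_form n q c w (u + v) = herm_form n q c w u + herm_form n q c w v"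
proof -
  have uv: "u + v \<in> carrier_vec n" using assms by simp
  have "to_ac (herm_form n q c (u + v) w) = to_ac (herm_form n q c u w + herm_form n q c v w)"
    "to_ac (herm_form n q c w (u + v)) = to_ac (herm_form n q c w u + herm_form n q c w v)"
    by (simp_all add: emb_add assms H.h_add_left H.h_add_right flip: h_emb[OF uv assms(3)] h_emb[OF assms(3) uv]
        h_emb[OF assms(1,3)] h_emb[OF assms(2,3)] h_emb[OF assms(3,1)] h_emb[OF assms(3,2)])
  then show "herm_form n q c (u + v) w = herm_form n q c u w + herm_form n q c v w"
    "herm_form n q c w (u + v) = herm_form n q c w u + herm_form n q c w v" by (simp_all only: to_ac_eq_iff)
qed

lemma ksub_vsum:
  assumes "ksub n U" "ksub n W" shows "ksub n (vsum U W)"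
proof -
  have c: "U \<subseteq> carrier_vec n" "W \<subseteq> carrier_vec n" using assms by (auto dest: ksub_carrier)
  show ?thesis unfolding ksub_def
  proof (intro conjI ballI allI)
    show "vsum U W \<subseteq> carrier_vec n" using c by (auto simp: vsum_def intro!: add_carrier_vec)
    have "(0\<^sub>v n :: 'a vec) = 0\<^sub>v n + 0\<^sub>v n" by simp
    then show "0\<^sub>v n \<in> vsum U W" using assms unfolding vsum_def ksub_def by blast
  next
    fix x y assume "x \<in> vsum U W" "y \<in> vsum U W"
    then obtain u w u' w' where e: "x = u + w" "y = u' + w'" "u \<in> U" "w \<in> W" "u' \<in> U" "w' \<in> W" by (auto simp: vsum_def)
    have "u \<in> carrier_vec n" "u' \<in> carrier_vec n" "w \<in> carrier_vec n" "w' \<in> carrier_vec n" using e c by auto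
    then have "x + y = (u + u') + (w + w')" unfolding e by (intro eq_vecI) auto
    moreover have "u + u' \<in> U" "w + w' \<in> W" using e(3-6) assms unfolding ksub_def by blast+
    ultimately show "x + y \<in> vsum U W" unfolding vsum_def by blast
  next
    fix a x assume "x \<in> vsum U W"
    then obtain u w where e: "x = u + w" "u \<in> U" "w \<in> W" by (auto simp: vsum_def)
    have "u \<in> carrier_vec n" "w \<in> carrier_vec n" using e c by auto
    then have "a \<cdot>\<^sub>v x = a \<cdot>\<^sub>v u + a \<cdot>\<^sub>v w" unfolding e by (rule smult_add_distrib_vec)
    moreover have "a \<cdot>\<^sub>v u \<in> U" "a \<cdot>\<^sub>v w \<in> W" using e(2,3) assms unfolding ksub_def by blast+
    ultimately show "a \<cdot>\<^sub>v x \<in> vsum U W" unfolding vsum_def by blast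
  qed
qed

text \<open>The apex is \<open>W = fixY \<inter> imY\<close>. It is isotropic because the kernel and
  the image of Y - 1 are orthogonal, nonzero because Y has a fixed vector in the nonzero space
  \<open>imY\<close>, and invariant because the tuple commutes with Y. The same orthogonality makes
  the sum of W with an isotropic subspace of \<open>fixY\<close> isotropic, and
  \<open>exists_fixed\<close> keeps intersections with \<open>fixY\<close> nonzero.\<close>

theorem esum_inv_iso_unipotent:
  assumes Y1: "Y \<noteq> 1\<^sub>m n" and \<rho>: "set \<rho> \<subseteq> carrier G" "Y \<in> set \<rho>" "\<And>A. A \<in> set \<rho> \<Longrightarrow> A * Y = Y * A"
  shows "esum (\<le>) (inv_iso \<rho>) = 0"
proof -
  define W where "W = fixY \<inter> imY"
  have inter: "ksub n (U \<inter> U')" if "ksub n U" "ksub n U'" for U U' :: "'a vec set"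
    using that unfolding ksub_def by blast
  have invI: "U \<in> inv_iso \<rho>" if U: "ksub n U" "U \<noteq> {0\<^sub>v n}" "\<And>u v. u \<in> U \<Longrightarrow> v \<in> U \<Longrightarrow> herm_form n q c u v = 0"
    "\<And>A u. A \<in> set \<rho> \<Longrightarrow> u \<in> U \<Longrightarrow> A *\<^sub>v u \<in> U" for U
  proof -
    have im: "(\<lambda>v. A *\<^sub>v v) ` U = U" if "A \<in> set \<rho>" for A
      by (rule G_image_eqI[OF subsetD[OF \<rho>(1) that] ksub_carrier[OF U(1)]]) (rule image_subsetI, rule U(4)[OF that])
    show ?thesis unfolding inv_iso_iff
      by (intro conjI ballI) (rule U(1), rule U(2), rule U(3), assumption, assumption, rule im, assumption)
  qed
  have invD: "ksub n U" "U \<noteq> {0\<^sub>v n}" "\<And>u v. u \<in> U \<Longrightarrow> v \<in> U \<Longrightarrow> herm_form n q c u v = 0"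
    "\<And>A u. A \<in> set \<rho> \<Longrightarrow> u \<in> U \<Longrightarrow> A *\<^sub>v u \<in> U" if U: "U \<in> inv_iso \<rho>" for U
  proof -
    note P = U[unfolded inv_iso_iff]
    show "ksub n U" by (rule P[THEN conjunct1])
    show "U \<noteq> {0\<^sub>v n}" by (rule P[THEN conjunct2, THEN conjunct1])
    show "herm_form n q c u v = 0" if "u \<in> U" "v \<in> U" for u v
      by (rule P[THEN conjunct2, THEN conjunct2, THEN conjunct1, THEN bspec, THEN bspec, OF that])
    show "A *\<^sub>v u \<in> U" if A: "A \<in> set \<rho>" "u \<in> U" for A u
      using imageI[OF A(2), of "\<lambda>v. A *\<^sub>v v"]
      unfolding bspec[OF P[THEN conjunct2, THEN conjunct2, THEN conjunct2] A(1)] .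
  qed
  have YA: "Y *\<^sub>v (A *\<^sub>v v) = A *\<^sub>v (Y *\<^sub>v v)" if "A \<in> set \<rho>" "v \<in> carrier_vec n" for A v
    using G_mult_vec[OF subsetD[OF \<rho>(1) that(1)] Y that(2)] G_mult_vec[OF Y subsetD[OF \<rho>(1) that(1)] that(2)] \<rho>(3)[OF that(1)] by simp
  have Ac: "A *\<^sub>v v \<in> carrier_vec n" if "A \<in> set \<rho>" "v \<in> carrier_vec n" for A v
    using G_carrier_mat[OF subsetD[OF \<rho>(1) that(1)]] that(2) by simp
  have fixA: "A *\<^sub>v v \<in> fixY" if "A \<in> set \<rho>" "v \<in> fixY" for A v
    using YA[OF that(1), of v] Ac[OF that(1), of v] that(2) by (simp add: fixY_def)
  have imA: "A *\<^sub>v v \<in> imY" if A: "A \<in> set \<rho>" and v: "v \<in> imY" for A v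
  proof -
    obtain x where x: "x \<in> carrier_vec n" "v = nil x" using v by (auto simp: imY_def)
    have "A *\<^sub>v v = A *\<^sub>v (Y *\<^sub>v x) - A *\<^sub>v x" unfolding x(2) nil_def
      using G_carrier_mat[OF subsetD[OF \<rho>(1) A]] x(1) Ym by (intro mult_minus_distrib_mat_vec) auto
    also have "\<dots> = nil (A *\<^sub>v x)" unfolding nil_def using YA[OF A x(1)] by simp
    finally show ?thesis using Ac[OF A x(1)] by (auto simp: imY_def)
  qed
  have kW: "ksub n W" unfolding W_def by (rule inter[OF ksub_fixY ksub_imY])
  have imY0: "imY \<noteq> {0\<^sub>v n}"
  proof
    assume z: "imY = {0\<^sub>v n}"
    have "Y *\<^sub>v v = v" if v: "v \<in> carrier_vec n" for v
      using nil_eq_0_iff[OF v] imageI[OF v, of nil] z unfolding imY_def by blast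
    then have e1: "opm Y (emb v) = opm (1\<^sub>m n) (emb v)" if "v \<in> carrier_vec n" for v
      using that Ym by (simp add: opm_emb)
    have "opm Y v = opm (1\<^sub>m n) v" if v: "v \<in> Vn n" for v
    proof (rule lin_ext[OF opm_add opm_scale opm_add opm_scale _ v])
      fix i assume i: "i < n"
      show "opm Y (std i) = opm (1\<^sub>m n) (std i)" unfolding std_emb[OF i] by (rule e1) simp
    qed
    then have "Y = 1\<^sub>m n" by (rule opm_eqD[OF Ym one_carrier_mat])
    then show False using Y1 by simp
  qed
  have "imY \<subseteq> carrier_vec n" by (rule ksub_carrier[OF ksub_imY])
  obtain w0 where w0: "w0 \<in> imY" "w0 \<noteq> 0\<^sub>v n" "Y *\<^sub>v w0 = w0"
    using exists_fixed[OF ksub_imY imY0 imA[OF \<rho>(2)]] .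
  have W0: "W \<noteq> {0\<^sub>v n}" using w0 \<open>imY \<subseteq> carrier_vec n\<close> unfolding W_def fixY_def by blast
  have WA: "A *\<^sub>v w \<in> W" if "A \<in> set \<rho>" "w \<in> W" for A w using fixA[OF that(1)] imA[OF that(1)] that(2) unfolding W_def by blast
  have WW: "herm_form n q c u w = 0" if "u \<in> W" "w \<in> W" for u w
    using herm_fix_im(1)[of u w] that unfolding W_def by blast
  have Win: "W \<in> inv_iso \<rho>" by (rule invI[OF kW W0 WW WA])
  have zW: "0\<^sub>v n \<in> W" using kW by (simp add: ksub_def)
  have Ufix: "U \<subseteq> fixY" if "U \<inter> fixY = U" for U using that by blast
  show ?thesis
  proof (rule esum_conically_contractible[where f = "\<lambda>U. U \<inter> fixY" and g = "\<lambda>U. vsum U W" and a = W])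
    show "finite (inv_iso \<rho>)" by (rule finite_inv_iso)
    show "U \<inter> fixY \<in> inv_iso \<rho>" if U: "U \<in> inv_iso \<rho>" for U
    proof (rule invI)
      show "ksub n (U \<inter> fixY)" by (rule inter[OF invD(1)[OF U] ksub_fixY])
      obtain u where "u \<in> U" "u \<noteq> 0\<^sub>v n" "Y *\<^sub>v u = u"
        using exists_fixed[OF invD(1,2)[OF U] invD(4)[OF U \<rho>(2)]] .
      then show "U \<inter> fixY \<noteq> {0\<^sub>v n}" using ksub_carrier[OF invD(1)[OF U]] unfolding fixY_def by blast
    qed (use invD(3,4)[OF U] fixA in auto)
    show "vsum U W \<in> inv_iso \<rho> \<and> vsum U W \<inter> fixY = vsum U W" if U: "U \<in> inv_iso \<rho>" "U \<inter> fixY = U" for U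
    proof
      have kV: "ksub n (vsum U W)" by (rule ksub_vsum[OF invD(1)[OF U(1)] kW])
      have Uc: "U \<subseteq> carrier_vec n" "W \<subseteq> carrier_vec n" by (rule ksub_carrier[OF invD(1)[OF U(1)]], rule ksub_carrier[OF kW])
      show "vsum U W \<in> inv_iso \<rho>"
      proof (rule invI[OF kV])
        have "W \<subseteq> vsum U W"
        proof
          fix w assume w: "w \<in> W"
          have "w = 0\<^sub>v n + w" using w Uc by auto
          then show "w \<in> vsum U W" using w invD(1)[OF U(1)] unfolding vsum_def ksub_def by blast
        qed
        then show "vsum U W \<noteq> {0\<^sub>v n}" using W0 zW by blast
        show "herm_form n q c x y = 0" if xy: "x \<in> vsum U W" "y \<in> vsum U W" for x y
        proof -
          obtain u w u' w' where e: "x = u + w" "y = u' + w'" "u \<in> U" "w \<in> W" "u' \<in> U" "w' \<in> W"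
            using xy by (auto simp: vsum_def)
          have cc: "u \<in> carrier_vec n" "u' \<in> carrier_vec n" "w \<in> carrier_vec n" "w' \<in> carrier_vec n" using e Uc by auto
          have z: "herm_form n q c u u' = 0" "herm_form n q c w w' = 0" "herm_form n q c u w' = 0" "herm_form n q c w u' = 0"
            using invD(3)[OF U(1) e(3,5)] WW[OF e(4,6)] herm_fix_im[of u w'] herm_fix_im[of u' w] Ufix[OF U(2)] e(3-6)
            unfolding W_def by blast+
          show ?thesis unfolding e(1,2) using cc z by (simp add: herm_form_add)
        qed
        show "A *\<^sub>v x \<in> vsum U W" if Ax: "A \<in> set \<rho>" "x \<in> vsum U W" for A x
        proof -
          obtain u w where e: "x = u + w" "u \<in> U" "w \<in> W" using Ax(2) by (auto simp: vsum_def)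
          have "A *\<^sub>v x = A *\<^sub>v u + A *\<^sub>v w" unfolding e
            using G_carrier_mat[OF subsetD[OF \<rho>(1) Ax(1)]] subsetD[OF Uc(1) e(2)] subsetD[OF Uc(2) e(3)] by (rule mult_add_distrib_mat_vec)
          then show ?thesis using invD(4)[OF U(1) Ax(1) e(2)] WA[OF Ax(1) e(3)] unfolding vsum_def by blast
        qed
      qed
      have "vsum U W \<subseteq> fixY"
      proof
        fix x assume "x \<in> vsum U W"
        then obtain u w where e: "x = u + w" "u \<in> U" "w \<in> W" by (auto simp: vsum_def)
        have "u \<in> fixY" "w \<in> fixY" using Ufix[OF U(2)] e(2,3) unfolding W_def by blast+
        then show "x \<in> fixY" using ksub_fixY unfolding e(1) ksub_def by blast
      qed
      then show "vsum U W \<inter> fixY = vsum U W" by blast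
    qed
    show "U \<subseteq> vsum U W" if U: "U \<in> inv_iso \<rho>" "U \<inter> fixY = U" for U
    proof
      fix u assume u: "u \<in> U"
      have "u = u + 0\<^sub>v n" using subsetD[OF ksub_carrier[OF invD(1)[OF U(1)]] u] by simp
      then show "u \<in> vsum U W" using u zW unfolding vsum_def by blast
    qed
    show "W \<subseteq> vsum U W" if U: "U \<in> inv_iso \<rho>" "U \<inter> fixY = U" for U
    proof
      fix w assume w: "w \<in> W"
      have "w = 0\<^sub>v n + w" using subsetD[OF ksub_carrier[OF kW] w] by simp
      moreover have "0\<^sub>v n \<in> U" using invD(1)[OF U(1)] by (simp add: ksub_def)
      ultimately show "w \<in> vsum U W" using w unfolding vsum_def by blast
    qed
    have absorb: "vsum (vsum U W) W = vsum U W" if U: "ksub n U" for U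
    proof
      note c = ksub_carrier[OF U] ksub_carrier[OF kW]
      show "vsum (vsum U W) W \<subseteq> vsum U W"
      proof
        fix x assume "x \<in> vsum (vsum U W) W"
        then obtain u w w' where e: "x = u + w + w'" "u \<in> U" "w \<in> W" "w' \<in> W" by (auto simp: vsum_def)
        have "x = u + (w + w')" unfolding e(1) using c e(2-4) by (intro assoc_add_vec) auto
        moreover have "w + w' \<in> W" using kW e(3,4) unfolding ksub_def by blast
        ultimately show "x \<in> vsum U W" using e(2) unfolding vsum_def by blast
      qed
      show "vsum U W \<subseteq> vsum (vsum U W) W"
      proof
        fix x assume x: "x \<in> vsum U W"
        have "x = x + 0\<^sub>v n" using subsetD[OF ksub_carrier[OF ksub_vsum[OF U kW]] x] by simp
        then show "x \<in> vsum (vsum U W) W" using x zW by (subst vsum_def) blast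
      qed
    qed
    show "vsum (vsum U W) W = vsum U W" if "U \<in> inv_iso \<rho>" "U \<inter> fixY = U" for U
      by (rule absorb[OF invD(1)[OF that(1)]])
    show "vsum W W = W"
    proof -
      have "vsum {0\<^sub>v n} W = W" unfolding vsum_def using ksub_carrier[OF kW] by (force simp: subset_iff)
      then show ?thesis using absorb[OF ksub_zero] by simp
    qed
    show "vsum U W \<subseteq> vsum U' W" if "U \<subseteq> U'" for U U' using that unfolding vsum_def by blast
    show "W \<inter> fixY = W" unfolding W_def by blast
  qed (use Win in auto)
qed

end

end

section \<open>The generating function\<close>

lemma power_gcd_eq_1:
  fixes z :: "'b::field"
  assumes "z ^ a = 1" "z ^ b = 1" "a \<noteq> 0" shows "z ^ gcd a b = 1"
proof -
  obtain x y where "a * x = b * y + gcd a b" using bezout_nat[OF assms(3)] by blast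
  then have "(z ^ a) ^ x = (z ^ b) ^ y * z ^ gcd a b" by (simp flip: power_mult power_add)
  then show ?thesis using assms by simp
qed

text \<open>If z is killed by a power of p and by M, it is killed by their greatest common divisor,
  a power of p dividing M and therefore dividing the p-part.\<close>

lemma p_power_root_iff:
  fixes z :: "'b::field"
  assumes p: "prime p" and M: "M > 0"
  shows "(\<exists>k. z ^ (p ^ k) = 1) \<and> z ^ M = 1 \<longleftrightarrow> z ^ p_part p M = 1"
proof
  assume "(\<exists>k. z ^ (p ^ k) = 1) \<and> z ^ M = 1"
  then obtain k where k: "z ^ (p ^ k) = 1" "z ^ M = 1" by blast
  have g: "z ^ gcd (p ^ k) M = 1" using k prime_gt_0_nat[OF p] by (intro power_gcd_eq_1) auto
  obtain i where i: "gcd (p ^ k) M = p ^ i" using divides_primepow_nat[OF p, of "gcd (p ^ k) M" k] by auto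
  then have "p ^ i dvd M" by (metis gcd_dvd2)
  then have "i \<le> multiplicity p M" using M p by (intro multiplicity_geI) auto
  then have "p ^ i dvd p_part p M" unfolding p_part_def by (rule le_imp_power_dvd)
  then obtain l where "p_part p M = p ^ i * l" by (elim dvdE)
  then show "z ^ p_part p M = 1" using g i by (simp add: power_mult)
next
  assume z: "z ^ p_part p M = 1"
  have "p_part p M dvd M" unfolding p_part_def by (rule multiplicity_dvd)
  then obtain l where "M = p_part p M * l" by (elim dvdE)
  then have "z ^ M = 1" using z by (metis power_mult power_one)
  then show "(\<exists>k. z ^ (p ^ k) = 1) \<and> z ^ M = 1" using z unfolding p_part_def by blast
qed

section \<open>Counting characters fixed by powers of the twist\<close>

context unitary_space
begin

lemma sg_pow: "(H.sg ^^ k) \<chi> = map (\<lambda>z. if even k then z ^ (q ^ k) else inverse (z ^ (q ^ k))) \<chi>"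
proof (induction k)
  case 0 then show ?case by (simp add: list.map_ident)
next
  case (Suc k)
  have "inverse (inverse (z ^ q ^ k) ^ q) = z ^ (q * q ^ k)" "(z ^ q ^ k) ^ q = z ^ (q * q ^ k)" for z :: "'a alg_closure"
    by (simp_all add: power_inverse mult.commute flip: power_mult)
  moreover have "(H.sg ^^ Suc k) \<chi> = map (\<lambda>z. inverse (z ^ q)) ((H.sg ^^ k) \<chi>)"
    unfolding funpow.simps o_apply by (rule H.sg_def)
  ultimately show ?case unfolding Suc by simp
qed

lemma unitary_M_pos:
  assumes "k > 0" shows "nat (int q ^ k - (-1) ^ k) > 0"
proof -
  have "int q ^ k \<ge> 2 ^ k" using H.q2 by (intro power_mono) auto
  moreover have "(2 :: int) ^ k \<ge> 2" using power_increasing[of 1 k "2::int"] assms by simp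
  moreover have "(-1 :: int) ^ k \<le> 1" by (cases "even k") auto
  ultimately show ?thesis by linarith
qed

text \<open>For even k the condition is z^(q^k) = z, for odd k it is z^(q^k) * z = 1; the two
  exponents q^k - 1 and q^k + 1 are q^k - (-1)^k.\<close>

lemma sg_fixed_iff:
  assumes k: "k > 0" and z: "z \<noteq> (0 :: 'a alg_closure)"
  shows "(if even k then z ^ (q ^ k) else inverse (z ^ (q ^ k))) = z \<longleftrightarrow> z ^ nat (int q ^ k - (-1) ^ k) = 1"
proof (cases "even k")
  case True
  then have M: "nat (int q ^ k - (-1) ^ k) = q ^ k - 1" by (simp add: nat_diff_distrib flip: of_nat_power)
  have "q ^ k = Suc (q ^ k - 1)" using H.q_pos by simp
  then have "z ^ (q ^ k) = z * z ^ (q ^ k - 1)" by (metis power_Suc)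
  then show ?thesis using True z M by simp
next
  case False
  then have "int q ^ k - (-1) ^ k = int (q ^ k + 1)" by simp
  then have M: "nat (int q ^ k - (-1) ^ k) = q ^ k + 1" by (simp only: nat_int)
  have "inverse (z ^ (q ^ k)) = z \<longleftrightarrow> z * z ^ (q ^ k) = 1" using z by (auto simp: field_simps)
  then show ?thesis using False unfolding M by simp
qed

lemma card_Fix_proots:
  assumes p: "prime p" and good: "of_nat p \<noteq> (0 :: 'a alg_closure) \<or> r = 0" and k: "k > 0"
  shows "card {\<chi> \<in> proots p r. (H.sg ^^ k) \<chi> = \<chi>} = p_part p (nat (int q ^ k - (-1) ^ k)) ^ r"
proof (cases "r = 0")
  case True
  have "{\<chi> \<in> proots p r. (H.sg ^^ k) \<chi> = \<chi>} = {[]}" using True by (auto simp: proots_def sg_pow)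
  then show ?thesis using True by simp
next
  case False
  define M where "M = nat (int q ^ k - (-1) ^ k)"
  define R where "R = {z :: 'a alg_closure. z ^ p_part p M = 1}"
  \<comment> \<open>The p-part is invertible in the field, so there are as many roots of unity as
    its value says; each of the r entries is chosen among them independently.\<close>
  have nz: "of_nat (p_part p M) \<noteq> (0 :: 'a alg_closure)" using good False by (simp add: p_part_def)
  have cR: "card R = p_part p M" unfolding R_def by (rule card_roots_of_unity[OF nz])
  have "p_part p M > 0" using prime_gt_0_nat[OF p] by (simp add: p_part_def)
  then have fR: "finite R" using cR card_ge_0_finite by metis
  have R_iff: "z \<in> R \<longleftrightarrow> (\<exists>k. z ^ (p ^ k) = 1) \<and> (if even k then z ^ (q ^ k) else inverse (z ^ (q ^ k))) = z" for z
  proof (cases "z = 0")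
    case True
    then show ?thesis using \<open>p_part p M > 0\<close> prime_gt_0_nat[OF p] by (auto simp: R_def power_0_left)
  next
    case False
    show ?thesis unfolding sg_fixed_iff[OF k False] R_def M_def
      using p_power_root_iff[OF p unitary_M_pos[OF k], of z] by simp
  qed
  have fix_iff: "(H.sg ^^ k) \<chi> = \<chi> \<longleftrightarrow> (\<forall>z\<in>set \<chi>. (if even k then z ^ (q ^ k) else inverse (z ^ (q ^ k))) = z)" for \<chi>
    unfolding sg_pow using map_eq_conv[of "\<lambda>z. if even k then z ^ (q ^ k) else inverse (z ^ (q ^ k))" \<chi> "\<lambda>z. z"]
    by (simp only: list.map_ident)
  have "{\<chi> \<in> proots p r. (H.sg ^^ k) \<chi> = \<chi>} = {\<chi>. set \<chi> \<subseteq> R \<and> length \<chi> = r}"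
    unfolding proots_def fix_iff using R_iff by blast
  then show ?thesis using card_lists_length_eq[OF fR] cR by (simp add: M_def)
qed

lemma esum_ptuples_unipotent:
  assumes p: "prime p" "of_nat p = (0 :: 'a alg_closure)"
    and \<rho>: "\<rho> \<in> ptuples p r" "\<rho> \<noteq> replicate r (1\<^sub>m n)" and A: "A \<in> centr \<rho>"
  shows "esum (\<le>) (inv_iso (A # \<rho>)) = 0"
proof -
  have "\<exists>Y\<in>set \<rho>. Y \<noteq> 1\<^sub>m n"
  proof (rule ccontr)
    assume "\<not> (\<exists>Y\<in>set \<rho>. Y \<noteq> 1\<^sub>m n)"
    then have "\<rho> = replicate (length \<rho>) (1\<^sub>m n)" by (intro replicate_eqI) auto
    then show False using \<rho> ptuples_D(1)[OF \<rho>(1)] by simp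
  qed
  then obtain Y where Y: "Y \<in> set \<rho>" "Y \<noteq> 1\<^sub>m n" by blast
  note YG = ptuples_D(2)[OF \<rho>(1) Y(1)]
  obtain k where "group.ord G Y = p ^ k" using ptuples_D(4)[OF \<rho>(1) Y(1)] by blast
  then have pw: "Y [^]\<^bsub>G\<^esub> (p ^ k) = \<one>\<^bsub>G\<^esub>" using group.pow_ord_eq_1[OF group_G YG] by simp
  have A': "A \<in> carrier G" "\<forall>C\<in>set \<rho>. A * C = C * A" using A unfolding centr_def by blast+
  show ?thesis
  proof (rule esum_inv_iso_unipotent[OF p YG pw Y(2)])
    show "set (A # \<rho>) \<subseteq> carrier G" using A'(1) ptuples_D(2)[OF \<rho>(1)] by auto
    show "Y \<in> set (A # \<rho>)" using Y(1) by simp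
    show "B * Y = Y * B" if "B \<in> set (A # \<rho>)" for B
    proof (cases "B = A")
      case True show ?thesis unfolding True by (rule bspec[OF A'(2) Y(1)])
    next
      case False
      then have "B \<in> set \<rho>" using that by simp
      then show ?thesis by (rule ptuples_D(3)[OF \<rho>(1) _ Y(1)])
    qed
  qed
qed

text \<open>Elements of p-power order are unipotent, so every tuple other than the trivial one
  contributes zero; the contribution of the trivial tuple does not depend on r.\<close>

lemma sum_hom_tuples_defining_char:
  assumes p: "prime p" "of_nat p = (0 :: 'a alg_closure)"
  shows "(\<Sum>Xs\<in>hom_tuples p (Suc r) G. esum (\<le>) (invariant_subposet (isotropic_subspaces n q c) (generate G (set Xs)))) =
    (\<Sum>A\<in>carrier G. esum (\<le>) (inv_iso [A]))"
proof -
  interpret group G by (rule group_G)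
  let ?one = "replicate r (1\<^sub>m n :: 'a mat)"
  have oneG: "(1\<^sub>m n :: 'a mat) \<in> carrier G" using one_closed by simp
  have pt: "?one \<in> ptuples p r" unfolding ptuples_def mem_Collect_eq
  proof (intro conjI ballI)
    show "length ?one = r" by simp
    show "set ?one \<subseteq> carrier G" using oneG by auto
    show "A * C = C * A" if "A \<in> set ?one" "C \<in> set ?one" for A C using that by auto
    show "\<exists>k. ord A = p ^ k" if "A \<in> set ?one" for A
    proof -
      have "A = \<one>\<^bsub>G\<^esub>" using that by auto
      moreover have "ord \<one>\<^bsub>G\<^esub> dvd 1" using pow_eq_id[OF one_closed, of 1] by (simp del: G_simps)
      ultimately show ?thesis by (intro exI[of _ 0]) (simp del: G_simps)
    qed
  qed
  have ct: "centr ?one = carrier G"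
  proof -
    have "A * C = C * A" if "A \<in> carrier G" "C \<in> set ?one" for A C
      using G_carrier_mat[OF that(1)] that(2) by auto
    then show ?thesis unfolding centr_def by blast
  qed
  have iso: "inv_iso (A # ?one) = inv_iso [A]" for A
  proof -
    have "(\<lambda>v. B *\<^sub>v v) ` U = U" if "ksub n U" "B \<in> set ?one" for U B
      using G_image_one[OF ksub_carrier[OF that(1)]] that(2) by auto
    then have "U \<in> inv_iso (A # ?one) \<longleftrightarrow> U \<in> inv_iso [A]" for U
      unfolding inv_iso_iff list.set(2) ball_simps(7) by (intro conj_cong refl) (simp add: ball_simps)
    then show ?thesis by blast
  qed
  have "(\<Sum>\<rho>\<in>ptuples p r. \<Sum>A\<in>centr \<rho>. esum (\<le>) (inv_iso (A # \<rho>))) =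
      (\<Sum>\<rho>\<in>{?one}. \<Sum>A\<in>centr \<rho>. esum (\<le>) (inv_iso (A # \<rho>)))"
  proof (rule sum.mono_neutral_right[OF finite_ptuples])
    show "{?one} \<subseteq> ptuples p r" using pt by simp
    show "\<forall>\<rho>\<in>ptuples p r - {?one}. (\<Sum>A\<in>centr \<rho>. esum (\<le>) (inv_iso (A # \<rho>))) = 0"
    proof
      fix \<rho> assume "\<rho> \<in> ptuples p r - {?one}"
      then have "\<rho> \<in> ptuples p r" "\<rho> \<noteq> ?one" by simp_all
      from esum_ptuples_unipotent[OF p this]
      show "(\<Sum>A\<in>centr \<rho>. esum (\<le>) (inv_iso (A # \<rho>))) = 0" by (intro sum.neutral ballI)
    qed
  qed
  then show ?thesis unfolding sum_hom_tuples_Sigma by (simp add: ct iso)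
qed

lemma equiv_reduced_euler_char_defining_char:
  assumes p: "prime p" "of_nat p = (0 :: 'a alg_closure)"
  shows "equiv_reduced_euler_char (Suc r) p n q c = equiv_reduced_euler_char (Suc 0) p n q c"
proof -
  have "(\<Sum>Xs\<in>hom_tuples p (Suc r) G. reduced_euler_char (invariant_subposet (isotropic_subspaces n q c) (generate G (set Xs)))) =
     - (\<Sum>A\<in>carrier G. esum (\<le>) (inv_iso [A]))" for r
    unfolding sum_hom_tuples_defining_char[OF p, of r, symmetric] sum_negf[symmetric]
    by (intro sum.cong refl reduced_euler_char_esum) (simp add: invariant_subposet_def finite_isotropic)
  then show ?thesis unfolding equiv_reduced_euler_char_def by (simp flip: of_int_sum)
qed

text \<open>As p divides q, the number q^k - (-1)^k is congruent to 1 or -1 modulo p.\<close>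

lemma p_part_defining_char:
  assumes p: "prime p" "of_nat p = (0 :: 'a alg_closure)" and k: "k > 0"
  shows "p_part p (nat (int q ^ k - (-1) ^ k)) = 1"
proof -
  obtain l where l: "l > 0" "q = CHAR('a) ^ l" using CHAR_primepow[OF primepow_q card_UNIV_q] .
  have "to_ac (of_nat p :: 'a) = of_nat p" by (induction p) simp_all
  then have "to_ac (of_nat p :: 'a) = to_ac 0" using p(2) by simp
  then have "(of_nat p :: 'a) = 0" by (simp only: to_ac_eq_iff)
  then have "CHAR('a) dvd p" by (simp add: of_nat_eq_0_iff_char_dvd)
  moreover have "CHAR('a) \<noteq> 1" by simp
  ultimately have "CHAR('a) = p" using p(1) by (metis prime_nat_iff)
  then have "p dvd q" using l by (simp add: dvd_power)
  then have "p dvd q ^ k" using dvd_trans[OF _ dvd_power[of k q]] k by blast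
  then have pq: "int p dvd int q ^ k" by (simp flip: of_nat_power)
  have "\<not> p dvd nat (int q ^ k - (-1) ^ k)"
  proof
    assume "p dvd nat (int q ^ k - (-1) ^ k)"
    then have "int p dvd int (nat (int q ^ k - (-1) ^ k))" by (simp only: int_dvd_int_iff)
    moreover have "0 < int q ^ k - (-1) ^ k" using unitary_M_pos[OF k] by (simp only: zero_less_nat_eq)
    ultimately have "int p dvd int q ^ k - (-1) ^ k" by (simp only: nat_0_le less_imp_le)
    then have "int p dvd int q ^ k - (int q ^ k - (-1) ^ k)" using pq by (rule dvd_diff[rotated])
    then have "int p dvd (-1) ^ k" by simp
    then have "int p dvd 1" by (cases "even k") simp_all
    then show False using prime_gt_1_nat[OF p(1)] by simp
  qed
  then show ?thesis unfolding p_part_def by (simp add: not_dvd_imp_multiplicity_0)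
qed

end

lemma FGL_minus_nondefining:
  fixes c :: "nat \<Rightarrow> 'a::{field,finite}"
  assumes p: "prime p" and U: "\<And>n. n > 0 \<Longrightarrow> unitary_space q n (c n)"
    and good: "of_nat p \<noteq> (0 :: 'a alg_closure) \<or> r = 0"
  shows "FGL_minus (Suc r) p q c =
    fps_exp 1 oo
      (- Abs_fps (\<lambda>n. if n = 0 then 0 else
            (-1) ^ n * of_nat (p_part p (nat (int q ^ n - (-1) ^ n)) ^ r) / of_nat n))"
proof -
  \<comment> \<open>The characters and their twist do not depend on the dimension n or on the scalar
    \<open>c n\<close>, so a single periodic map serves all coefficients of the series.\<close>
  define T where "T = (unitary_space.proots p r :: 'a alg_closure list set)"
  define s where "s = (herm_space.sg q :: 'a alg_closure list \<Rightarrow> _)"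
  interpret PM: periodic_map T s
    unfolding T_def s_def using unitary_space.periodic_map_proots[OF U[of 1]] by simp
  have cf: "card (PM.Fix k) = p_part p (nat (int q ^ k - (-1) ^ k)) ^ r" if "k > 0" for k
    unfolding PM.Fix_def unfolding T_def s_def by (rule unitary_space.card_Fix_proots[OF U[OF that] p good that])
  have eq: "equiv_reduced_euler_char (Suc r) p n q (c n) = - of_int (PM.wt_sum n)" if "n > 0" for n
    unfolding T_def s_def by (rule unitary_space.equiv_reduced_euler_char_eq[OF U[OF that] p good])
  \<comment> \<open>For n = 0 only the empty chain remains, which gives the constant term 1 of the
    generating function.\<close>
  have "PM.isotypes {#} = {}" by (auto simp: PM.isotypes_def)
  then have 0: "PM.wt_sum 0 = 1"
    by (simp add: PM.wt_sum_def PM.stable_0 PM.wt_def esum_def chain_empty Collect_conv_if cong: conj_cong)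
  have "FGL_minus (Suc r) p q c = Abs_fps (\<lambda>n. of_int (PM.wt_sum n))"
    unfolding FGL_minus_def by (rule fps_ext) (simp add: eq 0)
  also have "\<dots> = fps_exp 1 oo (- Abs_fps (\<lambda>n. if n = 0 then 0 else (-1) ^ n * of_nat (card (PM.Fix n)) / of_nat n))"
    by (rule PM.wt_sum_fps)
  also have "(\<lambda>n. if n = 0 then 0 else (-1) ^ n * of_nat (card (PM.Fix n)) / of_nat n :: rat) =
      (\<lambda>n. if n = 0 then 0 else (-1) ^ n * of_nat (p_part p (nat (int q ^ n - (-1) ^ n)) ^ r) / of_nat n)"
    by (rule ext) (simp add: cf)
  finally show ?thesis .
qed

theorem theorem1p6:
  fixes p q r :: nat and c :: "nat \<Rightarrow> 'a::{field,finite}"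
  assumes "prime p"
    and "primepow q"
    and "card (UNIV :: 'a set) = q ^ 2"
    and "\<And>n. n \<ge> 1 \<Longrightarrow> c n \<noteq> 0 \<and> c n ^ (q - 1) = (-1) ^ (n + 1)"
  shows "FGL_minus (r + 1) p q c =
    fps_exp 1 oo
      (- Abs_fps (\<lambda>n. if n = 0 then 0 else
            (-1) ^ n * of_nat (p_part p (nat (int q ^ n - (-1) ^ n)) ^ r) / of_nat n))"
proof -
  have U: "unitary_space q n (c n)" if "n > 0" for n
    using assms that by unfold_locales auto
  show ?thesis
  proof (cases "of_nat p \<noteq> (0 :: 'a alg_closure)")
    case True
    then show ?thesis using FGL_minus_nondefining[where ?r = r, OF assms(1) U] by simp
  next
    case False
    then have p0: "of_nat p = (0 :: 'a alg_closure)" by simp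
    \<comment> \<open>In the defining characteristic neither side depends on r: the coefficients by
      contractibility, the right-hand side because all p-parts are 1.\<close>
    have "equiv_reduced_euler_char (r + 1) p n q (c n) = equiv_reduced_euler_char (Suc 0) p n q (c n)" if "n > 0" for n
      using unitary_space.equiv_reduced_euler_char_defining_char[OF U[OF that] assms(1) p0, of r] by simp
    then have "(\<lambda>n. if n = 0 then 0 else equiv_reduced_euler_char (r + 1) p n q (c n)) =
        (\<lambda>n. if n = 0 then 0 else equiv_reduced_euler_char (Suc 0) p n q (c n))"
      by (intro ext) (simp only: neq0_conv split: if_split, blast)
    then have "FGL_minus (r + 1) p q c = FGL_minus (Suc 0) p q c" by (simp only: FGL_minus_def)
    also have "\<dots> = fps_exp 1 oo
      (- Abs_fps (\<lambda>n. if n = 0 then 0 else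
            (-1) ^ n * of_nat (p_part p (nat (int q ^ n - (-1) ^ n)) ^ 0) / of_nat n))"
      by (rule FGL_minus_nondefining[OF assms(1) U]) simp_all
    also have "(\<lambda>n. if n = 0 then 0 else
            (-1) ^ n * of_nat (p_part p (nat (int q ^ n - (-1) ^ n)) ^ 0) / of_nat n :: rat) =
        (\<lambda>n. if n = 0 then 0 else
            (-1) ^ n * of_nat (p_part p (nat (int q ^ n - (-1) ^ n)) ^ r) / of_nat n)"
      by (rule ext) (use unitary_space.p_part_defining_char[OF U assms(1) p0] in simp)
    finally show ?thesis .
  qed
qed

end
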